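(* Let $T>0$, $p\in(1,\infty]$, and let $q$ be the conjugate exponent of $p$ (i.e. $\frac1p+\frac1q=1$). Let $u\in L^1(0,T;W_0^{1,q}(\Omega))\cap L^1(0,T;C(\overline\Omega))$ with $\nabla\cdot u=0$, and let $\rho\in L^\infty(0,T;L^p(\Omega))$ be a weak solution of the transport equation $\rho_t-u\cdot\nabla\rho=0$ in $(0,T)\times\Omega$ with velocity field $u$ and initial density $\rho_0\equiv0$. Then $\rho\equiv0$.
   Context: $\Omega\subseteq\mathbb{R}^N$ is an open, bounded, connected and simply connected set with smooth boundary. The velocity field $u=u(x,t)$ is $\mathbb{R}^N$-valued, and $W_0^{1,q}(\Omega)$ is the closure of $C_c^\infty(\Omega)$ in the Sobolev space $W^{1,q}(\Omega)$ (here for $\mathbb{R}^N$-valued functions). $\nabla\cdot u=0$ is meant in the weak sense: for almost every $t$, $\int_\Omega u(x,t)\cdot\nabla\varphi(x)\,dx=0$ for every $\varphi\in C_c^\infty(\Omega)$. A function $\rho\in L^\infty(0,T;L^p(\Omega))$ (real-valued) is a weak solution of $\rho_t-u\cdot\nabla\rho=0$ with velocity field $u$ and initial density $\rho_0\in L^p(\Omega)$ if $$-\int_0^T\int_\Omega \rho\,\phi_t\,dx\,dt-\int_\Omega\rho_0(x)\phi(x,0)\,dx+\int_0^T\int_\Omega\rho\,(u\cdot\nabla\phi)\,dx\,dt=0$$ for every smooth real-valued $\phi$ with compact support in $[0,T)\times\Omega$. The conclusion $\rho\equiv0$ means equality in $L^\infty(0,T;L^p(\Omega))$. *)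

theory Defs
  imports "HOL-Analysis.Analysis" "HOL-Probability.Essential_Supremum"
begin

(* Functions on a set S are represented by total functions whose values off S are irrelevant;
   elements of Lebesgue and Sobolev spaces are represented by representatives of their classes. *)

primrec Ck_on :: "nat \<Rightarrow> 'a::euclidean_space set \<Rightarrow> ('a \<Rightarrow> 'b::euclidean_space) \<Rightarrow> bool" where
  "Ck_on 0 U f \<longleftrightarrow> continuous_on U f"
| "Ck_on (Suc k) U f \<longleftrightarrow> (\<forall>x\<in>U. f differentiable (at x)) \<and>
     (\<forall>v. Ck_on k U (\<lambda>x. frechet_derivative f (at x) v))"

(* S need not be open: f is required to be smooth on a neighbourhood of S. *)
definition smooth_on :: "'a::euclidean_space set \<Rightarrow> ('a \<Rightarrow> 'b::euclidean_space) \<Rightarrow> bool" where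
  "smooth_on S f \<longleftrightarrow> (\<exists>U. open U \<and> S \<subseteq> U \<and> (\<forall>k. Ck_on k U f))"

(* For S = [0,T) x Omega such an f need not vanish at t = 0. *)
definition Cc_infinity :: "'a::euclidean_space set \<Rightarrow> ('a \<Rightarrow> 'b::euclidean_space) set" where
  "Cc_infinity S = {f. smooth_on S f \<and>
     compact (closure (support_on S f)) \<and> closure (support_on S f) \<subseteq> S}"

definition grad :: "('a::euclidean_space \<Rightarrow> real) \<Rightarrow> 'a \<Rightarrow> 'a" where
  "grad f x = (\<Sum>b\<in>Basis. frechet_derivative f (at x) b *\<^sub>R b)"

(* Near each boundary point the set is the sublevel set of a smooth function without
   critical points; in particular it lies locally on one side of its boundary. *)
definition smooth_boundary :: "'a::euclidean_space set \<Rightarrow> bool" where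
  "smooth_boundary S \<longleftrightarrow> (\<forall>x\<in>frontier S. \<exists>V (r :: 'a \<Rightarrow> real). open V \<and> x \<in> V \<and>
     smooth_on V r \<and> (\<forall>y\<in>V. grad r y \<noteq> 0) \<and> S \<inter> V = {y\<in>V. r y < 0})"

definition Lp_norm :: "ennreal \<Rightarrow> 'a::euclidean_space set \<Rightarrow> ('a \<Rightarrow> 'b::euclidean_space) \<Rightarrow> ennreal" where
  "Lp_norm p S f =
     (if p = \<infinity> then esssup (lebesgue_on S) (\<lambda>x. ennreal (norm (f x)))
      else let I = (\<integral>\<^sup>+x. ennreal (norm (f x) powr enn2real p) \<partial>lebesgue_on S)
           in if I = \<infinity> then \<infinity> else ennreal (enn2real I powr (1 / enn2real p)))"

definition Lp_space :: "ennreal \<Rightarrow> 'a::euclidean_space set \<Rightarrow> ('a \<Rightarrow> 'b::euclidean_space) set" where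
  "Lp_space p S = {f \<in> borel_measurable (lebesgue_on S). Lp_norm p S f < \<infinity>}"

definition loc_integrable :: "'a::euclidean_space set \<Rightarrow> ('a \<Rightarrow> 'b::euclidean_space) \<Rightarrow> bool" where
  "loc_integrable S f \<longleftrightarrow> (\<forall>K. compact K \<longrightarrow> K \<subseteq> S \<longrightarrow> f absolutely_integrable_on K)"

(* g is the weak derivative of f on the open set S in the direction b. *)
definition is_weak_deriv ::
  "'a::euclidean_space set \<Rightarrow> 'a \<Rightarrow> ('a \<Rightarrow> 'b::euclidean_space) \<Rightarrow> ('a \<Rightarrow> 'b) \<Rightarrow> bool" where
  "is_weak_deriv S b f g \<longleftrightarrow> loc_integrable S f \<and> loc_integrable S g \<and>
     (\<forall>\<psi>::'a \<Rightarrow> real. \<psi> \<in> Cc_infinity S \<longrightarrow>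
        (LINT x|lebesgue_on S. frechet_derivative \<psi> (at x) b *\<^sub>R f x) =
        - (LINT x|lebesgue_on S. \<psi> x *\<^sub>R g x))"

(* Weak derivatives are unique almost everywhere, so norms do not depend on the choice. *)
definition weak_deriv ::
  "'a::euclidean_space set \<Rightarrow> 'a \<Rightarrow> ('a \<Rightarrow> 'b::euclidean_space) \<Rightarrow> 'a \<Rightarrow> 'b" where
  "weak_deriv S b f = (SOME g. is_weak_deriv S b f g)"

definition W1 :: "ennreal \<Rightarrow> 'a::euclidean_space set \<Rightarrow> ('a \<Rightarrow> 'b::euclidean_space) set" where
  "W1 q S = {f \<in> Lp_space q S. \<forall>b\<in>Basis. \<exists>g\<in>Lp_space q S. is_weak_deriv S b f g}"

definition W1_norm :: "ennreal \<Rightarrow> 'a::euclidean_space set \<Rightarrow> ('a \<Rightarrow> 'b::euclidean_space) \<Rightarrow> ennreal" where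
  "W1_norm q S f = Lp_norm q S f + (\<Sum>b\<in>Basis. Lp_norm q S (weak_deriv S b f))"

definition W1_0 :: "ennreal \<Rightarrow> 'a::euclidean_space set \<Rightarrow> ('a \<Rightarrow> 'b::euclidean_space) set" where
  "W1_0 q S = {f \<in> W1 q S. \<forall>\<epsilon>>0::real. \<exists>\<psi>\<in>Cc_infinity S. W1_norm q S (\<lambda>x. f x - \<psi> x) < ennreal \<epsilon>}"

definition C_space :: "'a::euclidean_space set \<Rightarrow> ('a \<Rightarrow> 'b::euclidean_space) set" where
  "C_space K = {f. continuous_on K f}"

definition sup_norm :: "'a::euclidean_space set \<Rightarrow> ('a \<Rightarrow> 'b::euclidean_space) \<Rightarrow> ennreal" where
  "sup_norm K f = (SUP x\<in>K. ennreal (norm (f x)))"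

(* The Bochner space L^1(0,T;X) for a space X of functions with norm N: strongly measurable f
   (almost everywhere N-limits of X-valued simple functions) with integrable norm. *)
definition Bochner_L1 ::
  "real \<Rightarrow> ('a \<Rightarrow> 'b) set \<Rightarrow> (('a \<Rightarrow> 'b) \<Rightarrow> ennreal) \<Rightarrow> (real \<Rightarrow> 'a \<Rightarrow> 'b::euclidean_space) set" where
  "Bochner_L1 T X N = {f.
     (AE t in lebesgue_on {0<..<T}. f t \<in> X) \<and>
     (\<exists>s :: nat \<Rightarrow> real \<Rightarrow> 'a \<Rightarrow> 'b.
        (\<forall>k. simple_function (lebesgue_on {0<..<T}) (s k) \<and> (\<forall>t\<in>{0<..<T}. s k t \<in> X)) \<and>
        (AE t in lebesgue_on {0<..<T}. (\<lambda>k. N (\<lambda>x. s k t x - f t x)) \<longlonglongrightarrow> 0)) \<and>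
     (\<integral>\<^sup>+t. N (f t) \<partial>lebesgue_on {0<..<T}) < \<infinity>}"

(* L^infinity(0,T;L^p(S)) via jointly measurable representatives. For p < infinity this is the
   Bochner space; for p = infinity it is L^infinity((0,T) x S), where strong measurability into
   the non-separable space L^infinity(S) would be too restrictive. *)
definition Linf_Lp :: "real \<Rightarrow> ennreal \<Rightarrow> 'a::euclidean_space set \<Rightarrow> (real \<Rightarrow> 'a \<Rightarrow> real) set" where
  "Linf_Lp T p S = {\<rho>.
     (\<lambda>(t, x). \<rho> t x) \<in> borel_measurable (lebesgue_on ({0<..<T} \<times> S)) \<and>
     (AE t in lebesgue_on {0<..<T}. \<rho> t \<in> Lp_space p S) \<and>
     esssup (lebesgue_on {0<..<T}) (\<lambda>t. Lp_norm p S (\<rho> t)) < \<infinity>}"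

definition weakly_div_free :: "real \<Rightarrow> 'a::euclidean_space set \<Rightarrow> (real \<Rightarrow> 'a \<Rightarrow> 'a) \<Rightarrow> bool" where
  "weakly_div_free T S u \<longleftrightarrow> (AE t in lebesgue_on {0<..<T}.
     \<forall>\<phi>\<in>Cc_infinity S. (LINT x|lebesgue_on S. u t x \<bullet> grad \<phi> x) = 0)"

definition weak_transport_solution ::
  "real \<Rightarrow> ennreal \<Rightarrow> 'a::euclidean_space set \<Rightarrow> (real \<Rightarrow> 'a \<Rightarrow> 'a) \<Rightarrow> ('a \<Rightarrow> real) \<Rightarrow>
   (real \<Rightarrow> 'a \<Rightarrow> real) \<Rightarrow> bool" where
  "weak_transport_solution T p S u \<rho>0 \<rho> \<longleftrightarrow>
     \<rho>0 \<in> Lp_space p S \<and> \<rho> \<in> Linf_Lp T p S \<and>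
     (\<forall>\<phi> :: real \<times> 'a \<Rightarrow> real. \<phi> \<in> Cc_infinity ({0..<T} \<times> S) \<longrightarrow>
        - (LINT t|lebesgue_on {0<..<T}. LINT x|lebesgue_on S. \<rho> t x * deriv (\<lambda>s. \<phi> (s, x)) t)
        - (LINT x|lebesgue_on S. \<rho>0 x * \<phi> (0, x))
        + (LINT t|lebesgue_on {0<..<T}. LINT x|lebesgue_on S.
             \<rho> t x * (u t x \<bullet> grad (\<lambda>y. \<phi> (t, y)) x)) = 0)"

end

theory Submission
  imports Defs
begin

text \<open>
  Renormalisation: mollify the equation in space and apply \<open>\<beta>(r) = 1 - 1 / (1 + r\<^sup>2)\<close>. As \<open>u\<close> is divergence free
  and the mollifier is even, the commutator is bounded at scale \<open>\<epsilon>\<close> by the integral of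
  \<open>\<bar>\<rho> x - \<rho> y\<bar> \<bar>u x - u y\<bar> / \<epsilon>\<^bsup>N+1\<^esup>\<close> over the pairs with \<open>\<bar>x - y\<bar> \<le> \<epsilon>\<close>. By duality this is at most a constant times the
  Sobolev norm of \<open>u\<close>, and it tends to 0 when \<open>u\<close> is a test function, hence for every \<open>u\<close> in the closure of the
  test functions. So \<open>\<beta>(\<rho>)\<close> solves the transport equation as well.

  No regularity of the boundary is used to extend the equation to test functions that do not vanish there. Let
  \<open>H(x)\<close> be the time integral of \<open>\<bar>u(t, x)\<bar>\<close>. It is a limit of test functions \<open>h\<close> whose derivatives have a common
  integrable majorant \<open>G\<close>. Testing with \<open>h / (\<delta> + h)\<close> bounds the integral of \<open>\<beta>(\<rho>(t))\<close> over the set \<open>H > 0\<close> by the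
  limit, as \<open>\<delta> \<rightarrow> 0\<close>, of the integral of \<open>H \<delta> G / (\<delta> + H)\<^sup>2\<close>, which is 0 by dominated convergence. Where \<open>H = 0\<close> the
  velocity vanishes for almost every time, so the equation loses its transport term and \<open>\<rho>\<close> vanishes there too.
\<close>

section \<open>Smooth functions\<close>

text \<open>The commutator estimate puts its two factors into dual norms and otherwise asks only
  that \<open>\<rho>\<close> be integrable. Convergence to 0 is shown for test functions alone,
  where the Lipschitz bound absorbs 1/\<epsilon> and continuity of translations in L1 suffices; this
  covers p = \<infinity>, where translations need not be continuous in the norm of
  \<open>\<rho>\<close>. The function \<beta> is bounded, has a bounded Lipschitz derivative,
  vanishes only at 0 and lies between 0 and |r|, so nonlinear expressions stay integrable although
  the square of \<open>\<rho>\<close> need not be. The cutoff works because it degenerates together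
  with the velocity: H \<delta> / (\<delta> + H)^2 is at most 1 for every \<delta> and tends to 0
  pointwise, so G alone is a majorant. G comes from a rapidly converging subsequence, as in the
  completeness proof for L1. Test functions in time may be nonzero at t = 0, so the weak equation
  itself encodes the initial value 0 and no trace of \<open>\<rho>\<close> at t = 0 has to be
  constructed.\<close>

abbreviation dderiv :: "('a::euclidean_space \<Rightarrow> 'b::euclidean_space) \<Rightarrow> 'a \<Rightarrow> 'a \<Rightarrow> 'b" where
  "dderiv f v x \<equiv> frechet_derivative f (at x) v"

lemma Ck_on_subset: "Ck_on k U f \<Longrightarrow> V \<subseteq> U \<Longrightarrow> Ck_on k V f"
  by (induction k arbitrary: f) (auto intro: continuous_on_subset)

text \<open>Openness of \<open>U\<close> is essential: the functions then agree near each point, so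
  their Frechet derivatives agree on \<open>U\<close> and the induction applies to these.\<close>

lemma Ck_on_cong:
  assumes "open U" "\<And>x. x \<in> U \<Longrightarrow> f x = g x" "Ck_on k U f"
  shows "Ck_on k U g"
  using assms(2,3)
proof (induction k arbitrary: f g)
  case 0
  then show ?case by (simp cong: continuous_on_cong)
next
  case (Suc k)
  have diff: "f differentiable (at x)" if "x \<in> U" for x
    using Suc.prems that by simp
  have eq: "frechet_derivative f (at x) = frechet_derivative g (at x)" if "x \<in> U" for x
    using frechet_derivative_transform_within_open[OF diff[OF that] assms(1) that Suc.prems(1)] by simp
  have "g differentiable (at x)" if "x \<in> U" for x
    using differentiable_transform_within[of f x UNIV] diff[OF that] assms(1) that Suc.prems(1)
    by (metis differentiable_def has_derivative_transform_within_open)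
  moreover have "Ck_on k U (\<lambda>x. dderiv g v x)" for v
    by (rule Suc.IH[of "\<lambda>x. dderiv f v x"]) (use eq Suc.prems in auto)
  ultimately show ?case by simp
qed

text \<open>Serves to glue a function on its domain to the zero function off its support.\<close>

lemma Ck_on_Un:
  assumes "open U" "open V" "Ck_on k U f" "Ck_on k V f"
  shows "Ck_on k (U \<union> V) f"
  using assms(3,4)
  by (induction k arbitrary: f) (auto intro: continuous_on_open_Un[OF assms(1,2)])

lemma Ck_SucI:
  assumes "\<And>x. (f has_derivative f' x) (at x)" "\<And>v. Ck_on k UNIV (\<lambda>x. f' x v)"
  shows "Ck_on (Suc k) UNIV f"
proof -
  have "frechet_derivative f (at x) = f' x" for x
    using frechet_derivative_at[OF assms(1)] by simp
  then show ?thesis using assms by (auto simp: differentiable_def)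
qed

lemma Ck_SucD:
  assumes "Ck_on (Suc k) UNIV f"
  shows "(f has_derivative frechet_derivative f (at x)) (at x)"
    and "Ck_on k UNIV (\<lambda>x. dderiv f v x)"
  using assms frechet_derivative_works by auto

text \<open>\<open>Ck_on (Suc k)\<close> asks for differentiability and for order k of the
  derivatives, but not for order k of the function itself. The base case is that differentiability
  implies continuity.\<close>

lemma Ck_Suc_lower: "Ck_on (Suc k) UNIV f \<Longrightarrow> Ck_on k UNIV f"
proof (induction k arbitrary: f)
  case 0
  then show ?case
    using differentiable_imp_continuous_on[of f UNIV] by (auto simp: differentiable_on_def)
next
  case (Suc k)
  show ?case
  proof (rule Ck_SucI)
    show "(f has_derivative frechet_derivative f (at x)) (at x)" for x
      by (rule Ck_SucD(1)[OF Suc.prems])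
    show "Ck_on k UNIV (\<lambda>x. dderiv f v x)" for v
      by (rule Suc.IH) (rule Ck_SucD(2)[OF Suc.prems])
  qed
qed

lemma Ck_const: "Ck_on k UNIV (\<lambda>x. c)"
proof (induction k arbitrary: c)
  case (Suc k)
  show ?case by (rule Ck_SucI[where f'="\<lambda>x h. 0"]) (auto simp: Suc)
qed auto

lemma Ck_add: "Ck_on k UNIV f \<Longrightarrow> Ck_on k UNIV g \<Longrightarrow> Ck_on k UNIV (\<lambda>x. f x + g x)"
proof (induction k arbitrary: f g)
  case (Suc k)
  show ?case
    by (rule Ck_SucI, rule has_derivative_add[OF Ck_SucD(1)[OF Suc.prems(1)] Ck_SucD(1)[OF Suc.prems(2)]])
      (intro Suc.IH Ck_SucD(2)[OF Suc.prems(1)] Ck_SucD(2)[OF Suc.prems(2)])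
qed (auto intro: continuous_intros)

lemma Ck_bounded_linear:
  assumes L: "bounded_linear L"
  shows "Ck_on k UNIV f \<Longrightarrow> Ck_on k UNIV (\<lambda>x. L (f x))"
proof (induction k arbitrary: f)
  case 0
  then show ?case by (auto intro: bounded_linear.continuous_on[OF L])
next
  case (Suc k)
  show ?case
    by (rule Ck_SucI, rule bounded_linear.has_derivative[OF L Ck_SucD(1)[OF Suc.prems]])
      (intro Suc.IH Ck_SucD(2)[OF Suc.prems])
qed

lemma Ck_bounded_bilinear:
  assumes B: "bounded_bilinear B"
  shows "Ck_on k UNIV f \<Longrightarrow> Ck_on k UNIV g \<Longrightarrow> Ck_on k UNIV (\<lambda>x. B (f x) (g x))"
proof (induction k arbitrary: f g)
  case 0
  then show ?case by (auto intro: bounded_bilinear.continuous_on[OF B])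
next
  case (Suc k)
  show ?case
    by (rule Ck_SucI, rule bounded_bilinear.FDERIV[OF B Ck_SucD(1)[OF Suc.prems(1)] Ck_SucD(1)[OF Suc.prems(2)]])
      (intro Ck_add Suc.IH Ck_SucD(2)[OF Suc.prems(1)] Ck_SucD(2)[OF Suc.prems(2)]
        Ck_Suc_lower[OF Suc.prems(1)] Ck_Suc_lower[OF Suc.prems(2)])
qed

lemma Ck_compose_affine:
  assumes A: "bounded_linear A"
  shows "Ck_on k UNIV f \<Longrightarrow> Ck_on k UNIV (\<lambda>x. f (a + A x))"
proof (induction k arbitrary: f)
  case 0
  then have "continuous_on (range (\<lambda>x. a + A x)) f" by (auto intro: continuous_on_subset)
  moreover have "continuous_on UNIV (\<lambda>x. a + A x)"
    by (intro continuous_intros bounded_linear.continuous_on[OF A])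
  ultimately show ?case
    using continuous_on_compose[of UNIV "\<lambda>x. a + A x" f] by (simp add: o_def)
next
  case (Suc k)
  have A': "((\<lambda>x. a + A x) has_derivative A) (at x)" for x
    using has_derivative_add[OF has_derivative_const bounded_linear_imp_has_derivative[OF A]] by simp
  have "((\<lambda>x. f (a + A x)) has_derivative (\<lambda>h. dderiv f (A h) (a + A x))) (at x)" for x
    using has_derivative_compose[OF A' Ck_SucD(1)[OF Suc.prems]] by simp
  then show ?case
    by (rule Ck_SucI) (rule Suc.IH, rule Ck_SucD(2)[OF Suc.prems])
qed

text \<open>\<open>g\<close> is smooth of every order because the induction replaces it by its
  derivative, while the order required of \<open>f\<close> drops by one. On the line the derivative
  of \<open>g\<close> is multiplication by \<open>dderiv g 1\<close>, so the chain rule gives a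
  product to which \<open>Ck_bounded_bilinear\<close> applies.\<close>

lemma Ck_compose_real:
  fixes g :: "real \<Rightarrow> real"
  shows "(\<And>k. Ck_on k UNIV g) \<Longrightarrow> Ck_on k UNIV f \<Longrightarrow> Ck_on k UNIV (\<lambda>x. g (f x))"
proof (induction k arbitrary: g)
  case 0
  have "continuous_on (range f) g" using 0(1)[of 0] by (auto intro: continuous_on_subset)
  then show ?case
    using continuous_on_compose[of UNIV f g] 0(2) by (simp add: o_def)
next
  case (Suc k)
  have lin: "dderiv g h y = h * dderiv g 1 y" for h y
  proof -
    have "linear (\<lambda>h. dderiv g h y)" by (rule has_derivative_linear[OF Ck_SucD(1)[OF Suc.prems(1)]])
    from linear_scale[OF this, of h 1] show ?thesis by simp
  qed
  have f': "(f has_derivative (\<lambda>h. dderiv f h x)) (at x)" for x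
    by (rule Ck_SucD(1)[OF Suc.prems(2)])
  have g': "(g has_derivative (\<lambda>h. h * dderiv g 1 y)) (at y)" for y
    by (rule has_derivative_eq_rhs[OF Ck_SucD(1)[OF Suc.prems(1)]]) (rule ext, rule lin)
  have "((\<lambda>x. g (f x)) has_derivative (\<lambda>h. dderiv f h x * dderiv g 1 (f x))) (at x)" for x
    using f' g' by (rule has_derivative_compose)
  then show ?case
  proof (rule Ck_SucI)
    have "Ck_on k UNIV (\<lambda>x. dderiv g 1 (f x))"
      by (rule Suc.IH[OF Ck_SucD(2)[OF Suc.prems(1)] Ck_Suc_lower[OF Suc.prems(2)]])
    then show "Ck_on k UNIV (\<lambda>x. dderiv f v x * dderiv g 1 (f x))" for v
      by (rule Ck_bounded_bilinear[OF bounded_bilinear_mult Ck_SucD(2)[OF Suc.prems(2)]])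
  qed
qed

text \<open>The derivative of 1 / f is built from two copies of 1 / f and the derivative of f, so
  the induction hypothesis for 1 / f itself closes the argument.\<close>

lemma Ck_inverse:
  fixes f :: "'a::euclidean_space \<Rightarrow> real"
  assumes nz: "\<And>x. f x \<noteq> 0"
  shows "Ck_on k UNIV f \<Longrightarrow> Ck_on k UNIV (\<lambda>x. inverse (f x))"
proof (induction k)
  case 0
  then show ?case using nz by (auto intro: continuous_intros)
next
  case (Suc k)
  have "((\<lambda>x. inverse (f x)) has_derivative
      (\<lambda>h. (-1) * (inverse (f x) * dderiv f h x * inverse (f x)))) (at x)" for x
    using Ck_SucD(1)[OF Suc.prems] nz by (auto intro!: derivative_eq_intros)
  then show ?case
    by (rule Ck_SucI)
      (intro Ck_bounded_bilinear[OF bounded_bilinear_mult] Ck_const Suc.IH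
        Ck_SucD(2)[OF Suc.prems] Ck_Suc_lower[OF Suc.prems])
qed

lemma Ck_sqrt:
  fixes f :: "'a::euclidean_space \<Rightarrow> real"
  assumes pos: "\<And>x. f x > 0"
  shows "Ck_on k UNIV f \<Longrightarrow> Ck_on k UNIV (\<lambda>x. sqrt (f x))"
proof (induction k)
  case 0
  then show ?case by (auto intro: continuous_intros)
next
  case (Suc k)
  \<comment> \<open>Rewriting 1 / sqrt f as sqrt f / f expresses the derivative through sqrt f and 1
    / f, which are of order k by induction and by \<open>Ck_inverse\<close>.\<close>
  have eq: "inverse (sqrt (f x)) = sqrt (f x) * inverse (f x)" for x
    using pos[of x] real_sqrt_mult_self[of "f x"] by (simp add: field_simps)
  have "((\<lambda>x. sqrt (f x)) has_derivative
      (\<lambda>h. (1/2) * (sqrt (f x) * inverse (f x) * dderiv f h x))) (at x)" for x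
    using Ck_SucD(1)[OF Suc.prems] pos[of x]
    by (auto intro!: derivative_eq_intros simp: eq[symmetric] field_simps)
  then show ?case
    by (rule Ck_SucI)
      (intro Ck_bounded_bilinear[OF bounded_bilinear_mult] Ck_const Suc.IH Ck_inverse
        Ck_SucD(2)[OF Suc.prems] Ck_Suc_lower[OF Suc.prems] less_imp_neq[OF pos, symmetric])
qed

text \<open>Global smoothness is enough because every test function is extended by zero to the whole
  space.\<close>

definition smooth :: "('a::euclidean_space \<Rightarrow> 'b::euclidean_space) \<Rightarrow> bool" where
  "smooth f \<longleftrightarrow> (\<forall>k. Ck_on k UNIV f)"

lemma smooth_const: "smooth (\<lambda>x. c)"
  and smooth_add: "smooth f \<Longrightarrow> smooth g \<Longrightarrow> smooth (\<lambda>x. f x + g x)"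
  by (simp_all add: smooth_def Ck_const Ck_add)

lemma smooth_bounded_linear: "bounded_linear L \<Longrightarrow> smooth f \<Longrightarrow> smooth (\<lambda>x. L (f x))"
  and smooth_bounded_bilinear: "bounded_bilinear B \<Longrightarrow> smooth f \<Longrightarrow> smooth g \<Longrightarrow> smooth (\<lambda>x. B (f x) (g x))"
  and smooth_compose_affine: "bounded_linear A \<Longrightarrow> smooth h \<Longrightarrow> smooth (\<lambda>x. h (a + A x))"
  by (simp_all add: smooth_def Ck_bounded_linear Ck_bounded_bilinear Ck_compose_affine)

lemmas smooth_mult = smooth_bounded_bilinear[OF bounded_bilinear_mult]
lemmas smooth_inner = smooth_bounded_bilinear[OF bounded_bilinear_inner]
lemma smooth_compose_real: "smooth g \<Longrightarrow> smooth f \<Longrightarrow> smooth (\<lambda>x. g (f x :: real) :: real)"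
  by (simp add: smooth_def Ck_compose_real)

lemma smooth_inverse: "smooth f \<Longrightarrow> (\<And>x. f x \<noteq> (0::real)) \<Longrightarrow> smooth (\<lambda>x. inverse (f x))"
  and smooth_sqrt: "smooth f \<Longrightarrow> (\<And>x. f x > (0::real)) \<Longrightarrow> smooth (\<lambda>x. sqrt (f x))"
  by (simp_all add: smooth_def Ck_inverse Ck_sqrt)

lemma smooth_ident: "smooth (\<lambda>x. x)"
proof -
  have "Ck_on k UNIV (\<lambda>x::'a. x)" for k
  proof (cases k)
    case (Suc k')
    show ?thesis unfolding Suc by (rule Ck_SucI[OF has_derivative_ident]) (rule Ck_const)
  qed auto
  then show ?thesis by (simp add: smooth_def)
qed

lemma smooth_uminus: "smooth f \<Longrightarrow> smooth (\<lambda>x. - f x)"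
  using smooth_bounded_linear[OF bounded_linear_minus[OF bounded_linear_ident]] .

lemma smooth_diff: "smooth f \<Longrightarrow> smooth g \<Longrightarrow> smooth (\<lambda>x. f x - g x)"
  using smooth_add[OF _ smooth_uminus, of f g] by simp

lemma smooth_has_derivative: "smooth f \<Longrightarrow> (f has_derivative frechet_derivative f (at x)) (at x)"
  using Ck_SucD(1)[of 0 f] unfolding smooth_def by blast

lemma smooth_differentiable: "smooth f \<Longrightarrow> f differentiable (at x)"
  using smooth_has_derivative differentiable_def by blast

lemma smooth_dderiv: "smooth f \<Longrightarrow> smooth (\<lambda>x. dderiv f v x)"
  using Ck_SucD(2) unfolding smooth_def by blast

lemma smooth_continuous: "smooth f \<Longrightarrow> continuous_on S f"
  using Ck_on.simps(1)[of UNIV f] unfolding smooth_def by (blast intro: continuous_on_subset)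

lemma smooth_borel: "smooth f \<Longrightarrow> f \<in> borel_measurable borel"
  by (intro borel_measurable_continuous_onI smooth_continuous)

lemma dderiv_eq: "(f has_derivative f') (at x) \<Longrightarrow> dderiv f v x = f' v"
  using frechet_derivative_at by metis

lemma smooth_dderiv_linear: "smooth f \<Longrightarrow> linear (\<lambda>v. dderiv f v x)"
  using has_derivative_linear[OF smooth_has_derivative] .

lemma dderiv_basis_sum:
  assumes "f differentiable (at x)"
  shows "dderiv f v x = (\<Sum>b\<in>Basis. (v \<bullet> b) *\<^sub>R dderiv f b x)"
proof -
  have "linear (\<lambda>v. dderiv f v x)" using linear_frechet_derivative[OF assms] .
  then have "dderiv f (\<Sum>b\<in>Basis. (v \<bullet> b) *\<^sub>R b) x = (\<Sum>b\<in>Basis. (v \<bullet> b) *\<^sub>R dderiv f b x)"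
    by (simp add: linear_sum linear_scale)
  then show ?thesis by (simp add: euclidean_representation)
qed

lemma inner_grad: "f differentiable (at x) \<Longrightarrow> v \<bullet> grad f x = dderiv f v x"
  by (subst dderiv_basis_sum) (auto simp: grad_def inner_sum_right mult.commute)

subsection \<open>The exponential bump\<close>

text \<open>For \<open>n = 0\<close> this is the flat function exp(-1/s). The negative powers make
  the family closed under differentiation up to linear combinations (\<open>exp_bump_deriv\<close>),
  so all members are shown smooth in one induction.\<close>

definition exp_bump :: "nat \<Rightarrow> real \<Rightarrow> real" where
  "exp_bump n s = (if s > 0 then inverse s ^ n * exp (- inverse s) else 0)"

lemma exp_bump_tendsto_0: "(exp_bump n \<longlongrightarrow> 0) (at 0)"
proof -
  have "((\<lambda>s. inverse s ^ n / exp (inverse s)) \<longlongrightarrow> (0::real)) (at_right 0)"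
    by (rule filterlim_compose[OF tendsto_power_div_exp_0 filterlim_inverse_at_top_right])
  then have "(exp_bump n \<longlongrightarrow> 0) (at_right 0)"
    by (rule Lim_transform_eventually)
      (auto simp: eventually_at_filter exp_bump_def exp_minus field_simps intro!: always_eventually)
  moreover have "(exp_bump n \<longlongrightarrow> 0) (at_left 0)"
    by (rule Lim_transform_eventually[OF tendsto_const])
      (auto simp: eventually_at_filter exp_bump_def)
  ultimately show ?thesis by (simp add: filterlim_split_at)
qed

lemma exp_bump_deriv:
  "(exp_bump n has_real_derivative (exp_bump (n + 2) s - real n * exp_bump (n + 1) s)) (at s)"
proof -
  consider "s > 0" | "s < 0" | "s = 0" by linarith
  then show ?thesis
  proof cases
    case 1
    have inv: "(inverse has_real_derivative - (inverse s * inverse s)) (at s)"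
      using DERIV_inverse[of s UNIV] 1 by (simp add: power2_eq_square)
    have "((\<lambda>s. inverse s ^ n * exp (- inverse s)) has_real_derivative
        (real n * (- (inverse s * inverse s) * inverse s ^ (n - Suc 0)) * exp (- inverse s)
         + exp (- inverse s) * (- (- (inverse s * inverse s))) * inverse s ^ n)) (at s)"
      by (intro DERIV_mult DERIV_power DERIV_fun_exp DERIV_minus inv)
    moreover have "real n * (- (inverse s * inverse s) * inverse s ^ (n - Suc 0)) * exp (- inverse s)
         + exp (- inverse s) * (- (- (inverse s * inverse s))) * inverse s ^ n
        = exp_bump (n + 2) s - real n * exp_bump (n + 1) s"
      using 1 by (cases n) (simp_all add: exp_bump_def algebra_simps)
    ultimately have "((\<lambda>s. inverse s ^ n * exp (- inverse s)) has_real_derivative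
        (exp_bump (n + 2) s - real n * exp_bump (n + 1) s)) (at s)"
      by simp
    then show ?thesis
      by (rule has_field_derivative_transform_within_open[where S="{0<..}"]) (use 1 in \<open>auto simp: exp_bump_def\<close>)
  next
    case 2
    have "((\<lambda>s. 0) has_real_derivative (exp_bump (n + 2) s - real n * exp_bump (n + 1) s)) (at s)"
      using 2 by (auto simp: exp_bump_def)
    then show ?thesis
      by (rule has_field_derivative_transform_within_open[where S="{..<0}"]) (use 2 in \<open>auto simp: exp_bump_def\<close>)
  next
    case 3
    \<comment> \<open>The difference quotient at 0 is \<open>exp_bump (n + 1)\<close> itself, whose
      limit is known.\<close>
    have "((\<lambda>h. (exp_bump n (0 + h) - exp_bump n 0) / h) \<longlongrightarrow> 0) (at 0)"
      by (rule Lim_transform_eventually[OF exp_bump_tendsto_0[of "n + 1"]])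
        (auto simp: eventually_at_filter exp_bump_def field_simps intro!: always_eventually)
    then show ?thesis using 3 by (simp add: DERIV_def exp_bump_def)
  qed
qed

lemma smooth_exp_bump: "smooth (exp_bump n)"
proof -
  have "Ck_on k UNIV (exp_bump n)" for k
  proof (induction k arbitrary: n)
    case 0
    have "isCont (exp_bump n) s" for s
      using DERIV_isCont[OF exp_bump_deriv] .
    then show ?case by (simp add: continuous_at_imp_continuous_on)
  next
    case (Suc k)
    have "(exp_bump n has_derivative (\<lambda>h. (exp_bump (n + 2) s + (- real n) * exp_bump (n + 1) s) * h)) (at s)" for s
      using exp_bump_deriv[of n s] by (simp add: has_field_derivative_def)
    then show ?case
      by (rule Ck_SucI) (intro Ck_bounded_bilinear[OF bounded_bilinear_mult] Ck_add Ck_const Suc.IH)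
  qed
  then show ?thesis by (simp add: smooth_def)
qed

lemma exp_bump_0_pos_iff: "exp_bump 0 s > 0 \<longleftrightarrow> s > 0"
  and exp_bump_0_eq_0_iff: "exp_bump 0 s = 0 \<longleftrightarrow> s \<le> 0"
  and exp_bump_0_nonneg: "exp_bump 0 s \<ge> 0"
  and exp_bump_0_le_1: "exp_bump 0 s \<le> 1"
  by (auto simp: exp_bump_def)

subsection \<open>Compactly supported smooth functions\<close>

text \<open>Unlike membership in \<open>Cc_infinity\<close>, this fixes the values off
  \<open>S\<close> to be zero, so that integrals over \<open>S\<close> and over the whole space
  agree and functions can be translated.\<close>

definition test_fun :: "'a::euclidean_space set \<Rightarrow> ('a \<Rightarrow> 'b::euclidean_space) \<Rightarrow> bool" where
  "test_fun S f \<longleftrightarrow> smooth f \<and> (\<exists>K. compact K \<and> K \<subseteq> S \<and> (\<forall>x. x \<notin> K \<longrightarrow> f x = 0))"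

lemma test_fun_smooth: "test_fun S f \<Longrightarrow> smooth f"
  by (simp add: test_fun_def)

lemma test_fun_outside: "test_fun S f \<Longrightarrow> x \<notin> S \<Longrightarrow> f x = 0"
  by (auto simp: test_fun_def)

lemma test_fun_mono: "test_fun S f \<Longrightarrow> S \<subseteq> S' \<Longrightarrow> test_fun S' f"
  unfolding test_fun_def by blast

lemma test_fun_0: "test_fun S (\<lambda>x. 0)"
  unfolding test_fun_def using smooth_const by blast

lemma test_funI:
  "smooth f \<Longrightarrow> compact K \<Longrightarrow> K \<subseteq> S \<Longrightarrow> (\<And>x. x \<notin> K \<Longrightarrow> f x = 0) \<Longrightarrow> test_fun S f"
  unfolding test_fun_def by blast

lemma test_funE:
  assumes "test_fun S f"
  obtains K where "compact K" "K \<subseteq> S" "\<And>x. x \<notin> K \<Longrightarrow> f x = 0"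
  using assms unfolding test_fun_def by blast

lemma test_fun_add:
  assumes "test_fun S f" "test_fun S g"
  shows "test_fun S (\<lambda>x. f x + g x)"
proof -
  obtain K where K: "compact K" "K \<subseteq> S" "\<And>x. x \<notin> K \<Longrightarrow> f x = 0" using test_funE[OF assms(1)] by blast
  obtain K' where K': "compact K'" "K' \<subseteq> S" "\<And>x. x \<notin> K' \<Longrightarrow> g x = 0" using test_funE[OF assms(2)] by blast
  show ?thesis
    by (rule test_funI[of _ "K \<union> K'"])
      (use K K' smooth_add[OF assms[THEN test_fun_smooth]] in auto)
qed

lemma test_fun_bounded_bilinear:
  assumes B: "bounded_bilinear B" and "test_fun S f" "smooth g"
  shows "test_fun S (\<lambda>x. B (f x) (g x))"
proof -
  obtain K where K: "compact K" "K \<subseteq> S" "\<And>x. x \<notin> K \<Longrightarrow> f x = 0" using test_funE[OF assms(2)] by blast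
  show ?thesis
    by (rule test_funI[OF smooth_bounded_bilinear[OF B test_fun_smooth[OF assms(2)] assms(3)] K(1,2)])
      (simp add: K(3) bounded_bilinear.zero_left[OF B])
qed

lemmas test_fun_mult = test_fun_bounded_bilinear[OF bounded_bilinear_mult]
lemmas test_fun_scaleR_left = test_fun_bounded_bilinear[OF bounded_bilinear_scaleR]

lemma test_fun_bounded_linear:
  assumes L: "bounded_linear L" and "test_fun S f"
  shows "test_fun S (\<lambda>x. L (f x))"
proof -
  obtain K where K: "compact K" "K \<subseteq> S" "\<And>x. x \<notin> K \<Longrightarrow> f x = 0" using test_funE[OF assms(2)] by blast
  show ?thesis
    by (rule test_funI[OF smooth_bounded_linear[OF L test_fun_smooth[OF assms(2)]] K(1,2)])
      (simp add: K(3) linear_0[OF bounded_linear.linear[OF L]])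
qed

lemma test_fun_uminus: "test_fun S f \<Longrightarrow> test_fun S (\<lambda>x. - f x)"
  using test_fun_bounded_linear[OF bounded_linear_minus[OF bounded_linear_ident]] .

lemma test_fun_diff: "test_fun S f \<Longrightarrow> test_fun S g \<Longrightarrow> test_fun S (\<lambda>x. f x - g x)"
  using test_fun_add[OF _ test_fun_uminus, of S f g] by simp

lemma test_fun_sum: "(\<And>i. i \<in> I \<Longrightarrow> test_fun S (f i)) \<Longrightarrow> test_fun S (\<lambda>x. \<Sum>i\<in>I. f i x)"
  by (induction I rule: infinite_finite_induct) (auto intro: test_fun_0 test_fun_add)

lemma dderiv_zero_outside:
  assumes "closed K" "\<And>x. x \<notin> K \<Longrightarrow> f x = 0" "x \<notin> K"
  shows "dderiv f v x = 0"
proof -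
  have "(f has_derivative (\<lambda>h. 0)) (at x)"
    by (rule has_derivative_transform_within_open[OF has_derivative_const[of 0], where s="-K"])
      (use assms in auto)
  then show ?thesis by (rule dderiv_eq)
qed

lemma test_fun_dderiv:
  assumes "test_fun S f"
  shows "test_fun S (\<lambda>x. dderiv f v x)"
proof -
  obtain K where K: "compact K" "K \<subseteq> S" "\<And>x. x \<notin> K \<Longrightarrow> f x = 0"
    using assms unfolding test_fun_def by blast
  have "dderiv f v x = 0" if "x \<notin> K" for x
    using dderiv_zero_outside[OF compact_imp_closed[OF K(1)] K(3) that] .
  then show ?thesis
    using assms K(1,2) smooth_dderiv unfolding test_fun_def by blast
qed

lemma test_fun_imp_Cc_infinity:
  assumes "test_fun S f"
  shows "f \<in> Cc_infinity S"
proof -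
  obtain K where K: "compact K" "K \<subseteq> S" "\<And>x. x \<notin> K \<Longrightarrow> f x = 0"
    using assms unfolding test_fun_def by blast
  have "support_on S f \<subseteq> K" using K(3) by (auto simp: support_on_def)
  then have cl: "closure (support_on S f) \<subseteq> K"
    by (simp add: K(1) closure_minimal compact_imp_closed)
  then have "compact (closure (support_on S f))"
    using K(1) compact_Int_closed[of K "closure (support_on S f)"] by (simp add: inf_absorb2)
  then show ?thesis
    using cl K(2) assms unfolding Cc_infinity_def smooth_on_def test_fun_def smooth_def by blast
qed

text \<open>The open set \<open>S\<close> and the open complement of the support cover the space.
  The extension equals \<open>f\<close> on the first and 0 on the second, and smoothness is
  local.\<close>

lemma Cc_infinity_imp_test_fun:
  assumes "f \<in> Cc_infinity S" "open S"
  shows "test_fun S (\<lambda>x. if x \<in> S then f x else 0)"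
proof -
  define K where "K = closure (support_on S f)"
  define g where "g = (\<lambda>x. if x \<in> S then f x else 0)"
  have K: "compact K" "K \<subseteq> S" "open (- K)"
    using assms by (auto simp: K_def Cc_infinity_def)
  have g0: "g x = 0" if "x \<notin> K" for x
    using that closure_subset[of "support_on S f"] by (auto simp: g_def K_def support_on_def)
  have "Ck_on k UNIV g" for k
  proof -
    have "Ck_on k S f" using assms(1) Ck_on_subset unfolding Cc_infinity_def smooth_on_def by blast
    then have "Ck_on k S g"
      by (rule Ck_on_cong[OF assms(2), rotated]) (auto simp: g_def)
    moreover have "Ck_on k (- K) g"
      by (rule Ck_on_cong[OF K(3) _ Ck_on_subset[OF Ck_const[of k 0]]]) (auto simp: g0)
    ultimately have "Ck_on k (S \<union> - K) g" by (rule Ck_on_Un[OF assms(2) K(3)])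
    moreover have "S \<union> - K = UNIV" using K(2) by auto
    ultimately show ?thesis by simp
  qed
  then show ?thesis
    using K(1,2) g0 unfolding test_fun_def smooth_def g_def by blast
qed

section \<open>Uniform bounds for test functions and their increments\<close>

lemma test_fun_bounded:
  assumes "test_fun S f"
  obtains B where "B > 0" "\<And>x. norm (f x) \<le> B"
proof -
  obtain K where K: "compact K" "\<And>x. x \<notin> K \<Longrightarrow> f x = 0"
    using assms unfolding test_fun_def by blast
  have "bounded (f ` K)"
    using K(1) assms smooth_continuous compact_continuous_image compact_imp_bounded test_fun_smooth by blast
  then obtain B where "B > 0" "\<forall>y\<in>f ` K. norm y \<le> B" using bounded_pos by blast
  then have "norm (f x) \<le> B" for x using K(2)[of x] by (cases "x \<in> K") auto
  with \<open>B > 0\<close> show ?thesis using that by blast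
qed

lemma test_fun_dderiv_bounded:
  assumes "test_fun S f"
  obtains B where "B > 0" "\<And>x v. norm (dderiv f v x) \<le> B * norm v"
proof -
  have "\<exists>B>0. \<forall>x. norm (dderiv f b x) \<le> B" for b
    using test_fun_bounded[OF test_fun_dderiv[OF assms]] by metis
  then obtain B where B: "\<And>b. B b > 0" "\<And>b x. norm (dderiv f b x) \<le> B b" by metis
  have "norm (dderiv f v x) \<le> (\<Sum>b\<in>Basis. B b) * norm v" for x v
  proof -
    have "norm (dderiv f v x) = norm (\<Sum>b\<in>Basis. (v \<bullet> b) *\<^sub>R dderiv f b x)"
      using dderiv_basis_sum smooth_differentiable test_fun_smooth assms by metis
    also have "\<dots> \<le> (\<Sum>b\<in>Basis. norm v * B b)"
      by (rule sum_norm_le) (auto intro!: mult_mono B Basis_le_norm)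
    finally show ?thesis by (simp add: sum_distrib_left mult.commute)
  qed
  moreover have "(\<Sum>b\<in>Basis. B (b::'a)) > 0" by (rule sum_pos) (auto simp: B)
  ultimately show ?thesis using that by blast
qed

lemma test_fun_lipschitz:
  assumes "test_fun S f"
  obtains L where "L > 0" "\<And>x y. norm (f x - f y) \<le> L * norm (x - y)"
proof -
  obtain B where B: "B > 0" "\<And>x v. norm (dderiv f v x) \<le> B * norm v"
    using test_fun_dderiv_bounded[OF assms] by blast
  have "norm (f x - f y) \<le> B * norm (x - y)" for x y
    by (rule differentiable_bound[of UNIV f "\<lambda>x. frechet_derivative f (at x)"])
      (use B smooth_has_derivative[OF test_fun_smooth[OF assms]] in \<open>auto intro!: onorm_le\<close>)
  then show ?thesis using that B(1) by blast
qed

text \<open>A second-order remainder with a constant independent of \<open>x\<close>, which later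
  allows differentiation of a convolution under the integral sign. It follows from the mean value
  theorem because the derivative is Lipschitz.\<close>

lemma test_fun_quadratic_approx:
  assumes "test_fun S f"
  obtains C where "C > 0" "\<And>x h. norm (f (x + h) - f x - dderiv f h x) \<le> C * norm h ^ 2"
proof -
  have sm: "smooth f" using assms test_fun_smooth by blast
  have "\<exists>L>0. \<forall>x y. norm (dderiv f b x - dderiv f b y) \<le> L * norm (x - y)" for b
    using test_fun_lipschitz[OF test_fun_dderiv[OF assms, of b]] by metis
  then obtain L where L: "\<And>b. L b > 0"
    "\<And>b x y. norm (dderiv f b x - dderiv f b y) \<le> L b * norm (x - y)" by metis
  \<comment> \<open>The Lipschitz constants of the partial derivatives add up to one for the whole
    derivative.\<close>
  define C where "C = (\<Sum>b\<in>Basis. L (b::'a))"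
  have C0: "C > 0" unfolding C_def by (rule sum_pos) (auto simp: L)
  have C: "norm (dderiv f v x - dderiv f v y) \<le> (C * norm (x - y)) * norm v" for v x y
  proof -
    have "norm (dderiv f v x - dderiv f v y) = norm (\<Sum>b\<in>Basis. (v \<bullet> b) *\<^sub>R (dderiv f b x - dderiv f b y))"
      using dderiv_basis_sum[OF smooth_differentiable[OF sm, of x], of v]
        dderiv_basis_sum[OF smooth_differentiable[OF sm, of y], of v]
      by (simp only: scaleR_diff_right sum_subtractf)
    also have "\<dots> \<le> (\<Sum>b\<in>Basis. norm v * (L b * norm (x - y)))"
      by (rule sum_norm_le) (auto intro!: mult_mono L Basis_le_norm)
    finally show ?thesis by (simp add: C_def sum_distrib_left sum_distrib_right mult_ac)
  qed
  have "norm (f (x + h) - f x - dderiv f h x) \<le> C * norm h ^ 2" for x h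
  proof -
    have "norm (f (x + h) - f x - dderiv f ((x + h) - x) x) \<le> norm ((x + h) - x) * (C * norm h)"
    proof (rule differentiable_bound_linearization[where S="cball x (norm h)"])
      show "(f has_derivative frechet_derivative f (at y)) (at y within cball x (norm h))" for y
        using smooth_has_derivative[OF sm] by (rule has_derivative_at_withinI)
      show "onorm (frechet_derivative f (at y) - frechet_derivative f (at x)) \<le> C * norm h"
        if "y \<in> cball x (norm h)" for y
      proof (rule onorm_le)
        fix v
        have "norm (dderiv f v y - dderiv f v x) \<le> (C * norm (y - x)) * norm v" by (rule C)
        also have "\<dots> \<le> (C * norm h) * norm v"
          using that C0 by (intro mult_right_mono mult_left_mono) (auto simp: dist_norm norm_minus_commute)
        finally show "norm ((frechet_derivative f (at y) - frechet_derivative f (at x)) v) \<le> C * norm h * norm v"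
          by simp
      qed
    qed (auto simp: dist_norm mult_left_le_one_le)
    then show ?thesis by (simp add: power2_eq_square mult_ac)
  qed
  then show ?thesis using that C0 by blast
qed

section \<open>Integration of test functions and mollification\<close>

lemma nn_integral_lborel_translate:
  fixes f :: "'a::euclidean_space \<Rightarrow> ennreal"
  assumes [measurable]: "f \<in> borel_measurable borel"
  shows "(\<integral>\<^sup>+x. f (x + a) \<partial>lborel) = (\<integral>\<^sup>+x. f x \<partial>lborel)"
proof -
  have "(\<integral>\<^sup>+x. f x \<partial>lborel) = (\<integral>\<^sup>+x. f x \<partial>distr lborel borel ((+) a))"
    by (simp add: lborel_distr_plus)
  also have "\<dots> = (\<integral>\<^sup>+x. f (a + x) \<partial>lborel)" by (rule nn_integral_distr) auto
  finally show ?thesis by (simp add: add.commute)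
qed

lemma integral_lborel_translate:
  fixes f :: "'a::euclidean_space \<Rightarrow> 'b::euclidean_space"
  assumes [measurable]: "f \<in> borel_measurable borel"
  shows "(\<integral>x. f (x + a) \<partial>lborel) = (\<integral>x. f x \<partial>lborel)"
proof -
  have "(\<integral>x. f x \<partial>lborel) = (\<integral>x. f x \<partial>distr lborel borel ((+) a))"
    by (simp add: lborel_distr_plus)
  also have "\<dots> = (\<integral>x. f (a + x) \<partial>lborel)" by (rule integral_distr) auto
  finally show ?thesis by (simp add: add.commute)
qed

lemma integrable_lborel_translate:
  fixes f :: "'a::euclidean_space \<Rightarrow> 'b::euclidean_space"
  assumes "integrable lborel f"
  shows "integrable lborel (\<lambda>x. f (x + a))"
proof -
  have [measurable]: "f \<in> borel_measurable borel" using assms by auto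
  have "integrable (distr lborel borel ((+) a)) f"
    using assms by (simp add: lborel_distr_plus)
  then show ?thesis by (subst (asm) integrable_distr_eq) (auto simp: add.commute)
qed

lemma nn_integral_lborel_scale_reflect:
  fixes f :: "'a::euclidean_space \<Rightarrow> ennreal"
  assumes [measurable]: "f \<in> borel_measurable borel" and "c \<noteq> 0"
  shows "(\<integral>\<^sup>+x. f x \<partial>lborel) = ennreal (\<bar>c\<bar> ^ DIM('a)) * (\<integral>\<^sup>+x. f (a + c *\<^sub>R x) \<partial>lborel)"
  by (subst lborel_affine[OF assms(2), of a])
    (simp add: nn_integral_density nn_integral_distr nn_integral_cmult)

lemma nn_integral_lborel_reflect:
  fixes f :: "'a::euclidean_space \<Rightarrow> ennreal"
  assumes [measurable]: "f \<in> borel_measurable borel"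
  shows "(\<integral>\<^sup>+x. f (a - x) \<partial>lborel) = (\<integral>\<^sup>+x. f x \<partial>lborel)"
  using nn_integral_lborel_scale_reflect[OF assms, of "-1" a] by simp

lemma test_fun_integrable:
  assumes "test_fun S f"
  shows "integrable lborel f"
proof -
  obtain K where K: "compact K" "K \<subseteq> S" "\<And>x. x \<notin> K \<Longrightarrow> f x = 0" using test_funE[OF assms] by blast
  have "(\<lambda>x. indicator K x *\<^sub>R f x) = f" using K(3) by (auto simp: indicator_def)
  then show ?thesis
    using borel_integrable_compact[OF K(1) smooth_continuous[OF test_fun_smooth[OF assms]]] by metis
qed

lemma test_fun_borel: "test_fun S f \<Longrightarrow> f \<in> borel_measurable borel"
  by (rule smooth_borel[OF test_fun_smooth])

text \<open>Difference quotients in the direction \<open>v\<close> have integral 0 by translation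
  invariance. They converge to the derivative and are bounded by the Lipschitz constant on a fixed
  compact set, so dominated convergence applies.\<close>

lemma integral_dderiv_eq_0:
  assumes "test_fun S f"
  shows "(\<integral>x. dderiv f v x \<partial>lborel) = 0"
proof -
  obtain K where K: "compact K" "K \<subseteq> S" "\<And>x. x \<notin> K \<Longrightarrow> f x = 0" using test_funE[OF assms] by blast
  obtain L where L: "L > 0" "\<And>x y. norm (f x - f y) \<le> L * norm (x - y)"
    using test_fun_lipschitz[OF assms] by blast
  obtain C where C: "C > 0" "\<And>x h. norm (f (x + h) - f x - dderiv f h x) \<le> C * norm h ^ 2"
    using test_fun_quadratic_approx[OF assms] by blast
  have sm: "smooth f" by (rule test_fun_smooth[OF assms])
  have [measurable]: "f \<in> borel_measurable borel" by (rule test_fun_borel[OF assms])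
  \<comment> \<open>Contains every point from which a step \<open>s *\<^sub>R v\<close> with s in
    [0,1] leads into \<open>K\<close>; all the quotients defined below vanish off it.\<close>
  define K' where "K' = {x - y |x y. x \<in> K \<and> y \<in> (\<lambda>s. s *\<^sub>R v) ` {0..1::real}}"
  have "compact ((\<lambda>s. s *\<^sub>R v) ` {0..1::real})" by (intro compact_continuous_image continuous_intros) auto
  then have cK': "compact K'" unfolding K'_def by (rule compact_differences[OF K(1)])
  define s where "s n x = (real n + 1) *\<^sub>R (f (x + (1 / (real n + 1)) *\<^sub>R v) - f x)" for n :: nat and x
  have s0: "(\<integral>x. s n x \<partial>lborel) = 0" for n
  proof -
    have "integrable lborel f" by (rule test_fun_integrable[OF assms])
    then show ?thesis
      unfolding s_def using integral_lborel_translate[of f] integrable_lborel_translate[of f] by simp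
  qed
  have "(\<lambda>n. \<integral>x. s n x \<partial>lborel) \<longlonglongrightarrow> (\<integral>x. dderiv f v x \<partial>lborel)"
  proof (rule integral_dominated_convergence[where w="\<lambda>x. indicator K' x *\<^sub>R (L * norm v)"])
    show "(\<lambda>x. dderiv f v x) \<in> borel_measurable lborel"
      using smooth_borel[OF smooth_dderiv[OF sm]] by simp
    show "s n \<in> borel_measurable lborel" for n unfolding s_def by measurable
    show "integrable lborel (\<lambda>x. indicator K' x *\<^sub>R (L * norm v))"
      by (rule borel_integrable_compact[OF cK']) auto
    show "AE x in lborel. (\<lambda>n. s n x) \<longlonglongrightarrow> dderiv f v x"
    proof (rule AE_I2)
      fix x
      have b: "norm (s n x - dderiv f v x) \<le> C * norm v ^ 2 * inverse (real (Suc n))" for n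
      proof -
        define r where "r = real n + 1"
        have r: "r > 0" by (simp add: r_def)
        have "s n x - dderiv f v x = r *\<^sub>R (f (x + (1/r) *\<^sub>R v) - f x - dderiv f ((1/r) *\<^sub>R v) x)"
          using r by (simp add: s_def r_def[symmetric] linear_scale[OF smooth_dderiv_linear[OF sm]] scaleR_diff_right)
        also have "norm \<dots> \<le> r * (C * norm ((1/r) *\<^sub>R v) ^ 2)"
          using C(2)[of x "(1/r) *\<^sub>R v"] r by (simp add: mult_left_mono)
        also have "\<dots> = C * norm v ^ 2 * inverse r"
          using r by (simp add: field_simps power2_eq_square)
        finally show ?thesis by (simp add: r_def add.commute)
      qed
      have l: "(\<lambda>n. C * norm v ^ 2 * inverse (real (Suc n))) \<longlonglongrightarrow> 0"
        using tendsto_mult_right_zero[OF LIMSEQ_inverse_real_of_nat] .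
      have "(\<lambda>n. s n x - dderiv f v x) \<longlonglongrightarrow> 0"
        by (rule Lim_null_comparison[OF always_eventually l]) (rule allI, rule b)
      then show "(\<lambda>n. s n x) \<longlonglongrightarrow> dderiv f v x" by (simp add: LIM_zero_iff)
    qed
    show "AE x in lborel. norm (s n x) \<le> indicator K' x *\<^sub>R (L * norm v)" for n
    proof (rule AE_I2)
      fix x
      show "norm (s n x) \<le> indicator K' x *\<^sub>R (L * norm v)"
      proof (cases "x \<in> K'")
        case True
        have "norm (s n x) = (real n + 1) * norm (f (x + (1 / (real n + 1)) *\<^sub>R v) - f x)"
          by (simp add: s_def)
        also have "\<dots> \<le> (real n + 1) * (L * norm ((x + (1 / (real n + 1)) *\<^sub>R v) - x))"
          by (intro mult_left_mono L(2)) simp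
        also have "\<dots> = L * norm v" by (simp add: field_simps)
        finally show ?thesis using True by simp
      next
        case False
        have "x \<notin> K" "x + (1 / (real n + 1)) *\<^sub>R v \<notin> K"
        proof -
          have "0 \<in> (\<lambda>s. s *\<^sub>R v) ` {0..1::real}" by (rule image_eqI[of _ _ 0]) auto
          moreover have "x = x - 0" by simp
          ultimately show "x \<notin> K" using False unfolding K'_def by blast
          show "x + (1 / (real n + 1)) *\<^sub>R v \<notin> K"
          proof
            assume "x + (1 / (real n + 1)) *\<^sub>R v \<in> K"
            moreover have "(1 / (real n + 1)) *\<^sub>R v \<in> (\<lambda>s. s *\<^sub>R v) ` {0..1::real}" by auto
            moreover have "x = (x + (1 / (real n + 1)) *\<^sub>R v) - (1 / (real n + 1)) *\<^sub>R v" by simp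
            ultimately show False using False unfolding K'_def by blast
          qed
        qed
        then show ?thesis using False by (simp add: s_def K(3) indicator_def)
      qed
    qed
  qed
  then show ?thesis using s0 LIMSEQ_unique[OF _ tendsto_const] by simp
qed

lemma dderiv_scaleR:
  assumes "smooth a" "smooth f"
  shows "dderiv (\<lambda>x. a x *\<^sub>R f x) v x = a x *\<^sub>R dderiv f v x + dderiv a v x *\<^sub>R f x"
  by (rule dderiv_eq[OF has_derivative_scaleR[OF smooth_has_derivative smooth_has_derivative]]) (fact assms)+

lemma integral_by_parts:
  assumes "test_fun S \<psi>" "smooth f"
  shows "(\<integral>x. dderiv \<psi> v x *\<^sub>R f x \<partial>lborel) = - (\<integral>x. \<psi> x *\<^sub>R dderiv f v x \<partial>lborel)"
proof -
  have "(\<integral>x. \<psi> x *\<^sub>R dderiv f v x + dderiv \<psi> v x *\<^sub>R f x \<partial>lborel) = 0"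
    using integral_dderiv_eq_0[OF test_fun_scaleR_left[OF assms], of v]
    by (simp add: dderiv_scaleR[OF test_fun_smooth[OF assms(1)] assms(2)])
  moreover have "integrable lborel (\<lambda>x. \<psi> x *\<^sub>R dderiv f v x)"
    by (rule test_fun_integrable[OF test_fun_scaleR_left[OF assms(1) smooth_dderiv[OF assms(2)]]])
  moreover have "integrable lborel (\<lambda>x. dderiv \<psi> v x *\<^sub>R f x)"
    by (rule test_fun_integrable[OF test_fun_scaleR_left[OF test_fun_dderiv[OF assms(1)] assms(2)]])
  ultimately show ?thesis by (simp add: eq_neg_iff_add_eq_0 add.commute)
qed

section \<open>Smoothness of convolutions with test functions\<close>

lemma has_derivative_quadratic:
  assumes "linear D" "\<And>h. norm (f (y + h) - f y - D h) \<le> C * norm h ^ 2"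
  shows "(f has_derivative D) (at (y::'a::euclidean_space))"
proof (rule has_derivativeI)
  show "bounded_linear D" using assms(1) linear_conv_bounded_linear by blast
  have "((\<lambda>z. C * norm (z - y)) \<longlongrightarrow> C * norm (y - y)) (at y)"
    by (intro tendsto_intros)
  then have lim: "((\<lambda>z. C * norm (z - y)) \<longlongrightarrow> 0) (at y)" by simp
  have "\<forall>\<^sub>F z in at y. norm ((f z - f y - D (z - y)) /\<^sub>R norm (z - y)) \<le> C * norm (z - y)"
    unfolding eventually_at_filter
  proof (intro always_eventually allI impI)
    fix z assume "z \<noteq> y"
    then show "norm ((f z - f y - D (z - y)) /\<^sub>R norm (z - y)) \<le> C * norm (z - y)"
      using assms(2)[of "z - y"] by (simp add: divide_simps power2_eq_square mult_ac)
  qed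
  from Lim_null_comparison[OF this lim]
  show "((\<lambda>z. (f z - f y - D (z - y)) /\<^sub>R norm (z - y)) \<longlongrightarrow> 0) (at y)" .
qed

lemma integrable_mult_test_fun:
  fixes w :: "'a::euclidean_space \<Rightarrow> real"
  assumes "integrable lborel w" "test_fun S \<kappa>"
  shows "integrable lborel (\<lambda>x. w x * (\<kappa> (y - x) :: real))"
proof -
  obtain B where "B > 0" "\<And>x. norm (\<kappa> x) \<le> B" using test_fun_bounded[OF assms(2)] by blast
  moreover have [measurable]: "\<kappa> \<in> borel_measurable borel" using assms(2) by (rule test_fun_borel)
  ultimately show ?thesis
    by (intro Bochner_Integration.integrable_bound[OF integrable_mult_right[OF assms(1), of B]])
      (use assms(1) in \<open>auto simp: abs_mult mult.commute[of B] intro!: mult_left_mono AE_I2\<close>)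
qed

text \<open>The remainder of \<open>\<kappa>\<close> is at most C |h|^2 uniformly in the point, so
  integration against \<open>w\<close> gives a quadratic remainder of the convolution.\<close>

lemma convolution_has_derivative:
  fixes w :: "'a::euclidean_space \<Rightarrow> real"
  assumes w: "integrable lborel w" and \<kappa>: "test_fun S \<kappa>"
  shows "((\<lambda>y. \<integral>x. w x * \<kappa> (y - x) \<partial>lborel) has_derivative
          (\<lambda>v. \<integral>x. w x * dderiv \<kappa> v (y - x) \<partial>lborel)) (at y)"
proof -
  obtain C where C: "C > 0" "\<And>x h. norm (\<kappa> (x + h) - \<kappa> x - dderiv \<kappa> h x) \<le> C * norm h ^ 2"
    using test_fun_quadratic_approx[OF \<kappa>] by blast
  have int: "integrable lborel (\<lambda>x. w x * \<kappa> (y - x))" "integrable lborel (\<lambda>x. w x * dderiv \<kappa> v (y - x))" for y v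
    by (intro integrable_mult_test_fun[OF w, of S] \<kappa> test_fun_dderiv)+
  note lin = smooth_dderiv_linear[OF test_fun_smooth[OF \<kappa>]]
  show ?thesis
  proof (rule has_derivative_quadratic)
    show "linear (\<lambda>v. \<integral>x. w x * dderiv \<kappa> v (y - x) \<partial>lborel)"
    proof (rule linearI)
      show "(\<integral>x. w x * dderiv \<kappa> (u + v) (y - x) \<partial>lborel)
          = (\<integral>x. w x * dderiv \<kappa> u (y - x) \<partial>lborel) + (\<integral>x. w x * dderiv \<kappa> v (y - x) \<partial>lborel)" for u v
        by (simp add: linear_add[OF lin] distrib_left int)
      show "(\<integral>x. w x * dderiv \<kappa> (r *\<^sub>R v) (y - x) \<partial>lborel)
          = r *\<^sub>R (\<integral>x. w x * dderiv \<kappa> v (y - x) \<partial>lborel)" for r v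
        by (simp add: linear_scale[OF lin] mult.left_commute)
    qed
    fix h
    have "(\<integral>x. w x * \<kappa> (y + h - x) \<partial>lborel) - (\<integral>x. w x * \<kappa> (y - x) \<partial>lborel) - (\<integral>x. w x * dderiv \<kappa> h (y - x) \<partial>lborel)
      = (\<integral>x. w x * (\<kappa> ((y - x) + h) - \<kappa> (y - x) - dderiv \<kappa> h (y - x)) \<partial>lborel)"
      using int by (simp add: right_diff_distrib add_diff_eq diff_add_eq)
    also have "norm \<dots> \<le> (\<integral>x. \<bar>w x\<bar> * (C * norm h ^ 2) \<partial>lborel)"
    proof (rule order_trans[OF integral_norm_bound integral_mono[OF integrable_norm]])
      show "integrable lborel (\<lambda>x. w x * (\<kappa> ((y - x) + h) - \<kappa> (y - x) - dderiv \<kappa> h (y - x)))"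
        using int[of "y + h"] int[of y] by (simp add: right_diff_distrib add_diff_eq diff_add_eq)
      show "integrable lborel (\<lambda>x. \<bar>w x\<bar> * (C * norm h ^ 2))" using w by simp
      show "norm (w x * (\<kappa> ((y - x) + h) - \<kappa> (y - x) - dderiv \<kappa> h (y - x))) \<le> \<bar>w x\<bar> * (C * norm h ^ 2)" for x
        using C(2)[of "y - x" h] by (simp add: abs_mult mult_left_mono)
    qed
    also have "\<dots> = ((\<integral>x. \<bar>w x\<bar> \<partial>lborel) * C) * norm h ^ 2" by simp
    finally show "norm ((\<integral>x. w x * \<kappa> (y + h - x) \<partial>lborel) - (\<integral>x. w x * \<kappa> (y - x) \<partial>lborel) - (\<integral>x. w x * dderiv \<kappa> h (y - x) \<partial>lborel))
      \<le> ((\<integral>x. \<bar>w x\<bar> \<partial>lborel) * C) * norm h ^ 2" .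
  qed
qed

lemma smooth_convolution:
  fixes w :: "'a::euclidean_space \<Rightarrow> real"
  assumes "integrable lborel w" "test_fun S \<kappa>"
  shows "smooth (\<lambda>y. \<integral>x. w x * \<kappa> (y - x) \<partial>lborel)"
proof -
  have "Ck_on k UNIV (\<lambda>y. \<integral>x. w x * \<kappa> (y - x) \<partial>lborel)" for k
    using assms(2)
  proof (induction k arbitrary: \<kappa>)
    case 0
    have "isCont (\<lambda>y. \<integral>x. w x * \<kappa> (y - x) \<partial>lborel) y" for y
      using has_derivative_continuous[OF convolution_has_derivative[OF assms(1) 0]] .
    then show ?case by (simp add: continuous_at_imp_continuous_on)
  next
    case (Suc k)
    show ?case
      by (rule Ck_SucI[OF convolution_has_derivative[OF assms(1) Suc.prems]])
        (rule Suc.IH[OF test_fun_dderiv[OF Suc.prems]])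
  qed
  then show ?thesis by (simp add: smooth_def)
qed

subsection \<open>Continuity of translations in the mean\<close>

text \<open>The functions with L1-continuous translations are closed in L1: the difference splits
  into three parts of size e/3, and the two approximation errors are equal by translation
  invariance.\<close>

lemma L1_translation_lim:
  fixes w :: "'a::euclidean_space \<Rightarrow> real"
  assumes [measurable]: "\<And>i. s i \<in> borel_measurable borel" "w \<in> borel_measurable borel"
    and lim: "(\<lambda>i. \<integral>\<^sup>+x. ennreal \<bar>s i x - w x\<bar> \<partial>lborel) \<longlonglongrightarrow> 0"
    and s: "\<And>i e. e > 0 \<Longrightarrow> \<exists>d>0. \<forall>z. norm z < d \<longrightarrow> (\<integral>\<^sup>+x. ennreal \<bar>s i (x + z) - s i x\<bar> \<partial>lborel) \<le> ennreal e"
    and "e > 0"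
  shows "\<exists>d>0. \<forall>z. norm z < d \<longrightarrow> (\<integral>\<^sup>+x. ennreal \<bar>w (x + z) - w x\<bar> \<partial>lborel) \<le> ennreal e"
proof -
  have "\<forall>\<^sub>F i in sequentially. (\<integral>\<^sup>+x. ennreal \<bar>s i x - w x\<bar> \<partial>lborel) < ennreal (e / 3)"
    using order_tendstoD(2)[OF lim, of "ennreal (e/3)"] \<open>e > 0\<close> by simp
  then obtain i where i: "(\<integral>\<^sup>+x. ennreal \<bar>s i x - w x\<bar> \<partial>lborel) < ennreal (e / 3)"
    by (auto simp: eventually_sequentially)
  obtain d where d: "d > 0" "\<And>z. norm z < d \<Longrightarrow> (\<integral>\<^sup>+x. ennreal \<bar>s i (x + z) - s i x\<bar> \<partial>lborel) \<le> ennreal (e / 3)"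
    using s[of "e/3" i] \<open>e > 0\<close> by auto
  have "(\<integral>\<^sup>+x. ennreal \<bar>w (x + z) - w x\<bar> \<partial>lborel) \<le> ennreal e" if z: "norm z < d" for z
  proof -
    have "(\<integral>\<^sup>+x. ennreal \<bar>w (x + z) - w x\<bar> \<partial>lborel)
      \<le> (\<integral>\<^sup>+x. ennreal \<bar>s i (x + z) - w (x + z)\<bar> + (ennreal \<bar>s i (x + z) - s i x\<bar> + ennreal \<bar>s i x - w x\<bar>) \<partial>lborel)"
      by (intro nn_integral_mono) (simp add: ennreal_plus[symmetric] del: ennreal_plus)
    also have "\<dots> = (\<integral>\<^sup>+x. ennreal \<bar>s i x - w x\<bar> \<partial>lborel)
        + ((\<integral>\<^sup>+x. ennreal \<bar>s i (x + z) - s i x\<bar> \<partial>lborel) + (\<integral>\<^sup>+x. ennreal \<bar>s i x - w x\<bar> \<partial>lborel))"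
      using nn_integral_lborel_translate[of "\<lambda>x. ennreal \<bar>s i x - w x\<bar>" z] by (simp add: nn_integral_add)
    also have "\<dots> \<le> ennreal (e/3) + (ennreal (e/3) + ennreal (e/3))"
      by (intro add_mono d(2)[OF z] less_imp_le[OF i])
    also have "\<dots> = ennreal e" using \<open>e > 0\<close> by (simp add: ennreal_plus[symmetric] del: ennreal_plus)
    finally show ?thesis .
  qed
  then show ?thesis using d(1) by blast
qed

text \<open>By regularity there are a compact \<open>K\<close> inside \<open>A\<close> and an open
  \<open>U\<close> around \<open>A\<close> with \<open>U - K\<close> of measure at most e/2. If |z|
  is below the distance from \<open>K\<close> to the complement of \<open>U\<close>, then
  \<open>A\<close> can separate x from x + z only when one of them lies in
  \<open>U - K\<close>.\<close>

lemma L1_translation_bounded_set: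
  fixes A :: "'a::euclidean_space set"
  assumes A: "A \<in> sets borel" "bounded A" and "e > 0"
  shows "\<exists>d>0. \<forall>z. norm z < d \<longrightarrow> (\<integral>\<^sup>+x. ennreal \<bar>indicator A (x + z) - indicator A x\<bar> \<partial>lborel) \<le> ennreal e"
proof -
  have e4: "0 < e / 4" using \<open>e > 0\<close> by simp
  obtain U where U: "open U" "A \<subseteq> U" "emeasure lborel (U - A) < ennreal (e/4)"
    by (rule outer_regular_lborel[OF A(1) e4])
  have "A \<in> sets lebesgue" using A(1) by simp
  then obtain K where K: "closed K" "K \<subseteq> A" "emeasure lebesgue (A - K) < ennreal (e/4)"
    using sets_lebesgue_inner_closed[OF _ e4] by metis
  have "compact K" using K A(2) bounded_subset compact_eq_bounded_closed by blast
  moreover have "K \<inter> (- U) = {}" using K(2) U(2) by blast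
  ultimately obtain d where d: "d > 0" "\<And>x y. x \<in> K \<Longrightarrow> y \<in> - U \<Longrightarrow> d \<le> dist x y"
    using separate_compact_closed[of K "- U"] closed_Compl[OF U(1)] by blast
  have [measurable]: "U \<in> sets borel" "K \<in> sets borel" "A \<in> sets borel" using U(1) K(1) A(1) by auto
  have m: "emeasure lborel (U - K) \<le> ennreal (e/2)"
  proof -
    have "emeasure lborel (U - K) \<le> emeasure lborel ((U - A) \<union> (A - K))" by (intro emeasure_mono) auto
    also have "\<dots> \<le> emeasure lborel (U - A) + emeasure lborel (A - K)" by (intro emeasure_subadditive) auto
    also have "\<dots> \<le> ennreal (e/4) + ennreal (e/4)"
      using U(3) K(3) by (intro add_mono) auto
    finally show ?thesis using \<open>e > 0\<close> by (simp add: ennreal_plus[symmetric] del: ennreal_plus)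
  qed
  have "(\<integral>\<^sup>+x. ennreal \<bar>indicator A (x + z) - indicator A x\<bar> \<partial>lborel) \<le> ennreal e" if z: "norm z < d" for z
  proof -
    have 1: "x + z \<in> U" "x - z \<in> U" if "x \<in> K" for x
      using d(2)[OF that, of "x + z"] d(2)[OF that, of "x - z"] z by (auto simp: dist_norm)
    have "(\<integral>\<^sup>+x. ennreal \<bar>indicator A (x + z) - indicator A x\<bar> \<partial>lborel)
       \<le> (\<integral>\<^sup>+x. indicator (U - K) (x + z) + indicator (U - K) x \<partial>lborel)"
    proof (intro nn_integral_mono)
      fix x
      show "ennreal \<bar>indicator A (x + z) - indicator A x\<bar> \<le> indicator (U - K) (x + z) + indicator (U - K) x"
        using 1(1)[of x] 1(2)[of "x + z"] K(2) U(2) by (auto simp: indicator_def)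
    qed
    also have "\<dots> = emeasure lborel (U - K) + emeasure lborel (U - K)"
      using nn_integral_lborel_translate[of "indicator (U - K)" z] by (simp add: nn_integral_add)
    also have "\<dots> \<le> ennreal (e/2) + ennreal (e/2)" by (intro add_mono m)
    also have "\<dots> = ennreal e" using \<open>e > 0\<close> by (simp add: ennreal_plus[symmetric] del: ennreal_plus)
    finally show ?thesis .
  qed
  then show ?thesis using d(1) by blast
qed

lemma L1_dominated:
  fixes s :: "nat \<Rightarrow> 'a \<Rightarrow> 'b::{banach, second_countable_topology}"
  assumes "\<And>i. s i \<in> borel_measurable M" "w \<in> borel_measurable M" "integrable M g"
    "AE x in M. (\<lambda>i. s i x) \<longlonglongrightarrow> w x" "\<And>i. AE x in M. norm (s i x) \<le> g x"
  shows "(\<lambda>i. \<integral>\<^sup>+x. ennreal (norm (s i x - w x)) \<partial>M) \<longlonglongrightarrow> 0"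
proof -
  have wg: "AE x in M. norm (w x) \<le> g x"
  proof -
    have "AE x in M. \<forall>i. norm (s i x) \<le> g x" using assms(5) by (simp add: AE_all_countable)
    with assms(4) show ?thesis
      by eventually_elim (rule Lim_bounded[OF tendsto_norm], auto)
  qed
  have "(\<integral>\<^sup>+x. ennreal (2 * g x) \<partial>M) \<le> (\<integral>\<^sup>+x. ennreal (norm (2 * g x)) \<partial>M)"
    by (intro nn_integral_mono ennreal_leI) simp
  also have "\<dots> < \<infinity>"
    using integrable_mult_right[OF assms(3), of 2] by (subst (asm) integrable_iff_bounded) blast
  finally have fin: "(\<integral>\<^sup>+x. ennreal (2 * g x) \<partial>M) < \<infinity>" .
  have "(\<lambda>i. \<integral>\<^sup>+x. ennreal (norm (s i x - w x)) \<partial>M) \<longlonglongrightarrow> (\<integral>\<^sup>+x. 0 \<partial>M)"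
  proof (rule nn_integral_dominated_convergence[where w="\<lambda>x. ennreal (2 * g x)"])
    show "AE x in M. ennreal (norm (s i x - w x)) \<le> ennreal (2 * g x)" for i
      using assms(5)[of i] wg by eventually_elim (intro ennreal_leI, smt (verit) norm_triangle_ineq4)
    show "AE x in M. (\<lambda>i. ennreal (norm (s i x - w x))) \<longlonglongrightarrow> 0"
      using assms(4)
    proof eventually_elim
      fix x assume "(\<lambda>i. s i x) \<longlonglongrightarrow> w x"
      then have "(\<lambda>i. norm (s i x - w x)) \<longlonglongrightarrow> 0" by (simp add: LIM_zero tendsto_norm_zero)
      then show "(\<lambda>i. ennreal (norm (s i x - w x))) \<longlonglongrightarrow> 0" using tendsto_ennrealI[of _ 0] by simp
    qed
    show "(\<lambda>x. ennreal (norm (s i x - w x))) \<in> borel_measurable M" for i using assms(1,2) by measurable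
    show "(\<lambda>x. ennreal (2 * g x)) \<in> borel_measurable M" using assms(3) by measurable
  qed (use fin in auto)
  then show ?thesis by simp
qed

lemma L1_translation_continuous:
  fixes w :: "'a::euclidean_space \<Rightarrow> real"
  assumes "integrable lborel w" "e > 0"
  shows "\<exists>d>0. \<forall>z. norm z < d \<longrightarrow> (\<integral>\<^sup>+x. ennreal \<bar>w (x + z) - w x\<bar> \<partial>lborel) \<le> ennreal e"
  using assms
proof (induction w arbitrary: e rule: integrable_induct)
  case (base A c)
  have [measurable]: "A \<in> sets borel" using base by simp
  \<comment> \<open>\<open>A\<close> has finite measure but may be unbounded, so it is exhausted by
    its intersections with balls.\<close>
  define s where "s i x = indicator (A \<inter> cball 0 (real i)) x *\<^sub>R c" for i :: nat and x
  have meas[measurable]: "s i \<in> borel_measurable borel" for i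
    unfolding s_def by (intro borel_measurable_scaleR borel_measurable_indicator) auto
  have "(\<lambda>i. \<integral>\<^sup>+x. ennreal (norm (s i x - indicator A x *\<^sub>R c)) \<partial>lborel) \<longlonglongrightarrow> 0"
  proof (rule L1_dominated[where g="\<lambda>x. indicator A x *\<^sub>R \<bar>c\<bar>"])
    show "AE x in lborel. (\<lambda>i. s i x) \<longlonglongrightarrow> indicator A x *\<^sub>R c"
    proof (rule AE_I2, rule tendsto_eventually)
      fix x :: 'a
      obtain n where "norm x \<le> real n" using real_arch_simple by blast
      then have "s i x = indicator A x *\<^sub>R c" if "i \<ge> n" for i
        using that unfolding s_def by (auto simp: indicator_def)
      then show "\<forall>\<^sub>F i in sequentially. s i x = indicator A x *\<^sub>R c" by (auto simp: eventually_sequentially)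
    qed
    show "integrable lborel (\<lambda>x. indicator A x *\<^sub>R \<bar>c\<bar>)" using base by simp
    show "AE x in lborel. norm (s i x) \<le> indicator A x *\<^sub>R \<bar>c\<bar>" for i
      by (rule AE_I2) (auto simp: s_def indicator_def)
  qed (auto simp: meas)
  then have lim: "(\<lambda>i. \<integral>\<^sup>+x. ennreal \<bar>s i x - indicator A x *\<^sub>R c\<bar> \<partial>lborel) \<longlonglongrightarrow> 0" by simp
  show ?case
  proof (rule L1_translation_lim[OF _ _ lim _ \<open>e > 0\<close>])
    fix i and e :: real assume "e > 0"
    show "\<exists>d>0. \<forall>z. norm z < d \<longrightarrow> (\<integral>\<^sup>+x. ennreal \<bar>s i (x + z) - s i x\<bar> \<partial>lborel) \<le> ennreal e"
    proof -
      define B where "B = A \<inter> cball 0 (real i)"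
      have [measurable]: "B \<in> sets borel" unfolding B_def by auto
      have "bounded B" unfolding B_def by (auto simp: bounded_Int)
      \<comment> \<open>The summand 1 covers c = 0.\<close>
      have "e / (\<bar>c\<bar> + 1) > 0" using \<open>e > 0\<close> by simp
      then obtain d where d: "d > 0" "\<And>z. norm z < d \<Longrightarrow>
          (\<integral>\<^sup>+x. ennreal \<bar>indicator B (x + z) - indicator B x\<bar> \<partial>lborel) \<le> ennreal (e / (\<bar>c\<bar> + 1))"
        using L1_translation_bounded_set[OF \<open>B \<in> sets borel\<close> \<open>bounded B\<close>] by blast
      have "(\<integral>\<^sup>+x. ennreal \<bar>s i (x + z) - s i x\<bar> \<partial>lborel) \<le> ennreal e" if "norm z < d" for z
      proof -
        have "(\<integral>\<^sup>+x. ennreal \<bar>s i (x + z) - s i x\<bar> \<partial>lborel)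
            = (\<integral>\<^sup>+x. ennreal \<bar>c\<bar> * ennreal \<bar>indicator B (x + z) - indicator B x\<bar> \<partial>lborel)"
          by (intro nn_integral_cong)
            (simp add: s_def B_def[symmetric] ennreal_mult[symmetric] abs_mult[symmetric] right_diff_distrib mult.commute[of _ c])
        also have "\<dots> = ennreal \<bar>c\<bar> * (\<integral>\<^sup>+x. ennreal \<bar>indicator B (x + z) - indicator B x\<bar> \<partial>lborel)"
          by (rule nn_integral_cmult) measurable
        also have "\<dots> \<le> ennreal \<bar>c\<bar> * ennreal (e / (\<bar>c\<bar> + 1))" by (intro mult_left_mono d(2) that) simp
        also have "\<dots> = ennreal (\<bar>c\<bar> * (e / (\<bar>c\<bar> + 1)))" using \<open>e > 0\<close> by (intro ennreal_mult[symmetric]) auto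
        also have "\<dots> \<le> ennreal e" using \<open>e > 0\<close> by (intro ennreal_leI) (simp add: field_simps)
        finally show ?thesis .
      qed
      then show ?thesis using d(1) by blast
    qed
  qed auto
next
  case (add f g)
  have [measurable]: "f \<in> borel_measurable borel" "g \<in> borel_measurable borel" using add by auto
  obtain d1 where d1: "d1 > 0" "\<And>z. norm z < d1 \<Longrightarrow> (\<integral>\<^sup>+x. ennreal \<bar>f (x + z) - f x\<bar> \<partial>lborel) \<le> ennreal (e/2)"
    using add.IH(1)[of "e/2"] add.prems by auto
  obtain d2 where d2: "d2 > 0" "\<And>z. norm z < d2 \<Longrightarrow> (\<integral>\<^sup>+x. ennreal \<bar>g (x + z) - g x\<bar> \<partial>lborel) \<le> ennreal (e/2)"
    using add.IH(2)[of "e/2"] add.prems by auto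
  have "(\<integral>\<^sup>+x. ennreal \<bar>f (x + z) + g (x + z) - (f x + g x)\<bar> \<partial>lborel) \<le> ennreal e" if z: "norm z < min d1 d2" for z
  proof -
    have "(\<integral>\<^sup>+x. ennreal \<bar>f (x + z) + g (x + z) - (f x + g x)\<bar> \<partial>lborel)
      \<le> (\<integral>\<^sup>+x. ennreal \<bar>f (x + z) - f x\<bar> + ennreal \<bar>g (x + z) - g x\<bar> \<partial>lborel)"
      by (intro nn_integral_mono) (simp add: ennreal_plus[symmetric] del: ennreal_plus)
    also have "\<dots> \<le> ennreal (e/2) + ennreal (e/2)"
      using z by (subst nn_integral_add) (auto intro!: add_mono d1 d2)
    also have "\<dots> = ennreal e" using \<open>e > 0\<close> by (simp add: ennreal_plus[symmetric] del: ennreal_plus)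
    finally show ?thesis .
  qed
  then show ?case using d1(1) d2(1) by (intro exI[of _ "min d1 d2"]) auto
next
  case (lim f s)
  have "(\<lambda>i. \<integral>\<^sup>+x. ennreal (norm (s i x - f x)) \<partial>lborel) \<longlonglongrightarrow> 0"
    by (rule L1_dominated[where g="\<lambda>x. 2 * norm (f x)"]) (use lim in auto)
  then have l: "(\<lambda>i. \<integral>\<^sup>+x. ennreal \<bar>s i x - f x\<bar> \<partial>lborel) \<longlonglongrightarrow> 0" by simp
  show ?case
  proof (rule L1_translation_lim[OF _ _ l _ \<open>0 < e\<close>])
    show "s i \<in> borel_measurable borel" for i using lim(1)[of i] by auto
    show "f \<in> borel_measurable borel" using lim.hyps(4) by auto
    show "\<exists>d>0. \<forall>z. norm z < d \<longrightarrow> (\<integral>\<^sup>+x. ennreal \<bar>s i (x + z) - s i x\<bar> \<partial>lborel) \<le> ennreal e"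
      if "e > 0" for i e by (rule lim.IH[OF that])
  qed
qed

lemma ball_sets_borel[measurable]: "ball c r \<in> sets borel" "cball c r \<in> sets borel"
  by auto

subsection \<open>Mollifiers\<close>

text \<open>The argument uses \<open>z \<bullet> z\<close> in place of the norm because it is smooth
  at 0 as well.\<close>

definition bump :: "'a::euclidean_space \<Rightarrow> real" where
  "bump z = exp_bump 0 (1 - z \<bullet> z)"

definition moll :: "real \<Rightarrow> 'a::euclidean_space \<Rightarrow> real" where
  "moll \<epsilon> z = bump (z /\<^sub>R \<epsilon>) / (\<epsilon> ^ DIM('a) * (\<integral>x. bump (x::'a) \<partial>lborel))"

lemma bump_nonneg: "bump z \<ge> 0"
  by (simp add: bump_def exp_bump_0_nonneg)

lemma bump_pos_iff: "bump z > 0 \<longleftrightarrow> norm z < 1"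
proof -
  have "z \<bullet> z < 1 \<longleftrightarrow> norm z < 1"
    by (simp add: power2_norm_eq_inner[symmetric] power_less_one_iff)
  then show ?thesis by (simp add: bump_def exp_bump_0_pos_iff)
qed

lemma bump_eq_0: "norm z \<ge> 1 \<Longrightarrow> bump z = 0"
  using bump_pos_iff[of z] bump_nonneg[of z] by linarith

lemma smooth_bump: "smooth bump"
  unfolding bump_def[abs_def]
  by (rule smooth_compose_real[OF smooth_exp_bump smooth_diff[OF smooth_const smooth_inner[OF smooth_ident smooth_ident]]])

lemma test_fun_bump: "test_fun UNIV bump"
  by (rule test_funI[OF smooth_bump compact_cball[of 0 1]]) (auto simp: bump_eq_0)

lemma integral_bump_pos: "(\<integral>x. bump (x::'a::euclidean_space) \<partial>lborel) > 0"
proof -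
  have int: "integrable lborel (bump :: 'a \<Rightarrow> real)" by (rule test_fun_integrable[OF test_fun_bump])
  have "(\<integral>x. bump (x::'a) \<partial>lborel) \<noteq> 0"
  proof
    assume "(\<integral>x. bump (x::'a) \<partial>lborel) = 0"
    then have "AE x in lborel. bump (x::'a) = 0"
      using integral_nonneg_eq_0_iff_AE[OF int] bump_nonneg by auto
    then have "AE x in lborel. x \<notin> ball (0::'a) 1"
      by eventually_elim (use bump_pos_iff in \<open>force simp: dist_norm\<close>)
    then have "ball (0::'a) 1 \<in> null_sets lborel" by (subst AE_iff_null_sets) auto
    then have "measure lborel (ball (0::'a) 1) = 0" by (auto simp: measure_def null_sets_def)
    then show False using content_ball_pos[of 1 "0::'a"] by simp
  qed
  moreover have "(\<integral>x. bump (x::'a) \<partial>lborel) \<ge> 0" by (simp add: bump_nonneg)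
  ultimately show ?thesis by simp
qed

lemma moll_nonneg: "\<epsilon> > 0 \<Longrightarrow> moll \<epsilon> z \<ge> 0"
  using integral_bump_pos by (simp add: moll_def bump_nonneg less_imp_le)

lemma moll_eq_0: "\<epsilon> > 0 \<Longrightarrow> norm z \<ge> \<epsilon> \<Longrightarrow> moll \<epsilon> z = 0"
  by (simp add: moll_def bump_eq_0 field_simps)

lemma moll_pos: "\<epsilon> > 0 \<Longrightarrow> norm z < \<epsilon> \<Longrightarrow> moll \<epsilon> (z::'a::euclidean_space) > 0"
proof -
  assume "\<epsilon> > 0" "norm z < \<epsilon>"
  then have "bump (z /\<^sub>R \<epsilon>) > 0" by (simp add: bump_pos_iff field_simps)
  then show ?thesis using integral_bump_pos[where 'a='a] \<open>\<epsilon> > 0\<close> by (simp add: moll_def)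
qed

lemma test_fun_moll:
  assumes "\<epsilon> > 0"
  shows "test_fun UNIV (moll \<epsilon> :: 'a::euclidean_space \<Rightarrow> real)"
proof (rule test_funI[OF _ compact_cball[of 0 \<epsilon>]])
  have "smooth (\<lambda>z::'a. bump (0 + z /\<^sub>R \<epsilon>) * inverse (\<epsilon> ^ DIM('a) * (\<integral>x. bump (x::'a) \<partial>lborel)))"
    by (rule smooth_mult[OF smooth_compose_affine[OF bounded_linear_scaleR_right smooth_bump] smooth_const])
  then show "smooth (moll \<epsilon> :: 'a \<Rightarrow> real)" by (simp add: moll_def[abs_def] divide_inverse)
qed (use assms in \<open>auto simp: moll_eq_0\<close>)

lemma nn_integral_moll:
  assumes "\<epsilon> > 0"
  shows "(\<integral>\<^sup>+z. ennreal (moll \<epsilon> (z::'a::euclidean_space)) \<partial>lborel) = 1"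
proof -
  define c where "c = (\<integral>x. bump (x::'a) \<partial>lborel)"
  have c: "c > 0" unfolding c_def by (rule integral_bump_pos)
  have [measurable]: "(bump :: 'a \<Rightarrow> real) \<in> borel_measurable borel" by (rule smooth_borel[OF smooth_bump])
  have [measurable]: "(moll \<epsilon> :: 'a \<Rightarrow> real) \<in> borel_measurable borel"
    using test_fun_borel[OF test_fun_moll[OF assms]] .
  have "(\<integral>\<^sup>+z. ennreal (moll \<epsilon> (z::'a)) \<partial>lborel)
      = ennreal (\<epsilon> ^ DIM('a)) * (\<integral>\<^sup>+x. ennreal (moll \<epsilon> (0 + \<epsilon> *\<^sub>R x :: 'a)) \<partial>lborel)"
    using nn_integral_lborel_scale_reflect[of "\<lambda>z::'a. ennreal (moll \<epsilon> z)" \<epsilon> 0] assms by simp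
  also have "\<dots> = ennreal (\<epsilon> ^ DIM('a)) * (\<integral>\<^sup>+x. ennreal (1 / (\<epsilon> ^ DIM('a) * c)) * ennreal (bump (x :: 'a)) \<partial>lborel)"
    using assms c by (intro arg_cong2[where f="(*)"] nn_integral_cong)
      (auto simp: moll_def c_def[symmetric] ennreal_mult[symmetric] bump_nonneg)
  also have "\<dots> = ennreal (\<epsilon> ^ DIM('a)) * (ennreal (1 / (\<epsilon> ^ DIM('a) * c)) * ennreal c)"
    by (subst nn_integral_cmult) (auto simp: c_def nn_integral_eq_integral test_fun_integrable[OF test_fun_bump] bump_nonneg)
  also have "\<dots> = 1" using assms c by (simp add: ennreal_mult[symmetric])
  finally show ?thesis .
qed

text \<open>Rescaling costs one factor 1/\<epsilon> for the derivative on top of the normalising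
  power of \<epsilon>, and \<open>C\<close> is free of \<epsilon>. This is the origin of the
  exponent \<open>DIM('a) + 1\<close> in the commutator kernel.\<close>

lemma moll_dderiv_bound:
  obtains C where "C > 0"
    "\<And>\<epsilon> v z. \<epsilon> > 0 \<Longrightarrow> \<bar>dderiv (moll \<epsilon>) v (z::'a::euclidean_space)\<bar> \<le> C / \<epsilon> ^ (DIM('a) + 1) * norm v * indicator (cball 0 \<epsilon>) z"
proof -
  obtain B where B: "B > 0" "\<And>x v. norm (dderiv bump v (x::'a)) \<le> B * norm v"
    using test_fun_dderiv_bounded[OF test_fun_bump] by blast
  define c where "c = (\<integral>x. bump (x::'a) \<partial>lborel)"
  have c: "c > 0" unfolding c_def by (rule integral_bump_pos)
  have "\<bar>dderiv (moll \<epsilon>) v (z::'a)\<bar> \<le> (B/c) / \<epsilon> ^ (DIM('a) + 1) * norm v * indicator (cball 0 \<epsilon>) z"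
    if e: "\<epsilon> > 0" for \<epsilon> v z
  proof (cases "z \<in> cball 0 \<epsilon>")
    case False
    have "dderiv (moll \<epsilon>) v z = 0"
      by (rule dderiv_zero_outside[OF closed_cball _ False]) (use e in \<open>auto simp: moll_eq_0\<close>)
    then show ?thesis using False by simp
  next
    case True
    have "((\<lambda>z::'a. z /\<^sub>R \<epsilon>) has_derivative (\<lambda>v. v /\<^sub>R \<epsilon>)) (at z)" by (auto intro!: derivative_eq_intros)
    then have "((\<lambda>z::'a. bump (z /\<^sub>R \<epsilon>)) has_derivative (\<lambda>v. dderiv bump (v /\<^sub>R \<epsilon>) (z /\<^sub>R \<epsilon>))) (at z)"
      by (rule has_derivative_compose) (rule smooth_has_derivative[OF smooth_bump])
    then have "((\<lambda>z::'a. bump (z /\<^sub>R \<epsilon>) * inverse (\<epsilon> ^ DIM('a) * c)) has_derivative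
        (\<lambda>v. dderiv bump (v /\<^sub>R \<epsilon>) (z /\<^sub>R \<epsilon>) * inverse (\<epsilon> ^ DIM('a) * c))) (at z)"
      by (rule has_derivative_mult_left)
    then have "(moll \<epsilon> has_derivative
        (\<lambda>v. dderiv bump (v /\<^sub>R \<epsilon>) (z /\<^sub>R \<epsilon>) * inverse (\<epsilon> ^ DIM('a) * c))) (at z)"
      by (simp add: moll_def[abs_def] c_def divide_inverse)
    then have "dderiv (moll \<epsilon>) v z = dderiv bump (v /\<^sub>R \<epsilon>) (z /\<^sub>R \<epsilon>) * inverse (\<epsilon> ^ DIM('a) * c)"
      by (rule dderiv_eq)
    also have "\<bar>\<dots>\<bar> \<le> (B * norm (v /\<^sub>R \<epsilon>)) * inverse (\<epsilon> ^ DIM('a) * c)"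
      unfolding abs_mult using B(2)[of "z /\<^sub>R \<epsilon>" "v /\<^sub>R \<epsilon>"] e c by (intro mult_mono) auto
    also have "\<dots> = (B/c) / \<epsilon> ^ (DIM('a) + 1) * norm v" using e c by (simp add: field_simps)
    finally show ?thesis using True by simp
  qed
  then show ?thesis using that[of "B/c"] B(1) c by simp
qed

lemma test_fun_moll_translate:
  assumes "\<epsilon> > 0" "cball y \<epsilon> \<subseteq> S"
  shows "test_fun S (\<lambda>x. moll \<epsilon> (y - x))"
proof (rule test_funI[OF _ compact_cball assms(2)])
  have "smooth (\<lambda>x. moll \<epsilon> (y + (- x)))"
    by (rule smooth_compose_affine[OF bounded_linear_minus[OF bounded_linear_ident] test_fun_smooth[OF test_fun_moll[OF assms(1)]]])
  then show "smooth (\<lambda>x. moll \<epsilon> (y - x))" by simp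
  show "moll \<epsilon> (y - x) = 0" if "x \<notin> cball y \<epsilon>" for x
    using that by (intro moll_eq_0 assms(1)) (auto simp: dist_norm)
qed

definition mollify :: "real \<Rightarrow> ('a::euclidean_space \<Rightarrow> real) \<Rightarrow> 'a \<Rightarrow> real" where
  "mollify \<epsilon> w y = (\<integral>x. w x * moll \<epsilon> (y - x) \<partial>lborel)"

lemma smooth_mollify: "integrable lborel w \<Longrightarrow> \<epsilon> > 0 \<Longrightarrow> smooth (mollify \<epsilon> w)"
  unfolding mollify_def[abs_def] by (rule smooth_convolution[OF _ test_fun_moll])

lemma mollify_sub_bound:
  fixes w :: "'a::euclidean_space \<Rightarrow> real"
  assumes w: "integrable lborel w" and e: "\<epsilon> > 0"
  shows "ennreal \<bar>mollify \<epsilon> w y - w y\<bar> \<le> (\<integral>\<^sup>+z. ennreal \<bar>w (y - z) - w y\<bar> * ennreal (moll \<epsilon> z) \<partial>lborel)"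
proof -
  have [measurable]: "w \<in> borel_measurable borel" using w by auto
  have [measurable]: "moll \<epsilon> \<in> borel_measurable borel" using test_fun_borel[OF test_fun_moll[OF e]] .
  have im: "integrable lborel (\<lambda>x. moll \<epsilon> (y - x))"
    by (rule test_fun_integrable[OF test_fun_moll_translate[OF e subset_UNIV]])
  have i1: "integrable lborel (\<lambda>x. w x * moll \<epsilon> (y - x))"
    by (rule integrable_mult_test_fun[OF w test_fun_moll[OF e]])
  have "(\<integral>x. moll \<epsilon> (y - x) \<partial>lborel) = 1"
  proof -
    have "ennreal (\<integral>x. moll \<epsilon> (y - x) \<partial>lborel) = (\<integral>\<^sup>+x. ennreal (moll \<epsilon> (y - x)) \<partial>lborel)"
      by (rule nn_integral_eq_integral[symmetric, OF im]) (simp add: moll_nonneg[OF e])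
    also have "\<dots> = 1" using nn_integral_lborel_reflect[of "\<lambda>x. ennreal (moll \<epsilon> x)" y] nn_integral_moll[OF e, where 'a='a] by simp
    finally show ?thesis by (simp add: ennreal_eq_1)
  qed
  then have "mollify \<epsilon> w y - w y = (\<integral>x. w x * moll \<epsilon> (y - x) \<partial>lborel) - (\<integral>x. w y * moll \<epsilon> (y - x) \<partial>lborel)"
    by (simp add: mollify_def)
  also have "\<dots> = (\<integral>x. (w x - w y) * moll \<epsilon> (y - x) \<partial>lborel)"
    using i1 im by (simp add: left_diff_distrib)
  finally have eq: "mollify \<epsilon> w y - w y = (\<integral>x. (w x - w y) * moll \<epsilon> (y - x) \<partial>lborel)" .
  have "ennreal (norm (\<integral>x. (w x - w y) * moll \<epsilon> (y - x) \<partial>lborel))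
      \<le> (\<integral>\<^sup>+x. ennreal (norm ((w x - w y) * moll \<epsilon> (y - x))) \<partial>lborel)"
    by (rule integral_norm_bound_ennreal) (use i1 im in \<open>simp add: left_diff_distrib\<close>)
  also have "\<dots> = (\<integral>\<^sup>+x. ennreal \<bar>w x - w y\<bar> * ennreal (moll \<epsilon> (y - x)) \<partial>lborel)"
    by (intro nn_integral_cong) (simp add: abs_mult ennreal_mult moll_nonneg[OF e])
  also have "\<dots> = (\<integral>\<^sup>+z. ennreal \<bar>w (y - z) - w y\<bar> * ennreal (moll \<epsilon> z) \<partial>lborel)"
    using nn_integral_lborel_reflect[of "\<lambda>z. ennreal \<bar>w (y - z) - w y\<bar> * ennreal (moll \<epsilon> z)" y] by simp
  finally show ?thesis using eq by simp
qed

text \<open>As the mollifier has integral 1, the error is an average of the differences w(y - z) -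
  w(y) over |z| < \<epsilon>; Fubini reduces its L1 norm to that of single translations.\<close>

lemma mollify_L1:
  fixes w :: "'a::euclidean_space \<Rightarrow> real"
  assumes w: "integrable lborel w" and "e > 0"
  shows "\<exists>d>0. \<forall>\<epsilon>. 0 < \<epsilon> \<longrightarrow> \<epsilon> < d \<longrightarrow> (\<integral>\<^sup>+y. ennreal \<bar>mollify \<epsilon> w y - w y\<bar> \<partial>lborel) \<le> ennreal e"
proof -
  have [measurable]: "w \<in> borel_measurable borel" using w by auto
  obtain d where d: "d > 0" "\<And>z. norm z < d \<Longrightarrow> (\<integral>\<^sup>+x. ennreal \<bar>w (x + z) - w x\<bar> \<partial>lborel) \<le> ennreal e"
    using L1_translation_continuous[OF assms] by blast
  have "(\<integral>\<^sup>+y. ennreal \<bar>mollify \<epsilon> w y - w y\<bar> \<partial>lborel) \<le> ennreal e" if e: "0 < \<epsilon>" "\<epsilon> < d" for \<epsilon>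
  proof -
    have [measurable]: "moll \<epsilon> \<in> borel_measurable borel" using test_fun_borel[OF test_fun_moll[OF e(1)]] .
    have "(\<integral>\<^sup>+y. ennreal \<bar>mollify \<epsilon> w y - w y\<bar> \<partial>lborel)
      \<le> (\<integral>\<^sup>+y. \<integral>\<^sup>+z. ennreal \<bar>w (y - z) - w y\<bar> * ennreal (moll \<epsilon> z) \<partial>lborel \<partial>lborel)"
      by (intro nn_integral_mono mollify_sub_bound[OF w e(1)])
    also have "\<dots> = (\<integral>\<^sup>+z. \<integral>\<^sup>+y. ennreal \<bar>w (y - z) - w y\<bar> * ennreal (moll \<epsilon> z) \<partial>lborel \<partial>lborel)"
      by (rule lborel_pair.Fubini') measurable
    also have "\<dots> \<le> (\<integral>\<^sup>+z. ennreal e * ennreal (moll \<epsilon> (z::'a)) \<partial>lborel)"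
    proof (rule nn_integral_mono)
      fix z :: 'a
      show "(\<integral>\<^sup>+y. ennreal \<bar>w (y - z) - w y\<bar> * ennreal (moll \<epsilon> z) \<partial>lborel) \<le> ennreal e * ennreal (moll \<epsilon> z)"
      proof (cases "norm z < \<epsilon>")
        case True
        then have "(\<integral>\<^sup>+y. ennreal \<bar>w (y + - z) - w y\<bar> \<partial>lborel) \<le> ennreal e" using d(2)[of "- z"] e by simp
        then show ?thesis by (simp add: nn_integral_multc mult_right_mono)
      next
        case False
        then show ?thesis using moll_eq_0[OF e(1), of z] by simp
      qed
    qed
    also have "\<dots> = ennreal e" by (simp add: nn_integral_cmult nn_integral_moll[OF e(1)])
    finally show ?thesis .
  qed
  then show ?thesis using d(1) by blast
qed

section \<open>The fundamental lemma of the calculus of variations\<close>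

lemma fundamental_lemma_ball:
  fixes w :: "'a::euclidean_space \<Rightarrow> real"
  assumes w: "integrable lborel w" and "r > 0"
    and test: "\<And>\<psi>::'a \<Rightarrow> real. test_fun (ball y0 (2 * r)) \<psi> \<Longrightarrow> (\<integral>x. \<psi> x * w x \<partial>lborel) = 0"
  shows "AE x in lborel. x \<in> ball y0 r \<longrightarrow> w x = 0"
proof -
  have [measurable]: "w \<in> borel_measurable borel" using w by auto
  have le: "(\<integral>\<^sup>+y. ennreal \<bar>w y\<bar> * indicator (ball y0 r) y \<partial>lborel) \<le> 0 + ennreal e" if "e > 0" for e
  proof -
    obtain d where d: "d > 0" "\<And>\<epsilon>. 0 < \<epsilon> \<Longrightarrow> \<epsilon> < d \<Longrightarrow> (\<integral>\<^sup>+y. ennreal \<bar>mollify \<epsilon> w y - w y\<bar> \<partial>lborel) \<le> ennreal e"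
      using mollify_L1[OF w \<open>e > 0\<close>] by blast
    \<comment> \<open>Below \<open>d\<close> the mollification is L1-close to \<open>w\<close>.
      Below \<open>r\<close> the kernels centred in the small ball are supported in the ball of
      radius 2r, so the mollification vanishes on the small ball.\<close>
    define \<epsilon> where "\<epsilon> = min (d/2) (r/2)"
    have e: "0 < \<epsilon>" "\<epsilon> < d" "\<epsilon> < r" using d(1) \<open>r > 0\<close> by (auto simp: \<epsilon>_def)
    have "mollify \<epsilon> w y = 0" if "y \<in> ball y0 r" for y
    proof -
      have "cball y \<epsilon> \<subseteq> ball y0 (2 * r)"
      proof
        fix x assume "x \<in> cball y \<epsilon>"
        then show "x \<in> ball y0 (2 * r)"
          using that e(3) dist_triangle[of y0 x y] by (auto simp: dist_commute)
      qed
      from test[OF test_fun_moll_translate[OF e(1) this]] show ?thesis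
        by (simp add: mollify_def mult.commute)
    qed
    then have "(\<integral>\<^sup>+y. ennreal \<bar>w y\<bar> * indicator (ball y0 r) y \<partial>lborel) \<le> (\<integral>\<^sup>+y. ennreal \<bar>mollify \<epsilon> w y - w y\<bar> \<partial>lborel)"
      by (intro nn_integral_mono) (auto simp: indicator_def)
    then show ?thesis using d(2)[OF e(1,2)] by simp
  qed
  have "(\<integral>\<^sup>+y. ennreal \<bar>w y\<bar> * indicator (ball y0 r) y \<partial>lborel) \<le> 0"
    by (rule ennreal_le_epsilon) (rule le)
  then have "(\<integral>\<^sup>+y. ennreal \<bar>w y\<bar> * indicator (ball y0 r) y \<partial>lborel) = 0" by simp
  then have "AE y in lborel. ennreal \<bar>w y\<bar> * indicator (ball y0 r) y = 0"
    by (subst (asm) nn_integral_0_iff_AE) measurable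
  then show ?thesis by eventually_elim (auto simp: indicator_def)
qed

text \<open>Cut off to a closed ball inside \<open>S\<close>, \<open>w\<close> has an integrable
  Borel representative, to which the previous lemma applies. Lindelof's theorem reduces
  \<open>S\<close> to countably many such balls.\<close>

lemma fundamental_lemma_real:
  fixes w :: "'a::euclidean_space \<Rightarrow> real"
  assumes S: "open S"
    and w: "\<And>K. compact K \<Longrightarrow> K \<subseteq> S \<Longrightarrow> integrable lebesgue (\<lambda>x. indicator K x * w x)"
    and test: "\<And>\<psi>::'a \<Rightarrow> real. test_fun S \<psi> \<Longrightarrow> (\<integral>x. \<psi> x * w x \<partial>lebesgue) = 0"
  shows "AE x in lebesgue. x \<in> S \<longrightarrow> w x = 0"
proof -
  have loc: "\<exists>r>0. AE x in lebesgue. x \<in> ball y r \<longrightarrow> w x = 0" if y: "y \<in> S" for y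
  proof -
    obtain r' where r': "r' > 0" "cball y r' \<subseteq> S"
      using S y unfolding open_contains_cball by blast
    define r where "r = r'/2"
    have r: "r > 0" "2 * r = r'" using r' by (auto simp: r_def)
    let ?w = "\<lambda>x. indicator (cball y r') x * w x"
    have int: "integrable lebesgue ?w" by (rule w[OF compact_cball r'(2)])
    from completion_ex_borel_measurable_real[OF borel_measurable_integrable[OF int]]
    obtain g where g: "g \<in> borel_measurable lborel" "AE x in lborel. ?w x = g x" by blast
    have gleb: "AE x in lebesgue. ?w x = g x" using g(2) by (rule AE_completion)
    have "integrable lebesgue g"
      using integrable_cong_AE[OF borel_measurable_integrable[OF int] measurable_completion[OF g(1)] gleb] int by blast
    then have gint: "integrable lborel g" using g(1) by (simp only: integrable_completion)
    have "AE x in lborel. x \<in> ball y r \<longrightarrow> g x = 0"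
    proof (rule fundamental_lemma_ball[OF gint r(1)])
      fix \<psi> :: "'a \<Rightarrow> real" assume psi: "test_fun (ball y (2 * r)) \<psi>"
      have [measurable]: "\<psi> \<in> borel_measurable lborel" using test_fun_borel[OF psi] by simp
      have [measurable]: "g \<in> borel_measurable lborel" by fact
      have "(\<integral>x. \<psi> x * g x \<partial>lborel) = (\<integral>x. \<psi> x * g x \<partial>lebesgue)"
        by (rule integral_completion[symmetric]) measurable
      also have "\<dots> = (\<integral>x. \<psi> x * ?w x \<partial>lebesgue)"
      proof (rule integral_cong_AE)
        show "AE x in lebesgue. \<psi> x * g x = \<psi> x * ?w x" using gleb by eventually_elim simp
        show "(\<lambda>x. \<psi> x * ?w x) \<in> borel_measurable lebesgue"
          by (rule borel_measurable_times[OF measurable_completion borel_measurable_integrable[OF int]]) measurable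
      qed (intro measurable_completion, measurable)
      also have "\<dots> = (\<integral>x. \<psi> x * w x \<partial>lebesgue)"
        by (rule Bochner_Integration.integral_cong) (use test_fun_outside[OF psi] r in \<open>auto simp: indicator_def\<close>)
      also have "\<dots> = 0"
        by (rule test[OF test_fun_mono[OF psi]]) (use r r' ball_subset_cball in auto)
      finally show "(\<integral>x. \<psi> x * g x \<partial>lborel) = 0" .
    qed
    then have "AE x in lebesgue. x \<in> ball y r \<longrightarrow> g x = 0" by (rule AE_completion)
    with gleb have "AE x in lebesgue. x \<in> ball y r \<longrightarrow> w x = 0"
      by eventually_elim (use r in \<open>auto simp: indicator_def\<close>)
    then show ?thesis using r(1) by blast
  qed
  then obtain r where r: "\<And>y. y \<in> S \<Longrightarrow> r y > 0" "\<And>y. y \<in> S \<Longrightarrow> AE x in lebesgue. x \<in> ball y (r y) \<longrightarrow> w x = 0"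
    by metis
  obtain F' where F': "F' \<subseteq> (\<lambda>y. ball y (r y)) ` S" "countable F'" "\<Union>F' = \<Union>((\<lambda>y. ball y (r y)) ` S)"
    using Lindelof[of "(\<lambda>y. ball y (r y)) ` S"] by blast
  have "AE x in lebesgue. \<forall>B\<in>F'. x \<in> B \<longrightarrow> w x = 0"
    by (subst AE_ball_countable[OF F'(2)]) (use F'(1) r(2) in auto)
  then show ?thesis
  proof eventually_elim
    fix x assume x: "\<forall>B\<in>F'. x \<in> B \<longrightarrow> w x = 0"
    show "x \<in> S \<longrightarrow> w x = 0"
    proof
      assume "x \<in> S"
      then have "x \<in> \<Union>((\<lambda>y. ball y (r y)) ` S)" using r(1) by force
      then show "w x = 0" using x F'(3) by blast
    qed
  qed
qed

section \<open>Indefinite integrals on an interval\<close>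

lemma AE_lebesgue_on_iff:
  "S \<in> sets lebesgue \<Longrightarrow> (AE x in lebesgue_on S. P x) \<longleftrightarrow> (AE x in lebesgue. x \<in> S \<longrightarrow> P x)"
  by (subst AE_restrict_space_iff) auto

lemma AE_lborel_imp_lebesgue_on:
  "S \<in> sets lebesgue \<Longrightarrow> AE x in lborel. P x \<Longrightarrow> AE x in lebesgue_on S. P x"
  by (subst AE_lebesgue_on_iff) (auto dest: AE_completion)

lemma borel_imp_lebesgue_on:
  "f \<in> borel_measurable borel \<Longrightarrow> f \<in> borel_measurable (lebesgue_on S)"
  by (intro measurable_restrict_space1 measurable_completion) simp

text \<open>Cut the interval from \<open>\<Phi> a\<close> to \<open>\<Phi> b\<close> into N equal
  pieces and choose times with these values: N increments of order (V/N)^2 sum to order 1/N, for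
  every N.\<close>

lemma eq_endpoints_if_quadratic_increments:
  fixes H \<Phi> :: "real \<Rightarrow> real"
  assumes "a \<le> b" and cont: "continuous_on {a..b} \<Phi>" and "\<Phi> a \<le> \<Phi> b"
    and incr: "\<And>s t. s \<in> {a..b} \<Longrightarrow> t \<in> {a..b} \<Longrightarrow> \<bar>H t - H s\<bar> \<le> C * (\<Phi> t - \<Phi> s)\<^sup>2"
  shows "H b = H a"
proof -
  define V where "V = \<Phi> b - \<Phi> a"
  have V: "V \<ge> 0" using assms(3) by (simp add: V_def)
  have bound: "real (Suc n) * \<bar>H b - H a\<bar> \<le> C * V\<^sup>2" for n
  proof -
    define N where "N = Suc n"
    have N: "real N > 0" by (simp add: N_def)
    have "\<exists>x\<ge>a. x \<le> b \<and> \<Phi> x = \<Phi> a + real i / real N * V" if "i \<le> N" for i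
    proof (rule IVT'[OF _ _ \<open>a \<le> b\<close> cont])
      show "\<Phi> a \<le> \<Phi> a + real i / real N * V" using V by simp
      have "real i / real N * V \<le> 1 * V" using that N V by (intro mult_right_mono) auto
      then show "\<Phi> a + real i / real N * V \<le> \<Phi> b" by (simp add: V_def)
    qed
    \<comment> \<open>The times need not be ordered, as \<open>incr\<close> holds for any pair.
      Equal values of \<open>\<Phi>\<close> force equal values of \<open>H\<close>, which matches
      the first and last time with the endpoints.\<close>
    then obtain \<tau> where \<tau>: "\<And>i. i \<le> N \<Longrightarrow> \<tau> i \<in> {a..b}" "\<And>i. i \<le> N \<Longrightarrow> \<Phi> (\<tau> i) = \<Phi> a + real i / real N * V"
      unfolding atLeastAtMost_iff by metis
    have "\<bar>H (\<tau> 0) - H a\<bar> \<le> C * (\<Phi> (\<tau> 0) - \<Phi> a)\<^sup>2" by (rule incr) (use \<tau>(1)[of 0] \<open>a \<le> b\<close> in auto)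
    then have H0: "H (\<tau> 0) = H a" using \<tau>(2)[of 0] by simp
    have "\<bar>H (\<tau> N) - H b\<bar> \<le> C * (\<Phi> (\<tau> N) - \<Phi> b)\<^sup>2" by (rule incr) (use \<tau>(1)[of N] \<open>a \<le> b\<close> in auto)
    then have HN: "H (\<tau> N) = H b" using \<tau>(2)[of N] N by (simp add: V_def)
    have "\<bar>H b - H a\<bar> = \<bar>\<Sum>i<N. H (\<tau> (Suc i)) - H (\<tau> i)\<bar>"
      using sum_lessThan_telescope[of "\<lambda>i. H (\<tau> i)" N] H0 HN by simp
    also have "\<dots> \<le> (\<Sum>i<N. \<bar>H (\<tau> (Suc i)) - H (\<tau> i)\<bar>)" by (rule sum_abs)
    also have "\<dots> \<le> (\<Sum>i<N. C * (V / real N)\<^sup>2)"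
    proof (rule sum_mono)
      fix i assume "i \<in> {..<N}"
      then have i: "i \<le> N" "Suc i \<le> N" by auto
      have "\<Phi> (\<tau> (Suc i)) - \<Phi> (\<tau> i) = V / real N"
        using \<tau>(2)[OF i(1)] \<tau>(2)[OF i(2)] N by (simp add: field_simps)
      then show "\<bar>H (\<tau> (Suc i)) - H (\<tau> i)\<bar> \<le> C * (V / real N)\<^sup>2"
        using incr[OF \<tau>(1)[OF i(1)] \<tau>(1)[OF i(2)]] by simp
    qed
    also have "\<dots> = C * V\<^sup>2 / real N" using N by (simp add: power2_eq_square field_simps)
    finally show ?thesis using N by (simp add: N_def[symmetric] field_simps)
  qed
  show ?thesis
  proof (rule ccontr)
    assume "H b \<noteq> H a"
    then have p: "\<bar>H b - H a\<bar> > 0" by simp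
    obtain n where "C * V\<^sup>2 < real n * \<bar>H b - H a\<bar>" using reals_Archimedean3[OF p] by blast
    moreover have "real n * \<bar>H b - H a\<bar> \<le> real (Suc n) * \<bar>H b - H a\<bar>" by (intro mult_right_mono) auto
    ultimately show False using bound[of n] by linarith
  qed
qed

locale time_interval =
  fixes T :: real
  assumes T_pos: "T > 0"
begin

definition M :: "real measure" where "M = lebesgue_on {0<..<T}"

text \<open>The integral of \<open>F\<close> from 0 to \<open>t\<close>, since \<open>M\<close>
  lives on (0,T); the half-line spares a case distinction on the position of
  \<open>t\<close>.\<close>

definition prim :: "(real \<Rightarrow> real) \<Rightarrow> real \<Rightarrow> real" where
  "prim F t = (\<integral>s. indicator {..t} s * F s \<partial>M)"

lemma I_sets: "{0<..<T} \<in> sets lebesgue" by simp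

lemma space_M[simp]: "space M = {0<..<T}" by (simp add: M_def)

lemma finite_M: "finite_measure M"
  unfolding M_def by (rule finite_measure_lebesgue_on) (simp add: bounded_set_imp_lmeasurable)

sublocale fM: finite_measure M by (rule finite_M)

lemma borel_M: "f \<in> borel_measurable borel \<Longrightarrow> f \<in> borel_measurable M"
  unfolding M_def by (rule borel_imp_lebesgue_on)

lemma id_M: "(\<lambda>x. x) \<in> borel_measurable M"
  by (rule borel_M) simp

lemma sets_M_borel: "A \<in> sets borel \<Longrightarrow> (\<lambda>s. indicator A s :: real) \<in> borel_measurable M"
  by (rule borel_M) simp

lemma integrable_indicator_mult:
  assumes "integrable M f" "A \<in> sets borel"
  shows "integrable M (\<lambda>s. indicator A s * f s :: real)"
proof (rule Bochner_Integration.integrable_bound[OF assms(1)])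
  show "(\<lambda>s. indicator A s * f s) \<in> borel_measurable M"
    by (rule borel_measurable_times[OF sets_M_borel[OF assms(2)] borel_measurable_integrable[OF assms(1)]])
  show "AE s in M. norm (indicator A s * f s) \<le> norm (f s)" by (rule AE_I2) (simp add: indicator_def)
qed

lemma prim_diff:
  assumes "integrable M f" "s \<le> t"
  shows "prim f t - prim f s = (\<integral>r. indicator {s<..t} r * f r \<partial>M)"
proof -
  have "prim f t - prim f s = (\<integral>r. indicator {..t} r * f r - indicator {..s} r * f r \<partial>M)"
    unfolding prim_def by (intro Bochner_Integration.integral_diff[symmetric] integrable_indicator_mult assms) auto
  also have "\<dots> = (\<integral>r. indicator {s<..t} r * f r \<partial>M)"
    by (rule Bochner_Integration.integral_cong) (use assms(2) in \<open>auto simp: indicator_def\<close>)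
  finally show ?thesis .
qed

lemma prim_0: "prim f 0 = 0"
proof -
  have "prim f 0 = (\<integral>s. 0 \<partial>M)" unfolding prim_def by (rule Bochner_Integration.integral_cong) auto
  then show ?thesis by simp
qed

lemma AE_M_neq: "AE s in M. s \<noteq> c"
  unfolding M_def by (rule AE_lborel_imp_lebesgue_on[OF I_sets AE_lborel_singleton])

lemma continuous_prim:
  assumes f: "integrable M f"
  shows "continuous_on A (prim f)"
proof (rule continuous_on_subset[OF _ subset_UNIV], subst continuous_on_sequentially, intro allI impI ballI)
  fix x :: "nat \<Rightarrow> real" and a assume "(\<forall>n. x n \<in> UNIV) \<and> x \<longlonglongrightarrow> a"
  then have x: "x \<longlonglongrightarrow> a" by simp
  show "(prim f \<circ> x) \<longlonglongrightarrow> prim f a"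
    unfolding o_def prim_def
  proof (rule integral_dominated_convergence[where w="\<lambda>s. \<bar>f s\<bar>"])
    show "AE s in M. (\<lambda>n. indicator {..x n} s * f s) \<longlonglongrightarrow> indicator {..a} s * f s"
      using AE_M_neq[of a]
    proof eventually_elim
      fix s assume "s \<noteq> a"
      then consider "s < a" | "s > a" by linarith
      then have "\<forall>\<^sub>F n in sequentially. indicator {..x n} s * f s = indicator {..a} s * f s"
      proof cases
        case 1
        show ?thesis by (rule eventually_mono[OF order_tendstoD(1)[OF x 1]]) (use 1 in \<open>simp add: indicator_def\<close>)
      next
        case 2
        show ?thesis by (rule eventually_mono[OF order_tendstoD(2)[OF x 2]]) (use 2 in \<open>simp add: indicator_def\<close>)
      qed
      then show "(\<lambda>n. indicator {..x n} s * f s) \<longlonglongrightarrow> indicator {..a} s * f s" by (rule tendsto_eventually)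
    qed
    show "integrable M (\<lambda>s. \<bar>f s\<bar>)" using f by simp
    show "AE s in M. norm (indicator {..x n} s * f s) \<le> \<bar>f s\<bar>" for n
      by (rule AE_I2) (auto simp: indicator_def)
  qed (intro borel_measurable_integrable integrable_indicator_mult f; simp)+
qed

lemma prim_borel: "integrable M f \<Longrightarrow> prim f \<in> borel_measurable M"
  by (intro borel_M borel_measurable_continuous_onI continuous_prim)

lemma prim_abs_diff:
  assumes "integrable M f" "s \<le> t"
  shows "\<bar>prim f t - prim f s\<bar> \<le> prim (\<lambda>r. \<bar>f r\<bar>) t - prim (\<lambda>r. \<bar>f r\<bar>) s"
proof -
  have "norm (\<integral>r. indicator {s<..t} r * f r \<partial>M) \<le> (\<integral>r. norm (indicator {s<..t} r * f r) \<partial>M)"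
    by (rule integral_norm_bound)
  also have "\<dots> = (\<integral>r. indicator {s<..t} r * \<bar>f r\<bar> \<partial>M)" by (simp add: abs_mult)
  finally show ?thesis
    using assms by (simp add: prim_diff)
qed

lemma prim_abs_mono: "integrable M f \<Longrightarrow> s \<le> t \<Longrightarrow> prim (\<lambda>r. \<bar>f r\<bar>) s \<le> prim (\<lambda>r. \<bar>f r\<bar>) t"
  using prim_abs_diff[of f s t] by linarith

text \<open>The chain rule for the absolutely continuous function \<^term>\<open>prim F\<close>: both sides agree up to an
  error that is quadratic in the increments of \<^term>\<open>prim (\<lambda>r. \<bar>F r\<bar>)\<close>.\<close>

lemma chain_rule_prim:
  assumes F: "integrable M F" and \<beta>: "\<And>x. (\<beta> has_real_derivative \<beta>' x) (at x)"
    and lip: "\<And>x y. \<bar>\<beta>' x - \<beta>' y\<bar> \<le> L * \<bar>x - y\<bar>" and "L \<ge> 0"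
    and bdd: "\<And>x. \<bar>\<beta>' x\<bar> \<le> B" and meas: "\<beta>' \<in> borel_measurable borel" and "t \<ge> 0"
  shows "\<beta> (prim F t) - \<beta> 0 = prim (\<lambda>s. \<beta>' (prim F s) * F s) t"
proof -
  let ?R = "prim F" and ?\<Phi> = "prim (\<lambda>r. \<bar>F r\<bar>)" and ?g = "\<lambda>s. \<beta>' (prim F s) * F s"
  have meas_R: "(\<lambda>s. \<beta>' (?R s)) \<in> borel_measurable M"
    using measurable_compose[OF prim_borel[OF F] meas] .
  have g: "integrable M ?g"
  proof (rule Bochner_Integration.integrable_bound[OF integrable_mult_right[OF F, of B]])
    show "?g \<in> borel_measurable M"
      by (rule borel_measurable_times[OF meas_R borel_measurable_integrable[OF F]])
    have "B \<ge> 0" using bdd[of 0] by linarith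
    then show "AE s in M. norm (?g s) \<le> norm (B * F s)"
      using bdd by (intro AE_I2) (auto simp: abs_mult intro!: mult_right_mono)
  qed
  define H where "H t = \<beta> (?R t) - prim ?g t" for t
  have le: "\<bar>H t - H s\<bar> \<le> 2 * L * (?\<Phi> t - ?\<Phi> s)\<^sup>2" if "s \<le> t" for s t
  proof -
    define D where "D = ?\<Phi> t - ?\<Phi> s"
    have D: "D \<ge> 0" unfolding D_def using prim_abs_mono[OF F \<open>s \<le> t\<close>] by simp
    have RD: "\<bar>?R t - ?R s\<bar> \<le> D" unfolding D_def by (rule prim_abs_diff[OF F \<open>s \<le> t\<close>])
    \<comment> \<open>An intermediate point from the mean value theorem. Only its distance from
      \<open>prim F s\<close> matters, so the order of the two values of \<open>prim F\<close> may
      be left open.\<close>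
    obtain \<eta> where \<eta>: "\<bar>\<eta> - ?R s\<bar> \<le> \<bar>?R t - ?R s\<bar>" "\<beta> (?R t) - \<beta> (?R s) = \<beta>' \<eta> * (?R t - ?R s)"
    proof -
      consider "?R s < ?R t" | "?R t < ?R s" | "?R s = ?R t" by linarith
      then show thesis
      proof cases
        case 1
        obtain z where "z > ?R s" "z < ?R t" "\<beta> (?R t) - \<beta> (?R s) = (?R t - ?R s) * \<beta>' z"
          using MVT2[OF 1 \<beta>] by blast
        then show thesis using that[of z] by (simp add: mult.commute)
      next
        case 2
        obtain z where "z > ?R t" "z < ?R s" "\<beta> (?R s) - \<beta> (?R t) = (?R s - ?R t) * \<beta>' z"
          using MVT2[OF 2 \<beta>] by blast
        then show thesis using that[of z] by (simp add: algebra_simps)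
      next
        case 3
        then show thesis using that[of "?R s"] by simp
      qed
    qed
    have i1: "integrable M (\<lambda>r. indicator {s<..t} r * F r)" "integrable M (\<lambda>r. indicator {s<..t} r * ?g r)"
      "integrable M (\<lambda>r. indicator {s<..t} r * \<bar>F r\<bar>)"
      by (intro integrable_indicator_mult F g integrable_abs; simp)+
    have "H t - H s = \<beta>' \<eta> * (\<integral>r. indicator {s<..t} r * F r \<partial>M) - (\<integral>r. indicator {s<..t} r * ?g r \<partial>M)"
      using \<eta>(2) unfolding H_def prim_diff[OF F \<open>s \<le> t\<close>, symmetric] prim_diff[OF g \<open>s \<le> t\<close>, symmetric] by simp
    also have "\<dots> = (\<integral>r. \<beta>' \<eta> * (indicator {s<..t} r * F r) - indicator {s<..t} r * ?g r \<partial>M)"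
      using i1 by simp
    finally have eq: "H t - H s = (\<integral>r. \<beta>' \<eta> * (indicator {s<..t} r * F r) - indicator {s<..t} r * ?g r \<partial>M)" .
    have "norm (\<integral>r. \<beta>' \<eta> * (indicator {s<..t} r * F r) - indicator {s<..t} r * ?g r \<partial>M)
      \<le> (\<integral>r. norm (\<beta>' \<eta> * (indicator {s<..t} r * F r) - indicator {s<..t} r * ?g r) \<partial>M)"
      by (rule integral_norm_bound)
    also have "\<dots> \<le> (\<integral>r. (2 * L * D) * (indicator {s<..t} r * \<bar>F r\<bar>) \<partial>M)"
    proof (rule integral_mono)
      show "integrable M (\<lambda>r. norm (\<beta>' \<eta> * (indicator {s<..t} r * F r) - indicator {s<..t} r * ?g r))"
        using i1 by (intro integrable_norm Bochner_Integration.integrable_diff integrable_mult_right)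
      show "integrable M (\<lambda>r. (2 * L * D) * (indicator {s<..t} r * \<bar>F r\<bar>))"
        by (rule integrable_mult_right[OF i1(3)])
      fix r
      show "norm (\<beta>' \<eta> * (indicator {s<..t} r * F r) - indicator {s<..t} r * ?g r)
        \<le> (2 * L * D) * (indicator {s<..t} r * \<bar>F r\<bar>)"
      proof (cases "r \<in> {s<..t}")
        case True
        have "\<bar>?R r - ?R s\<bar> \<le> D"
          using prim_abs_diff[OF F, of s r] prim_abs_mono[OF F, of r t] True unfolding D_def by auto
        \<comment> \<open>Both \<eta> and \<open>prim F r\<close> lie within \<open>D\<close> of
          \<open>prim F s\<close>; this is where the factor 2 in the constant arises.\<close>
        then have "\<bar>\<eta> - ?R r\<bar> \<le> 2 * D" using \<eta>(1) RD by linarith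
        then have "L * \<bar>\<eta> - ?R r\<bar> \<le> L * (2 * D)" using \<open>L \<ge> 0\<close> by (rule mult_left_mono)
        then have "\<bar>\<beta>' \<eta> - \<beta>' (?R r)\<bar> \<le> 2 * L * D" using lip[of \<eta> "?R r"] by (simp add: mult_ac)
        then have "\<bar>\<beta>' \<eta> - \<beta>' (?R r)\<bar> * \<bar>F r\<bar> \<le> 2 * L * D * \<bar>F r\<bar>" by (rule mult_right_mono) simp
        then show ?thesis using True by (simp add: left_diff_distrib[symmetric] abs_mult)
      qed simp
    qed
    also have "\<dots> = 2 * L * D * (?\<Phi> t - ?\<Phi> s)"
      using prim_diff[OF integrable_abs[OF F] \<open>s \<le> t\<close>] by simp
    finally show ?thesis unfolding eq D_def[symmetric] by (simp add: power2_eq_square)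
  qed
  have "H t = H 0"
  proof (rule eq_endpoints_if_quadratic_increments[where H=H and a=0 and b=t and \<Phi>="?\<Phi>" and C="2 * L"])
    show "continuous_on {0..t} ?\<Phi>" by (rule continuous_prim[OF integrable_abs[OF F]])
    show "?\<Phi> 0 \<le> ?\<Phi> t" by (rule prim_abs_mono[OF F \<open>t \<ge> 0\<close>])
    show "\<bar>H t - H s\<bar> \<le> 2 * L * (?\<Phi> t - ?\<Phi> s)\<^sup>2" for s t
      using le[of s t] le[of t s] by (cases "s \<le> t") (auto simp: abs_minus_commute power2_commute)
  qed fact
  then show ?thesis by (simp add: H_def prim_0)
qed

section \<open>Weak derivatives in time with zero initial value\<close>

lemma integral_M_borel:
  fixes g :: "real \<Rightarrow> real"
  assumes [measurable]: "g \<in> borel_measurable borel"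
  shows "(\<integral>t. g t \<partial>M) = (\<integral>t. indicator {0<..<T} t * g t \<partial>lborel)"
proof -
  have "(\<integral>t. g t \<partial>M) = (\<integral>t. indicator {0<..<T} t *\<^sub>R g t \<partial>lebesgue)"
    unfolding M_def by (rule integral_restrict_space) simp
  also have "\<dots> = (\<integral>t. indicator {0<..<T} t *\<^sub>R g t \<partial>lborel)"
    by (rule integral_completion) (use assms in \<open>auto intro!: borel_measurable_scaleR borel_measurable_indicator\<close>)
  finally show ?thesis by simp
qed

text \<open>The fundamental theorem of calculus on [s,T]: as a function of \<open>t\<close>,
  \<open>indicator {..t} s\<close> is the indicator of t \<ge> s, and the boundary term at T
  drops.\<close>

lemma integral_dderiv_tail:
  fixes a :: "real \<Rightarrow> real"
  assumes a: "smooth a" and aT: "a T = 0" and s: "s \<in> {0<..<T}"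
  shows "(\<integral>t. indicator {..t} s * dderiv a 1 t \<partial>M) = - a s"
proof -
  have der: "(a has_real_derivative dderiv a 1 x) (at x)" for x
  proof -
    have lin: "dderiv a h x = h * dderiv a 1 x" for h
      using linear_scale[OF smooth_dderiv_linear[OF a, of x], of h 1] by simp
    show ?thesis unfolding has_field_derivative_def
      by (rule has_derivative_eq_rhs[OF smooth_has_derivative[OF a]]) (rule ext, subst mult.commute, rule lin)
  qed
  have [measurable]: "(\<lambda>t. dderiv a 1 t) \<in> borel_measurable borel" by (rule smooth_borel[OF smooth_dderiv[OF a]])
  have [measurable]: "(\<lambda>t. indicator {..t} s :: real) \<in> borel_measurable borel"
  proof -
    have "(\<lambda>t. indicator {..t} s :: real) = indicator {s..}" by (auto simp: indicator_def)
    then show ?thesis by simp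
  qed
  have "(\<integral>t. indicator {..t} s * dderiv a 1 t \<partial>M)
      = (\<integral>t. indicator {0<..<T} t * (indicator {..t} s * dderiv a 1 t) \<partial>lborel)"
    by (rule integral_M_borel) measurable
  also have "\<dots> = (\<integral>t. dderiv a 1 t * indicator {s..T} t \<partial>lborel)"
  proof (rule integral_cong_AE)
    show "AE t in lborel. indicator {0<..<T} t * (indicator {..t} s * dderiv a 1 t) = dderiv a 1 t * indicator {s..T} t"
      using AE_lborel_singleton[of T] by eventually_elim (use s in \<open>auto simp: indicator_def\<close>)
  qed measurable
  also have "\<dots> = a T - a s"
    by (rule integral_FTC_Icc_real)
      (use s der smooth_continuous[OF smooth_dderiv[OF a], of UNIV] in \<open>auto simp: continuous_on_eq_continuous_at\<close>)
  finally show ?thesis using aT by simp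
qed

lemma Fubini_prim:
  assumes g: "g \<in> borel_measurable borel" "\<And>t. \<bar>g t\<bar> \<le> B" and F: "integrable M F"
  shows "(\<integral>t. g t * prim F t \<partial>M) = (\<integral>s. (\<integral>t. indicator {..t} s * g t \<partial>M) * F s \<partial>M)"
proof -
  interpret P: pair_sigma_finite M M by standard
  note id_M[measurable]
  have gM[measurable]: "g \<in> borel_measurable M" by (rule borel_M[OF g(1)])
  have FM[measurable]: "F \<in> borel_measurable M" using F by auto
  have ind: "indicator {..t} s = (if s \<le> t then 1 else 0 :: real)" for s t :: real by simp
  have int: "integrable (M \<Otimes>\<^sub>M M) (\<lambda>(t, s). indicator {..t} s * (g t * F s))"
  proof (rule P.Fubini_integrable)
    show "(\<lambda>(t, s). indicator {..t} s * (g t * F s)) \<in> borel_measurable (M \<Otimes>\<^sub>M M)"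
      unfolding ind by measurable
    show "AE t in M. integrable M (\<lambda>s. case (t, s) of (t, s) \<Rightarrow> indicator {..t} s * (g t * F s))"
      by (rule AE_I2) (use F in \<open>auto intro!: integrable_indicator_mult\<close>)
    have m: "(\<lambda>t. \<integral>s. norm (case (t, s) of (t, s) \<Rightarrow> indicator {..t} s * (g t * F s)) \<partial>M) \<in> borel_measurable M"
      unfolding ind by measurable
    have "(\<integral>s. norm (indicator {..t} s * (g t * F s)) \<partial>M) \<le> B * (\<integral>s. \<bar>F s\<bar> \<partial>M)" for t
    proof -
      have "(\<integral>s. norm (indicator {..t} s * (g t * F s)) \<partial>M) \<le> (\<integral>s. B * \<bar>F s\<bar> \<partial>M)"
      proof (rule integral_mono)
        show "integrable M (\<lambda>s. norm (indicator {..t} s * (g t * F s)))"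
          by (intro integrable_norm integrable_indicator_mult) (use F in auto)
        show "norm (indicator {..t} s * (g t * F s)) \<le> B * \<bar>F s\<bar>" for s
          using g(2)[of t] mult_right_mono[OF g(2)[of t], of "\<bar>F s\<bar>"] by (auto simp: indicator_def abs_mult)
      qed (use F in auto)
      then show ?thesis by simp
    qed
    then show "integrable M (\<lambda>t. \<integral>s. norm (case (t, s) of (t, s) \<Rightarrow> indicator {..t} s * (g t * F s)) \<partial>M)"
      by (intro fM.integrable_const_bound[where B="B * (\<integral>s. \<bar>F s\<bar> \<partial>M)"] m) (auto intro!: AE_I2)
  qed
  have "(\<integral>t. g t * prim F t \<partial>M) = (\<integral>t. \<integral>s. indicator {..t} s * (g t * F s) \<partial>M \<partial>M)"
    unfolding prim_def by (simp add: mult.left_commute flip: integral_mult_right_zero)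
  also have "\<dots> = (\<integral>s. \<integral>t. indicator {..t} s * (g t * F s) \<partial>M \<partial>M)"
    by (rule P.Fubini_integral[symmetric, OF int])
  also have "\<dots> = (\<integral>s. (\<integral>t. indicator {..t} s * g t \<partial>M) * F s \<partial>M)"
    by (simp add: mult.assoc flip: integral_mult_left_zero)
  finally show ?thesis .
qed

text \<open>Test functions that vanish near T but not near 0 leave no free constant, so the weak
  equation determines \<open>m\<close> including its initial value 0. On (0,T) each \<psi> supported
  there is the derivative of such a function, and Fubini gives \<open>prim F\<close> the same weak
  equation; the fundamental lemma then compares the two.\<close>

lemma AE_eq_prim_if_weak:
  assumes m: "integrable M m" and F: "integrable M F"
    and weak: "\<And>(a::real \<Rightarrow> real) \<tau>. smooth a \<Longrightarrow> \<tau> < T \<Longrightarrow> (\<And>t. t \<ge> \<tau> \<Longrightarrow> a t = 0) \<Longrightarrow>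
      (\<integral>t. dderiv a 1 t * m t \<partial>M) = - (\<integral>t. a t * F t \<partial>M)"
  shows "AE t in M. m t = prim F t"
proof -
  define w where "w t = m t - prim F t" for t
  obtain B0 where B0: "\<And>t. t \<in> {0..T} \<Longrightarrow> \<bar>prim F t\<bar> \<le> B0"
  proof -
    have "bounded (prim F ` {0..T})"
      by (rule compact_imp_bounded[OF compact_continuous_image[OF continuous_prim[OF F] compact_Icc]])
    then show thesis using that unfolding bounded_iff by force
  qed
  have intR: "integrable M (prim F)"
    by (rule fM.integrable_const_bound[where B=B0]) (use B0 prim_borel[OF F] in auto)
  have w: "integrable M w" unfolding w_def using m intR by simp
  have "AE t in lebesgue. t \<in> {0<..<T} \<longrightarrow> w t = 0"
  proof (rule fundamental_lemma_real)
    show "open {0<..<T}" by simp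
    have w': "integrable lebesgue (\<lambda>t. indicator {0<..<T} t *\<^sub>R w t)"
      using w unfolding M_def by (subst (asm) integrable_restrict_space) auto
    show "integrable lebesgue (\<lambda>t. indicator K t * w t)" if K: "compact K" "K \<subseteq> {0<..<T}" for K
    proof -
      have "integrable lebesgue (\<lambda>t. indicator K t *\<^sub>R (indicator {0<..<T} t *\<^sub>R w t))"
        by (rule integrable_mult_indicator[OF _ w']) (use K(1) in \<open>auto simp: compact_imp_closed\<close>)
      moreover have "(\<lambda>t. indicator K t *\<^sub>R (indicator {0<..<T} t *\<^sub>R w t)) = (\<lambda>t. indicator K t * w t)"
        using K(2) by (intro ext) (auto simp: indicator_def)
      ultimately show ?thesis by simp
    qed
    fix \<psi> :: "real \<Rightarrow> real" assume \<psi>: "test_fun {0<..<T} \<psi>"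
    obtain K where K: "compact K" "K \<subseteq> {0<..<T}" "\<And>x. x \<notin> K \<Longrightarrow> \<psi> x = 0" using test_funE[OF \<psi>] by blast
    obtain \<tau> where \<tau>: "\<tau> < T" "\<And>t. t > \<tau> \<Longrightarrow> \<psi> t = 0" "\<tau> > 0"
    proof (cases "K = {}")
      case True
      then show thesis using that[of "T/2"] K(3) T_pos by auto
    next
      case False
      then obtain k where k: "k \<in> K" "\<And>x. x \<in> K \<Longrightarrow> x \<le> k" using compact_attains_sup[OF K(1)] by blast
      show thesis
      proof (rule that[of k])
        show "k < T" "k > 0" using k(1) K(2) by auto
        show "\<psi> t = 0" if t: "t > k" for t
          by (rule K(3)) (use k(2)[of t] t in auto)
      qed
    qed
    \<comment> \<open>With the indicator of [-T,0] the convolution makes a(t) minus the integral of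
      \<psi> over [t, t + T]. For t in (0,T) the upper end lies beyond the support of \<psi>, so a'
      = \<psi> there, and \<open>smooth_convolution\<close> supplies smoothness.\<close>
    define w0 where "w0 = (\<lambda>x::real. indicator {- T..0} x :: real)"
    have w0: "integrable lborel w0" unfolding w0_def
      by (rule integrable_real_indicator) (use T_pos in \<open>simp_all add: emeasure_lborel_Icc_eq\<close>)
    define a where "a t = - (\<integral>x. w0 x * \<psi> (t - x) \<partial>lborel)" for t
    have sa: "smooth a" unfolding a_def[abs_def] by (rule smooth_uminus[OF smooth_convolution[OF w0 \<psi>]])
    \<comment> \<open>\<psi> vanishes strictly after \<tau>, and \<open>weak\<close> wants a
      threshold below T from which on \<open>a\<close> vanishes: the midpoint serves both.\<close>
    have a0: "a t = 0" if t: "t \<ge> (\<tau> + T) / 2" for t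
    proof -
      have z: "w0 x * \<psi> (t - x) = 0" for x
        using \<tau>(2)[of "t - x"] t \<tau>(1) by (auto simp: w0_def indicator_def)
      show ?thesis unfolding a_def z by simp
    qed
    have da: "dderiv a 1 t = \<psi> t" if t: "t \<in> {0<..<T}" for t
    proof -
      have s\<psi>: "smooth \<psi>" by (rule test_fun_smooth[OF \<psi>])
      have "(a has_derivative (\<lambda>v. - (\<integral>x. w0 x * dderiv \<psi> v (t - x) \<partial>lborel))) (at t)"
        unfolding a_def[abs_def] by (rule has_derivative_minus[OF convolution_has_derivative[OF w0 \<psi>]])
      then have "dderiv a 1 t = - (\<integral>x. w0 x * dderiv \<psi> 1 (t - x) \<partial>lborel)" by (rule dderiv_eq)
      also have "(\<integral>x. w0 x * dderiv \<psi> 1 (t - x) \<partial>lborel) = (\<integral>x. dderiv \<psi> 1 (t - x) * indicator {-T..0} x \<partial>lborel)"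
        by (simp add: w0_def mult.commute)
      also have "\<dots> = (\<lambda>x. - \<psi> (t - x)) 0 - (\<lambda>x. - \<psi> (t - x)) (-T)"
      proof (rule integral_FTC_Icc_real)
        show "- T \<le> 0" using T_pos by simp
        show "((\<lambda>x. - \<psi> (t - x)) has_real_derivative dderiv \<psi> 1 (t - x)) (at x)" for x
        proof -
          have "((\<lambda>x. t - x) has_derivative (\<lambda>h. - h)) (at x)" by (auto intro!: derivative_eq_intros)
          then have "((\<lambda>x. \<psi> (t - x)) has_derivative (\<lambda>h. dderiv \<psi> (- h) (t - x))) (at x)"
            by (rule has_derivative_compose) (rule smooth_has_derivative[OF s\<psi>])
          then have "((\<lambda>x. - \<psi> (t - x)) has_derivative (\<lambda>h. - dderiv \<psi> (- h) (t - x))) (at x)"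
            by (rule has_derivative_minus)
          moreover have "- dderiv \<psi> (- h) (t - x) = dderiv \<psi> 1 (t - x) * h" for h
            using linear_scale[OF smooth_dderiv_linear[OF s\<psi>, of "t - x"], of "- h" 1] by simp
          ultimately show ?thesis unfolding has_field_derivative_def by simp
        qed
        have "continuous_on UNIV (\<lambda>x. dderiv \<psi> 1 (t - x))"
          by (rule continuous_on_compose2[OF smooth_continuous[OF smooth_dderiv[OF s\<psi>], of UNIV]])
            (auto intro: continuous_intros)
        then show "isCont (\<lambda>x. dderiv \<psi> 1 (t - x)) x" for x by (simp add: continuous_on_eq_continuous_at)
      qed
      also have "\<dots> = - \<psi> t" using test_fun_outside[OF \<psi>, of "t + T"] t by simp
      finally show ?thesis by simp
    qed
    obtain B1 where B1: "B1 > 0" "\<And>x. norm (\<psi> x) \<le> B1" using test_fun_bounded[OF \<psi>] by blast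
    have \<psi>b: "\<psi> \<in> borel_measurable borel" by (rule test_fun_borel[OF \<psi>])
    have e1: "(\<integral>t. \<psi> t * m t \<partial>M) = - (\<integral>t. a t * F t \<partial>M)"
    proof -
      have "(\<integral>t. \<psi> t * m t \<partial>M) = (\<integral>t. dderiv a 1 t * m t \<partial>M)"
        by (rule Bochner_Integration.integral_cong) (use da in auto)
      also have "\<dots> = - (\<integral>t. a t * F t \<partial>M)" by (rule weak[where \<tau>="(\<tau> + T) / 2", OF sa _ a0]) (use \<tau>(1) in auto)
      finally show ?thesis .
    qed
    have e2: "(\<integral>t. \<psi> t * prim F t \<partial>M) = - (\<integral>t. a t * F t \<partial>M)"
    proof -
      have "(\<integral>t. \<psi> t * prim F t \<partial>M) = (\<integral>s. (\<integral>t. indicator {..t} s * \<psi> t \<partial>M) * F s \<partial>M)"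
        by (rule Fubini_prim[OF \<psi>b _ F]) (use B1 in auto)
      also have "\<dots> = (\<integral>s. (- a s) * F s \<partial>M)"
      proof (rule Bochner_Integration.integral_cong[OF refl])
        fix s assume s: "s \<in> space M"
        have "(\<integral>t. indicator {..t} s * \<psi> t \<partial>M) = (\<integral>t. indicator {..t} s * dderiv a 1 t \<partial>M)"
          by (rule Bochner_Integration.integral_cong) (use da in auto)
        also have "\<dots> = - a s" by (rule integral_dderiv_tail[OF sa a0]) (use s \<tau> in auto)
        finally show "(\<integral>t. indicator {..t} s * \<psi> t \<partial>M) * F s = (- a s) * F s" by simp
      qed
      finally show ?thesis by simp
    qed
    have i: "integrable M (\<lambda>t. \<psi> t * f t)" if f: "integrable M f" for f
      by (rule Bochner_Integration.integrable_bound[OF integrable_mult_right[OF f, of B1]])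
        (use B1 f borel_M[OF \<psi>b] in \<open>auto simp: abs_mult intro!: mult_right_mono\<close>)
    have "(\<integral>t. \<psi> t * w t \<partial>lebesgue) = (\<integral>t. indicator {0<..<T} t *\<^sub>R (\<psi> t * w t) \<partial>lebesgue)"
      by (rule Bochner_Integration.integral_cong) (use test_fun_outside[OF \<psi>] in \<open>auto simp: indicator_def\<close>)
    also have "\<dots> = (\<integral>t. \<psi> t * w t \<partial>M)" unfolding M_def by (rule integral_restrict_space[symmetric]) simp
    also have "\<dots> = (\<integral>t. \<psi> t * m t \<partial>M) - (\<integral>t. \<psi> t * prim F t \<partial>M)"
      using i[OF m] i[OF intR] by (simp add: w_def right_diff_distrib)
    finally show "(\<integral>t. \<psi> t * w t \<partial>lebesgue) = 0" using e1 e2 by simp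
  qed
  then have "AE t in M. w t = 0" unfolding M_def by (subst AE_lebesgue_on_iff) auto
  then show ?thesis by eventually_elim (simp add: w_def)
qed

end

section \<open>The renormalisation function\<close>

text \<open>A bounded function that vanishes only at 0, with values between 0 and |r|. Its
  derivative \<open>renorm'\<close> is bounded and Lipschitz, as \<open>chain_rule_prim\<close>
  demands, and being rational it is smooth by \<open>smooth_inverse\<close>.\<close>

definition renorm :: "real \<Rightarrow> real" where "renorm r = 1 - inverse (1 + r * r)"

definition renorm' :: "real \<Rightarrow> real" where "renorm' r = 2 * r * (inverse (1 + r * r) * inverse (1 + r * r))"

lemma one_plus_square_pos: "1 + r * r > (0::real)"
  by (simp add: add_pos_nonneg)

lemma renorm_bounds: "0 \<le> renorm r" "renorm r \<le> 1" "\<bar>renorm r\<bar> \<le> 1"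
  using one_plus_square_pos[of r] by (auto simp: renorm_def field_simps)

lemma renorm_eq_0_iff: "renorm r = 0 \<longleftrightarrow> r = 0"
  using one_plus_square_pos[of r] by (auto simp: renorm_def field_simps)

lemma renorm_has_derivative: "(renorm has_real_derivative renorm' r) (at r)"
  unfolding renorm_def[abs_def] renorm'_def using one_plus_square_pos[of r]
  by (auto intro!: derivative_eq_intros)

lemma smooth_renorm: "smooth renorm"
  unfolding renorm_def[abs_def]
  by (rule smooth_diff[OF smooth_const smooth_inverse[OF smooth_add[OF smooth_const smooth_mult[OF smooth_ident smooth_ident]]]])
    (use one_plus_square_pos in \<open>simp add: less_imp_neq[symmetric]\<close>)

lemma renorm'_bound: "\<bar>renorm' r\<bar> \<le> 1"
proof -
  define c where "c = inverse (1 + r * r)"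
  have c: "0 < c" "c \<le> 1" using one_plus_square_pos[of r] by (auto simp: c_def field_simps)
  have "2 * \<bar>r\<bar> \<le> 1 + r * r" using zero_le_power2[of "\<bar>r\<bar> - 1"] by (simp add: power2_eq_square algebra_simps)
  then have "2 * \<bar>r\<bar> * c \<le> 1" using one_plus_square_pos[of r] by (simp add: c_def field_simps)
  then have "(2 * \<bar>r\<bar> * c) * c \<le> 1 * 1" using c by (intro mult_mono) auto
  then show ?thesis using c by (simp add: renorm'_def c_def[symmetric] abs_mult mult_ac)
qed

lemma renorm_lipschitz: "\<bar>renorm x - renorm y\<bar> \<le> \<bar>x - y\<bar>"
  using field_differentiable_bound[of UNIV renorm renorm' 1 x y] renorm_has_derivative renorm'_bound by simp

text \<open>With c = 1 / (1 + r^2) the second derivative is 2 c^2 - 8 r^2 c^3. As c \<le> 1 and r^2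
  c \<le> 1, its modulus is at most 2 + 8 = 10.\<close>

lemma renorm'_lipschitz: "\<bar>renorm' x - renorm' y\<bar> \<le> 10 * \<bar>x - y\<bar>"
proof -
  define c where "c r = inverse (1 + r * r)" for r :: real
  have c: "0 < c r" "c r \<le> 1" "r * r * c r \<le> 1" for r
    using one_plus_square_pos[of r] by (auto simp: c_def field_simps)
  have d: "(renorm' has_real_derivative 2 * (c r * c r) - 8 * (r * r * c r) * (c r * c r)) (at r)" for r
    unfolding renorm'_def[abs_def] c_def using one_plus_square_pos[of r]
    by (auto intro!: derivative_eq_intros)
  have "norm (2 * (c r * c r) - 8 * (r * r * c r) * (c r * c r)) \<le> 10" for r
  proof -
    have cc: "0 \<le> c r * c r" "c r * c r \<le> 1" using c[of r] by (auto intro: mult_le_one)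
    have rr: "0 \<le> r * r * c r" using c[of r] by simp
    have "(r * r * c r) * (c r * c r) \<le> 1" "0 \<le> (r * r * c r) * (c r * c r)"
      using cc rr c(3)[of r] by (auto intro: mult_le_one)
    moreover have "8 * (r * r * c r) * (c r * c r) = 8 * ((r * r * c r) * (c r * c r))" by simp
    ultimately show ?thesis using cc unfolding real_norm_def abs_le_iff by linarith
  qed
  then show ?thesis
    using field_differentiable_bound[OF convex_UNIV, of renorm' "\<lambda>r. 2 * (c r * c r) - 8 * (r * r * c r) * (c r * c r)" 10 x y] d
    by simp
qed

lemma renorm_borel[measurable]: "renorm \<in> borel_measurable borel" "renorm' \<in> borel_measurable borel"
  unfolding renorm_def[abs_def] renorm'_def[abs_def] by measurable

section \<open>Renormalisation of the transport equation\<close>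

lemma dderiv_reflect:
  assumes "smooth \<kappa>"
  shows "dderiv (\<lambda>x. \<kappa> (y - x)) v x = - dderiv \<kappa> v (y - x)"
proof -
  have "((\<lambda>x. y - x) has_derivative (\<lambda>h. - h)) (at x)" by (auto intro!: derivative_eq_intros)
  then have "((\<lambda>x. \<kappa> (y - x)) has_derivative (\<lambda>h. dderiv \<kappa> (- h) (y - x))) (at x)"
    by (rule has_derivative_compose) (rule smooth_has_derivative[OF assms])
  then have "dderiv (\<lambda>x. \<kappa> (y - x)) v x = dderiv \<kappa> (- v) (y - x)" by (rule dderiv_eq)
  then show ?thesis using linear_neg[OF smooth_dderiv_linear[OF assms]] by metis
qed

text \<open>The direction varies together with the point; expanding it in the basis leaves only
  continuous partial derivatives.\<close>

lemma dderiv_measurable: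
  assumes "smooth \<psi>" and [measurable]: "f \<in> borel_measurable K" "g \<in> borel_measurable K"
  shows "(\<lambda>z. dderiv \<psi> (f z) (g z)) \<in> borel_measurable K"
proof -
  have [measurable]: "(\<lambda>x. dderiv \<psi> b x) \<in> borel_measurable borel" for b
    by (rule smooth_borel[OF smooth_dderiv[OF assms(1)]])
  have "(\<lambda>z. \<Sum>b\<in>Basis. (f z \<bullet> b) *\<^sub>R dderiv \<psi> b (g z)) \<in> borel_measurable K"
    by measurable
  moreover have "(\<lambda>z. \<Sum>b\<in>Basis. (f z \<bullet> b) *\<^sub>R dderiv \<psi> b (g z)) = (\<lambda>z. dderiv \<psi> (f z) (g z))"
    by (rule ext) (rule dderiv_basis_sum[OF smooth_differentiable[OF assms(1)], symmetric])
  ultimately show ?thesis by simp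
qed

context time_interval begin

lemma borel_measurable_time_slice:
  fixes f :: "real \<Rightarrow> 'a::euclidean_space \<Rightarrow> 'b::euclidean_space"
  assumes "(\<lambda>z. f (fst z) (snd z)) \<in> borel_measurable (M \<Otimes>\<^sub>M lborel)" "t \<in> {0<..<T}"
  shows "f t \<in> borel_measurable borel"
proof -
  have "(\<lambda>x. (t, x)) \<in> measurable lborel (M \<Otimes>\<^sub>M lborel)" using assms(2) by (intro measurable_Pair1') simp
  from measurable_compose[OF this assms(1)] show ?thesis by simp
qed

end

text \<open>The estimates are assumed at every time, so exceptional null sets must have been removed
  from the representatives. The weak equation is required for products a(t) \<phi>(x) only; that
  \<open>a\<close> may be nonzero at 0 encodes the initial density 0.\<close>

locale transport = time_interval T for T :: real +
  fixes \<Omega> :: "'a::euclidean_space set" and \<rho> :: "real \<Rightarrow> 'a \<Rightarrow> real" and u :: "real \<Rightarrow> 'a \<Rightarrow> 'a"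
    and C\<rho> :: real and Mu :: "real \<Rightarrow> real"
  assumes open_\<Omega>: "open \<Omega>"
    and \<rho>_measurable: "(\<lambda>z. \<rho> (fst z) (snd z)) \<in> borel_measurable (M \<Otimes>\<^sub>M lborel)"
    and u_measurable: "(\<lambda>z. u (fst z) (snd z)) \<in> borel_measurable (M \<Otimes>\<^sub>M lborel)"
    and \<rho>_integrable: "\<And>t. t \<in> {0<..<T} \<Longrightarrow> integrable lborel (\<rho> t)"
    and \<rho>_bound: "\<And>t. t \<in> {0<..<T} \<Longrightarrow> (\<integral>x. \<bar>\<rho> t x\<bar> \<partial>lborel) \<le> C\<rho>"
    and u_bound: "\<And>t x. t \<in> {0<..<T} \<Longrightarrow> norm (u t x) \<le> Mu t"
    and Mu_integrable: "integrable M Mu"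
    and div_free: "\<And>t \<phi>. t \<in> {0<..<T} \<Longrightarrow> test_fun \<Omega> \<phi> \<Longrightarrow> (\<integral>x. dderiv (\<phi>::'a \<Rightarrow> real) (u t x) x \<partial>lborel) = 0"
    and weak_eq: "\<And>a \<tau> \<phi>. smooth a \<Longrightarrow> \<tau> < T \<Longrightarrow> (\<And>t. t \<ge> \<tau> \<Longrightarrow> a t = 0) \<Longrightarrow> test_fun \<Omega> \<phi> \<Longrightarrow>
      (\<integral>t. dderiv a 1 t * (\<integral>x. \<rho> t x * \<phi> x \<partial>lborel) \<partial>M)
      = (\<integral>t. a t * (\<integral>x. \<rho> t x * dderiv (\<phi>::'a \<Rightarrow> real) (u t x) x \<partial>lborel) \<partial>M)"
begin

sublocale P: pair_sigma_finite M lborel by standard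

lemma \<rho>_measurable'[measurable (raw)]:
  "f \<in> measurable K M \<Longrightarrow> g \<in> measurable K lborel \<Longrightarrow> (\<lambda>z. \<rho> (f z) (g z)) \<in> borel_measurable K"
  using measurable_compose[OF measurable_Pair \<rho>_measurable, of f K g] by simp

lemma u_measurable'[measurable (raw)]:
  "f \<in> measurable K M \<Longrightarrow> g \<in> measurable K lborel \<Longrightarrow> (\<lambda>z. u (f z) (g z)) \<in> borel_measurable K"
  using measurable_compose[OF measurable_Pair u_measurable, of f K g] by simp

lemma \<rho>_sec: "t \<in> {0<..<T} \<Longrightarrow> \<rho> t \<in> borel_measurable borel"
  using \<rho>_integrable by auto

lemmas u_sec = borel_measurable_time_slice[OF u_measurable]

lemma Mu_nonneg: "t \<in> {0<..<T} \<Longrightarrow> Mu t \<ge> 0"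
  using u_bound[of t undefined] norm_ge_zero order_trans by blast

lemma C\<rho>_nonneg: "C\<rho> \<ge> 0"
proof -
  have "0 \<le> (\<integral>x. \<bar>\<rho> (T/2) x\<bar> \<partial>lborel)" by (rule Bochner_Integration.integral_nonneg) simp
  from order_trans[OF this \<rho>_bound[of "T/2"]] show ?thesis using T_pos by simp
qed

lemma integrable_\<rho>_mult:
  assumes t: "t \<in> {0<..<T}" and g: "g \<in> borel_measurable borel" "\<And>x. \<bar>g x\<bar> \<le> B"
  shows "integrable lborel (\<lambda>x. \<rho> t x * g x)" "\<bar>\<integral>x. \<rho> t x * g x \<partial>lborel\<bar> \<le> B * C\<rho>"
proof -
  have B: "B \<ge> 0" using g(2)[of undefined] by linarith
  have le: "norm (\<rho> t x * g x) \<le> norm (B * \<bar>\<rho> t x\<bar>)" for x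
    using mult_right_mono[OF g(2)[of x], of "\<bar>\<rho> t x\<bar>"] B by (simp add: abs_mult mult.commute)
  show i: "integrable lborel (\<lambda>x. \<rho> t x * g x)"
    by (rule Bochner_Integration.integrable_bound[of _ "\<lambda>x. B * \<bar>\<rho> t x\<bar>"])
      (use \<rho>_integrable[OF t] \<rho>_sec[OF t] g le in auto)
  have "norm (\<integral>x. \<rho> t x * g x \<partial>lborel) \<le> (\<integral>x. norm (\<rho> t x * g x) \<partial>lborel)" by (rule integral_norm_bound)
  also have "\<dots> \<le> (\<integral>x. B * \<bar>\<rho> t x\<bar> \<partial>lborel)"
    by (rule integral_mono[OF integrable_norm[OF i]]) (use \<rho>_integrable[OF t] le B in \<open>auto simp: abs_mult\<close>)
  also have "\<dots> \<le> B * C\<rho>" using \<rho>_bound[OF t] B by (simp add: mult_left_mono)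
  finally show "\<bar>\<integral>x. \<rho> t x * g x \<partial>lborel\<bar> \<le> B * C\<rho>" by simp
qed

lemma integrable_\<rho>_dderiv:
  fixes \<kappa> :: "'a \<Rightarrow> real"
  assumes t: "t \<in> {0<..<T}" and \<kappa>: "smooth \<kappa>" "\<And>x v. \<bar>dderiv \<kappa> v x\<bar> \<le> B * norm v" and B: "B \<ge> 0"
    and w: "w \<in> borel_measurable borel" "\<And>x. norm (w x) \<le> W" and h: "h \<in> borel_measurable borel"
  shows "integrable lborel (\<lambda>x. \<rho> t x * dderiv \<kappa> (w x) (h x))"
    "\<bar>\<integral>x. \<rho> t x * dderiv \<kappa> (w x) (h x) \<partial>lborel\<bar> \<le> (B * W) * C\<rho>"
proof -
  have m: "(\<lambda>x. dderiv \<kappa> (w x) (h x)) \<in> borel_measurable borel"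
    by (rule dderiv_measurable[OF \<kappa>(1) w(1) h])
  have b: "\<bar>dderiv \<kappa> (w x) (h x)\<bar> \<le> B * W" for x
    using \<kappa>(2)[where v="w x" and x="h x"] mult_left_mono[OF w(2)[of x] B] by linarith
  show "integrable lborel (\<lambda>x. \<rho> t x * dderiv \<kappa> (w x) (h x))"
    "\<bar>\<integral>x. \<rho> t x * dderiv \<kappa> (w x) (h x) \<partial>lborel\<bar> \<le> (B * W) * C\<rho>"
    using integrable_\<rho>_mult[OF t m b] by auto
qed

text \<open>The time derivative of the mollified density at \<open>y\<close>. Testing with
  \<open>moll \<epsilon> (y - x)\<close> as a function of x yields a minus sign from the reflection,
  which matches the sign of integration by parts in time.\<close>

definition flux :: "real \<Rightarrow> real \<Rightarrow> 'a \<Rightarrow> real" where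
  "flux \<epsilon> s y = (\<integral>x. \<rho> s x * dderiv (moll \<epsilon>) (u s x) (y - x) \<partial>lborel)"

lemma flux_measurable:
  assumes "\<epsilon> > 0"
  shows "(\<lambda>z. flux \<epsilon> (fst z) (snd z)) \<in> borel_measurable (M \<Otimes>\<^sub>M lborel)"
proof -
  have "(\<lambda>p. dderiv (moll \<epsilon>) (u (fst (fst p)) (snd p)) (snd (fst p) - snd p)) \<in> borel_measurable ((M \<Otimes>\<^sub>M lborel) \<Otimes>\<^sub>M lborel)"
    by (rule dderiv_measurable[OF test_fun_smooth[OF test_fun_moll[OF assms]]]) measurable
  then have "(\<lambda>p. \<rho> (fst (fst p)) (snd p) * dderiv (moll \<epsilon>) (u (fst (fst p)) (snd p)) (snd (fst p) - snd p))
      \<in> borel_measurable ((M \<Otimes>\<^sub>M lborel) \<Otimes>\<^sub>M lborel)"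
    by (rule borel_measurable_times[rotated]) measurable
  then have "(\<lambda>(z, x). \<rho> (fst z) x * dderiv (moll \<epsilon>) (u (fst z) x) (snd z - x))
      \<in> borel_measurable ((M \<Otimes>\<^sub>M lborel) \<Otimes>\<^sub>M lborel)"
    by (simp only: split_beta')
  then show ?thesis unfolding flux_def by (rule lborel.borel_measurable_lebesgue_integral)
qed

lemma mollify_measurable:
  assumes "\<epsilon> > 0"
  shows "(\<lambda>z. mollify \<epsilon> (\<rho> (fst z)) (snd z)) \<in> borel_measurable (M \<Otimes>\<^sub>M lborel)"
proof -
  have [measurable]: "moll \<epsilon> \<in> borel_measurable borel" using test_fun_borel[OF test_fun_moll[OF assms]] .
  have "(\<lambda>p. \<rho> (fst (fst p)) (snd p) * moll \<epsilon> (snd (fst p) - snd p))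
      \<in> borel_measurable ((M \<Otimes>\<^sub>M lborel) \<Otimes>\<^sub>M lborel)"
    by measurable
  then show ?thesis
    unfolding mollify_def by (intro lborel.borel_measurable_lebesgue_integral) (simp add: split_beta')
qed

lemma flux_bound:
  assumes "\<epsilon> > 0"
  obtains B where "B \<ge> 0" "\<And>s y. s \<in> {0<..<T} \<Longrightarrow> \<bar>flux \<epsilon> s y\<bar> \<le> B * Mu s"
proof -
  obtain B where B: "B > 0" "\<And>x v. norm (dderiv (moll \<epsilon>) v (x::'a)) \<le> B * norm v"
    using test_fun_dderiv_bounded[OF test_fun_moll[OF assms]] by blast
  have "\<bar>flux \<epsilon> s y\<bar> \<le> (B * C\<rho>) * Mu s" if s: "s \<in> {0<..<T}" for s y
  proof -
    have "\<bar>\<integral>x. \<rho> s x * dderiv (moll \<epsilon>) (u s x) (y - x) \<partial>lborel\<bar> \<le> (B * Mu s) * C\<rho>"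
    proof (rule integrable_\<rho>_dderiv(2)[OF s])
      show "smooth (moll \<epsilon>)" by (rule test_fun_smooth[OF test_fun_moll[OF assms]])
      show "\<bar>dderiv (moll \<epsilon>) v x\<bar> \<le> B * norm v" for x v :: 'a using B(2)[of x v] by simp
      show "u s \<in> borel_measurable borel" by (rule u_sec[OF s])
      show "norm (u s x) \<le> Mu s" for x by (rule u_bound[OF s])
    qed (use B in auto)
    then show ?thesis by (simp add: flux_def mult_ac)
  qed
  then show ?thesis using that[of "B * C\<rho>"] B(1) C\<rho>_nonneg by simp
qed

lemma integrable_flux:
  assumes "\<epsilon> > 0"
  shows "integrable M (\<lambda>s. flux \<epsilon> s y)"
proof -
  obtain B where B: "B \<ge> 0" "\<And>s y. s \<in> {0<..<T} \<Longrightarrow> \<bar>flux \<epsilon> s y\<bar> \<le> B * Mu s"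
    using flux_bound[OF assms] by blast
  have m: "(\<lambda>s. flux \<epsilon> s y) \<in> borel_measurable M"
    using measurable_compose[OF measurable_Pair2' flux_measurable[OF assms], of y] by simp
  show ?thesis
    by (rule Bochner_Integration.integrable_bound[OF integrable_mult_right[OF Mu_integrable, of B] m])
      (use B Mu_nonneg in \<open>auto intro!: AE_I2 simp: abs_mult\<close>)
qed

lemma mollify_\<rho>_bound:
  assumes "\<epsilon> > 0"
  obtains B where "\<And>s y. s \<in> {0<..<T} \<Longrightarrow> \<bar>mollify \<epsilon> (\<rho> s) y\<bar> \<le> B"
proof -
  obtain B where B: "B > 0" "\<And>x. norm (moll \<epsilon> (x::'a)) \<le> B"
    using test_fun_bounded[OF test_fun_moll[OF assms]] by blast
  have [measurable]: "(moll \<epsilon> :: 'a \<Rightarrow> real) \<in> borel_measurable borel"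
    using test_fun_borel[OF test_fun_moll[OF assms]] .
  have "\<bar>mollify \<epsilon> (\<rho> s) y\<bar> \<le> B * C\<rho>" if s: "s \<in> {0<..<T}" for s y
    unfolding mollify_def by (rule integrable_\<rho>_mult(2)[OF s]) (use B in \<open>auto simp: real_norm_def[symmetric] simp del: real_norm_def\<close>)
  then show ?thesis using that by blast
qed

text \<open>At a fixed point \<open>y\<close> the weak equation becomes a scalar one in time. The
  exceptional null set of times depends on \<open>y\<close>.\<close>

lemma AE_mollify_eq_prim:
  assumes e: "\<epsilon> > 0" and y: "cball y \<epsilon> \<subseteq> \<Omega>"
  shows "AE t in M. mollify \<epsilon> (\<rho> t) y = prim (\<lambda>s. flux \<epsilon> s y) t"
proof (rule AE_eq_prim_if_weak)
  obtain B where B: "\<And>s y. s \<in> {0<..<T} \<Longrightarrow> \<bar>mollify \<epsilon> (\<rho> s) y\<bar> \<le> B"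
    using mollify_\<rho>_bound[OF e] by blast
  have m: "(\<lambda>s. mollify \<epsilon> (\<rho> s) y) \<in> borel_measurable M"
    using measurable_compose[OF measurable_Pair2' mollify_measurable[OF e], of y] by simp
  show "integrable M (\<lambda>t. mollify \<epsilon> (\<rho> t) y)"
    by (rule fM.integrable_const_bound[OF _ m, of B]) (use B in auto)
  show "integrable M (\<lambda>s. flux \<epsilon> s y)" by (rule integrable_flux[OF e])
  fix a :: "real \<Rightarrow> real" and \<tau> assume a: "smooth a" "\<tau> < T" "\<And>t. \<tau> \<le> t \<Longrightarrow> a t = 0"
  have "(\<integral>t. dderiv a 1 t * (\<integral>x. \<rho> t x * moll \<epsilon> (y - x) \<partial>lborel) \<partial>M)
      = (\<integral>t. a t * (\<integral>x. \<rho> t x * dderiv (\<lambda>x. moll \<epsilon> (y - x)) (u t x) x \<partial>lborel) \<partial>M)"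
    by (rule weak_eq[OF a test_fun_moll_translate[OF e y]])
  then show "(\<integral>t. dderiv a 1 t * mollify \<epsilon> (\<rho> t) y \<partial>M) = - (\<integral>t. a t * flux \<epsilon> t y \<partial>M)"
    by (simp add: mollify_def flux_def dderiv_reflect[OF test_fun_smooth[OF test_fun_moll[OF e]]])
qed

lemma prim_cong_AE:
  assumes "AE s in M. f s = g s" "f \<in> borel_measurable M" "g \<in> borel_measurable M"
  shows "prim f t = prim g t"
  unfolding prim_def
proof (rule integral_cong_AE)
  show "AE s in M. indicator {..t} s * f s = indicator {..t} s * g s"
    using assms(1) by eventually_elim simp
qed (intro borel_measurable_times sets_M_borel assms; simp)+

lemma AE_renorm_mollify:
  assumes e: "\<epsilon> > 0" and y: "cball y \<epsilon> \<subseteq> \<Omega>"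
  shows "AE t in M. renorm (mollify \<epsilon> (\<rho> t) y)
    = prim (\<lambda>s. renorm' (mollify \<epsilon> (\<rho> s) y) * flux \<epsilon> s y) t"
proof -
  have int: "integrable M (\<lambda>s. flux \<epsilon> s y)" by (rule integrable_flux[OF e])
  have m1[measurable]: "(\<lambda>s. mollify \<epsilon> (\<rho> s) y) \<in> borel_measurable M"
    using measurable_compose[OF measurable_Pair2' mollify_measurable[OF e], of y] by simp
  have m2[measurable]: "(\<lambda>s. flux \<epsilon> s y) \<in> borel_measurable M" using int by auto
  have m3[measurable]: "prim (\<lambda>s. flux \<epsilon> s y) \<in> borel_measurable M" by (rule prim_borel[OF int])
  have "prim (\<lambda>s. renorm' (prim (\<lambda>s. flux \<epsilon> s y) s) * flux \<epsilon> s y) t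
      = prim (\<lambda>s. renorm' (mollify \<epsilon> (\<rho> s) y) * flux \<epsilon> s y) t" for t
  proof (rule prim_cong_AE)
    show "AE s in M. renorm' (prim (\<lambda>s. flux \<epsilon> s y) s) * flux \<epsilon> s y = renorm' (mollify \<epsilon> (\<rho> s) y) * flux \<epsilon> s y"
      using AE_mollify_eq_prim[OF assms] by eventually_elim simp
  qed measurable
  moreover have "renorm (prim (\<lambda>s. flux \<epsilon> s y) t) - renorm 0
      = prim (\<lambda>s. renorm' (prim (\<lambda>s. flux \<epsilon> s y) s) * flux \<epsilon> s y) t" if "t \<ge> 0" for t
    by (rule chain_rule_prim[OF int renorm_has_derivative renorm'_lipschitz _ renorm'_bound _ that]) auto
  ultimately have *: "renorm (prim (\<lambda>s. flux \<epsilon> s y) t) = prim (\<lambda>s. renorm' (mollify \<epsilon> (\<rho> s) y) * flux \<epsilon> s y) t"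
    if "t \<ge> 0" for t using that by (simp add: renorm_def)
  show ?thesis
    using AE_mollify_eq_prim[OF assms] AE_space by eventually_elim (use * in auto)
qed

text \<open>Controls the commutator at time \<open>s\<close>: the kernel is, up to a constant, the
  bound of \<open>moll_dderiv_bound\<close> for the derivative of the mollifier. With values in
  \<open>ennreal\<close> it may be formed before it is known to be finite.\<close>

definition defect :: "real \<Rightarrow> real \<Rightarrow> ennreal" where
  "defect \<epsilon> s = (\<integral>\<^sup>+y. \<integral>\<^sup>+x. ennreal (\<bar>\<rho> s x - \<rho> s y\<bar> * norm (u s x - u s y) *
     (indicator (cball 0 \<epsilon>) (y - x) / \<epsilon> ^ (DIM('a) + 1))) \<partial>lborel \<partial>lborel)"

text \<open>For each y the equation fails on a null set of times depending on y. Exchanging the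
  quantifiers by Fubini gives, for almost every t, the equation for almost every y, which can then
  be integrated against \<psi>.\<close>

lemma AE_integral_renorm_mollify:
  assumes e: "\<epsilon> > 0" and \<psi>: "test_fun \<Omega> (\<psi>::'a \<Rightarrow> real)" and K: "\<And>y. \<psi> y \<noteq> 0 \<Longrightarrow> cball y \<epsilon> \<subseteq> \<Omega>"
  shows "AE t in M. (\<integral>y. \<psi> y * renorm (mollify \<epsilon> (\<rho> t) y) \<partial>lborel)
    = prim (\<lambda>s. \<integral>y. \<psi> y * (renorm' (mollify \<epsilon> (\<rho> s) y) * flux \<epsilon> s y) \<partial>lborel) t"
    "(\<lambda>s. \<integral>y. \<psi> y * (renorm' (mollify \<epsilon> (\<rho> s) y) * flux \<epsilon> s y) \<partial>lborel) \<in> borel_measurable M"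
    "integrable M (\<lambda>s. \<integral>y. \<psi> y * (renorm' (mollify \<epsilon> (\<rho> s) y) * flux \<epsilon> s y) \<partial>lborel)"
proof -
  define g where "g s y = \<psi> y * (renorm' (mollify \<epsilon> (\<rho> s) y) * flux \<epsilon> s y)" for s y
  have [measurable]: "\<psi> \<in> borel_measurable borel" by (rule test_fun_borel[OF \<psi>])
  note [measurable] = mollify_measurable[OF e] flux_measurable[OF e] id_M
  have gm: "(\<lambda>z. g (fst z) (snd z)) \<in> borel_measurable (M \<Otimes>\<^sub>M lborel)" unfolding g_def by measurable
  have gm'[measurable (raw)]: "(\<lambda>z. g (f z) (h z)) \<in> borel_measurable N"
    if "f \<in> measurable N M" "h \<in> measurable N lborel" for f h N
    using measurable_compose[OF measurable_Pair gm, OF that] by simp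
  obtain B where B: "B \<ge> 0" "\<And>s y. s \<in> {0<..<T} \<Longrightarrow> \<bar>flux \<epsilon> s y\<bar> \<le> B * Mu s"
    using flux_bound[OF e] by blast
  have gb: "\<bar>g s y\<bar> \<le> \<bar>\<psi> y\<bar> * (B * Mu s)" if s: "s \<in> {0<..<T}" for s y
  proof -
    have "\<bar>renorm' (mollify \<epsilon> (\<rho> s) y)\<bar> * \<bar>flux \<epsilon> s y\<bar> \<le> 1 * (B * Mu s)"
      by (intro mult_mono renorm'_bound B(2)[OF s]) auto
    then show ?thesis unfolding g_def abs_mult by (intro mult_left_mono) auto
  qed
  have \<psi>i: "integrable lborel \<psi>" by (rule test_fun_integrable[OF \<psi>])
  have gi1: "integrable lborel (g s)" if s: "s \<in> {0<..<T}" for s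
  proof (rule Bochner_Integration.integrable_bound[of _ "\<lambda>y. \<bar>\<psi> y\<bar> * (B * Mu s)"])
    have "(\<lambda>y. s) \<in> measurable lborel M" using s by (intro measurable_const) simp
    then show "g s \<in> borel_measurable lborel" using gm'[OF _ measurable_ident] by (simp only: id_apply)
  qed (use \<psi>i gb[OF s] B(1) Mu_nonneg[OF s] in \<open>auto simp: abs_mult\<close>)
  have gi1': "(\<integral>y. \<bar>g s y\<bar> \<partial>lborel) \<le> (\<integral>y. \<bar>\<psi> y\<bar> \<partial>lborel) * (B * Mu s)" if s: "s \<in> {0<..<T}" for s
  proof -
    have "(\<integral>y. \<bar>g s y\<bar> \<partial>lborel) \<le> (\<integral>y. \<bar>\<psi> y\<bar> * (B * Mu s) \<partial>lborel)"
      by (rule integral_mono) (use gi1[OF s] \<psi>i gb[OF s] in auto)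
    then show ?thesis by simp
  qed
  have gint: "integrable (M \<Otimes>\<^sub>M lborel) (\<lambda>(s, y). indicator {..t} s * g s y)" for t
  proof (rule P.Fubini_integrable)
    have ind: "(\<lambda>s. indicator {..t} s :: real) \<in> borel_measurable M" by (rule sets_M_borel) simp
    note [measurable] = ind
    show m: "(\<lambda>(s, y). indicator {..t} s * g s y) \<in> borel_measurable (M \<Otimes>\<^sub>M lborel)" by measurable
    show "AE s in M. integrable lborel (\<lambda>y. case (s, y) of (s, y) \<Rightarrow> indicator {..t} s * g s y)"
      using AE_space by eventually_elim (use gi1 in auto)
    show "integrable M (\<lambda>s. \<integral>y. norm (case (s, y) of (s, y) \<Rightarrow> indicator {..t} s * g s y) \<partial>lborel)"
    proof (rule Bochner_Integration.integrable_bound[OF integrable_mult_right[OF Mu_integrable, of "(\<integral>y. \<bar>\<psi> y\<bar> \<partial>lborel) * B"]])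
      show "(\<lambda>s. \<integral>y. norm (case (s, y) of (s, y) \<Rightarrow> indicator {..t} s * g s y) \<partial>lborel) \<in> borel_measurable M"
        by measurable
      have "norm (\<integral>y. norm (indicator {..t} s * g s y) \<partial>lborel) \<le> norm ((\<integral>y. \<bar>\<psi> y\<bar> \<partial>lborel) * B * Mu s)"
        if s: "s \<in> {0<..<T}" for s
      proof -
        have "norm (\<integral>y. norm (indicator {..t} s * g s y) \<partial>lborel) = indicator {..t} s * (\<integral>y. \<bar>g s y\<bar> \<partial>lborel)"
          by (simp add: abs_mult)
        also have "\<dots> \<le> 1 * ((\<integral>y. \<bar>\<psi> y\<bar> \<partial>lborel) * (B * Mu s))"
          by (intro mult_mono gi1'[OF s]) (auto simp: indicator_def)
        finally show ?thesis by (simp add: mult.assoc)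
      qed
      then show "AE s in M. norm (\<integral>y. norm (case (s, y) of (s, y) \<Rightarrow> indicator {..t} s * g s y) \<partial>lborel)
        \<le> norm ((\<integral>y. \<bar>\<psi> y\<bar> \<partial>lborel) * B * Mu s)"
        by (intro AE_I2) auto
    qed
  qed
  show mI: "(\<lambda>s. \<integral>y. \<psi> y * (renorm' (mollify \<epsilon> (\<rho> s) y) * flux \<epsilon> s y) \<partial>lborel) \<in> borel_measurable M"
    unfolding g_def[symmetric] by measurable
  show "integrable M (\<lambda>s. \<integral>y. \<psi> y * (renorm' (mollify \<epsilon> (\<rho> s) y) * flux \<epsilon> s y) \<partial>lborel)"
  proof (rule Bochner_Integration.integrable_bound[OF integrable_mult_right[OF Mu_integrable, of "(\<integral>y. \<bar>\<psi> y\<bar> \<partial>lborel) * B"] mI])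
    have "norm (\<integral>y. g s y \<partial>lborel) \<le> norm ((\<integral>y. \<bar>\<psi> y\<bar> \<partial>lborel) * B * Mu s)" if s: "s \<in> {0<..<T}" for s
      using order_trans[OF integral_norm_bound[of lborel "g s"], of "(\<integral>y. \<bar>\<psi> y\<bar> \<partial>lborel) * (B * Mu s)"] gi1'[OF s]
      by (simp add: mult.assoc)
    then show "AE s in M. norm (\<integral>y. \<psi> y * (renorm' (mollify \<epsilon> (\<rho> s) y) * flux \<epsilon> s y) \<partial>lborel)
        \<le> norm ((\<integral>y. \<bar>\<psi> y\<bar> \<partial>lborel) * B * Mu s)"
      unfolding g_def[symmetric] by (intro AE_I2) auto
  qed
  \<comment> \<open>Written as a condition on the pair (s, t), so that joint measurability in both
    times is visible.\<close>
  have ind2: "indicator {..t} s = (if s \<le> t then 1 else 0 :: real)" for s t :: real by simp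
  have "AE y in lborel. AE t in M. \<psi> y * renorm (mollify \<epsilon> (\<rho> t) y) = prim (\<lambda>s. g s y) t"
  proof (rule AE_I2)
    fix y :: 'a
    show "AE t in M. \<psi> y * renorm (mollify \<epsilon> (\<rho> t) y) = prim (\<lambda>s. g s y) t"
    proof (cases "\<psi> y = 0")
      case True
      then show ?thesis by (simp add: g_def prim_def)
    next
      case False
      have pr: "prim (\<lambda>s. g s y) t = \<psi> y * prim (\<lambda>s. renorm' (mollify \<epsilon> (\<rho> s) y) * flux \<epsilon> s y) t" for t
        unfolding prim_def g_def by (simp add: mult.left_commute flip: integral_mult_right_zero)
      show ?thesis using AE_renorm_mollify[OF e K[OF False]] by eventually_elim (simp add: pr)
    qed
  qed
  then have "AE t in M. AE y in lborel. \<psi> y * renorm (mollify \<epsilon> (\<rho> t) y) = prim (\<lambda>s. g s y) t"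
  proof (subst P.AE_commute)
    show "{z \<in> space (M \<Otimes>\<^sub>M lborel). \<psi> (snd z) * renorm (mollify \<epsilon> (\<rho> (fst z)) (snd z)) = prim (\<lambda>s. g s (snd z)) (fst z)}
        \<in> sets (M \<Otimes>\<^sub>M lborel)"
      unfolding prim_def ind2 by measurable
  qed
  then show "AE t in M. (\<integral>y. \<psi> y * renorm (mollify \<epsilon> (\<rho> t) y) \<partial>lborel)
    = prim (\<lambda>s. \<integral>y. \<psi> y * (renorm' (mollify \<epsilon> (\<rho> s) y) * flux \<epsilon> s y) \<partial>lborel) t"
    using AE_space
  proof eventually_elim
    fix t assume ae: "AE y in lborel. \<psi> y * renorm (mollify \<epsilon> (\<rho> t) y) = prim (\<lambda>s. g s y) t" and "t \<in> space M"
    then have t: "t \<in> {0<..<T}" by simp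
    have [measurable]: "mollify \<epsilon> (\<rho> t) \<in> borel_measurable borel"
      by (rule smooth_borel[OF smooth_mollify[OF \<rho>_integrable[OF t] e]])
    have "(\<integral>y. \<psi> y * renorm (mollify \<epsilon> (\<rho> t) y) \<partial>lborel) = (\<integral>y. prim (\<lambda>s. g s y) t \<partial>lborel)"
    proof (rule integral_cong_AE[OF _ _ ae])
      show "(\<lambda>y. prim (\<lambda>s. g s y) t) \<in> borel_measurable lborel" unfolding prim_def ind2 by measurable
    qed measurable
    also have "\<dots> = (\<integral>y. \<integral>s. indicator {..t} s * g s y \<partial>M \<partial>lborel)" by (simp add: prim_def)
    also have "\<dots> = (\<integral>s. \<integral>y. indicator {..t} s * g s y \<partial>lborel \<partial>M)"
      by (rule P.Fubini_integral[OF gint])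
    also have "\<dots> = prim (\<lambda>s. \<integral>y. g s y \<partial>lborel) t" by (simp add: prim_def)
    finally show "(\<integral>y. \<psi> y * renorm (mollify \<epsilon> (\<rho> t) y) \<partial>lborel)
      = prim (\<lambda>s. \<integral>y. \<psi> y * (renorm' (mollify \<epsilon> (\<rho> s) y) * flux \<epsilon> s y) \<partial>lborel) t"
      unfolding g_def .
  qed
qed

end

context transport begin

subsection \<open>The commutator\<close>

text \<open>Since \<^term>\<open>u s\<close> is divergence free and the mollifier is even, \<^term>\<open>\<rho> s x\<close> may be replaced by the increment
  \<^term>\<open>\<rho> s x - \<rho> s y\<close> in the commutator; no limit has to be identified.\<close>

lemma flux_decomposition:
  assumes e: "\<epsilon> > 0" and s: "s \<in> {0<..<T}" and y: "cball y \<epsilon> \<subseteq> \<Omega>"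
  shows "flux \<epsilon> s y = dderiv (mollify \<epsilon> (\<rho> s)) (u s y) y
      + (\<integral>x. (\<rho> s x - \<rho> s y) * dderiv (moll \<epsilon>) (u s x - u s y) (y - x) \<partial>lborel)"
    (is "_ = _ + ?r")
proof -
  have tm: "test_fun UNIV (moll \<epsilon> :: 'a \<Rightarrow> real)" by (rule test_fun_moll[OF e])
  have sm: "smooth (moll \<epsilon> :: 'a \<Rightarrow> real)" by (rule test_fun_smooth[OF tm])
  obtain B where B: "B > 0" "\<And>x v. norm (dderiv (moll \<epsilon>) v (x::'a)) \<le> B * norm v"
    using test_fun_dderiv_bounded[OF tm] by blast
  have us: "u s \<in> borel_measurable borel" by (rule u_sec[OF s])
  have h: "(\<lambda>x. y - x) \<in> borel_measurable borel" by measurable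
  have b: "\<bar>dderiv (moll \<epsilon>) v x\<bar> \<le> B * norm v" for x v :: 'a using B(2)[of x v] by simp
  have i1: "integrable lborel (\<lambda>x. \<rho> s x * dderiv (moll \<epsilon>) (u s x) (y - x))"
    by (rule integrable_\<rho>_dderiv(1)[OF s sm b _ us u_bound[OF s] h]) (use B in auto)
  have i2: "integrable lborel (\<lambda>x. \<rho> s x * dderiv (moll \<epsilon>) (u s y) (y - x))"
    by (rule integrable_\<rho>_dderiv(1)[OF s sm b _ _ u_bound[OF s] h]) (use B in auto)
  have ind: "dderiv (moll \<epsilon>) v (y - x) = indicator (cball y \<epsilon>) x * dderiv (moll \<epsilon>) v (y - x)" for v x
  proof (cases "x \<in> cball y \<epsilon>")
    case False
    then have "y - x \<notin> cball 0 \<epsilon>" by (simp add: dist_norm norm_minus_commute)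
    from dderiv_zero_outside[OF closed_cball _ this, of "moll \<epsilon>" v] show ?thesis
      using moll_eq_0[OF e, where 'a='a] by (simp add: False)
  qed simp
  have i3: "integrable lborel (\<lambda>x. dderiv (moll \<epsilon>) (w x) (y - x))"
    if w: "w \<in> borel_measurable borel" "\<And>x. norm (w x) \<le> Mu s" for w :: "'a \<Rightarrow> 'a"
  proof (rule Bochner_Integration.integrable_bound)
    show "integrable lborel (\<lambda>x. indicator (cball y \<epsilon>) x * (B * Mu s))"
      by (intro integrable_mult_left integrable_real_indicator emeasure_lborel_cball_finite) simp
    show "(\<lambda>x. dderiv (moll \<epsilon>) (w x) (y - x)) \<in> borel_measurable lborel"
      using dderiv_measurable[OF sm w(1) h] by simp
    have "norm (dderiv (moll \<epsilon>) (w x) (y - x)) \<le> norm (indicator (cball y \<epsilon>) x * (B * Mu s))" for x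
    proof -
      have "norm (dderiv (moll \<epsilon>) (w x) (y - x)) = indicator (cball y \<epsilon>) x * norm (dderiv (moll \<epsilon>) (w x) (y - x))"
        by (subst ind) (simp add: abs_mult)
      also have "\<dots> \<le> indicator (cball y \<epsilon>) x * (B * Mu s)"
        using B(2)[of "y - x" "w x"] mult_left_mono[OF w(2)[of x], of B] B(1)
        by (intro mult_left_mono) (auto intro: order_trans)
      finally show ?thesis using B(1) Mu_nonneg[OF s] by simp
    qed
    then show "AE x in lborel. norm (dderiv (moll \<epsilon>) (w x) (y - x)) \<le> norm (indicator (cball y \<epsilon>) x * (B * Mu s))"
      by (rule AE_I2)
  qed
  have i3u: "integrable lborel (\<lambda>x. dderiv (moll \<epsilon>) (u s x) (y - x))" by (rule i3[OF us u_bound[OF s]])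
  have i3c: "integrable lborel (\<lambda>x. dderiv (moll \<epsilon>) (u s y) (y - x))" by (rule i3) (use u_bound[OF s] in auto)
  \<comment> \<open>The condition on \<open>y\<close> makes the translated mollifier a test function
    in \<open>\<Omega>\<close>, to which the divergence condition applies; for the constant vector
    \<open>u s y\<close> in \<open>z2\<close> it is integration by parts.\<close>
  have z1: "(\<integral>x. dderiv (moll \<epsilon>) (u s x) (y - x) \<partial>lborel) = 0"
    using div_free[OF s test_fun_moll_translate[OF e y]] by (simp add: dderiv_reflect[OF sm])
  have z2: "(\<integral>x. dderiv (moll \<epsilon>) (u s y) (y - x) \<partial>lborel) = 0"
    using integral_dderiv_eq_0[OF test_fun_moll_translate[OF e y], of "u s y"] by (simp add: dderiv_reflect[OF sm])
  have lin: "dderiv (moll \<epsilon>) (u s x - u s y) z = dderiv (moll \<epsilon>) (u s x) z - dderiv (moll \<epsilon>) (u s y) z" for x z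
    by (rule linear_diff[OF smooth_dderiv_linear[OF sm]])
  have d: "dderiv (mollify \<epsilon> (\<rho> s)) (u s y) y = (\<integral>x. \<rho> s x * dderiv (moll \<epsilon>) (u s y) (y - x) \<partial>lborel)"
    unfolding mollify_def[abs_def] by (rule dderiv_eq[OF convolution_has_derivative[OF \<rho>_integrable[OF s] tm]])
  \<comment> \<open>Multiplied out, the integrand has four terms: the two carrying
    \<open>\<rho> s y\<close> integrate to 0 by \<open>z1\<close> and \<open>z2\<close>, the others
    are the flux and the derivative of the mollified density.\<close>
  have "?r = (\<integral>x. (\<rho> s x * dderiv (moll \<epsilon>) (u s x) (y - x) - \<rho> s x * dderiv (moll \<epsilon>) (u s y) (y - x))
      - (\<rho> s y * dderiv (moll \<epsilon>) (u s x) (y - x) - \<rho> s y * dderiv (moll \<epsilon>) (u s y) (y - x)) \<partial>lborel)"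
    by (intro Bochner_Integration.integral_cong refl) (simp add: lin algebra_simps)
  also have "\<dots> = ((\<integral>x. \<rho> s x * dderiv (moll \<epsilon>) (u s x) (y - x) \<partial>lborel) - (\<integral>x. \<rho> s x * dderiv (moll \<epsilon>) (u s y) (y - x) \<partial>lborel))
      - (\<rho> s y * (\<integral>x. dderiv (moll \<epsilon>) (u s x) (y - x) \<partial>lborel) - \<rho> s y * (\<integral>x. dderiv (moll \<epsilon>) (u s y) (y - x) \<partial>lborel))"
    using i1 i2 i3u i3c by simp
  finally have "?r = flux \<epsilon> s y - dderiv (mollify \<epsilon> (\<rho> s)) (u s y) y"
    by (simp add: z1 z2 d flux_def)
  then show ?thesis by simp
qed

text \<open>The product of \<open>\<psi>\<close> with \<open>renorm (m y)\<close> is itself a test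
  function, so the divergence condition and the product rule integrate by parts without
  differentiating \<open>u\<close>.\<close>

lemma div_free_renorm:
  assumes s: "s \<in> {0<..<T}" and m: "smooth m" and \<psi>: "test_fun \<Omega> (\<psi>::'a \<Rightarrow> real)"
  shows "(\<integral>y. \<psi> y * (renorm' (m y) * dderiv m (u s y) y) \<partial>lborel) = - (\<integral>y. renorm (m y) * dderiv \<psi> (u s y) y \<partial>lborel)"
    "integrable lborel (\<lambda>y. \<psi> y * (renorm' (m y) * dderiv m (u s y) y))"
    "integrable lborel (\<lambda>y. renorm (m y) * dderiv \<psi> (u s y) y)"
proof -
  have sr: "smooth (\<lambda>y. renorm (m y))" by (rule smooth_compose_real[OF smooth_renorm m])
  have s\<psi>: "smooth \<psi>" by (rule test_fun_smooth[OF \<psi>])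
  have dr: "dderiv (\<lambda>y. renorm (m y)) v y = renorm' (m y) * dderiv m v y" for v y
  proof (rule dderiv_eq)
    show "((\<lambda>y. renorm (m y)) has_derivative (\<lambda>v. renorm' (m y) * dderiv m v y)) (at y)"
      by (rule has_derivative_compose[OF smooth_has_derivative[OF m]])
        (rule renorm_has_derivative[unfolded has_field_derivative_def])
  qed
  have prod: "dderiv (\<lambda>y. \<psi> y * renorm (m y)) v y = \<psi> y * (renorm' (m y) * dderiv m v y) + renorm (m y) * dderiv \<psi> v y" for v y
  proof -
    have "dderiv (\<lambda>y. \<psi> y *\<^sub>R renorm (m y)) v y = \<psi> y *\<^sub>R dderiv (\<lambda>y. renorm (m y)) v y + dderiv \<psi> v y *\<^sub>R renorm (m y)"
      by (rule dderiv_scaleR[OF s\<psi> sr])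
    then show ?thesis by (simp add: dr mult.commute)
  qed
  have us: "u s \<in> borel_measurable borel" by (rule u_sec[OF s])
  have meas: "(\<lambda>y. dderiv f (u s y) y) \<in> borel_measurable lborel" if "smooth f" for f :: "'a \<Rightarrow> real"
    using dderiv_measurable[OF that us measurable_ident] by (simp add: id_def)
  have int: "integrable lborel (\<lambda>y. dderiv f (u s y) y)" if f: "test_fun \<Omega> f" for f :: "'a \<Rightarrow> real"
  proof -
    have "integrable lborel (\<lambda>y. \<Sum>b\<in>Basis. (u s y \<bullet> b) *\<^sub>R dderiv f b y)"
    proof (rule Bochner_Integration.integrable_sum)
      fix b :: 'a assume b: "b \<in> Basis"
      have fb: "test_fun \<Omega> (\<lambda>y. dderiv f b y)" by (rule test_fun_dderiv[OF f])
      show "integrable lborel (\<lambda>y. (u s y \<bullet> b) *\<^sub>R dderiv f b y)"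
      proof (rule Bochner_Integration.integrable_bound[OF integrable_mult_right[OF test_fun_integrable[OF fb], of "Mu s"]])
        show "(\<lambda>y. (u s y \<bullet> b) *\<^sub>R dderiv f b y) \<in> borel_measurable lborel"
          using us test_fun_borel[OF fb] by measurable
        have "\<bar>u s y \<bullet> b\<bar> \<le> Mu s" for y
          using Basis_le_norm[OF b, of "u s y"] u_bound[OF s, of y] by linarith
        then show "AE y in lborel. norm ((u s y \<bullet> b) *\<^sub>R dderiv f b y) \<le> norm (Mu s * dderiv f b y)"
          using Mu_nonneg[OF s] by (intro AE_I2) (auto simp: abs_mult intro!: mult_right_mono)
      qed
    qed
    moreover have "(\<lambda>y. \<Sum>b\<in>Basis. (u s y \<bullet> b) *\<^sub>R dderiv f b y) = (\<lambda>y. dderiv f (u s y) y)"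
      by (rule ext) (rule dderiv_basis_sum[OF smooth_differentiable[OF test_fun_smooth[OF f]], symmetric])
    ultimately show ?thesis by simp
  qed
  have tp: "test_fun \<Omega> (\<lambda>y. \<psi> y * renorm (m y))" by (rule test_fun_mult[OF \<psi> sr])
  have mm: "(\<lambda>y. renorm (m y)) \<in> borel_measurable borel" by (rule smooth_borel[OF sr])
  show i2: "integrable lborel (\<lambda>y. renorm (m y) * dderiv \<psi> (u s y) y)"
  proof (rule Bochner_Integration.integrable_bound[OF int[OF \<psi>]])
    show "(\<lambda>y. renorm (m y) * dderiv \<psi> (u s y) y) \<in> borel_measurable lborel"
      using mm meas[OF s\<psi>] by (intro borel_measurable_times) auto
    show "AE y in lborel. norm (renorm (m y) * dderiv \<psi> (u s y) y) \<le> norm (dderiv \<psi> (u s y) y)"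
      by (rule AE_I2) (simp add: abs_mult mult_left_le_one_le renorm_bounds)
  qed
  have i0: "integrable lborel (\<lambda>y. \<psi> y * (renorm' (m y) * dderiv m (u s y) y) + renorm (m y) * dderiv \<psi> (u s y) y)"
    using int[OF tp] by (simp add: prod)
  show i1: "integrable lborel (\<lambda>y. \<psi> y * (renorm' (m y) * dderiv m (u s y) y))"
    using Bochner_Integration.integrable_diff[OF i0 i2] by simp
  have "(\<integral>y. \<psi> y * (renorm' (m y) * dderiv m (u s y) y) + renorm (m y) * dderiv \<psi> (u s y) y \<partial>lborel) = 0"
    using div_free[OF s tp] by (simp add: prod)
  then show "(\<integral>y. \<psi> y * (renorm' (m y) * dderiv m (u s y) y) \<partial>lborel) = - (\<integral>y. renorm (m y) * dderiv \<psi> (u s y) y \<partial>lborel)"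
    using i1 i2 by simp
qed

definition transp :: "('a \<Rightarrow> real) \<Rightarrow> (real \<Rightarrow> 'a \<Rightarrow> real) \<Rightarrow> real \<Rightarrow> real" where
  "transp \<psi> m s = (\<integral>y. renorm (m s y) * dderiv \<psi> (u s y) y \<partial>lborel)"

text \<open>\<open>flux_decomposition\<close> splits off the transport of the mollified density,
  which \<open>div_free_renorm\<close> turns into \<open>transp\<close> with the opposite sign. The
  remainder is controlled by the bound of \<open>\<psi>\<close>, |renorm'| \<le> 1 and the mollifier
  constant, so \<open>C\<close> depends on neither \<epsilon> nor the time.\<close>

lemma flux_defect_bound:
  assumes \<psi>: "test_fun \<Omega> (\<psi>::'a \<Rightarrow> real)"
  obtains C where "C \<ge> 0" "\<And>\<epsilon> s. \<epsilon> > 0 \<Longrightarrow> (\<And>y. \<psi> y \<noteq> 0 \<Longrightarrow> cball y \<epsilon> \<subseteq> \<Omega>) \<Longrightarrow> s \<in> {0<..<T} \<Longrightarrow>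
     ennreal \<bar>(\<integral>y. \<psi> y * (renorm' (mollify \<epsilon> (\<rho> s) y) * flux \<epsilon> s y) \<partial>lborel) + transp \<psi> (\<lambda>s. mollify \<epsilon> (\<rho> s)) s\<bar>
     \<le> ennreal C * defect \<epsilon> s"
proof -
  obtain B where B: "B > 0" "\<And>y. norm (\<psi> y) \<le> B" using test_fun_bounded[OF \<psi>] by blast
  obtain C where C: "C > 0" "\<And>\<epsilon> v z. \<epsilon> > 0 \<Longrightarrow> \<bar>dderiv (moll \<epsilon>) v (z::'a)\<bar> \<le> C / \<epsilon> ^ (DIM('a) + 1) * norm v * indicator (cball 0 \<epsilon>) z"
    using moll_dderiv_bound[where 'a='a] by blast
  have "ennreal \<bar>(\<integral>y. \<psi> y * (renorm' (mollify \<epsilon> (\<rho> s) y) * flux \<epsilon> s y) \<partial>lborel) + transp \<psi> (\<lambda>s. mollify \<epsilon> (\<rho> s)) s\<bar>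
     \<le> ennreal (B * C) * defect \<epsilon> s"
    if e: "\<epsilon> > 0" and K: "\<And>y. \<psi> y \<noteq> 0 \<Longrightarrow> cball y \<epsilon> \<subseteq> \<Omega>" and s: "s \<in> {0<..<T}" for \<epsilon> s
  proof -
    define m where "m = mollify \<epsilon> (\<rho> s)"
    define r where "r y = (\<integral>x. (\<rho> s x - \<rho> s y) * dderiv (moll \<epsilon>) (u s x - u s y) (y - x) \<partial>lborel)" for y
    define k where "k y x = \<bar>\<rho> s x - \<rho> s y\<bar> * norm (u s x - u s y) * (indicator (cball 0 \<epsilon>) (y - x) / \<epsilon> ^ (DIM('a) + 1))" for x y
    have sm: "smooth m" unfolding m_def by (rule smooth_mollify[OF \<rho>_integrable[OF s] e])
    have [measurable]: "\<rho> s \<in> borel_measurable borel" "u s \<in> borel_measurable borel"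
      using \<rho>_sec[OF s] u_sec[OF s] by auto
    have k[measurable]: "(\<lambda>(y, x). k y x) \<in> borel_measurable (lborel \<Otimes>\<^sub>M lborel)" unfolding k_def by measurable
    have rk: "ennreal \<bar>r y\<bar> \<le> ennreal C * (\<integral>\<^sup>+x. ennreal (k y x) \<partial>lborel)" for y
    proof (cases "integrable lborel (\<lambda>x. (\<rho> s x - \<rho> s y) * dderiv (moll \<epsilon>) (u s x - u s y) (y - x))")
      case True
      have "ennreal (norm (r y)) \<le> (\<integral>\<^sup>+x. ennreal (norm ((\<rho> s x - \<rho> s y) * dderiv (moll \<epsilon>) (u s x - u s y) (y - x))) \<partial>lborel)"
        unfolding r_def by (rule integral_norm_bound_ennreal[OF True])
      also have "\<dots> \<le> (\<integral>\<^sup>+x. ennreal C * ennreal (k y x) \<partial>lborel)"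
      proof (rule nn_integral_mono)
        fix x
        have "norm ((\<rho> s x - \<rho> s y) * dderiv (moll \<epsilon>) (u s x - u s y) (y - x))
          \<le> \<bar>\<rho> s x - \<rho> s y\<bar> * (C / \<epsilon> ^ (DIM('a) + 1) * norm (u s x - u s y) * indicator (cball 0 \<epsilon>) (y - x))"
          unfolding real_norm_def abs_mult by (intro mult_left_mono C(2)[OF e]) auto
        also have "\<dots> = C * k y x" by (simp add: k_def)
        finally have "ennreal (norm ((\<rho> s x - \<rho> s y) * dderiv (moll \<epsilon>) (u s x - u s y) (y - x))) \<le> ennreal (C * k y x)"
          by (rule ennreal_leI)
        also have "\<dots> = ennreal C * ennreal (k y x)" using C(1) e by (intro ennreal_mult) (auto simp: k_def)
        finally show "ennreal (norm ((\<rho> s x - \<rho> s y) * dderiv (moll \<epsilon>) (u s x - u s y) (y - x))) \<le> ennreal C * ennreal (k y x)" .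
      qed
      also have "\<dots> = ennreal C * (\<integral>\<^sup>+x. ennreal (k y x) \<partial>lborel)" by (rule nn_integral_cmult) measurable
      finally show ?thesis by simp
    next
      \<comment> \<open>The Bochner integral of a non-integrable function is 0 by convention, so the
        bound is trivial here.\<close>
      case False
      then show ?thesis by (simp add: r_def not_integrable_integral_eq)
    qed
    have r_meas: "r \<in> borel_measurable lborel"
    proof -
      have "(\<lambda>(y, x). dderiv (moll \<epsilon>) (u s x - u s y) (y - x)) \<in> borel_measurable (lborel \<Otimes>\<^sub>M lborel)"
        unfolding split_beta' by (rule dderiv_measurable[OF test_fun_smooth[OF test_fun_moll[OF e]]]) measurable
      then have "(\<lambda>(y, x). (\<rho> s x - \<rho> s y) * dderiv (moll \<epsilon>) (u s x - u s y) (y - x)) \<in> borel_measurable (lborel \<Otimes>\<^sub>M lborel)"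
        unfolding split_beta' by (rule borel_measurable_times[rotated]) measurable
      then show ?thesis unfolding r_def[abs_def] by (rule lborel.borel_measurable_lebesgue_integral)
    qed
    define R where "R y = \<psi> y * (renorm' (m y) * r y)" for y
    have eq: "\<psi> y * (renorm' (m y) * flux \<epsilon> s y) = \<psi> y * (renorm' (m y) * dderiv m (u s y) y) + R y" for y
    proof (cases "\<psi> y = 0")
      case False
      show ?thesis using flux_decomposition[OF e s K[OF False]] by (simp add: R_def m_def r_def algebra_simps)
    qed (simp add: R_def)
    have Rb: "(\<integral>\<^sup>+y. ennreal (norm (R y)) \<partial>lborel) \<le> ennreal (B * C) * defect \<epsilon> s"
    proof -
      have "(\<integral>\<^sup>+y. ennreal (norm (R y)) \<partial>lborel) \<le> (\<integral>\<^sup>+y. ennreal (B * C) * (\<integral>\<^sup>+x. ennreal (k y x) \<partial>lborel) \<partial>lborel)"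
      proof (rule nn_integral_mono)
        fix y
        have "\<bar>renorm' (m y)\<bar> * \<bar>r y\<bar> \<le> 1 * \<bar>r y\<bar>" by (intro mult_right_mono renorm'_bound) auto
        then have "norm (R y) \<le> B * \<bar>r y\<bar>"
          unfolding R_def real_norm_def abs_mult using B by (intro mult_mono) (auto simp: real_norm_def[symmetric] simp del: real_norm_def)
        then have "ennreal (norm (R y)) \<le> ennreal B * ennreal \<bar>r y\<bar>"
          using B(1) by (simp add: ennreal_mult[symmetric] ennreal_leI)
        also have "\<dots> \<le> ennreal B * (ennreal C * (\<integral>\<^sup>+x. ennreal (k y x) \<partial>lborel))" by (intro mult_left_mono rk) simp
        finally show "ennreal (norm (R y)) \<le> ennreal (B * C) * (\<integral>\<^sup>+x. ennreal (k y x) \<partial>lborel)"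
          using B(1) C(1) by (simp add: ennreal_mult mult.assoc)
      qed
      also have "\<dots> = ennreal (B * C) * defect \<epsilon> s"
        unfolding defect_def k_def[symmetric] by (rule nn_integral_cmult) measurable
      finally show ?thesis .
    qed
    show ?thesis
    proof (cases "defect \<epsilon> s = \<infinity>")
      case True
      then show ?thesis using B(1) C(1) by (simp add: ennreal_mult_eq_top_iff ennreal_top_mult ennreal_mult_top)
    next
      case False
      have [measurable]: "\<psi> \<in> borel_measurable borel" "m \<in> borel_measurable borel" "r \<in> borel_measurable borel"
        using test_fun_borel[OF \<psi>] smooth_borel[OF sm] r_meas by auto
      have "(\<integral>\<^sup>+y. ennreal (norm (R y)) \<partial>lborel) < \<infinity>"
      proof (rule order_le_less_trans[OF Rb])
        have "defect \<epsilon> s < top" using False by (simp add: less_top)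
        then show "ennreal (B * C) * defect \<epsilon> s < \<infinity>" by (simp add: ennreal_mult_less_top)
      qed
      then have Ri: "integrable lborel R"
        by (intro integrableI_bounded) (auto simp: R_def[abs_def])
      note dr = div_free_renorm[OF s sm \<psi>]
      have "(\<integral>y. \<psi> y * (renorm' (m y) * flux \<epsilon> s y) \<partial>lborel) + transp \<psi> (\<lambda>s. mollify \<epsilon> (\<rho> s)) s = (\<integral>y. R y \<partial>lborel)"
        unfolding eq using dr Ri by (simp add: transp_def m_def)
      then have "ennreal \<bar>(\<integral>y. \<psi> y * (renorm' (m y) * flux \<epsilon> s y) \<partial>lborel) + transp \<psi> (\<lambda>s. mollify \<epsilon> (\<rho> s)) s\<bar>
        \<le> (\<integral>\<^sup>+y. ennreal (norm (R y)) \<partial>lborel)"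
        using integral_norm_bound_ennreal[OF Ri] by simp
      then show ?thesis using Rb unfolding m_def by (rule order_trans)
    qed
  qed
  then show ?thesis using that[of "B * C"] B(1) C(1) by simp
qed

end

context transport begin

section \<open>Passage to the limit in the mollified equation\<close>

lemma test_fun_support_margin:
  assumes "test_fun \<Omega> (\<psi>::'a \<Rightarrow> real)"
  obtains d where "d > 0" "\<And>\<epsilon> y. \<epsilon> < d \<Longrightarrow> \<psi> y \<noteq> 0 \<Longrightarrow> cball y \<epsilon> \<subseteq> \<Omega>"
proof -
  obtain K where K: "compact K" "K \<subseteq> \<Omega>" "\<And>x. x \<notin> K \<Longrightarrow> \<psi> x = 0" using test_funE[OF assms] by blast
  have "K \<inter> - \<Omega> = {}" using K(2) by auto
  then obtain d where d: "d > 0" "\<forall>x\<in>K. \<forall>y\<in>-\<Omega>. d \<le> dist x y"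
    using separate_compact_closed[OF K(1) closed_Compl[OF open_\<Omega>]] by blast
  show thesis
  proof (rule that[OF d(1)])
    fix \<epsilon> y assume e: "\<epsilon> < d" and y: "\<psi> y \<noteq> 0"
    have "y \<in> K" using K(3) y by blast
    show "cball y \<epsilon> \<subseteq> \<Omega>"
    proof
      fix x assume "x \<in> cball y \<epsilon>"
      then have "dist y x < d" using e by simp
      then show "x \<in> \<Omega>" using d(2) \<open>y \<in> K\<close> by (metis ComplI not_le)
    qed
  qed
qed

lemma dderiv_u_bound:
  assumes \<psi>: "test_fun \<Omega> (\<psi>::'a \<Rightarrow> real)"
  obtains W where "W \<ge> 0" "\<And>s. s \<in> {0<..<T} \<Longrightarrow> integrable lborel (\<lambda>y. dderiv \<psi> (u s y) y)"
    "\<And>s. s \<in> {0<..<T} \<Longrightarrow> (\<integral>y. \<bar>dderiv \<psi> (u s y) y\<bar> \<partial>lborel) \<le> W * Mu s"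
    "\<And>s y. s \<in> {0<..<T} \<Longrightarrow> \<bar>dderiv \<psi> (u s y) y\<bar> \<le> W * Mu s"
proof -
  obtain K where K: "compact K" "K \<subseteq> \<Omega>" "\<And>x. x \<notin> K \<Longrightarrow> \<psi> x = 0" using test_funE[OF \<psi>] by blast
  obtain B where B: "B > 0" "\<And>x v. norm (dderiv \<psi> v x) \<le> B * norm v"
    using test_fun_dderiv_bounded[OF \<psi>] by blast
  have Kfin: "emeasure lborel K < \<infinity>" by (rule emeasure_compact_finite[OF K(1)])
  have Ks: "K \<in> sets lborel" using K(1) by (simp add: compact_imp_closed)
  have le: "\<bar>dderiv \<psi> (u s y) y\<bar> \<le> indicator K y * (B * Mu s)" if s: "s \<in> {0<..<T}" for s y
  proof (cases "y \<in> K")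
    case True
    have "norm (dderiv \<psi> (u s y) y) \<le> B * Mu s"
      using B(2)[of y "u s y"] mult_left_mono[OF u_bound[OF s, of y], of B] B(1) by linarith
    then show ?thesis using True by simp
  next
    case False
    then show ?thesis using dderiv_zero_outside[OF compact_imp_closed[OF K(1)] K(3) False] by simp
  qed
  have ib: "integrable lborel (\<lambda>y. indicator K y * (B * Mu s))" for s
    by (intro integrable_mult_left integrable_real_indicator Ks Kfin)
  have i: "integrable lborel (\<lambda>y. dderiv \<psi> (u s y) y)" if s: "s \<in> {0<..<T}" for s
  proof (rule Bochner_Integration.integrable_bound[OF ib])
    show "(\<lambda>y. dderiv \<psi> (u s y) y) \<in> borel_measurable lborel"
      using dderiv_measurable[OF test_fun_smooth[OF \<psi>] u_sec[OF s] measurable_ident] by (simp add: id_def)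
    show "AE y in lborel. norm (dderiv \<psi> (u s y) y) \<le> norm (indicator K y * (B * Mu s))"
      using le[OF s] by (intro AE_I2) (simp add: order_trans[OF _ abs_ge_self])
  qed
  \<comment> \<open>The summand 1 makes \<open>W\<close> at least \<open>B\<close>, so one constant
    serves for the integral and for the pointwise bound.\<close>
  define W where "W = B * (measure lborel K + 1)"
  show thesis
  proof (rule that[of W])
    show "W \<ge> 0" using B(1) by (simp add: W_def)
    fix s assume s: "s \<in> {0<..<T}"
    show "integrable lborel (\<lambda>y. dderiv \<psi> (u s y) y)" by (rule i[OF s])
    have "(\<integral>y. \<bar>dderiv \<psi> (u s y) y\<bar> \<partial>lborel) \<le> (\<integral>y. indicator K y * (B * Mu s) \<partial>lborel)"
      by (rule integral_mono[OF integrable_abs[OF i[OF s]] ib le[OF s]])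
    also have "\<dots> = measure lborel K * (B * Mu s)" using Ks Kfin by simp
    also have "\<dots> \<le> W * Mu s" using B(1) Mu_nonneg[OF s] by (simp add: W_def algebra_simps)
    finally show "(\<integral>y. \<bar>dderiv \<psi> (u s y) y\<bar> \<partial>lborel) \<le> W * Mu s" .
    have "indicator K y * (B * Mu s) \<le> 1 * (B * Mu s)" for y
      using B(1) Mu_nonneg[OF s] by (intro mult_right_mono) (auto simp: indicator_def)
    moreover have "B * Mu s \<le> W * Mu s"
      using B(1) Mu_nonneg[OF s] by (intro mult_right_mono) (auto simp: W_def algebra_simps)
    ultimately show "\<bar>dderiv \<psi> (u s y) y\<bar> \<le> W * Mu s" for y
      using le[OF s, of y] by (smt (verit))
  qed
qed

lemma transp_measurable:
  assumes \<psi>: "test_fun \<Omega> (\<psi>::'a \<Rightarrow> real)" and m: "(\<lambda>z. m (fst z) (snd z)) \<in> borel_measurable (M \<Otimes>\<^sub>M lborel)"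
  shows "transp \<psi> m \<in> borel_measurable M"
proof -
  note [measurable] = m
  have "(\<lambda>(s, y). dderiv \<psi> (u s y) y) \<in> borel_measurable (M \<Otimes>\<^sub>M lborel)"
    unfolding split_beta' by (rule dderiv_measurable[OF test_fun_smooth[OF \<psi>]]) measurable
  then have "(\<lambda>(s, y). renorm (m s y) * dderiv \<psi> (u s y) y) \<in> borel_measurable (M \<Otimes>\<^sub>M lborel)"
    unfolding split_beta' by (rule borel_measurable_times[rotated]) measurable
  then show ?thesis unfolding transp_def[abs_def] by (rule lborel.borel_measurable_lebesgue_integral)
qed

lemma transp_integrand:
  assumes \<psi>: "test_fun \<Omega> (\<psi>::'a \<Rightarrow> real)" and s: "s \<in> {0<..<T}" and m: "m s \<in> borel_measurable borel"
    and i: "integrable lborel (\<lambda>y. dderiv \<psi> (u s y) y)"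
  shows "integrable lborel (\<lambda>y. renorm (m s y) * dderiv \<psi> (u s y) y)"
    "\<bar>transp \<psi> m s\<bar> \<le> (\<integral>y. \<bar>dderiv \<psi> (u s y) y\<bar> \<partial>lborel)"
proof -
  have le: "norm (renorm (m s y) * dderiv \<psi> (u s y) y) \<le> \<bar>dderiv \<psi> (u s y) y\<bar>" for y
    by (simp add: abs_mult mult_left_le_one_le renorm_bounds)
  show ii: "integrable lborel (\<lambda>y. renorm (m s y) * dderiv \<psi> (u s y) y)"
  proof (rule Bochner_Integration.integrable_bound[OF i])
    have "(\<lambda>y. renorm (m s y)) \<in> borel_measurable lborel" using m by simp
    then show "(\<lambda>y. renorm (m s y) * dderiv \<psi> (u s y) y) \<in> borel_measurable lborel"
      by (rule borel_measurable_times[OF _ borel_measurable_integrable[OF i]])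
  qed (use le in auto)
  have "norm (transp \<psi> m s) \<le> (\<integral>y. norm (renorm (m s y) * dderiv \<psi> (u s y) y) \<partial>lborel)"
    unfolding transp_def by (rule integral_norm_bound)
  also have "\<dots> \<le> (\<integral>y. \<bar>dderiv \<psi> (u s y) y\<bar> \<partial>lborel)"
    by (rule integral_mono[OF integrable_norm[OF ii] integrable_abs[OF i] le])
  finally show "\<bar>transp \<psi> m s\<bar> \<le> (\<integral>y. \<bar>dderiv \<psi> (u s y) y\<bar> \<partial>lborel)" by simp
qed

lemma defect_measurable: "defect \<epsilon> \<in> borel_measurable M"
  unfolding defect_def[abs_def] by measurable

abbreviation eps :: "nat \<Rightarrow> real" where "eps n \<equiv> 1 / (real n + 1)"

lemma eps_pos: "eps n > 0" by simp

lemma eps_lim: "eps \<longlonglongrightarrow> 0"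
  using LIMSEQ_inverse_real_of_nat by (simp add: inverse_eq_divide add.commute)

lemma mollify_\<rho>_lim:
  assumes "s \<in> {0<..<T}"
  shows "(\<lambda>n. \<integral>x. \<bar>mollify (eps n) (\<rho> s) x - \<rho> s x\<bar> \<partial>lborel) \<longlonglongrightarrow> 0"
    "\<forall>\<^sub>F n in sequentially. integrable lborel (\<lambda>x. mollify (eps n) (\<rho> s) x - \<rho> s x)"
proof -
  note int = \<rho>_integrable[OF assms]
  have fin: "integrable lborel (\<lambda>x. mollify \<epsilon> (\<rho> s) x - \<rho> s x)"
    if "\<epsilon> > 0" "(\<integral>\<^sup>+y. ennreal \<bar>mollify \<epsilon> (\<rho> s) y - \<rho> s y\<bar> \<partial>lborel) \<le> ennreal e" for \<epsilon> e
  proof (rule integrableI_bounded)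
    have "mollify \<epsilon> (\<rho> s) \<in> borel_measurable borel" by (rule smooth_borel[OF smooth_mollify[OF int that(1)]])
    then show "(\<lambda>x. mollify \<epsilon> (\<rho> s) x - \<rho> s x) \<in> borel_measurable lborel" using int by simp
    show "(\<integral>\<^sup>+x. ennreal (norm (mollify \<epsilon> (\<rho> s) x - \<rho> s x)) \<partial>lborel) < \<infinity>"
      using that(2) by (simp add: le_less_trans[OF _ ennreal_less_top])
  qed
  have ev: "\<forall>\<^sub>F n in sequentially. (\<integral>\<^sup>+y. ennreal \<bar>mollify (eps n) (\<rho> s) y - \<rho> s y\<bar> \<partial>lborel) \<le> ennreal e"
    if e: "e > 0" for e
  proof -
    obtain d where d: "d > 0" "\<forall>\<epsilon>. 0 < \<epsilon> \<longrightarrow> \<epsilon> < d \<longrightarrow> (\<integral>\<^sup>+y. ennreal \<bar>mollify \<epsilon> (\<rho> s) y - \<rho> s y\<bar> \<partial>lborel) \<le> ennreal e"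
      using mollify_L1[OF int e] by blast
    show ?thesis using order_tendstoD(2)[OF eps_lim d(1)]
      by eventually_elim (use d(2) eps_pos in blast)
  qed
  show "\<forall>\<^sub>F n in sequentially. integrable lborel (\<lambda>x. mollify (eps n) (\<rho> s) x - \<rho> s x)"
    using ev[OF zero_less_one] by eventually_elim (rule fin[OF eps_pos])
  show "(\<lambda>n. \<integral>x. \<bar>mollify (eps n) (\<rho> s) x - \<rho> s x\<bar> \<partial>lborel) \<longlonglongrightarrow> 0"
  proof (rule LIMSEQ_I)
    fix r :: real assume r: "r > 0"
    have "\<forall>\<^sub>F n in sequentially. norm ((\<integral>x. \<bar>mollify (eps n) (\<rho> s) x - \<rho> s x\<bar> \<partial>lborel) - 0) < r"
      using ev[OF half_gt_zero[OF r]]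
    proof eventually_elim
      fix n assume le: "(\<integral>\<^sup>+y. ennreal \<bar>mollify (eps n) (\<rho> s) y - \<rho> s y\<bar> \<partial>lborel) \<le> ennreal (r / 2)"
      have i: "integrable lborel (\<lambda>x. \<bar>mollify (eps n) (\<rho> s) x - \<rho> s x\<bar>)"
        using fin[OF eps_pos le] by (rule integrable_abs)
      have "ennreal (\<integral>x. \<bar>mollify (eps n) (\<rho> s) x - \<rho> s x\<bar> \<partial>lborel) \<le> ennreal (r/2)"
        using le by (subst nn_integral_eq_integral[symmetric, OF i]) auto
      then have "(\<integral>x. \<bar>mollify (eps n) (\<rho> s) x - \<rho> s x\<bar> \<partial>lborel) \<le> r/2" using r by simp
      then show "norm ((\<integral>x. \<bar>mollify (eps n) (\<rho> s) x - \<rho> s x\<bar> \<partial>lborel) - 0) < r" using r by simp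
    qed
    then show "\<exists>no. \<forall>n\<ge>no. norm ((\<integral>x. \<bar>mollify (eps n) (\<rho> s) x - \<rho> s x\<bar> \<partial>lborel) - 0) < r"
      by (simp add: eventually_sequentially)
  qed
qed

text \<open>\<open>renorm\<close> is 1-Lipschitz and \<open>g\<close> is bounded, so L1 convergence
  of the mollified density is enough.\<close>

lemma mollify_renorm_lim:
  assumes s: "s \<in> {0<..<T}" and g: "g \<in> borel_measurable borel" "\<And>y. \<bar>g y\<bar> \<le> W" and gi: "integrable lborel g"
  shows "(\<lambda>n. \<integral>y. renorm (mollify (eps n) (\<rho> s) y) * g y \<partial>lborel) \<longlonglongrightarrow> (\<integral>y. renorm (\<rho> s y) * g y \<partial>lborel)"
proof -
  have W: "W \<ge> 0" using g(2)[of undefined] by linarith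
  have i: "integrable lborel (\<lambda>y. renorm (w y) * g y)" if "w \<in> borel_measurable borel" for w
  proof (rule Bochner_Integration.integrable_bound[OF gi])
    show "(\<lambda>y. renorm (w y) * g y) \<in> borel_measurable lborel" using that g(1) by measurable
    show "AE y in lborel. norm (renorm (w y) * g y) \<le> norm (g y)"
      by (rule AE_I2) (simp add: abs_mult mult_left_le_one_le renorm_bounds)
  qed
  note i\<rho> = i[OF \<rho>_sec[OF s]]
  have im: "integrable lborel (\<lambda>y. renorm (mollify (eps n) (\<rho> s) y) * g y)" for n
    by (rule i[OF smooth_borel[OF smooth_mollify[OF \<rho>_integrable[OF s] eps_pos]]])
  have ev: "\<forall>\<^sub>F n in sequentially. norm ((\<integral>y. renorm (mollify (eps n) (\<rho> s) y) * g y \<partial>lborel) - (\<integral>y. renorm (\<rho> s y) * g y \<partial>lborel))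
      \<le> W * (\<integral>x. \<bar>mollify (eps n) (\<rho> s) x - \<rho> s x\<bar> \<partial>lborel)"
    using mollify_\<rho>_lim(2)[OF s]
  proof eventually_elim
    fix n assume id: "integrable lborel (\<lambda>x. mollify (eps n) (\<rho> s) x - \<rho> s x)"
    have "(\<integral>y. renorm (mollify (eps n) (\<rho> s) y) * g y \<partial>lborel) - (\<integral>y. renorm (\<rho> s y) * g y \<partial>lborel)
       = (\<integral>y. renorm (mollify (eps n) (\<rho> s) y) * g y - renorm (\<rho> s y) * g y \<partial>lborel)"
      by (rule Bochner_Integration.integral_diff[symmetric, OF im i\<rho>])
    also have "norm \<dots> \<le> (\<integral>y. norm (renorm (mollify (eps n) (\<rho> s) y) * g y - renorm (\<rho> s y) * g y) \<partial>lborel)"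
      by (rule integral_norm_bound)
    also have "\<dots> \<le> (\<integral>y. W * \<bar>mollify (eps n) (\<rho> s) y - \<rho> s y\<bar> \<partial>lborel)"
    proof (rule integral_mono)
      show "integrable lborel (\<lambda>y. norm (renorm (mollify (eps n) (\<rho> s) y) * g y - renorm (\<rho> s y) * g y))"
        by (intro integrable_norm Bochner_Integration.integrable_diff im i\<rho>)
      show "integrable lborel (\<lambda>y. W * \<bar>mollify (eps n) (\<rho> s) y - \<rho> s y\<bar>)"
        by (intro integrable_mult_right integrable_abs id)
      fix y
      have "norm (renorm (mollify (eps n) (\<rho> s) y) * g y - renorm (\<rho> s y) * g y)
         = \<bar>renorm (mollify (eps n) (\<rho> s) y) - renorm (\<rho> s y)\<bar> * \<bar>g y\<bar>"
        by (simp add: left_diff_distrib[symmetric] abs_mult)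
      also have "\<dots> \<le> \<bar>mollify (eps n) (\<rho> s) y - \<rho> s y\<bar> * W"
        by (intro mult_mono renorm_lipschitz g(2)) auto
      finally show "norm (renorm (mollify (eps n) (\<rho> s) y) * g y - renorm (\<rho> s y) * g y) \<le> W * \<bar>mollify (eps n) (\<rho> s) y - \<rho> s y\<bar>"
        by (simp add: mult.commute)
    qed
    finally show "norm ((\<integral>y. renorm (mollify (eps n) (\<rho> s) y) * g y \<partial>lborel) - (\<integral>y. renorm (\<rho> s y) * g y \<partial>lborel))
      \<le> W * (\<integral>x. \<bar>mollify (eps n) (\<rho> s) x - \<rho> s x\<bar> \<partial>lborel)" by simp
  qed
  have "(\<lambda>n. W * (\<integral>x. \<bar>mollify (eps n) (\<rho> s) x - \<rho> s x\<bar> \<partial>lborel)) \<longlonglongrightarrow> 0"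
    using tendsto_mult_right_zero[OF mollify_\<rho>_lim(1)[OF s]] .
  from Lim_null_comparison[OF ev this] show ?thesis by (simp add: LIM_zero_iff)
qed

lemma prim_lim:
  assumes m: "\<And>n. f n \<in> borel_measurable M" "g \<in> borel_measurable M"
    and lim: "\<And>s. s \<in> {0<..<T} \<Longrightarrow> (\<lambda>n. f n s) \<longlonglongrightarrow> g s"
    and b: "\<And>n s. s \<in> {0<..<T} \<Longrightarrow> \<bar>f n s\<bar> \<le> W * Mu s"
  shows "(\<lambda>n. prim (f n) t) \<longlonglongrightarrow> prim g t"
  unfolding prim_def
proof (rule integral_dominated_convergence[where w="\<lambda>s. W * Mu s"])
  have ind: "(\<lambda>s. indicator {..t} s :: real) \<in> borel_measurable M" by (rule sets_M_borel) simp
  show "(\<lambda>s. indicator {..t} s * g s) \<in> borel_measurable M" by (rule borel_measurable_times[OF ind m(2)])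
  show "(\<lambda>s. indicator {..t} s * f n s) \<in> borel_measurable M" for n by (rule borel_measurable_times[OF ind m(1)])
  show "integrable M (\<lambda>s. W * Mu s)" by (rule integrable_mult_right[OF Mu_integrable])
  show "AE s in M. (\<lambda>n. indicator {..t} s * f n s) \<longlonglongrightarrow> indicator {..t} s * g s"
    by (rule AE_I2) (intro tendsto_mult tendsto_const lim; simp)
  have "norm (indicator {..t} s * f n s) \<le> W * Mu s" if s: "s \<in> {0<..<T}" for s n
    using b[OF s, of n] order_trans[OF abs_ge_zero b[OF s, of n]] by (auto simp: indicator_def)
  then show "AE s in M. norm (indicator {..t} s * f n s) \<le> W * Mu s" for n by (intro AE_I2) auto
qed

end

locale transport_vanishing_defect = transport +
  fixes D :: "real \<Rightarrow> ennreal"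
  assumes defect_lim: "\<And>s. s \<in> {0<..<T} \<Longrightarrow> (\<lambda>n. defect (1 / (real n + 1)) s) \<longlonglongrightarrow> 0"
    and defect_bound: "\<And>n s. s \<in> {0<..<T} \<Longrightarrow> defect (1 / (real n + 1)) s \<le> D s"
    and D_measurable: "D \<in> borel_measurable M" and D_finite: "(\<integral>\<^sup>+s. D s \<partial>M) < \<infinity>"
begin

lemma nn_integral_defect_lim: "(\<lambda>n. \<integral>\<^sup>+s. defect (eps n) s \<partial>M) \<longlonglongrightarrow> 0"
proof -
  have "(\<lambda>n. \<integral>\<^sup>+s. defect (eps n) s \<partial>M) \<longlonglongrightarrow> (\<integral>\<^sup>+s. 0 \<partial>M)"
  proof (rule nn_integral_dominated_convergence[where w=D])
    show "AE s in M. defect (eps n) s \<le> D s" for n by (rule AE_I2) (simp add: defect_bound)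
    show "AE s in M. (\<lambda>n. defect (eps n) s) \<longlonglongrightarrow> 0" by (rule AE_I2) (simp add: defect_lim)
  qed (use D_measurable D_finite defect_measurable in auto)
  then show ?thesis by simp
qed

text \<open>Integrated over time, the error is at most a constant times the integral of the defect,
  which tends to 0. There is no initial term because \<open>renorm 0 = 0\<close>. The exceptional
  times of countably many n form a single null set.\<close>

lemma renormalised_equation:
  assumes \<psi>: "test_fun \<Omega> (\<psi>::'a \<Rightarrow> real)"
  shows "AE t in M. (\<integral>y. \<psi> y * renorm (\<rho> t y) \<partial>lborel) = - prim (transp \<psi> \<rho>) t"
proof -
  obtain d where d: "d > 0" "\<And>\<epsilon> y. \<epsilon> < d \<Longrightarrow> \<psi> y \<noteq> 0 \<Longrightarrow> cball y \<epsilon> \<subseteq> \<Omega>"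
    using test_fun_support_margin[OF \<psi>] by blast
  obtain C where C: "C \<ge> 0" "\<And>\<epsilon> s. \<epsilon> > 0 \<Longrightarrow> (\<And>y. \<psi> y \<noteq> 0 \<Longrightarrow> cball y \<epsilon> \<subseteq> \<Omega>) \<Longrightarrow> s \<in> {0<..<T} \<Longrightarrow>
     ennreal \<bar>(\<integral>y. \<psi> y * (renorm' (mollify \<epsilon> (\<rho> s) y) * flux \<epsilon> s y) \<partial>lborel) + transp \<psi> (\<lambda>s. mollify \<epsilon> (\<rho> s)) s\<bar>
     \<le> ennreal C * defect \<epsilon> s"
    by (rule flux_defect_bound[OF \<psi>]) blast
  obtain W where W: "W \<ge> 0" "\<And>s. s \<in> {0<..<T} \<Longrightarrow> integrable lborel (\<lambda>y. dderiv \<psi> (u s y) y)"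
    "\<And>s. s \<in> {0<..<T} \<Longrightarrow> (\<integral>y. \<bar>dderiv \<psi> (u s y) y\<bar> \<partial>lborel) \<le> W * Mu s"
    "\<And>s y. s \<in> {0<..<T} \<Longrightarrow> \<bar>dderiv \<psi> (u s y) y\<bar> \<le> W * Mu s"
    by (rule dderiv_u_bound[OF \<psi>]) blast
  define I where "I n s = (\<integral>y. \<psi> y * (renorm' (mollify (eps n) (\<rho> s) y) * flux (eps n) s y) \<partial>lborel)" for n s
  define A where "A n = transp \<psi> (\<lambda>s. mollify (eps n) (\<rho> s))" for n
  define L where "L n t = (\<integral>y. \<psi> y * renorm (mollify (eps n) (\<rho> t) y) \<partial>lborel)" for n t
  \<comment> \<open>For smaller n the balls of radius \<open>eps n\<close> around the support of
    \<open>\<psi>\<close> might leave \<open>\<Omega>\<close>.\<close>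
  obtain N where N: "\<And>n. n \<ge> N \<Longrightarrow> eps n < d"
    using order_tendstoD(2)[OF eps_lim d(1)] unfolding eventually_sequentially by blast
  have A_meas: "A n \<in> borel_measurable M" for n
    unfolding A_def by (rule transp_measurable[OF \<psi> mollify_measurable[OF eps_pos]])
  have A_meas': "transp \<psi> \<rho> \<in> borel_measurable M" by (rule transp_measurable[OF \<psi> \<rho>_measurable])
  have msec: "mollify (eps n) (\<rho> s) \<in> borel_measurable borel" if "s \<in> {0<..<T}" for n s
    by (rule smooth_borel[OF smooth_mollify[OF \<rho>_integrable[OF that] eps_pos]])
  have A_bound: "\<bar>A n s\<bar> \<le> W * Mu s" if s: "s \<in> {0<..<T}" for n s
    unfolding A_def
    by (rule order_trans[OF transp_integrand(2)[where m="\<lambda>s. mollify (eps n) (\<rho> s)", OF \<psi> s msec[OF s] W(2)[OF s]] W(3)[OF s]])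
  have A_int: "integrable M (A n)" for n
    by (rule Bochner_Integration.integrable_bound[OF integrable_mult_right[OF Mu_integrable, of W] A_meas])
      (use A_bound in \<open>auto intro!: AE_I2 order_trans[OF _ abs_ge_self]\<close>)
  have A_lim: "(\<lambda>n. A n s) \<longlonglongrightarrow> transp \<psi> \<rho> s" if s: "s \<in> {0<..<T}" for s
    unfolding A_def transp_def
    by (rule mollify_renorm_lim[OF s _ W(4)[OF s] W(2)[OF s]]) (use W(2)[OF s] in auto)
  have prim_A: "(\<lambda>n. prim (A n) t) \<longlonglongrightarrow> prim (transp \<psi> \<rho>) t" for t
    by (rule prim_lim[OF A_meas A_meas' A_lim A_bound])
  have L_lim: "(\<lambda>n. L n t) \<longlonglongrightarrow> (\<integral>y. \<psi> y * renorm (\<rho> t y) \<partial>lborel)" if t: "t \<in> {0<..<T}" for t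
  proof -
    obtain B where B: "B > 0" "\<And>y. norm (\<psi> y) \<le> B" using test_fun_bounded[OF \<psi>] by blast
    have "(\<lambda>n. \<integral>y. renorm (mollify (eps n) (\<rho> t) y) * \<psi> y \<partial>lborel) \<longlonglongrightarrow> (\<integral>y. renorm (\<rho> t y) * \<psi> y \<partial>lborel)"
      by (rule mollify_renorm_lim[OF t test_fun_borel[OF \<psi>] _ test_fun_integrable[OF \<psi>], of B]) (use B in auto)
    then show ?thesis by (simp add: L_def mult.commute)
  qed
  have I_int: "integrable M (I n)" and L_eq: "AE t in M. L n t = prim (I n) t" if n: "n \<ge> N" for n
    using AE_integral_renorm_mollify[OF eps_pos \<psi> d(2)[OF N[OF n]]] unfolding I_def[abs_def] L_def by blast+
  have defect_est: "ennreal \<bar>prim (I n) t + prim (A n) t\<bar> \<le> ennreal C * (\<integral>\<^sup>+s. defect (eps n) s \<partial>M)" if n: "n \<ge> N" for n t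
  proof -
    have IA: "integrable M (\<lambda>s. indicator {..t} s * (I n s + A n s))"
      by (intro integrable_indicator_mult Bochner_Integration.integrable_add I_int[OF n] A_int) simp
    have "prim (I n) t + prim (A n) t = (\<integral>s. indicator {..t} s * I n s + indicator {..t} s * A n s \<partial>M)"
      unfolding prim_def by (intro Bochner_Integration.integral_add[symmetric] integrable_indicator_mult I_int[OF n] A_int) auto
    also have "\<dots> = (\<integral>s. indicator {..t} s * (I n s + A n s) \<partial>M)" by (simp add: distrib_left)
    finally have "ennreal \<bar>prim (I n) t + prim (A n) t\<bar> \<le> (\<integral>\<^sup>+s. ennreal (norm (indicator {..t} s * (I n s + A n s))) \<partial>M)"
      using integral_norm_bound_ennreal[OF IA] by simp
    also have "\<dots> \<le> (\<integral>\<^sup>+s. ennreal C * defect (eps n) s \<partial>M)"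
    proof (rule nn_integral_mono)
      fix s assume "s \<in> space M"
      then have s: "s \<in> {0<..<T}" by simp
      have "ennreal (norm (indicator {..t} s * (I n s + A n s))) \<le> ennreal \<bar>I n s + A n s\<bar>"
        by (intro ennreal_leI) (auto simp: indicator_def)
      also have "\<dots> \<le> ennreal C * defect (eps n) s"
        unfolding I_def A_def by (rule C(2)[OF eps_pos d(2)[OF N[OF n]] s])
      finally show "ennreal (norm (indicator {..t} s * (I n s + A n s))) \<le> ennreal C * defect (eps n) s" .
    qed
    also have "\<dots> = ennreal C * (\<integral>\<^sup>+s. defect (eps n) s \<partial>M)" by (rule nn_integral_cmult[OF defect_measurable])
    finally show ?thesis .
  qed
  have IA_lim: "(\<lambda>n. prim (I n) t + prim (A n) t) \<longlonglongrightarrow> 0" for t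
  proof -
    have "(\<lambda>n. ennreal C * (\<integral>\<^sup>+s. defect (eps n) s \<partial>M)) \<longlonglongrightarrow> ennreal C * 0"
      by (rule ennreal_tendsto_cmult[OF _ nn_integral_defect_lim]) simp
    then have up: "(\<lambda>n. ennreal C * (\<integral>\<^sup>+s. defect (eps n) s \<partial>M)) \<longlonglongrightarrow> 0" by simp
    have ev: "\<forall>\<^sub>F n in sequentially. ennreal \<bar>prim (I n) t + prim (A n) t\<bar> \<le> ennreal C * (\<integral>\<^sup>+s. defect (eps n) s \<partial>M)"
      using defect_est unfolding eventually_sequentially by blast
    have "(\<lambda>n. ennreal \<bar>prim (I n) t + prim (A n) t\<bar>) \<longlonglongrightarrow> 0"
      by (rule tendsto_sandwich[OF _ ev tendsto_const up]) simp
    then have "(\<lambda>n. \<bar>prim (I n) t + prim (A n) t\<bar>) \<longlonglongrightarrow> 0"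
      using tendsto_ennreal_iff[of "\<lambda>n. \<bar>prim (I n) t + prim (A n) t\<bar>" sequentially 0] by simp
    then show ?thesis by (rule tendsto_rabs_zero_cancel)
  qed
  have "AE t in M. \<forall>n\<ge>N. L n t = prim (I n) t"
    unfolding AE_all_countable using L_eq by (intro allI) (simp add: AE_impI)
  then show ?thesis using AE_space
  proof eventually_elim
    fix t assume e: "\<forall>n\<ge>N. L n t = prim (I n) t" and "t \<in> space M"
    then have t: "t \<in> {0<..<T}" by simp
    have "(\<lambda>n. L n t + prim (A n) t) \<longlonglongrightarrow> (\<integral>y. \<psi> y * renorm (\<rho> t y) \<partial>lborel) + prim (transp \<psi> \<rho>) t"
      by (rule tendsto_add[OF L_lim[OF t] prim_A])
    moreover have "(\<lambda>n. L n t + prim (A n) t) \<longlonglongrightarrow> 0"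
    proof (rule Lim_transform_eventually[OF IA_lim[of t]])
      show "\<forall>\<^sub>F n in sequentially. prim (I n) t + prim (A n) t = L n t + prim (A n) t"
        unfolding eventually_sequentially by (rule exI[of _ N]) (simp add: e)
    qed
    ultimately have "(\<integral>y. \<psi> y * renorm (\<rho> t y) \<partial>lborel) + prim (transp \<psi> \<rho>) t = 0"
      by (rule LIMSEQ_unique)
    then show "(\<integral>y. \<psi> y * renorm (\<rho> t y) \<partial>lborel) = - prim (transp \<psi> \<rho>) t" by simp
  qed
qed

end

section \<open>Uniqueness from a cutoff adapted to the velocity\<close>

text \<open>\<open>h\<close> approximates the time integral of the speed by test functions, and
  \<open>G\<close> bounds all their gradients at once. The compact supports inside
  \<open>\<Omega>\<close> express that the velocity vanishes at the boundary.\<close>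

locale transport_cutoff = transport_vanishing_defect T \<Omega> \<rho> u C\<rho> Mu D
  for T :: real and \<Omega> :: "'a::euclidean_space set" and \<rho> u C\<rho> Mu D +
  fixes h :: "nat \<Rightarrow> 'a \<Rightarrow> real" and G :: "'a \<Rightarrow> real"
  assumes \<rho>_outside: "\<And>t x. t \<in> {0<..<T} \<Longrightarrow> x \<notin> \<Omega> \<Longrightarrow> \<rho> t x = 0"
    and h_test: "\<And>k. test_fun \<Omega> (h k)" and h_nonneg: "\<And>k x. h k x \<ge> 0"
    and h_lim: "AE x in lborel. (\<lambda>k. h k x) \<longlonglongrightarrow> (\<integral>t. norm (u t x) \<partial>M)"
    and G_integrable: "integrable lborel G" and G_nonneg: "\<And>x. G x \<ge> 0"
    and h_deriv: "\<And>k. AE x in lborel. \<forall>v. \<bar>dderiv (h k) v x\<bar> \<le> G x * norm v"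
begin

definition H :: "'a \<Rightarrow> real" where "H x = (\<integral>t. norm (u t x) \<partial>M)"

definition Mtot :: real where "Mtot = (\<integral>t. Mu t \<partial>M)"

lemma u_sec_time: "(\<lambda>t. u t x) \<in> borel_measurable M"
  by measurable

lemma u_integrable_time: "integrable M (\<lambda>t. norm (u t x))"
  by (rule Bochner_Integration.integrable_bound[OF Mu_integrable])
    (use u_bound u_sec_time in \<open>auto intro!: AE_I2 order_trans[OF _ abs_ge_self]\<close>)

lemma H_borel[measurable]: "H \<in> borel_measurable borel"
proof -
  have "(\<lambda>(x, t). norm (u t x)) \<in> borel_measurable (lborel \<Otimes>\<^sub>M M)" by measurable
  then have "H \<in> borel_measurable lborel"
    unfolding H_def[abs_def] by (rule fM.borel_measurable_lebesgue_integral)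
  then show ?thesis by simp
qed

lemma H_bounds: "0 \<le> H x" "H x \<le> Mtot"
proof -
  show "0 \<le> H x" unfolding H_def by (rule Bochner_Integration.integral_nonneg) simp
  show "H x \<le> Mtot" unfolding H_def Mtot_def
    by (rule integral_mono[OF u_integrable_time Mu_integrable]) (use u_bound in auto)
qed

lemma nn_integral_u_time: "(\<integral>\<^sup>+t. ennreal (norm (u t x)) \<partial>M) = ennreal (H x)"
  unfolding H_def by (rule nn_integral_eq_integral[OF u_integrable_time]) auto

definition cutoff :: "real \<Rightarrow> nat \<Rightarrow> 'a \<Rightarrow> real" where
  "cutoff \<delta> k x = h k x * inverse (\<delta> + h k x)"

lemma cutoff_test: "\<delta> > 0 \<Longrightarrow> test_fun \<Omega> (cutoff \<delta> k)"
proof -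
  assume d: "\<delta> > 0"
  have "\<delta> + h k x \<noteq> 0" for x using d h_nonneg[of k x] by linarith
  then have "smooth (\<lambda>x. inverse (\<delta> + h k x))"
    by (rule smooth_inverse[OF smooth_add[OF smooth_const test_fun_smooth[OF h_test]]])
  from test_fun_mult[OF h_test this] show ?thesis unfolding cutoff_def[abs_def] .
qed

lemma cutoff_dderiv:
  assumes d: "\<delta> > 0"
  shows "dderiv (cutoff \<delta> k) v x = \<delta> * dderiv (h k) v x * (inverse (\<delta> + h k x))\<^sup>2"
proof -
  have nz: "\<delta> + h k x \<noteq> 0" using d h_nonneg[of k x] by linarith
  \<comment> \<open>Used with a = h, b its derivative, c = \<delta> and i = 1 / (\<delta> + h): the
    two terms containing h cancel, and \<delta> remains as a factor.\<close>
  have alg: "a * - (i * b * i) + b * i * ((c + a) * i) = c * b * i\<^sup>2" for a b c i :: real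
    by (simp add: power2_eq_square algebra_simps)
  have "(h k has_derivative (\<lambda>v. dderiv (h k) v x)) (at x)"
    using smooth_has_derivative[OF test_fun_smooth[OF h_test]] .
  then have "(cutoff \<delta> k has_derivative (\<lambda>v. h k x * - (inverse (\<delta> + h k x) * dderiv (h k) v x * inverse (\<delta> + h k x))
      + dderiv (h k) v x * inverse (\<delta> + h k x))) (at x)"
    unfolding cutoff_def[abs_def] using nz by (auto intro!: derivative_eq_intros)
  then have "dderiv (cutoff \<delta> k) v x = h k x * - (inverse (\<delta> + h k x) * dderiv (h k) v x * inverse (\<delta> + h k x))
      + dderiv (h k) v x * inverse (\<delta> + h k x)" by (rule dderiv_eq)
  also have "\<dots> = h k x * - (inverse (\<delta> + h k x) * dderiv (h k) v x * inverse (\<delta> + h k x))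
      + dderiv (h k) v x * inverse (\<delta> + h k x) * ((\<delta> + h k x) * inverse (\<delta> + h k x))"
    using nz by simp
  also have "\<dots> = \<delta> * dderiv (h k) v x * (inverse (\<delta> + h k x))\<^sup>2"
    by (rule alg)
  finally show ?thesis .
qed

lemma h_borel[measurable]: "h k \<in> borel_measurable borel"
  by (rule test_fun_borel[OF h_test])

lemma G_borel[measurable]: "G \<in> borel_measurable borel"
  using G_integrable by auto

text \<open>Integrating the speed over time against the gradient bound of
  \<open>cutoff \<delta> k\<close> produces the factor \<open>H\<close>; \<open>Qlim\<close> is the
  limit as \<open>h k\<close> tends to \<open>H\<close>.\<close>

definition Q :: "real \<Rightarrow> nat \<Rightarrow> 'a \<Rightarrow> real" where
  "Q \<delta> k x = H x * (\<delta> * G x * (inverse (\<delta> + h k x))\<^sup>2)"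

definition Qlim :: "real \<Rightarrow> 'a \<Rightarrow> real" where
  "Qlim \<delta> x = H x * (\<delta> * G x * (inverse (\<delta> + H x))\<^sup>2)"

text \<open>Testing with \<open>h / (\<delta> + h)\<close> turns the derivative of the cutoff into \<open>\<delta> Dh / (\<delta> + h)\<^sup>2\<close>, and the time integral
  of the speed supplies a factor \<open>H\<close>, the limit of the \<open>h k\<close>: the product vanishes as \<open>\<delta> \<rightarrow> 0\<close>.\<close>

lemma renorm_cutoff_le:
  assumes d: "\<delta> > 0"
  shows "AE t in M. (\<integral>\<^sup>+x. ennreal (cutoff \<delta> k x * renorm (\<rho> t x)) \<partial>lborel) \<le> (\<integral>\<^sup>+x. ennreal (Q \<delta> k x) \<partial>lborel)"
  using renormalised_equation[OF cutoff_test[OF d, of k]] AE_space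
proof eventually_elim
  fix t assume eq: "(\<integral>y. cutoff \<delta> k y * renorm (\<rho> t y) \<partial>lborel) = - prim (transp (cutoff \<delta> k) \<rho>) t" and "t \<in> space M"
  then have t: "t \<in> {0<..<T}" by simp
  let ?\<psi> = "cutoff \<delta> k"
  note tst = cutoff_test[OF d, of k]
  obtain W where W: "W \<ge> 0" "\<And>s. s \<in> {0<..<T} \<Longrightarrow> integrable lborel (\<lambda>y. dderiv ?\<psi> (u s y) y)"
    "\<And>s. s \<in> {0<..<T} \<Longrightarrow> (\<integral>y. \<bar>dderiv ?\<psi> (u s y) y\<bar> \<partial>lborel) \<le> W * Mu s"
    "\<And>s y. s \<in> {0<..<T} \<Longrightarrow> \<bar>dderiv ?\<psi> (u s y) y\<bar> \<le> W * Mu s"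
    by (rule dderiv_u_bound[OF tst]) blast
  have nn: "0 \<le> ?\<psi> x * renorm (\<rho> t x)" for x
    using h_nonneg[of k x] d renorm_bounds(1) by (simp add: cutoff_def)
  have int: "integrable lborel (\<lambda>x. ?\<psi> x * renorm (\<rho> t x))"
  proof (rule Bochner_Integration.integrable_bound[OF test_fun_integrable[OF tst]])
    have [measurable]: "\<rho> t \<in> borel_measurable borel" "?\<psi> \<in> borel_measurable borel"
      using \<rho>_sec[OF t] test_fun_borel[OF tst] by auto
    show "(\<lambda>x. ?\<psi> x * renorm (\<rho> t x)) \<in> borel_measurable lborel" by measurable
  qed (auto simp: abs_mult mult_left_le renorm_bounds)
  have ti: "integrable M (\<lambda>s. indicator {..t} s * transp ?\<psi> \<rho> s)"
  proof (intro integrable_indicator_mult)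
    have "\<bar>transp ?\<psi> \<rho> s\<bar> \<le> W * Mu s" if s: "s \<in> {0<..<T}" for s
      by (rule order_trans[OF transp_integrand(2)[where m=\<rho>, OF tst s \<rho>_sec[OF s] W(2)[OF s]] W(3)[OF s]])
    then show "integrable M (transp ?\<psi> \<rho>)"
      by (intro Bochner_Integration.integrable_bound[OF integrable_mult_right[OF Mu_integrable, of W] transp_measurable[OF tst \<rho>_measurable]])
        (auto intro!: AE_I2 order_trans[OF _ abs_ge_self])
  qed simp
  have "(\<integral>\<^sup>+x. ennreal (?\<psi> x * renorm (\<rho> t x)) \<partial>lborel) = ennreal (\<integral>x. ?\<psi> x * renorm (\<rho> t x) \<partial>lborel)"
    by (rule nn_integral_eq_integral[OF int]) (simp add: nn)
  also have "\<dots> \<le> ennreal (norm (prim (transp ?\<psi> \<rho>) t))" unfolding eq by (intro ennreal_leI) simp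
  also have "\<dots> \<le> (\<integral>\<^sup>+s. ennreal (norm (indicator {..t} s * transp ?\<psi> \<rho> s)) \<partial>M)"
    unfolding prim_def by (rule integral_norm_bound_ennreal[OF ti])
  also have "\<dots> \<le> (\<integral>\<^sup>+s. \<integral>\<^sup>+y. ennreal (norm (u s y)) * ennreal (\<delta> * G y * (inverse (\<delta> + h k y))\<^sup>2) \<partial>lborel \<partial>M)"
  proof (rule nn_integral_mono)
    fix s assume "s \<in> space M"
    then have s: "s \<in> {0<..<T}" by simp
    have "ennreal (norm (indicator {..t} s * transp ?\<psi> \<rho> s)) \<le> ennreal (\<integral>y. \<bar>dderiv ?\<psi> (u s y) y\<bar> \<partial>lborel)"
      using transp_integrand(2)[where m=\<rho>, OF tst s \<rho>_sec[OF s] W(2)[OF s]]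
      by (intro ennreal_leI) (auto simp: indicator_def)
    also have "\<dots> = (\<integral>\<^sup>+y. ennreal \<bar>dderiv ?\<psi> (u s y) y\<bar> \<partial>lborel)"
      by (rule nn_integral_eq_integral[symmetric, OF integrable_abs[OF W(2)[OF s]]]) simp
    also have "\<dots> \<le> (\<integral>\<^sup>+y. ennreal (norm (u s y)) * ennreal (\<delta> * G y * (inverse (\<delta> + h k y))\<^sup>2) \<partial>lborel)"
    proof (rule nn_integral_mono_AE, use h_deriv[of k] in eventually_elim)
      fix y assume le: "\<forall>v. \<bar>dderiv (h k) v y\<bar> \<le> G y * norm v"
      have "\<bar>dderiv ?\<psi> (u s y) y\<bar> = \<delta> * \<bar>dderiv (h k) (u s y) y\<bar> * (inverse (\<delta> + h k y))\<^sup>2"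
        using d by (simp add: cutoff_dderiv[OF d] abs_mult)
      also have "\<dots> \<le> \<delta> * (G y * norm (u s y)) * (inverse (\<delta> + h k y))\<^sup>2"
        using d le by (intro mult_right_mono mult_left_mono) auto
      finally have "ennreal \<bar>dderiv ?\<psi> (u s y) y\<bar> \<le> ennreal (norm (u s y) * (\<delta> * G y * (inverse (\<delta> + h k y))\<^sup>2))"
        by (intro ennreal_leI) (simp add: mult_ac)
      then show "ennreal \<bar>dderiv ?\<psi> (u s y) y\<bar> \<le> ennreal (norm (u s y)) * ennreal (\<delta> * G y * (inverse (\<delta> + h k y))\<^sup>2)"
        using d G_nonneg[of y] by (subst ennreal_mult[symmetric]) auto
    qed
    finally show "ennreal (norm (indicator {..t} s * transp ?\<psi> \<rho> s))
      \<le> (\<integral>\<^sup>+y. ennreal (norm (u s y)) * ennreal (\<delta> * G y * (inverse (\<delta> + h k y))\<^sup>2) \<partial>lborel)" .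
  qed
  also have "\<dots> = (\<integral>\<^sup>+y. \<integral>\<^sup>+s. ennreal (norm (u s y)) * ennreal (\<delta> * G y * (inverse (\<delta> + h k y))\<^sup>2) \<partial>M \<partial>lborel)"
    by (rule P.Fubini'[symmetric]) measurable
  also have "\<dots> = (\<integral>\<^sup>+y. ennreal (Q \<delta> k y) \<partial>lborel)"
  proof (rule nn_integral_cong)
    fix y
    have "(\<integral>\<^sup>+s. ennreal (norm (u s y)) * ennreal (\<delta> * G y * (inverse (\<delta> + h k y))\<^sup>2) \<partial>M)
      = ennreal (H y) * ennreal (\<delta> * G y * (inverse (\<delta> + h k y))\<^sup>2)"
      by (subst nn_integral_multc) (auto simp: nn_integral_u_time)
    then show "(\<integral>\<^sup>+s. ennreal (norm (u s y)) * ennreal (\<delta> * G y * (inverse (\<delta> + h k y))\<^sup>2) \<partial>M) = ennreal (Q \<delta> k y)"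
      unfolding Q_def using d G_nonneg[of y] H_bounds(1)[of y] by (subst ennreal_mult) auto
  qed
  finally show "(\<integral>\<^sup>+x. ennreal (?\<psi> x * renorm (\<rho> t x)) \<partial>lborel) \<le> (\<integral>\<^sup>+x. ennreal (Q \<delta> k x) \<partial>lborel)" .
qed

text \<open>For fixed \<delta> the bounds 1 / (\<delta> + h) \<le> 1 / \<delta> and H \<le> Mtot
  give a majorant, at the price of a factor 1 / \<delta>. Hence the limit in k is taken before
  \<delta> tends to 0.\<close>

lemma Q_lim:
  assumes d: "\<delta> > 0"
  shows "(\<lambda>k. \<integral>\<^sup>+x. ennreal (Q \<delta> k x) \<partial>lborel) \<longlonglongrightarrow> (\<integral>\<^sup>+x. ennreal (Qlim \<delta> x) \<partial>lborel)"
proof (rule nn_integral_dominated_convergence[where w="\<lambda>x. ennreal (Mtot * inverse \<delta> * G x)"])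
  show "AE x in lborel. ennreal (Q \<delta> k x) \<le> ennreal (Mtot * inverse \<delta> * G x)" for k
  proof (rule AE_I2, rule ennreal_leI)
    fix x
    have "inverse (\<delta> + h k x) \<le> inverse \<delta>" using d h_nonneg[of k x] by (intro le_imp_inverse_le) auto
    then have "(inverse (\<delta> + h k x))\<^sup>2 \<le> (inverse \<delta>)\<^sup>2" using d h_nonneg[of k x] by (intro power_mono) auto
    then have "\<delta> * G x * (inverse (\<delta> + h k x))\<^sup>2 \<le> \<delta> * G x * (inverse \<delta>)\<^sup>2"
      using d G_nonneg[of x] by (intro mult_left_mono) auto
    also have "\<dots> = inverse \<delta> * G x" using d by (simp add: power2_eq_square)
    finally have le: "\<delta> * G x * (inverse (\<delta> + h k x))\<^sup>2 \<le> inverse \<delta> * G x" .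
    have "H x * (\<delta> * G x * (inverse (\<delta> + h k x))\<^sup>2) \<le> Mtot * (inverse \<delta> * G x)"
      by (rule mult_mono[OF H_bounds(2) le order_trans[OF H_bounds]]) (use d G_nonneg[of x] in simp)
    then show "Q \<delta> k x \<le> Mtot * inverse \<delta> * G x" by (simp add: Q_def mult.assoc)
  qed
  have "integrable lborel (\<lambda>x. Mtot * inverse \<delta> * G x)" by (rule integrable_mult_right[OF G_integrable])
  then have "(\<integral>\<^sup>+x. ennreal (norm (Mtot * inverse \<delta> * G x)) \<partial>lborel) < \<infinity>" by (subst (asm) integrable_iff_bounded) blast
  moreover have "norm (Mtot * inverse \<delta> * G x) = Mtot * inverse \<delta> * G x" for x
    using order_trans[OF H_bounds] d G_nonneg[of x] by simp
  ultimately show "(\<integral>\<^sup>+x. ennreal (Mtot * inverse \<delta> * G x) \<partial>lborel) < \<infinity>" by simp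
  show "AE x in lborel. (\<lambda>k. ennreal (Q \<delta> k x)) \<longlonglongrightarrow> ennreal (Qlim \<delta> x)"
    using h_lim
  proof eventually_elim
    fix x assume l: "(\<lambda>k. h k x) \<longlonglongrightarrow> (\<integral>t. norm (u t x) \<partial>M)"
    have "\<delta> + H x \<noteq> 0" using d H_bounds(1)[of x] by linarith
    then have "(\<lambda>k. Q \<delta> k x) \<longlonglongrightarrow> Qlim \<delta> x"
      unfolding Q_def Qlim_def by (intro tendsto_intros l[folded H_def])
    then show "(\<lambda>k. ennreal (Q \<delta> k x)) \<longlonglongrightarrow> ennreal (Qlim \<delta> x)" by (rule tendsto_ennrealI)
  qed
qed (auto simp: Q_def[abs_def] Qlim_def[abs_def])

text \<open>After the limit in k the two occurrences of H compensate each other: H \<delta> \<le>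
  (\<delta> + H)^2 makes \<open>G\<close> a majorant for all \<delta>. Pointwise the integrand is 0
  where H = 0 and of order \<delta> elsewhere.\<close>

lemma Qlim_lim: "(\<lambda>j. \<integral>\<^sup>+x. ennreal (Qlim (eps j) x) \<partial>lborel) \<longlonglongrightarrow> 0"
proof -
  have "(\<lambda>j. \<integral>\<^sup>+x. ennreal (Qlim (eps j) x) \<partial>lborel) \<longlonglongrightarrow> (\<integral>\<^sup>+x. 0 \<partial>(lborel :: 'a measure))"
  proof (rule nn_integral_dominated_convergence[where w="\<lambda>x. ennreal (G x)"])
    show "AE x in lborel. ennreal (Qlim (eps j) x) \<le> ennreal (G x)" for j
    proof (rule AE_I2, rule ennreal_leI)
      fix x
      define \<delta> where "\<delta> = eps j"
      have d: "\<delta> > 0" by (simp add: \<delta>_def)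
      have p: "\<delta> + H x > 0" using d H_bounds(1)[of x] by linarith
      have "H x * \<delta> \<le> (\<delta> + H x) * (\<delta> + H x)" using H_bounds(1)[of x] d by (intro mult_mono) auto
      then have "H x * \<delta> * (inverse (\<delta> + H x))\<^sup>2 \<le> (\<delta> + H x) * (\<delta> + H x) * (inverse (\<delta> + H x))\<^sup>2"
        by (rule mult_right_mono) simp
      also have "\<dots> = ((\<delta> + H x) * inverse (\<delta> + H x))\<^sup>2" by (simp only: power2_eq_square mult_ac)
      also have "\<dots> = 1" using p by simp
      finally have "H x * \<delta> * (inverse (\<delta> + H x))\<^sup>2 \<le> 1" .
      then have "(H x * \<delta> * (inverse (\<delta> + H x))\<^sup>2) * G x \<le> 1 * G x" by (rule mult_right_mono) (rule G_nonneg)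
      then show "Qlim (eps j) x \<le> G x" by (simp add: Qlim_def \<delta>_def[symmetric] mult_ac)
    qed
    have "(\<integral>\<^sup>+x. ennreal (norm (G x)) \<partial>lborel) < \<infinity>" using G_integrable by (subst (asm) integrable_iff_bounded) blast
    then show "(\<integral>\<^sup>+x. ennreal (G x) \<partial>lborel) < \<infinity>" using G_nonneg by simp
    show "AE x in lborel. (\<lambda>j. ennreal (Qlim (eps j) x)) \<longlonglongrightarrow> 0"
    proof (rule AE_I2)
      fix x
      have "(\<lambda>j. Qlim (eps j) x) \<longlonglongrightarrow> 0"
      proof (cases "H x = 0")
        case False
        have "(\<lambda>j. H x * (eps j * G x * (inverse (eps j + H x))\<^sup>2)) \<longlonglongrightarrow> H x * (0 * G x * (inverse (0 + H x))\<^sup>2)"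
          by (intro tendsto_intros eps_lim) (use False in auto)
        then show ?thesis by (simp add: Qlim_def)
      qed (simp add: Qlim_def)
      then show "(\<lambda>j. ennreal (Qlim (eps j) x)) \<longlonglongrightarrow> 0" using tendsto_ennrealI[of _ 0] by simp
    qed
  qed (auto simp: Qlim_def[abs_def])
  then show ?thesis by simp
qed

text \<open>The inequality of \<open>renorm_cutoff_le\<close> passes to the limit first in k and
  then in \<delta>: the cutoffs tend to H / (\<delta> + H), and these to the indicator of H > 0. On
  the left both limits are dominated by |\<rho>|, as \<open>renorm\<close> is at most the modulus
  and the cutoffs lie in [0,1].\<close>

lemma renorm_vanishes_on_support_of_H:
  "AE t in M. AE x in lborel. H x > 0 \<longrightarrow> renorm (\<rho> t x) = 0"
proof -
  have "AE t in M. \<forall>j k. (\<integral>\<^sup>+x. ennreal (cutoff (eps j) k x * renorm (\<rho> t x)) \<partial>lborel) \<le> (\<integral>\<^sup>+x. ennreal (Q (eps j) k x) \<partial>lborel)"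
    unfolding AE_all_countable using renorm_cutoff_le[OF eps_pos] by blast
  then show ?thesis using AE_space
  proof eventually_elim
    fix t assume le: "\<forall>j k. (\<integral>\<^sup>+x. ennreal (cutoff (eps j) k x * renorm (\<rho> t x)) \<partial>lborel) \<le> (\<integral>\<^sup>+x. ennreal (Q (eps j) k x) \<partial>lborel)"
      and "t \<in> space M"
    then have t: "t \<in> {0<..<T}" by simp
    have [measurable]: "\<rho> t \<in> borel_measurable borel" by (rule \<rho>_sec[OF t])
    have [measurable]: "(\<lambda>x. renorm (\<rho> t x)) \<in> borel_measurable borel" by measurable
    have fin: "(\<integral>\<^sup>+x. ennreal \<bar>\<rho> t x\<bar> \<partial>lborel) < \<infinity>"
      using \<rho>_integrable[OF t] by (simp add: integrable_iff_bounded)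
    have r\<rho>: "renorm (\<rho> t x) \<le> \<bar>\<rho> t x\<bar>" for x
      using renorm_lipschitz[of "\<rho> t x" 0] renorm_bounds(3)[of "\<rho> t x"] by (simp add: renorm_def)
    have dom: "ennreal (c * renorm (\<rho> t x)) \<le> ennreal \<bar>\<rho> t x\<bar>" if "0 \<le> c" "c \<le> 1" for c x
      using mult_mono[OF that(2) r\<rho>[of x]] renorm_bounds(1)[of "\<rho> t x"] by (intro ennreal_leI) simp
    have le2: "(\<integral>\<^sup>+x. ennreal (H x * inverse (eps j + H x) * renorm (\<rho> t x)) \<partial>lborel) \<le> (\<integral>\<^sup>+x. ennreal (Qlim (eps j) x) \<partial>lborel)" for j
    proof (rule LIMSEQ_le[OF _ Q_lim[OF eps_pos]])
      show "(\<lambda>k. \<integral>\<^sup>+x. ennreal (cutoff (eps j) k x * renorm (\<rho> t x)) \<partial>lborel)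
        \<longlonglongrightarrow> (\<integral>\<^sup>+x. ennreal (H x * inverse (eps j + H x) * renorm (\<rho> t x)) \<partial>lborel)"
      proof (rule nn_integral_dominated_convergence[where w="\<lambda>x. ennreal \<bar>\<rho> t x\<bar>", OF _ _ _ _ fin])
        show "AE x in lborel. ennreal (cutoff (eps j) k x * renorm (\<rho> t x)) \<le> ennreal \<bar>\<rho> t x\<bar>" for k
        proof (rule AE_I2, rule dom)
          fix x
          have p: "eps j + h k x > 0" using eps_pos[of j] h_nonneg[of k x] by linarith
          show "0 \<le> cutoff (eps j) k x" using p h_nonneg[of k x] by (simp add: cutoff_def)
          have "h k x * inverse (eps j + h k x) \<le> (eps j + h k x) * inverse (eps j + h k x)"
            using p eps_pos[of j] by (intro mult_right_mono) auto
          then show "cutoff (eps j) k x \<le> 1" using p by (simp add: cutoff_def)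
        qed
        show "AE x in lborel. (\<lambda>k. ennreal (cutoff (eps j) k x * renorm (\<rho> t x))) \<longlonglongrightarrow> ennreal (H x * inverse (eps j + H x) * renorm (\<rho> t x))"
          using h_lim
        proof eventually_elim
          fix x assume l: "(\<lambda>k. h k x) \<longlonglongrightarrow> (\<integral>t. norm (u t x) \<partial>M)"
          have "eps j + H x \<noteq> 0" using eps_pos[of j] H_bounds(1)[of x] by linarith
          then have "(\<lambda>k. cutoff (eps j) k x * renorm (\<rho> t x)) \<longlonglongrightarrow> H x * inverse (eps j + H x) * renorm (\<rho> t x)"
            unfolding cutoff_def by (intro tendsto_intros l[folded H_def])
          then show "(\<lambda>k. ennreal (cutoff (eps j) k x * renorm (\<rho> t x))) \<longlonglongrightarrow> ennreal (H x * inverse (eps j + H x) * renorm (\<rho> t x))"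
            by (rule tendsto_ennrealI)
        qed
      qed (auto simp: cutoff_def[abs_def])
      show "\<exists>N. \<forall>n\<ge>N. (\<integral>\<^sup>+x. ennreal (cutoff (eps j) n x * renorm (\<rho> t x)) \<partial>lborel) \<le> (\<integral>\<^sup>+x. ennreal (Q (eps j) n x) \<partial>lborel)"
        using le by blast
    qed
    define I where "I x = (if H x > 0 then 1 else 0 :: real)" for x
    have "(\<integral>\<^sup>+x. ennreal (I x * renorm (\<rho> t x)) \<partial>lborel) \<le> 0"
    proof (rule LIMSEQ_le[OF _ Qlim_lim])
      show "(\<lambda>j. \<integral>\<^sup>+x. ennreal (H x * inverse (eps j + H x) * renorm (\<rho> t x)) \<partial>lborel)
        \<longlonglongrightarrow> (\<integral>\<^sup>+x. ennreal (I x * renorm (\<rho> t x)) \<partial>lborel)"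
      proof (rule nn_integral_dominated_convergence[where w="\<lambda>x. ennreal \<bar>\<rho> t x\<bar>", OF _ _ _ _ fin])
        show "AE x in lborel. ennreal (H x * inverse (eps j + H x) * renorm (\<rho> t x)) \<le> ennreal \<bar>\<rho> t x\<bar>" for j
        proof (rule AE_I2, rule dom)
          fix x
          have p: "eps j + H x > 0" using eps_pos[of j] H_bounds(1)[of x] by linarith
          show "0 \<le> H x * inverse (eps j + H x)" using p H_bounds(1)[of x] by simp
          have "H x * inverse (eps j + H x) \<le> (eps j + H x) * inverse (eps j + H x)"
            using p eps_pos[of j] by (intro mult_right_mono) auto
          then show "H x * inverse (eps j + H x) \<le> 1" using p by simp
        qed
        show "AE x in lborel. (\<lambda>j. ennreal (H x * inverse (eps j + H x) * renorm (\<rho> t x))) \<longlonglongrightarrow> ennreal (I x * renorm (\<rho> t x))"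
        proof (rule AE_I2, rule tendsto_ennrealI)
          fix x
          show "(\<lambda>j. H x * inverse (eps j + H x) * renorm (\<rho> t x)) \<longlonglongrightarrow> I x * renorm (\<rho> t x)"
          proof (cases "H x = 0")
            case False
            then have "(\<lambda>j. H x * inverse (eps j + H x) * renorm (\<rho> t x)) \<longlonglongrightarrow> H x * inverse (0 + H x) * renorm (\<rho> t x)"
              by (intro tendsto_intros eps_lim) auto
            moreover have "H x * inverse (0 + H x) = I x" using False H_bounds(1)[of x] by (simp add: I_def)
            ultimately show ?thesis by simp
          qed (simp add: I_def)
        qed
      qed (auto simp: I_def[abs_def])
      show "\<exists>N. \<forall>n\<ge>N. (\<integral>\<^sup>+x. ennreal (H x * inverse (eps n + H x) * renorm (\<rho> t x)) \<partial>lborel) \<le> (\<integral>\<^sup>+x. ennreal (Qlim (eps n) x) \<partial>lborel)"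
        using le2 by blast
    qed
    then have "(\<integral>\<^sup>+x. ennreal (I x * renorm (\<rho> t x)) \<partial>lborel) = 0" by simp
    then have "AE x in lborel. ennreal (I x * renorm (\<rho> t x)) = 0"
      by (subst (asm) nn_integral_0_iff_AE) (auto simp: I_def[abs_def])
    then show "AE x in lborel. H x > 0 \<longrightarrow> renorm (\<rho> t x) = 0"
    proof eventually_elim
      fix x assume "ennreal (I x * renorm (\<rho> t x)) = 0"
      then show "H x > 0 \<longrightarrow> renorm (\<rho> t x) = 0"
        using renorm_bounds(1)[of "\<rho> t x"] by (auto simp: I_def ennreal_eq_0_iff)
    qed
  qed
qed

text \<open>At a single x a vanishing integral of the speed makes the velocity 0 for almost every
  time; Fubini exchanges the quantifiers.\<close>

lemma u_vanishes_off_support_of_H: "AE t in M. AE x in lborel. H x = 0 \<longrightarrow> u t x = 0"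
proof (subst P.AE_commute)
  show "{z \<in> space (M \<Otimes>\<^sub>M lborel). H (snd z) = 0 \<longrightarrow> u (fst z) (snd z) = 0} \<in> sets (M \<Otimes>\<^sub>M lborel)"
    by measurable
  show "AE x in lborel. AE t in M. H x = 0 \<longrightarrow> u t x = 0"
  proof (rule AE_I2)
    fix x
    show "AE t in M. H x = 0 \<longrightarrow> u t x = 0"
    proof (cases "H x = 0")
      case True
      then have "AE t in M. norm (u t x) = 0"
        unfolding H_def by (subst (asm) integral_nonneg_eq_0_iff_AE[OF u_integrable_time]) auto
      then show ?thesis by eventually_elim simp
    qed simp
  qed
qed

text \<open>Off a null set of points either \<open>renorm (\<rho> s x)\<close> or
  \<open>u s x\<close> is 0, whatever the zero set of \<open>H\<close> looks like.\<close>

lemma transp_\<rho>_eq_0: "test_fun \<Omega> \<psi> \<Longrightarrow> prim (transp \<psi> \<rho>) t = 0"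
proof -
  assume \<psi>: "test_fun \<Omega> \<psi>"
  have "AE s in M. transp \<psi> \<rho> s = 0"
    using renorm_vanishes_on_support_of_H u_vanishes_off_support_of_H
  proof eventually_elim
    fix s assume 1: "AE x in lborel. H x > 0 \<longrightarrow> renorm (\<rho> s x) = 0" and 2: "AE x in lborel. H x = 0 \<longrightarrow> u s x = 0"
    have "AE x in lborel. renorm (\<rho> s x) * dderiv \<psi> (u s x) x = 0"
      using 1 2
    proof eventually_elim
      fix x assume x: "H x > 0 \<longrightarrow> renorm (\<rho> s x) = 0" "H x = 0 \<longrightarrow> u s x = 0"
      show "renorm (\<rho> s x) * dderiv \<psi> (u s x) x = 0"
      proof (cases "H x = 0")
        case True
        then show ?thesis using x(2) linear_0[OF smooth_dderiv_linear[OF test_fun_smooth[OF \<psi>], of x]] by simp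
      next
        case False
        then show ?thesis using x(1) H_bounds(1)[of x] by simp
      qed
    qed
    then show "transp \<psi> \<rho> s = 0" unfolding transp_def by (rule integral_eq_zero_AE)
  qed
  then have "prim (transp \<psi> \<rho>) t = prim (\<lambda>s. 0) t"
    by (rule prim_cong_AE[OF _ transp_measurable[OF \<psi> \<rho>_measurable]]) simp
  then show ?thesis by (simp add: prim_def)
qed

theorem density_vanishes: "AE t in M. AE x in lborel. \<rho> t x = 0"
proof -
  obtain Y :: "'a set" where Y: "countable Y" "\<And>X. open X \<Longrightarrow> X \<noteq> {} \<Longrightarrow> \<exists>y\<in>Y. y \<in> X"
    by (rule countable_dense_setE) blast
  \<comment> \<open>A countable family of mollifiers, so that one null set of times serves for all.
    The centres are dense and the radii tend to 0, hence the balls on which the mollifiers are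
    positive cover \<open>\<Omega>\<close>.\<close>
  define I where "I = {(y, n). y \<in> Y \<and> cball y (eps n) \<subseteq> \<Omega>}"
  have "countable (Y \<times> (UNIV :: nat set))" using Y(1) by auto
  then have I: "countable I" by (rule countable_subset[rotated]) (auto simp: I_def)
  have "AE t in M. \<forall>i\<in>I. (\<integral>x. moll (eps (snd i)) (fst i - x) * renorm (\<rho> t x) \<partial>lborel) = 0"
  proof (subst AE_ball_countable[OF I], rule ballI)
    fix i assume "i \<in> I"
    then have \<psi>: "test_fun \<Omega> (\<lambda>x. moll (eps (snd i)) (fst i - x))"
      by (intro test_fun_moll_translate eps_pos) (auto simp: I_def)
    show "AE t in M. (\<integral>x. moll (eps (snd i)) (fst i - x) * renorm (\<rho> t x) \<partial>lborel) = 0"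
      using renormalised_equation[OF \<psi>] by eventually_elim (simp add: transp_\<rho>_eq_0[OF \<psi>])
  qed
  then show ?thesis using AE_space
  proof eventually_elim
    fix t assume z: "\<forall>i\<in>I. (\<integral>x. moll (eps (snd i)) (fst i - x) * renorm (\<rho> t x) \<partial>lborel) = 0" and "t \<in> space M"
    then have t: "t \<in> {0<..<T}" by simp
    have [measurable]: "\<rho> t \<in> borel_measurable borel" by (rule \<rho>_sec[OF t])
    have "AE x in lborel. \<forall>i\<in>I. moll (eps (snd i)) (fst i - x) * renorm (\<rho> t x) = 0"
    proof (subst AE_ball_countable[OF I], rule ballI)
      fix i assume i: "i \<in> I"
      then have \<psi>: "test_fun \<Omega> (\<lambda>x. moll (eps (snd i)) (fst i - x))"
        by (intro test_fun_moll_translate eps_pos) (auto simp: I_def)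
      have [measurable]: "(\<lambda>x. moll (eps (snd i)) (fst i - x)) \<in> borel_measurable borel" by (rule test_fun_borel[OF \<psi>])
      have "integrable lborel (\<lambda>x. moll (eps (snd i)) (fst i - x) * renorm (\<rho> t x))"
        by (rule Bochner_Integration.integrable_bound[OF test_fun_integrable[OF \<psi>]])
          (auto simp: abs_mult mult_left_le renorm_bounds)
      moreover have "AE x in lborel. 0 \<le> moll (eps (snd i)) (fst i - x) * renorm (\<rho> t x)"
        by (rule AE_I2) (intro mult_nonneg_nonneg moll_nonneg[OF eps_pos] renorm_bounds)
      ultimately show "AE x in lborel. moll (eps (snd i)) (fst i - x) * renorm (\<rho> t x) = 0"
        using z i integral_nonneg_eq_0_iff_AE by blast
    qed
    then show "AE x in lborel. \<rho> t x = 0"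
    proof eventually_elim
      fix x assume x: "\<forall>i\<in>I. moll (eps (snd i)) (fst i - x) * renorm (\<rho> t x) = 0"
      show "\<rho> t x = 0"
      proof (cases "x \<in> \<Omega>")
        case True
        then obtain r where r: "r > 0" "cball x r \<subseteq> \<Omega>" using open_\<Omega> unfolding open_contains_cball by blast
        \<comment> \<open>The centre is chosen within \<open>eps n\<close> of x and the ball around
          it has radius \<open>eps n\<close>, so together they stay within r of x.\<close>
        obtain n where n: "eps n < r / 2"
          using order_tendstoD(2)[OF eps_lim, of "r/2"] r(1) by (auto simp: eventually_sequentially)
        obtain y where y: "y \<in> Y" "y \<in> ball x (eps n)"
          using Y(2)[OF open_ball, of x "eps n"] eps_pos[of n] by auto
        have "cball y (eps n) \<subseteq> cball x r"
        proof
          fix w assume "w \<in> cball y (eps n)"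
          then show "w \<in> cball x r" using y(2) n dist_triangle[of x w y] by auto
        qed
        then have "(y, n) \<in> I" using y(1) r(2) by (auto simp: I_def)
        then have "moll (eps n) (y - x) * renorm (\<rho> t x) = 0" using x by force
        moreover have "moll (eps n) (y - x) > 0"
          by (rule moll_pos[OF eps_pos]) (use y(2) in \<open>simp add: dist_norm norm_minus_commute\<close>)
        ultimately show ?thesis by (simp add: renorm_eq_0_iff)
      qed (rule \<rho>_outside[OF t])
    qed
  qed
qed

end

section \<open>Lebesgue and Sobolev norms\<close>

text \<open>In \<open>ennreal\<close>, 1 / top = 0 and 1 / 0 = top. The condition 1 < p excludes q =
  top, so q is always a real number at least 1 and only p may be infinite.\<close>

lemma conjugate_exponent_cases:
  fixes p q :: ennreal
  assumes "1 < p" "1 / p + 1 / q = 1"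
  obtains (top) "p = \<infinity>" "q = ennreal 1"
    | (fin) a b where "p = ennreal a" "q = ennreal b" "a > 1" "b > 1" "1 / a + 1 / b = 1"
proof (cases p)
  case top
  then have "1 / q = 1" using assms(2) by (simp add: ennreal_divide_top)
  then have "q = ennreal 1"
  proof (cases q)
    case (real r)
    show ?thesis
    proof (cases "r = 0")
      case True
      then show ?thesis using \<open>1 / q = 1\<close> real by (simp add: ennreal_divide_zero)
    next
      case False
      then have "ennreal (1 / r) = 1" using \<open>1 / q = 1\<close> real divide_ennreal[of 1 r] by simp
      then show ?thesis using real by (simp add: ennreal_eq_1)
    qed
  qed (simp add: ennreal_divide_top)
  then show thesis using that(1) top by simp
next
  case (real a)
  then have a: "a > 1" using assms(1) by (simp add: ennreal_less_iff flip: ennreal_1)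
  have ia: "1 / p = ennreal (1 / a)" using real a divide_ennreal[of 1 a] by simp
  show thesis
  proof (cases q)
    case (real b)
    have "b \<noteq> 0"
    proof
      assume "b = 0"
      then have "1 / q = top" using real by (simp add: ennreal_divide_zero)
      then show False using assms(2) by simp
    qed
    then have b: "b > 0" using real by simp
    then have "1 / q = ennreal (1 / b)" using real divide_ennreal[of 1 b] by simp
    then have "ennreal (1 / a + 1 / b) = 1" using assms(2) ia a b by simp
    then have e: "1 / a + 1 / b = 1" by (simp add: ennreal_eq_1)
    have "1 / a > 0" using a by simp
    then have "1 / b < 1" using e by linarith
    then have "b > 1" using b by simp
    then show thesis using that(2)[OF \<open>p = ennreal a\<close> real(2) a _ e] by simp
  next
    case top
    then have "ennreal (1 / a) = 1" using assms(2) ia by (simp add: ennreal_divide_top)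
    then show thesis using a by (simp add: ennreal_eq_1)
  qed
qed

definition pow_int :: "real \<Rightarrow> 'a::euclidean_space set \<Rightarrow> ('a \<Rightarrow> 'b::euclidean_space) \<Rightarrow> ennreal" where
  "pow_int b S g = (\<integral>\<^sup>+x. ennreal (norm (g x) powr b) \<partial>lebesgue_on S)"

lemma Lp_norm_finite_exponent:
  assumes "b \<ge> 1"
  shows "Lp_norm (ennreal b) S g =
    (if pow_int b S g = \<infinity> then \<infinity> else ennreal (enn2real (pow_int b S g) powr (1 / b)))"
  using assms by (simp add: Lp_norm_def pow_int_def Let_def)

lemma pow_int_le_imp_Lp_norm_le:
  assumes b: "b \<ge> 1" and le: "pow_int b S f \<le> pow_int b S g"
  shows "Lp_norm (ennreal b) S f \<le> Lp_norm (ennreal b) S g"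
proof (cases "pow_int b S g = \<infinity>")
  case False
  then have "pow_int b S f \<noteq> \<infinity>" using le by (auto simp: top_unique)
  moreover have "enn2real (pow_int b S f) \<le> enn2real (pow_int b S g)"
    using False le by (intro enn2real_mono) (auto simp: less_top)
  ultimately show ?thesis
    using False b by (simp add: Lp_norm_finite_exponent ennreal_leI powr_mono2)
qed (simp add: Lp_norm_finite_exponent b)

lemma Lp_norm_mono_AE:
  assumes "b \<ge> 1" "AE x in lebesgue_on S. norm (f x) \<le> norm (g x)"
  shows "Lp_norm (ennreal b) S f \<le> Lp_norm (ennreal b) S g"
proof (rule pow_int_le_imp_Lp_norm_le[OF assms(1)])
  show "pow_int b S f \<le> pow_int b S g"
    unfolding pow_int_def
  proof (rule nn_integral_mono_AE)
    show "AE x in lebesgue_on S. ennreal (norm (f x) powr b) \<le> ennreal (norm (g x) powr b)"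
      using assms(2) by eventually_elim (use assms(1) in \<open>auto intro!: ennreal_leI powr_mono2\<close>)
  qed
qed

lemma Lp_norm_cong_AE:
  assumes "b \<ge> 1" "AE x in lebesgue_on S. norm (f x) = norm (g x)"
  shows "Lp_norm (ennreal b) S f = Lp_norm (ennreal b) S g"
proof (rule antisym)
  show "Lp_norm (ennreal b) S f \<le> Lp_norm (ennreal b) S g"
    by (rule Lp_norm_mono_AE[OF assms(1)]) (use assms(2) in eventually_elim, simp)
  show "Lp_norm (ennreal b) S g \<le> Lp_norm (ennreal b) S f"
    by (rule Lp_norm_mono_AE[OF assms(1)]) (use assms(2) in eventually_elim, simp)
qed

text \<open>A quasi-triangle inequality with constant 4 is enough below, so Minkowski's inequality is not needed.\<close>

lemma Lp_norm_quasi_triangle: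
  assumes b: "b \<ge> 1" and [measurable]: "f \<in> borel_measurable (lebesgue_on S)" "g \<in> borel_measurable (lebesgue_on S)"
    and le: "AE x in lebesgue_on S. norm (h x) \<le> norm (f x) + norm (g x)"
  shows "Lp_norm (ennreal b) S h \<le> 4 * (Lp_norm (ennreal b) S f + Lp_norm (ennreal b) S g)"
proof (cases "pow_int b S f = \<infinity> \<or> pow_int b S g = \<infinity>")
  case True
  then have "Lp_norm (ennreal b) S f + Lp_norm (ennreal b) S g = \<infinity>"
    using b by (auto simp: Lp_norm_finite_exponent)
  then show ?thesis by (simp only:) (simp add: ennreal_mult_top)
next
  case False
  define A B where "A = enn2real (pow_int b S f)" and "B = enn2real (pow_int b S g)"
  have AB: "pow_int b S f = ennreal A" "pow_int b S g = ennreal B" "A \<ge> 0" "B \<ge> 0"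
    using False by (auto simp: A_def B_def less_top)
  \<comment> \<open>One factor 2 comes from this bound, via |f| + |g| \<le> 2 max; the other from
    the root of A + B \<le> 2 max. Together they give the constant 4.\<close>
  have pt: "norm (h x) powr b \<le> 2 powr b * (norm (f x) powr b + norm (g x) powr b)"
    if "norm (h x) \<le> norm (f x) + norm (g x)" for x
  proof -
    define m where "m = max (norm (f x)) (norm (g x))"
    have "norm (h x) \<le> 2 * m" using that by (auto simp: m_def)
    then have "norm (h x) powr b \<le> (2 * m) powr b" using b by (intro powr_mono2) auto
    also have "\<dots> = 2 powr b * m powr b" by (rule powr_mult)
    also have "m powr b \<le> norm (f x) powr b + norm (g x) powr b" by (auto simp: m_def max_def)
    finally show ?thesis by simp
  qed
  have "pow_int b S h \<le> (\<integral>\<^sup>+x. ennreal (2 powr b) * (ennreal (norm (f x) powr b) + ennreal (norm (g x) powr b)) \<partial>lebesgue_on S)"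
    unfolding pow_int_def
  proof (rule nn_integral_mono_AE)
    show "AE x in lebesgue_on S. ennreal (norm (h x) powr b) \<le> ennreal (2 powr b) * (ennreal (norm (f x) powr b) + ennreal (norm (g x) powr b))"
      using le
    proof eventually_elim
      fix x assume "norm (h x) \<le> norm (f x) + norm (g x)"
      from ennreal_leI[OF pt[OF this]]
      show "ennreal (norm (h x) powr b) \<le> ennreal (2 powr b) * (ennreal (norm (f x) powr b) + ennreal (norm (g x) powr b))"
        by (simp add: ennreal_mult)
    qed
  qed
  also have "\<dots> = ennreal (2 powr b) * (pow_int b S f + pow_int b S g)"
    unfolding pow_int_def by (subst nn_integral_cmult, measurable, subst nn_integral_add) auto
  also have "\<dots> = ennreal (2 powr b * (A + B))" using AB by (simp add: ennreal_mult)
  finally have le': "pow_int b S h \<le> ennreal (2 powr b * (A + B))" .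
  then have fin: "pow_int b S h \<noteq> \<infinity>" by (auto simp: top_unique)
  have "enn2real (pow_int b S h) \<le> 2 powr b * (A + B)"
    using le' AB(3,4) by (intro enn2real_leI) auto
  then have "enn2real (pow_int b S h) powr (1 / b) \<le> (2 powr b * (A + B)) powr (1 / b)"
    using b by (intro powr_mono2) auto
  also have "\<dots> = 2 * (A + B) powr (1 / b)" using AB(3,4) b by (simp add: powr_mult powr_powr)
  also have "(A + B) powr (1 / b) \<le> 2 * (A powr (1 / b) + B powr (1 / b))"
  proof -
    define m where "m = max A B"
    have "(A + B) powr (1 / b) \<le> (2 * m) powr (1 / b)" using b AB by (intro powr_mono2) (auto simp: m_def)
    also have "\<dots> = 2 powr (1 / b) * m powr (1 / b)" by (rule powr_mult)
    also have "\<dots> \<le> 2 * (A powr (1 / b) + B powr (1 / b))"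
    proof (rule mult_mono)
      have "2 powr (1 / b) \<le> 2 powr 1" using b by (intro powr_mono) auto
      then show "2 powr (1 / b) \<le> 2" by simp
      show "m powr (1 / b) \<le> A powr (1 / b) + B powr (1 / b)" by (auto simp: m_def max_def)
    qed auto
    finally show ?thesis .
  qed
  finally have "enn2real (pow_int b S h) powr (1 / b) \<le> 4 * (A powr (1 / b) + B powr (1 / b))" by simp
  then have "ennreal (enn2real (pow_int b S h) powr (1 / b)) \<le> ennreal (4 * (A powr (1 / b) + B powr (1 / b)))"
    by (rule ennreal_leI)
  also have "\<dots> = 4 * (ennreal (A powr (1 / b)) + ennreal (B powr (1 / b)))" by (simp add: ennreal_mult)
  finally show ?thesis using False fin b by (simp add: Lp_norm_finite_exponent A_def B_def)
qed

text \<open>Young's inequality for f / c and g / B, with B the norm of g. Its weights 1/a and 1/b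
  are both estimated by 1, whence the factor 2. A positive bound \<open>c\<close> in place of the
  norm of f avoids division by 0.\<close>

lemma Holder_Lp_norm:
  fixes f :: "'a::euclidean_space \<Rightarrow> real" and g :: "'a \<Rightarrow> 'b::euclidean_space"
  assumes "1 < p" "1 / p + 1 / q = 1" "c > 0" and f_le: "Lp_norm p S f \<le> ennreal c"
    and [measurable]: "f \<in> borel_measurable (lebesgue_on S)" "g \<in> borel_measurable (lebesgue_on S)"
  shows "(\<integral>\<^sup>+x. ennreal (\<bar>f x\<bar> * norm (g x)) \<partial>lebesgue_on S) \<le> ennreal (2 * c) * Lp_norm q S g"
  using assms(1,2)
proof (cases rule: conjugate_exponent_cases)
  case top
  have ae: "AE x in lebesgue_on S. ennreal \<bar>f x\<bar> \<le> ennreal c"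
    using esssup_AE[of "\<lambda>x. ennreal (norm (f x))" "lebesgue_on S"] f_le top
    by (auto simp: Lp_norm_def elim!: eventually_mono)
  have "(\<integral>\<^sup>+x. ennreal (\<bar>f x\<bar> * norm (g x)) \<partial>lebesgue_on S) \<le> (\<integral>\<^sup>+x. ennreal c * ennreal (norm (g x) powr 1) \<partial>lebesgue_on S)"
  proof (rule nn_integral_mono_AE, use ae in eventually_elim)
    fix x assume "ennreal \<bar>f x\<bar> \<le> ennreal c"
    then have "ennreal \<bar>f x\<bar> * ennreal (norm (g x)) \<le> ennreal c * ennreal (norm (g x))" by (rule mult_right_mono) simp
    then show "ennreal (\<bar>f x\<bar> * norm (g x)) \<le> ennreal c * ennreal (norm (g x) powr 1)"
      using \<open>c > 0\<close> by (simp add: ennreal_mult)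
  qed
  also have "\<dots> = ennreal c * pow_int 1 S g" unfolding pow_int_def by (rule nn_integral_cmult) measurable
  also have "pow_int 1 S g = Lp_norm q S g" using Lp_norm_finite_exponent[of 1 S g] top by (cases "pow_int 1 S g") auto
  also have "ennreal c * Lp_norm q S g \<le> ennreal (2 * c) * Lp_norm q S g"
    using \<open>c > 0\<close> by (intro mult_right_mono ennreal_leI) auto
  finally show ?thesis .
next
  case (fin a b)
  have f1: "Lp_norm p S f = (if pow_int a S f = \<infinity> then \<infinity> else ennreal (enn2real (pow_int a S f) powr (1 / a)))"
    using fin by (simp add: Lp_norm_finite_exponent)
  have ffin: "pow_int a S f \<noteq> \<infinity>" using f1 f_le by (auto simp: top_unique)
  define A where "A = enn2real (pow_int a S f)"
  have A: "pow_int a S f = ennreal A" "A \<ge> 0" using ffin by (auto simp: A_def less_top)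
  have "A powr (1 / a) \<le> c" using f1 f_le ffin \<open>c > 0\<close> by (simp add: A_def)
  then have "(A powr (1 / a)) powr a \<le> c powr a" using fin(3) by (intro powr_mono2) auto
  then have Ac: "A \<le> c powr a" using fin(3) A(2) by (simp add: powr_powr)
  show ?thesis
  proof (cases "pow_int b S g = \<infinity> \<or> pow_int b S g = 0")
    case True
    then show ?thesis
    proof
      assume "pow_int b S g = \<infinity>"
      then show ?thesis using fin \<open>c > 0\<close> by (simp add: Lp_norm_finite_exponent ennreal_mult_top)
    next
      assume "pow_int b S g = 0"
      then have "AE x in lebesgue_on S. ennreal (norm (g x) powr b) = 0"
        unfolding pow_int_def by (subst (asm) nn_integral_0_iff_AE) measurable
      then have "AE x in lebesgue_on S. ennreal (\<bar>f x\<bar> * norm (g x)) = 0" by eventually_elim simp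
      then have "(\<integral>\<^sup>+x. ennreal (\<bar>f x\<bar> * norm (g x)) \<partial>lebesgue_on S) = (\<integral>\<^sup>+x. 0 \<partial>lebesgue_on S)"
        by (rule nn_integral_cong_AE)
      then show ?thesis by simp
    qed
  next
    case False
    define I where "I = enn2real (pow_int b S g)"
    have I: "pow_int b S g = ennreal I" "I \<ge> 0" using False by (auto simp: I_def less_top)
    have I0: "I > 0" using I False by (cases "I = 0") auto
    define B where "B = I powr (1 / b)"
    have B: "B > 0" "B powr b = I" using I0 fin(4) by (auto simp: B_def powr_powr)
    have young: "\<bar>f x\<bar> * norm (g x) \<le> (c * B / c powr a) * \<bar>f x\<bar> powr a + (c * B / I) * norm (g x) powr b" for x
    proof -
      have "(\<bar>f x\<bar> / c) * (norm (g x) / B) \<le> (\<bar>f x\<bar> / c) powr a / a + (norm (g x) / B) powr b / b"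
        by (rule Youngs_inequality) (use fin \<open>c > 0\<close> B in auto)
      also have "\<dots> \<le> (\<bar>f x\<bar> / c) powr a / 1 + (norm (g x) / B) powr b / 1"
        using fin by (intro add_mono divide_left_mono) auto
      also have "\<dots> = \<bar>f x\<bar> powr a / c powr a + norm (g x) powr b / I"
        using \<open>c > 0\<close> B by (simp add: powr_divide)
      finally have "(c * B) * ((\<bar>f x\<bar> / c) * (norm (g x) / B)) \<le> (c * B) * (\<bar>f x\<bar> powr a / c powr a + norm (g x) powr b / I)"
        using \<open>c > 0\<close> B by (intro mult_left_mono) auto
      moreover have "(c * B) * ((\<bar>f x\<bar> / c) * (norm (g x) / B)) = \<bar>f x\<bar> * norm (g x)" using \<open>c > 0\<close> B by simp
      ultimately show ?thesis by (simp add: distrib_left)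
    qed
    have "(\<integral>\<^sup>+x. ennreal (\<bar>f x\<bar> * norm (g x)) \<partial>lebesgue_on S)
      \<le> (\<integral>\<^sup>+x. ennreal (c * B / c powr a) * ennreal (norm (f x) powr a) + ennreal (c * B / I) * ennreal (norm (g x) powr b) \<partial>lebesgue_on S)"
    proof (rule nn_integral_mono)
      fix x
      from ennreal_leI[OF young[of x]]
      show "ennreal (\<bar>f x\<bar> * norm (g x)) \<le> ennreal (c * B / c powr a) * ennreal (norm (f x) powr a) + ennreal (c * B / I) * ennreal (norm (g x) powr b)"
        using \<open>c > 0\<close> B I0 by (simp add: ennreal_mult[symmetric] ennreal_plus[symmetric] del: ennreal_plus)
    qed
    also have "\<dots> = ennreal (c * B / c powr a) * pow_int a S f + ennreal (c * B / I) * pow_int b S g"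
      unfolding pow_int_def by (subst nn_integral_add, measurable, subst nn_integral_cmult, measurable, subst nn_integral_cmult) auto
    also have "\<dots> = ennreal ((c * B / c powr a) * A + (c * B / I) * I)"
      unfolding A(1) I(1) using \<open>c > 0\<close> B I0 A(2) by (simp add: ennreal_mult[symmetric] ennreal_plus[symmetric] del: ennreal_plus)
    also have "\<dots> \<le> ennreal (2 * c * B)"
    proof (rule ennreal_leI)
      have "(c * B / c powr a) * A \<le> (c * B / c powr a) * c powr a" using Ac \<open>c > 0\<close> B by (intro mult_left_mono) auto
      moreover have "(c * B / c powr a) * c powr a = c * B" "(c * B / I) * I = c * B" using \<open>c > 0\<close> I0 by auto
      ultimately have "(c * B / c powr a) * A + (c * B / I) * I \<le> c * B + c * B" by (simp only: add_mono)
      moreover have "c * B + c * B = 2 * c * B" by simp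
      ultimately show "(c * B / c powr a) * A + (c * B / I) * I \<le> 2 * c * B" by (simp only:)
    qed
    also have "\<dots> = ennreal (2 * c) * Lp_norm q S g"
      using fin False \<open>c > 0\<close> by (simp add: Lp_norm_finite_exponent B_def I_def ennreal_mult)
    finally show ?thesis .
  qed
qed

subsection \<open>Weak derivatives\<close>

text \<open>Only the values of \<open>f\<close> on the compact support of \<open>\<psi>\<close> are
  seen, so local integrability suffices and the integrals over \<open>S\<close> and over the whole
  space coincide.\<close>

lemma integrable_lebesgue_on_test:
  fixes f :: "'a::euclidean_space \<Rightarrow> 'b::euclidean_space"
  assumes S: "open S" and f: "loc_integrable S f" and \<psi>: "test_fun S (\<psi>::'a \<Rightarrow> real)"
  shows "integrable lebesgue (\<lambda>x. \<psi> x *\<^sub>R f x)" "integrable (lebesgue_on S) (\<lambda>x. \<psi> x *\<^sub>R f x)"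
    "(LINT x|lebesgue_on S. \<psi> x *\<^sub>R f x) = (LINT x|lebesgue. \<psi> x *\<^sub>R f x)"
proof -
  obtain K where K: "compact K" "K \<subseteq> S" "\<And>x. x \<notin> K \<Longrightarrow> \<psi> x = 0" using test_funE[OF \<psi>] by blast
  obtain B where B: "B > 0" "\<And>x. norm (\<psi> x) \<le> B" using test_fun_bounded[OF \<psi>] by blast
  have fK: "integrable lebesgue (\<lambda>x. indicator K x *\<^sub>R f x)"
    using f K unfolding loc_integrable_def set_integrable_def by blast
  have \<psi>m: "\<psi> \<in> borel_measurable lebesgue"
    by (rule measurable_completion) (use test_fun_borel[OF \<psi>] in simp)
  have eq: "(\<lambda>x. \<psi> x *\<^sub>R f x) = (\<lambda>x. \<psi> x *\<^sub>R (indicator K x *\<^sub>R f x))"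
    using K(3) by (intro ext) (auto simp: indicator_def)
  show i: "integrable lebesgue (\<lambda>x. \<psi> x *\<^sub>R f x)"
    unfolding eq
  proof (rule Bochner_Integration.integrable_bound[OF integrable_scaleR_right[OF fK, of B]])
    show "(\<lambda>x. \<psi> x *\<^sub>R (indicator K x *\<^sub>R f x)) \<in> borel_measurable lebesgue"
      by (rule borel_measurable_scaleR[OF \<psi>m borel_measurable_integrable[OF fK]])
    have "norm (\<psi> x *\<^sub>R (indicator K x *\<^sub>R f x)) \<le> norm (B *\<^sub>R (indicator K x *\<^sub>R f x))" for x
      unfolding norm_scaleR using B(2)[of x] B(1) by (intro mult_right_mono) auto
    then show "AE x in lebesgue. norm (\<psi> x *\<^sub>R (indicator K x *\<^sub>R f x)) \<le> norm (B *\<^sub>R (indicator K x *\<^sub>R f x))"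
      by (rule AE_I2)
  qed
  have Sl: "S \<inter> space lebesgue \<in> sets lebesgue" using S by (simp add: lmeasurable_open)
  have eq2: "(\<lambda>x. indicator S x *\<^sub>R (\<psi> x *\<^sub>R f x)) = (\<lambda>x. \<psi> x *\<^sub>R f x)"
    using test_fun_outside[OF \<psi>] by (intro ext) (auto simp: indicator_def)
  show "integrable (lebesgue_on S) (\<lambda>x. \<psi> x *\<^sub>R f x)"
    by (subst integrable_restrict_space[OF Sl]) (simp only: eq2 i)
  show "(LINT x|lebesgue_on S. \<psi> x *\<^sub>R f x) = (LINT x|lebesgue. \<psi> x *\<^sub>R f x)"
    by (subst integral_restrict_space[OF Sl]) (simp only: eq2)
qed

lemma open_sets_lebesgue: "open S \<Longrightarrow> S \<in> sets lebesgue"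
  by simp

text \<open>The fundamental lemma, applied to each coordinate of the difference.\<close>

lemma weak_deriv_unique:
  fixes g g' :: "'a::euclidean_space \<Rightarrow> 'b::euclidean_space"
  assumes S: "open S" and g: "is_weak_deriv S b f g" and g': "is_weak_deriv S b f g'"
  shows "AE x in lebesgue_on S. g x = g' x"
proof -
  have lg: "loc_integrable S g" "loc_integrable S g'" using g g' by (auto simp: is_weak_deriv_def)
  have "AE x in lebesgue. x \<in> S \<longrightarrow> (g x - g' x) \<bullet> c = 0" for c
  proof (rule fundamental_lemma_real[OF S])
    show "integrable lebesgue (\<lambda>x. indicator K x * ((g x - g' x) \<bullet> c))" if K: "compact K" "K \<subseteq> S" for K
    proof -
      have "integrable lebesgue (\<lambda>x. indicator K x *\<^sub>R g x)" "integrable lebesgue (\<lambda>x. indicator K x *\<^sub>R g' x)"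
        using lg K unfolding loc_integrable_def set_integrable_def by blast+
      then have "integrable lebesgue (\<lambda>x. (indicator K x *\<^sub>R g x - indicator K x *\<^sub>R g' x) \<bullet> c)"
        by (intro integrable_inner_left Bochner_Integration.integrable_diff)
      then show ?thesis by (simp add: inner_diff_left right_diff_distrib)
    qed
    fix \<psi> :: "'a \<Rightarrow> real" assume \<psi>: "test_fun S \<psi>"
    have "\<psi> \<in> Cc_infinity S" by (rule test_fun_imp_Cc_infinity[OF \<psi>])
    then have "(LINT x|lebesgue_on S. \<psi> x *\<^sub>R g x) = (LINT x|lebesgue_on S. \<psi> x *\<^sub>R g' x)"
      using g g' unfolding is_weak_deriv_def by (metis neg_equal_iff_equal)
    then have e: "(LINT x|lebesgue. \<psi> x *\<^sub>R g x) = (LINT x|lebesgue. \<psi> x *\<^sub>R g' x)"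
      by (simp only: integrable_lebesgue_on_test(3)[OF S lg(1) \<psi>] integrable_lebesgue_on_test(3)[OF S lg(2) \<psi>])
    note i = integrable_lebesgue_on_test(1)[OF S lg(1) \<psi>] integrable_lebesgue_on_test(1)[OF S lg(2) \<psi>]
    have "(LINT x|lebesgue. \<psi> x * ((g x - g' x) \<bullet> c)) = (LINT x|lebesgue. (\<psi> x *\<^sub>R g x - \<psi> x *\<^sub>R g' x) \<bullet> c)"
      by (simp add: inner_diff_left right_diff_distrib)
    also have "\<dots> = (LINT x|lebesgue. \<psi> x *\<^sub>R g x - \<psi> x *\<^sub>R g' x) \<bullet> c"
      by (rule integral_inner_left) (intro Bochner_Integration.integrable_diff i)
    also have "\<dots> = 0" using i e by simp
    finally show "(LINT x|lebesgue. \<psi> x * ((g x - g' x) \<bullet> c)) = 0" .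
  qed
  then have "AE x in lebesgue. \<forall>c\<in>Basis. x \<in> S \<longrightarrow> (g x - g' x) \<bullet> c = 0"
    by (subst AE_ball_countable) (auto simp: countable_finite)
  then have "AE x in lebesgue. x \<in> S \<longrightarrow> g x = g' x"
  proof eventually_elim
    fix x assume a: "\<forall>c\<in>Basis. x \<in> S \<longrightarrow> (g x - g' x) \<bullet> c = 0"
    show "x \<in> S \<longrightarrow> g x = g' x"
    proof
      assume x: "x \<in> S"
      show "g x = g' x"
      proof (rule euclidean_eqI)
        fix c :: 'b assume c: "c \<in> Basis"
        have "(g x - g' x) \<bullet> c = 0" using a c x by blast
        then show "g x \<bullet> c = g' x \<bullet> c" by (simp add: inner_diff_left)
      qed
    qed
  qed
  then show ?thesis by (simp add: AE_lebesgue_on_iff open_sets_lebesgue[OF S])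
qed

lemma is_weak_deriv_diff:
  assumes S: "open S" and f: "is_weak_deriv S b f g" and f': "is_weak_deriv S b f' g'"
  shows "is_weak_deriv S b (\<lambda>x. f x - f' x) (\<lambda>x. g x - g' x)"
proof -
  have li: "loc_integrable S f" "loc_integrable S f'" "loc_integrable S g" "loc_integrable S g'"
    using f f' by (auto simp: is_weak_deriv_def)
  have l: "loc_integrable S (\<lambda>x. f x - f' x)" "loc_integrable S (\<lambda>x. g x - g' x)"
    using li unfolding loc_integrable_def by (auto intro!: set_integral_diff(1))
  have "(LINT x|lebesgue_on S. dderiv \<psi> b x *\<^sub>R (f x - f' x)) = - (LINT x|lebesgue_on S. \<psi> x *\<^sub>R (g x - g' x))"
    if \<psi>: "\<psi> \<in> Cc_infinity S" for \<psi> :: "_ \<Rightarrow> real"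
  proof -
    \<comment> \<open>Elements of \<open>Cc_infinity\<close> are arbitrary off \<open>S\<close>; the
      zero extension has the same values and derivatives on the open set \<open>S\<close> and is a
      test function.\<close>
    define \<eta> where "\<eta> = (\<lambda>x. if x \<in> S then \<psi> x else 0)"
    have \<eta>: "test_fun S \<eta>" unfolding \<eta>_def by (rule Cc_infinity_imp_test_fun[OF \<psi> S])
    have d\<eta>: "test_fun S (\<lambda>x. dderiv \<eta> b x)" by (rule test_fun_dderiv[OF \<eta>])
    have eq: "dderiv \<eta> b x = dderiv \<psi> b x" if "x \<in> S" for x
      using frechet_derivative_transform_within_open[OF smooth_differentiable[OF test_fun_smooth[OF \<eta>]] S that, of \<psi>]
      by (simp add: \<eta>_def)
    have sp: "space (lebesgue_on S) = S" by simp
    have c: "(LINT x|lebesgue_on S. dderiv \<psi> b x *\<^sub>R k x) = (LINT x|lebesgue_on S. dderiv \<eta> b x *\<^sub>R k x)"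
      "(LINT x|lebesgue_on S. \<psi> x *\<^sub>R k x) = (LINT x|lebesgue_on S. \<eta> x *\<^sub>R k x)" for k :: "_ \<Rightarrow> 'b"
      by (rule Bochner_Integration.integral_cong, rule refl, simp add: eq)
        (rule Bochner_Integration.integral_cong, rule refl, simp add: \<eta>_def)
    have e: "(LINT x|lebesgue_on S. dderiv \<psi> b x *\<^sub>R f x) = - (LINT x|lebesgue_on S. \<psi> x *\<^sub>R g x)"
      "(LINT x|lebesgue_on S. dderiv \<psi> b x *\<^sub>R f' x) = - (LINT x|lebesgue_on S. \<psi> x *\<^sub>R g' x)"
      using f f' \<psi> unfolding is_weak_deriv_def by blast+
    show ?thesis
      using e unfolding c
      by (simp add: scaleR_diff_right integrable_lebesgue_on_test(2)[OF S li(1) d\<eta>] integrable_lebesgue_on_test(2)[OF S li(2) d\<eta>]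
          integrable_lebesgue_on_test(2)[OF S li(3) \<eta>] integrable_lebesgue_on_test(2)[OF S li(4) \<eta>])
  qed
  then show ?thesis using l unfolding is_weak_deriv_def by blast
qed

lemma test_fun_loc_integrable: "test_fun UNIV f \<Longrightarrow> loc_integrable S f"
  unfolding loc_integrable_def set_integrable_def
proof (intro allI impI)
  fix K :: "'a set" assume f: "test_fun UNIV f" and K: "compact K"
  have "integrable lborel f" by (rule test_fun_integrable[OF f])
  then have "integrable lebesgue f" by (simp add: integrable_completion borel_measurable_integrable)
  then show "integrable lebesgue (\<lambda>x. indicator K x *\<^sub>R f x)"
    by (rule integrable_mult_indicator[rotated]) (use K in \<open>simp add: compact_imp_closed\<close>)
qed

lemma test_fun_weak_deriv:
  assumes S: "open S" and \<phi>: "test_fun S \<phi>"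
  shows "is_weak_deriv S b \<phi> (\<lambda>x. dderiv \<phi> b x)"
proof -
  have \<phi>U: "test_fun UNIV \<phi>" by (rule test_fun_mono[OF \<phi>]) simp
  have l: "loc_integrable S \<phi>" "loc_integrable S (\<lambda>x. dderiv \<phi> b x)"
    by (rule test_fun_loc_integrable, rule \<phi>U) (rule test_fun_loc_integrable, rule test_fun_dderiv[OF \<phi>U])
  have "(LINT x|lebesgue_on S. dderiv \<psi> b x *\<^sub>R \<phi> x) = - (LINT x|lebesgue_on S. \<psi> x *\<^sub>R dderiv \<phi> b x)"
    if \<psi>: "\<psi> \<in> Cc_infinity S" for \<psi> :: "_ \<Rightarrow> real"
  proof -
    define \<eta> where "\<eta> = (\<lambda>x. if x \<in> S then \<psi> x else 0)"
    have \<eta>: "test_fun S \<eta>" unfolding \<eta>_def by (rule Cc_infinity_imp_test_fun[OF \<psi> S])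
    have d\<eta>: "test_fun S (\<lambda>x. dderiv \<eta> b x)" by (rule test_fun_dderiv[OF \<eta>])
    have eq: "dderiv \<eta> b x = dderiv \<psi> b x" if "x \<in> S" for x
      using frechet_derivative_transform_within_open[OF smooth_differentiable[OF test_fun_smooth[OF \<eta>]] S that, of \<psi>]
      by (simp add: \<eta>_def)
    have "(LINT x|lebesgue_on S. dderiv \<psi> b x *\<^sub>R \<phi> x) = (LINT x|lebesgue_on S. dderiv \<eta> b x *\<^sub>R \<phi> x)"
      by (rule Bochner_Integration.integral_cong) (simp_all add: eq)
    also have "\<dots> = (LINT x|lebesgue. dderiv \<eta> b x *\<^sub>R \<phi> x)" by (rule integrable_lebesgue_on_test(3)[OF S l(1) d\<eta>])
    also have "\<dots> = (\<integral>x. dderiv \<eta> b x *\<^sub>R \<phi> x \<partial>lborel)"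
      by (rule integral_completion) (use test_fun_borel[OF test_fun_scaleR_left[OF d\<eta> test_fun_smooth[OF \<phi>]]] in simp)
    also have "\<dots> = - (\<integral>x. \<eta> x *\<^sub>R dderiv \<phi> b x \<partial>lborel)" by (rule integral_by_parts[OF \<eta> test_fun_smooth[OF \<phi>]])
    also have "(\<integral>x. \<eta> x *\<^sub>R dderiv \<phi> b x \<partial>lborel) = (LINT x|lebesgue. \<eta> x *\<^sub>R dderiv \<phi> b x)"
      by (rule integral_completion[symmetric])
        (use test_fun_borel[OF test_fun_scaleR_left[OF \<eta> smooth_dderiv[OF test_fun_smooth[OF \<phi>]]]] in simp)
    also have "\<dots> = (LINT x|lebesgue_on S. \<eta> x *\<^sub>R dderiv \<phi> b x)"
      by (rule integrable_lebesgue_on_test(3)[OF S l(2) \<eta>, symmetric])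
    also have "\<dots> = (LINT x|lebesgue_on S. \<psi> x *\<^sub>R dderiv \<phi> b x)"
      by (rule Bochner_Integration.integral_cong) (simp_all add: \<eta>_def)
    finally show ?thesis .
  qed
  then show ?thesis using l unfolding is_weak_deriv_def by blast
qed

text \<open>The qualitative part of \<open>W1\<close>: weak derivatives exist and are measurable.
  \<open>W1_norm\<close> of a difference can thus be estimated before it is known to be
  finite.\<close>

definition weakly_diff :: "'a::euclidean_space set \<Rightarrow> ('a \<Rightarrow> 'b::euclidean_space) set" where
  "weakly_diff S = {f \<in> borel_measurable (lebesgue_on S).
     \<forall>b\<in>Basis. \<exists>g\<in>borel_measurable (lebesgue_on S). is_weak_deriv S b f g}"

lemma W1_subset_weakly_diff: "W1 q S \<subseteq> weakly_diff S"
  unfolding W1_def weakly_diff_def Lp_space_def by blast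

lemma weakly_diff_diff:
  assumes "open S" "f \<in> weakly_diff S" "f' \<in> weakly_diff S"
  shows "(\<lambda>x. f x - f' x) \<in> weakly_diff S"
proof -
  have "\<exists>k\<in>borel_measurable (lebesgue_on S). is_weak_deriv S b (\<lambda>x. f x - f' x) k" if b: "b \<in> Basis" for b
  proof -
    obtain g where g: "g \<in> borel_measurable (lebesgue_on S)" "is_weak_deriv S b f g"
      using assms(2) b unfolding weakly_diff_def by blast
    obtain g' where g': "g' \<in> borel_measurable (lebesgue_on S)" "is_weak_deriv S b f' g'"
      using assms(3) b unfolding weakly_diff_def by blast
    have "(\<lambda>x. g x - g' x) \<in> borel_measurable (lebesgue_on S)" using g(1) g'(1) by measurable
    then show ?thesis using is_weak_deriv_diff[OF assms(1) g(2) g'(2)] by blast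
  qed
  moreover have "(\<lambda>x. f x - f' x) \<in> borel_measurable (lebesgue_on S)"
    using assms(2,3) unfolding weakly_diff_def by auto
  ultimately show ?thesis unfolding weakly_diff_def by blast
qed

lemma test_fun_lebesgue_on: "test_fun S' f \<Longrightarrow> f \<in> borel_measurable (lebesgue_on S)"
  by (rule borel_imp_lebesgue_on[OF test_fun_borel])

lemma test_fun_weakly_diff: "open S \<Longrightarrow> test_fun S \<phi> \<Longrightarrow> \<phi> \<in> weakly_diff S"
  unfolding weakly_diff_def
  using test_fun_weak_deriv[of S \<phi>] test_fun_lebesgue_on[of S \<phi> S] test_fun_lebesgue_on[OF test_fun_dderiv[of S \<phi>], of _ S]
  by blast

text \<open>\<open>weak_deriv\<close> is an arbitrary choice; uniqueness almost everywhere lets an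
  explicit derivative replace it inside a norm.\<close>

lemma Lp_norm_weak_deriv:
  assumes S: "open S" and b: "r \<ge> 1" and g: "is_weak_deriv S b f g"
  shows "Lp_norm (ennreal r) S (weak_deriv S b f) = Lp_norm (ennreal r) S g"
proof (rule Lp_norm_cong_AE[OF b])
  have "is_weak_deriv S b f (weak_deriv S b f)" unfolding weak_deriv_def by (rule someI[of "is_weak_deriv S b f", OF g])
  from weak_deriv_unique[OF S this g]
  show "AE x in lebesgue_on S. norm (weak_deriv S b f x) = norm (g x)" by eventually_elim simp
qed

lemma W1_norm_test:
  assumes "open S" "r \<ge> 1" "test_fun S \<phi>"
  shows "W1_norm (ennreal r) S \<phi> = Lp_norm (ennreal r) S \<phi> + (\<Sum>b\<in>Basis. Lp_norm (ennreal r) S (\<lambda>x. dderiv \<phi> b x))"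
  unfolding W1_norm_def by (simp add: Lp_norm_weak_deriv[OF assms(1,2) test_fun_weak_deriv[OF assms(1,3)]])

lemma W1_norm_diff:
  fixes f f' :: "'a::euclidean_space \<Rightarrow> 'b::euclidean_space"
  assumes S: "open S" and r: "r \<ge> 1" and f: "f \<in> weakly_diff S" and f': "f' \<in> weakly_diff S"
  shows "W1_norm (ennreal r) S (\<lambda>x. f x - f' x) \<le> 4 * (W1_norm (ennreal r) S f + W1_norm (ennreal r) S f')"
proof -
  let ?N = "Lp_norm (ennreal r) S"
  have "?N (\<lambda>x. f x - f' x) \<le> 4 * (?N f + ?N f')"
    by (rule Lp_norm_quasi_triangle[OF r])
      (use f f' in \<open>auto simp: weakly_diff_def intro!: AE_I2 norm_triangle_ineq4\<close>)
  moreover have "?N (weak_deriv S b (\<lambda>x. f x - f' x)) \<le> 4 * (?N (weak_deriv S b f) + ?N (weak_deriv S b f'))"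
    if b: "b \<in> Basis" for b
  proof -
    obtain g where g: "g \<in> borel_measurable (lebesgue_on S)" "is_weak_deriv S b f g"
      using f b unfolding weakly_diff_def by blast
    obtain g' where g': "g' \<in> borel_measurable (lebesgue_on S)" "is_weak_deriv S b f' g'"
      using f' b unfolding weakly_diff_def by blast
    have "?N (\<lambda>x. g x - g' x) \<le> 4 * (?N g + ?N g')"
      by (rule Lp_norm_quasi_triangle[OF r g(1) g'(1)]) (rule AE_I2, rule norm_triangle_ineq4)
    then show ?thesis
      by (simp only: Lp_norm_weak_deriv[OF S r is_weak_deriv_diff[OF S g(2) g'(2)]]
        Lp_norm_weak_deriv[OF S r g(2)] Lp_norm_weak_deriv[OF S r g'(2)])
  qed
  ultimately have "W1_norm (ennreal r) S (\<lambda>x. f x - f' x)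
    \<le> 4 * (?N f + ?N f') + (\<Sum>b\<in>Basis. 4 * (?N (weak_deriv S b f) + ?N (weak_deriv S b f')))"
    unfolding W1_norm_def by (intro add_mono sum_mono)
  also have "\<dots> = 4 * (W1_norm (ennreal r) S f + W1_norm (ennreal r) S f')"
    unfolding W1_norm_def by (simp add: sum_distrib_left[symmetric] sum.distrib distrib_left algebra_simps)
  finally show ?thesis .
qed

text \<open>Functions that agree on \<open>S\<close> have literally the same set of weak
  derivatives, so the choice operator picks the same one for both.\<close>

lemma W1_norm_cong:
  fixes f g :: "'a::euclidean_space \<Rightarrow> 'b::euclidean_space"
  assumes r: "r \<ge> 1" and eq: "\<And>x. x \<in> S \<Longrightarrow> f x = g x"
  shows "W1_norm (ennreal r) S f = W1_norm (ennreal r) S g" "f \<in> weakly_diff S \<longleftrightarrow> g \<in> weakly_diff S"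
proof -
  have "is_weak_deriv S b f k \<longleftrightarrow> is_weak_deriv S b g k" for b k
  proof -
    have "f absolutely_integrable_on K \<longleftrightarrow> g absolutely_integrable_on K" if "K \<subseteq> S" for K
      unfolding set_integrable_def
      by (rule Bochner_Integration.integrable_cong) (use that eq in \<open>auto simp: indicator_def\<close>)
    then have "loc_integrable S f \<longleftrightarrow> loc_integrable S g" unfolding loc_integrable_def by blast
    moreover have "(LINT x|lebesgue_on S. dderiv \<psi> b x *\<^sub>R f x) = (LINT x|lebesgue_on S. dderiv \<psi> b x *\<^sub>R g x)" for \<psi> :: "'a \<Rightarrow> real"
      by (rule Bochner_Integration.integral_cong) (use eq in auto)
    ultimately show ?thesis unfolding is_weak_deriv_def by simp
  qed
  then have *: "is_weak_deriv S b f = is_weak_deriv S b g" for b by blast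
  then have "weak_deriv S b f = weak_deriv S b g" for b unfolding weak_deriv_def by simp
  moreover have "Lp_norm (ennreal r) S f = Lp_norm (ennreal r) S g"
    by (rule Lp_norm_cong_AE[OF r]) (rule AE_I2, use eq in simp)
  ultimately show "W1_norm (ennreal r) S f = W1_norm (ennreal r) S g" by (simp add: W1_norm_def)
  have "f \<in> borel_measurable (lebesgue_on S) \<longleftrightarrow> g \<in> borel_measurable (lebesgue_on S)"
    by (rule measurable_cong) (use eq in auto)
  then show "f \<in> weakly_diff S \<longleftrightarrow> g \<in> weakly_diff S" by (simp add: weakly_diff_def *)
qed

section \<open>The commutator defect of a Sobolev velocity\<close>

text \<open>One power of \<epsilon> more than for a normalised ball indicator, so the total mass is
  of order 1/\<epsilon>: the size of the derivative of a mollifier.\<close>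

definition kern :: "real \<Rightarrow> 'a::euclidean_space \<Rightarrow> real" where
  "kern \<epsilon> z = indicator (cball 0 \<epsilon>) z / \<epsilon> ^ (DIM('a) + 1)"

definition comm_defect :: "real \<Rightarrow> ('a::euclidean_space \<Rightarrow> real) \<Rightarrow> ('a \<Rightarrow> 'a) \<Rightarrow> ennreal" where
  "comm_defect \<epsilon> \<rho> w = (\<integral>\<^sup>+y. \<integral>\<^sup>+x. ennreal (\<bar>\<rho> x - \<rho> y\<bar> * norm (w x - w y) * kern \<epsilon> (y - x)) \<partial>lborel \<partial>lborel)"

definition grad_norm :: "real \<Rightarrow> 'a::euclidean_space set \<Rightarrow> ('a \<Rightarrow> 'b::euclidean_space) \<Rightarrow> ennreal" where
  "grad_norm r \<Omega> \<phi> = (\<Sum>b\<in>Basis. Lp_norm (ennreal r) \<Omega> (\<lambda>x. dderiv \<phi> b x))"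

lemma kern_nonneg: "\<epsilon> > 0 \<Longrightarrow> kern \<epsilon> z \<ge> 0"
  by (simp add: kern_def)

lemma kern_borel[measurable]: "kern \<epsilon> \<in> borel_measurable borel"
  unfolding kern_def[abs_def] by measurable

lemma nn_integral_kern:
  assumes e: "\<epsilon> > 0"
  shows "(\<integral>\<^sup>+z. ennreal (kern \<epsilon> (z::'a::euclidean_space)) \<partial>lborel) = ennreal (unit_ball_vol DIM('a) / \<epsilon>)"
proof -
  have "(\<integral>\<^sup>+z. ennreal (kern \<epsilon> (z::'a)) \<partial>lborel) = (\<integral>\<^sup>+z. ennreal (1 / \<epsilon> ^ (DIM('a) + 1)) * indicator (cball 0 \<epsilon>) (z::'a) \<partial>lborel)"
    by (intro nn_integral_cong) (simp add: kern_def indicator_def)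
  also have "\<dots> = ennreal (1 / \<epsilon> ^ (DIM('a) + 1)) * emeasure lborel (cball (0::'a) \<epsilon>)"
    by (rule nn_integral_cmult_indicator) simp
  also have "\<dots> = ennreal (1 / \<epsilon> ^ (DIM('a) + 1)) * ennreal (unit_ball_vol DIM('a) * \<epsilon> ^ DIM('a))"
    using e by (simp add: emeasure_cball)
  also have "\<dots> = ennreal (1 / \<epsilon> ^ (DIM('a) + 1) * (unit_ball_vol DIM('a) * \<epsilon> ^ DIM('a)))"
    using e by (intro ennreal_mult[symmetric]) auto
  also have "1 / \<epsilon> ^ (DIM('a) + 1) * (unit_ball_vol DIM('a) * \<epsilon> ^ DIM('a)) = unit_ball_vol DIM('a) / \<epsilon>"
    using e by (simp add: field_simps)
  finally show ?thesis .
qed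

text \<open>A factor \<epsilon> gained from increments over |z| \<le> \<epsilon> cancels the mass of
  the kernel, which leaves a bound uniform in \<epsilon>.\<close>

lemma nn_integral_kern_mult:
  fixes F :: "'a::euclidean_space \<Rightarrow> ennreal"
  assumes e: "\<epsilon> > 0" and F: "\<And>z. norm z \<le> \<epsilon> \<Longrightarrow> F z \<le> ennreal (a * \<epsilon>) * B" and "a \<ge> 0"
  shows "(\<integral>\<^sup>+z. ennreal (kern \<epsilon> z) * F z \<partial>lborel) \<le> ennreal (a * unit_ball_vol DIM('a)) * B"
proof -
  have "(\<integral>\<^sup>+z. ennreal (kern \<epsilon> z) * F z \<partial>lborel) \<le> (\<integral>\<^sup>+z. ennreal (kern \<epsilon> (z::'a)) * (ennreal (a * \<epsilon>) * B) \<partial>lborel)"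
  proof (rule nn_integral_mono)
    fix z :: 'a
    show "ennreal (kern \<epsilon> z) * F z \<le> ennreal (kern \<epsilon> z) * (ennreal (a * \<epsilon>) * B)"
    proof (cases "norm z \<le> \<epsilon>")
      case True
      then show ?thesis by (intro mult_left_mono F) auto
    qed (simp add: kern_def)
  qed
  also have "\<dots> = (\<integral>\<^sup>+z. ennreal (kern \<epsilon> (z::'a)) \<partial>lborel) * (ennreal (a * \<epsilon>) * B)" by (rule nn_integral_multc) simp
  also have "\<dots> = ennreal (unit_ball_vol DIM('a) / \<epsilon>) * (ennreal (a * \<epsilon>) * B)" by (simp only: nn_integral_kern[OF e])
  also have "\<dots> = ennreal (unit_ball_vol DIM('a) / \<epsilon> * (a * \<epsilon>)) * B"
    using e \<open>a \<ge> 0\<close> by (subst mult.assoc[symmetric], subst ennreal_mult) auto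
  also have "unit_ball_vol DIM('a) / \<epsilon> * (a * \<epsilon>) = a * unit_ball_vol DIM('a)" using e by simp
  finally show ?thesis .
qed

text \<open>With y = x + z the defect becomes a superposition over shifts z, and each shift can be
  estimated by duality on its own.\<close>

lemma comm_defect_eq:
  fixes w :: "'a::euclidean_space \<Rightarrow> 'a"
  assumes [measurable]: "\<rho> \<in> borel_measurable borel" "w \<in> borel_measurable borel" and e: "\<epsilon> > 0"
  shows "comm_defect \<epsilon> \<rho> w = (\<integral>\<^sup>+z. ennreal (kern \<epsilon> z) *
    (\<integral>\<^sup>+x. ennreal (\<bar>\<rho> x - \<rho> (x + z)\<bar> * norm (w x - w (x + z))) \<partial>lborel) \<partial>lborel)"
proof -
  let ?f = "\<lambda>x y. ennreal (\<bar>\<rho> x - \<rho> y\<bar> * norm (w x - w y) * kern \<epsilon> (y - x))"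
  have "comm_defect \<epsilon> \<rho> w = (\<integral>\<^sup>+x. \<integral>\<^sup>+y. ?f x y \<partial>lborel \<partial>lborel)"
    unfolding comm_defect_def by (rule lborel_pair.Fubini') measurable
  also have "\<dots> = (\<integral>\<^sup>+x. \<integral>\<^sup>+z. ?f x (z + x) \<partial>lborel \<partial>lborel)"
  proof (rule nn_integral_cong)
    fix x
    show "(\<integral>\<^sup>+y. ?f x y \<partial>lborel) = (\<integral>\<^sup>+z. ?f x (z + x) \<partial>lborel)"
      by (rule nn_integral_lborel_translate[symmetric]) measurable
  qed
  also have "\<dots> = (\<integral>\<^sup>+z. \<integral>\<^sup>+x. ?f x (z + x) \<partial>lborel \<partial>lborel)"
    by (rule lborel_pair.Fubini') measurable
  also have "\<dots> = (\<integral>\<^sup>+z. ennreal (kern \<epsilon> z) *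
    (\<integral>\<^sup>+x. ennreal (\<bar>\<rho> x - \<rho> (x + z)\<bar> * norm (w x - w (x + z))) \<partial>lborel) \<partial>lborel)"
  proof (rule nn_integral_cong)
    fix z
    have "(\<integral>\<^sup>+x. ?f x (z + x) \<partial>lborel) = (\<integral>\<^sup>+x. ennreal (kern \<epsilon> z) * ennreal (\<bar>\<rho> x - \<rho> (x + z)\<bar> * norm (w x - w (x + z))) \<partial>lborel)"
      using kern_nonneg[OF e, of z] by (intro nn_integral_cong) (simp add: ennreal_mult[symmetric] mult_ac add.commute)
    also have "\<dots> = ennreal (kern \<epsilon> z) * (\<integral>\<^sup>+x. ennreal (\<bar>\<rho> x - \<rho> (x + z)\<bar> * norm (w x - w (x + z))) \<partial>lborel)"
      by (rule nn_integral_cmult) measurable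
    finally show "(\<integral>\<^sup>+x. ?f x (z + x) \<partial>lborel) = \<dots>" .
  qed
  finally show ?thesis .
qed

text \<open>The increment is written as an integral over the segment and not bounded by a supremum,
  because the gradient is later controlled only in an integral norm.\<close>

lemma norm_increment_le:
  fixes \<phi> :: "'a::euclidean_space \<Rightarrow> 'b::euclidean_space"
  assumes \<phi>: "smooth \<phi>"
  shows "ennreal (norm (\<phi> (x + z) - \<phi> x))
    \<le> ennreal (norm z) * (\<integral>\<^sup>+\<tau>. indicator {0..1} \<tau> * (\<Sum>b\<in>Basis. ennreal (norm (dderiv \<phi> b (x + \<tau> *\<^sub>R z)))) \<partial>lborel)"
proof -
  have der: "((\<lambda>\<tau>. \<phi> (x + \<tau> *\<^sub>R z)) has_vector_derivative dderiv \<phi> z (x + \<tau> *\<^sub>R z)) (at \<tau> within {0..1})" for \<tau> :: real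
  proof -
    have "((\<lambda>\<tau>. x + \<tau> *\<^sub>R z) has_derivative (\<lambda>h. h *\<^sub>R z)) (at \<tau>)" by (auto intro!: derivative_eq_intros)
    then have "((\<lambda>\<tau>. \<phi> (x + \<tau> *\<^sub>R z)) has_derivative (\<lambda>h. dderiv \<phi> (h *\<^sub>R z) (x + \<tau> *\<^sub>R z))) (at \<tau>)"
      by (rule has_derivative_compose) (rule smooth_has_derivative[OF \<phi>])
    then have "((\<lambda>\<tau>. \<phi> (x + \<tau> *\<^sub>R z)) has_vector_derivative dderiv \<phi> z (x + \<tau> *\<^sub>R z)) (at \<tau>)"
      unfolding has_vector_derivative_def linear_scale[OF smooth_dderiv_linear[OF \<phi>]] .
    then show ?thesis by (rule has_vector_derivative_at_within)
  qed
  have cont: "continuous_on {0..1} (\<lambda>\<tau>::real. dderiv \<phi> z (x + \<tau> *\<^sub>R z))"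
    by (rule continuous_on_compose2[OF smooth_continuous[OF smooth_dderiv[OF \<phi>], of UNIV]]) (auto intro!: continuous_intros)
  have ftc: "has_bochner_integral lborel (\<lambda>\<tau>. indicator {0..1} \<tau> *\<^sub>R dderiv \<phi> z (x + \<tau> *\<^sub>R z)) (\<phi> (x + 1 *\<^sub>R z) - \<phi> (x + 0 *\<^sub>R z))"
    by (rule has_bochner_integral_FTC_Icc[OF _ der cont]) auto
  have "ennreal (norm (\<phi> (x + z) - \<phi> x)) \<le> (\<integral>\<^sup>+\<tau>. ennreal (norm (indicator {0..1} \<tau> *\<^sub>R dderiv \<phi> z (x + \<tau> *\<^sub>R z))) \<partial>lborel)"
    using integral_norm_bound_ennreal[OF integrable.intros[OF ftc], unfolded has_bochner_integral_integral_eq[OF ftc]]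
    by simp
  also have "\<dots> \<le> (\<integral>\<^sup>+\<tau>. ennreal (norm z) * (indicator {0..1} \<tau> * (\<Sum>b\<in>Basis. ennreal (norm (dderiv \<phi> b (x + \<tau> *\<^sub>R z))))) \<partial>lborel)"
  proof (rule nn_integral_mono)
    fix \<tau> :: real
    have "norm (dderiv \<phi> z (x + \<tau> *\<^sub>R z)) = norm (\<Sum>b\<in>Basis. (z \<bullet> b) *\<^sub>R dderiv \<phi> b (x + \<tau> *\<^sub>R z))"
      using dderiv_basis_sum[OF smooth_differentiable[OF \<phi>, of "x + \<tau> *\<^sub>R z"], of z] by metis
    also have "\<dots> \<le> (\<Sum>b\<in>Basis. norm z * norm (dderiv \<phi> b (x + \<tau> *\<^sub>R z)))"
      by (rule sum_norm_le) (auto intro!: mult_right_mono Basis_le_norm)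
    finally have "ennreal (norm (dderiv \<phi> z (x + \<tau> *\<^sub>R z))) \<le> ennreal (norm z * (\<Sum>b\<in>Basis. norm (dderiv \<phi> b (x + \<tau> *\<^sub>R z))))"
      by (intro ennreal_leI) (simp add: sum_distrib_left)
    also have "\<dots> = ennreal (norm z) * (\<Sum>b\<in>Basis. ennreal (norm (dderiv \<phi> b (x + \<tau> *\<^sub>R z))))"
      by (simp add: ennreal_mult sum_nonneg sum_ennreal)
    finally show "ennreal (norm (indicator {0..1} \<tau> *\<^sub>R dderiv \<phi> z (x + \<tau> *\<^sub>R z)))
      \<le> ennreal (norm z) * (indicator {0..1} \<tau> * (\<Sum>b\<in>Basis. ennreal (norm (dderiv \<phi> b (x + \<tau> *\<^sub>R z)))))"
      by (simp add: indicator_def)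
  qed
  also have "\<dots> = ennreal (norm z) * (\<integral>\<^sup>+\<tau>. indicator {0..1} \<tau> * (\<Sum>b\<in>Basis. ennreal (norm (dderiv \<phi> b (x + \<tau> *\<^sub>R z)))) \<partial>lborel)"
  proof (rule nn_integral_cmult)
    have "(\<lambda>\<tau>. dderiv \<phi> b (x + \<tau> *\<^sub>R z)) \<in> borel_measurable borel" for b
      by (rule dderiv_measurable[OF \<phi>]) measurable
    then show "(\<lambda>\<tau>. indicator {0..1} \<tau> * (\<Sum>b\<in>Basis. ennreal (norm (dderiv \<phi> b (x + \<tau> *\<^sub>R z))))) \<in> borel_measurable lborel"
      by measurable
  qed
  finally show ?thesis .
qed

text \<open>Duality is kept in the abstract form of a pairing with arbitrary translates of functions
  supported in \<open>\<Omega>\<close>, which hides whether the exponent of the density is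
  finite.\<close>

locale density_pairing =
  fixes \<Omega> :: "'a::euclidean_space set" and r c :: real and \<rho> :: "'a \<Rightarrow> real"
  assumes open_dom: "open \<Omega>" and r_ge_1: "r \<ge> 1" and c_nonneg: "c \<ge> 0" and \<rho>_int: "integrable lborel \<rho>"
    and pairing: "\<And>(g :: 'a \<Rightarrow> real) a. g \<in> borel_measurable borel \<Longrightarrow> (\<And>x. x \<notin> \<Omega> \<Longrightarrow> g x = 0) \<Longrightarrow>
      (\<integral>\<^sup>+x. ennreal (\<bar>\<rho> x\<bar> * \<bar>g (x + a)\<bar>) \<partial>lborel) \<le> ennreal c * Lp_norm (ennreal r) \<Omega> g"
begin

lemma \<rho>_borel[measurable]: "\<rho> \<in> borel_measurable borel"
  using \<rho>_int by auto

lemma pairing_norm: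
  fixes g :: "'a \<Rightarrow> 'b::euclidean_space"
  assumes "g \<in> borel_measurable borel" "\<And>x. x \<notin> \<Omega> \<Longrightarrow> g x = 0"
  shows "(\<integral>\<^sup>+x. ennreal (\<bar>\<rho> x\<bar> * norm (g (x + a))) \<partial>lborel) \<le> ennreal c * Lp_norm (ennreal r) \<Omega> g"
proof -
  have "(\<integral>\<^sup>+x. ennreal (\<bar>\<rho> x\<bar> * \<bar>norm (g (x + a))\<bar>) \<partial>lborel) \<le> ennreal c * Lp_norm (ennreal r) \<Omega> (\<lambda>x. norm (g x))"
    by (rule pairing) (use assms in auto)
  also have "Lp_norm (ennreal r) \<Omega> (\<lambda>x. norm (g x)) = Lp_norm (ennreal r) \<Omega> g"
    by (rule Lp_norm_cong_AE[OF r_ge_1]) simp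
  finally show ?thesis by simp
qed

text \<open>By Fubini the average over the segment comes outside; at each \<tau> the pairing with
  the shift \<tau> z gives the norm of the gradient. The factor |z| is the gain that the kernel
  calls for.\<close>

lemma pairing_increment:
  fixes \<phi> :: "'a \<Rightarrow> 'a"
  assumes \<phi>: "test_fun \<Omega> \<phi>"
  shows "(\<integral>\<^sup>+x. ennreal (\<bar>\<rho> x\<bar> * norm (\<phi> (x + z) - \<phi> x)) \<partial>lborel) \<le> ennreal (norm z) * (ennreal c * grad_norm r \<Omega> \<phi>)"
proof -
  have sm: "smooth \<phi>" by (rule test_fun_smooth[OF \<phi>])
  have [measurable]: "(\<lambda>x. dderiv \<phi> b x) \<in> borel_measurable borel" for b
    by (rule test_fun_borel[OF test_fun_dderiv[OF \<phi>]])
  let ?g = "\<lambda>x \<tau>. \<Sum>b\<in>Basis. ennreal (norm (dderiv \<phi> b (x + \<tau> *\<^sub>R z)))"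
  have inner: "(\<integral>\<^sup>+x. ennreal \<bar>\<rho> x\<bar> * ?g x \<tau> \<partial>lborel) \<le> ennreal c * grad_norm r \<Omega> \<phi>" for \<tau>
  proof -
    have "(\<integral>\<^sup>+x. ennreal \<bar>\<rho> x\<bar> * ?g x \<tau> \<partial>lborel)
      = (\<Sum>b\<in>Basis. \<integral>\<^sup>+x. ennreal (\<bar>\<rho> x\<bar> * norm (dderiv \<phi> b (x + \<tau> *\<^sub>R z))) \<partial>lborel)"
      by (simp add: sum_distrib_left ennreal_mult nn_integral_sum del: sum_ennreal)
    also have "\<dots> \<le> (\<Sum>b\<in>Basis. ennreal c * Lp_norm (ennreal r) \<Omega> (\<lambda>x. dderiv \<phi> b x))"
      by (intro sum_mono pairing_norm test_fun_borel[OF test_fun_dderiv[OF \<phi>]] test_fun_outside[OF test_fun_dderiv[OF \<phi>]])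
    also have "\<dots> = ennreal c * grad_norm r \<Omega> \<phi>" by (simp add: grad_norm_def sum_distrib_left)
    finally show ?thesis .
  qed
  have "(\<integral>\<^sup>+x. ennreal (\<bar>\<rho> x\<bar> * norm (\<phi> (x + z) - \<phi> x)) \<partial>lborel)
    \<le> (\<integral>\<^sup>+x. ennreal (norm z) * (\<integral>\<^sup>+\<tau>. indicator {0..1} \<tau> * (ennreal \<bar>\<rho> x\<bar> * ?g x \<tau>) \<partial>lborel) \<partial>lborel)"
  proof (rule nn_integral_mono)
    fix x
    have "ennreal (\<bar>\<rho> x\<bar> * norm (\<phi> (x + z) - \<phi> x)) = ennreal \<bar>\<rho> x\<bar> * ennreal (norm (\<phi> (x + z) - \<phi> x))"
      by (rule ennreal_mult) auto
    also have "\<dots> \<le> ennreal \<bar>\<rho> x\<bar> * (ennreal (norm z) * (\<integral>\<^sup>+\<tau>. indicator {0..1} \<tau> * ?g x \<tau> \<partial>lborel))"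
      by (intro mult_left_mono norm_increment_le[OF sm]) simp
    also have "\<dots> = ennreal (norm z) * (ennreal \<bar>\<rho> x\<bar> * (\<integral>\<^sup>+\<tau>. indicator {0..1} \<tau> * ?g x \<tau> \<partial>lborel))"
      by (rule mult.left_commute)
    also have "ennreal \<bar>\<rho> x\<bar> * (\<integral>\<^sup>+\<tau>. indicator {0..1} \<tau> * ?g x \<tau> \<partial>lborel)
      = (\<integral>\<^sup>+\<tau>. ennreal \<bar>\<rho> x\<bar> * (indicator {0..1} \<tau> * ?g x \<tau>) \<partial>lborel)"
      by (rule nn_integral_cmult[symmetric]) measurable
    finally show "ennreal (\<bar>\<rho> x\<bar> * norm (\<phi> (x + z) - \<phi> x))
      \<le> ennreal (norm z) * (\<integral>\<^sup>+\<tau>. indicator {0..1} \<tau> * (ennreal \<bar>\<rho> x\<bar> * ?g x \<tau>) \<partial>lborel)"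
      by (simp only: mult.left_commute)
  qed
  also have "\<dots> = ennreal (norm z) * (\<integral>\<^sup>+x. \<integral>\<^sup>+\<tau>. indicator {0..1} \<tau> * (ennreal \<bar>\<rho> x\<bar> * ?g x \<tau>) \<partial>lborel \<partial>lborel)"
    by (rule nn_integral_cmult) measurable
  also have "(\<integral>\<^sup>+x. \<integral>\<^sup>+\<tau>. indicator {0..1} \<tau> * (ennreal \<bar>\<rho> x\<bar> * ?g x \<tau>) \<partial>(lborel :: real measure) \<partial>lborel)
     = (\<integral>\<^sup>+\<tau>. \<integral>\<^sup>+x. indicator {0..1} \<tau> * (ennreal \<bar>\<rho> x\<bar> * ?g x \<tau>) \<partial>lborel \<partial>lborel)"
    by (rule lborel_pair.Fubini') measurable
  also have "\<dots> = (\<integral>\<^sup>+\<tau>. indicator {0..1::real} \<tau> * (\<integral>\<^sup>+x. ennreal \<bar>\<rho> x\<bar> * ?g x \<tau> \<partial>lborel) \<partial>lborel)"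
    by (intro nn_integral_cong nn_integral_cmult) measurable
  also have "\<dots> \<le> (\<integral>\<^sup>+\<tau>. (ennreal c * grad_norm r \<Omega> \<phi>) * indicator {0..1::real} \<tau> \<partial>lborel)"
  proof (rule nn_integral_mono)
    fix \<tau> :: real
    have "indicator {0..1} \<tau> * (\<integral>\<^sup>+x. ennreal \<bar>\<rho> x\<bar> * ?g x \<tau> \<partial>lborel) \<le> indicator {0..1} \<tau> * (ennreal c * grad_norm r \<Omega> \<phi>)"
      by (rule mult_left_mono[OF inner]) simp
    then show "indicator {0..1} \<tau> * (\<integral>\<^sup>+x. ennreal \<bar>\<rho> x\<bar> * ?g x \<tau> \<partial>lborel) \<le> (ennreal c * grad_norm r \<Omega> \<phi>) * indicator {0..1} \<tau>"
      by (simp only: mult.commute)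
  qed
  also have "\<dots> = (ennreal c * grad_norm r \<Omega> \<phi>) * emeasure lborel {0..1::real}"
    by (rule nn_integral_cmult_indicator) simp
  finally show ?thesis by (simp add: mult_left_mono)
qed

lemma shift_pairing:
  fixes F :: "'a \<Rightarrow> 'a \<Rightarrow> real"
  assumes [measurable]: "(\<lambda>x. F x (x + z)) \<in> borel_measurable borel" "(\<lambda>x. F (x + - z) x) \<in> borel_measurable borel"
  shows "(\<integral>\<^sup>+x. ennreal (\<bar>\<rho> (x + z)\<bar> * F x (x + z)) \<partial>lborel) = (\<integral>\<^sup>+x. ennreal (\<bar>\<rho> x\<bar> * F (x + - z) x) \<partial>lborel)"
proof -
  have "(\<integral>\<^sup>+x. ennreal (\<bar>\<rho> (x + z)\<bar> * F ((x + z) + - z) (x + z)) \<partial>lborel) = (\<integral>\<^sup>+x. ennreal (\<bar>\<rho> x\<bar> * F (x + - z) x) \<partial>lborel)"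
    by (rule nn_integral_lborel_translate) (use assms in measurable)
  then show ?thesis by simp
qed

text \<open>Bounding |\<rho>(x) - \<rho>(x + z)| by a sum gives up all cancellation in the density,
  but each half pairs with an increment of \<open>\<phi>\<close> after a shift. Hence the factor 2
  and a bound independent of \<epsilon>.\<close>

lemma comm_defect_test:
  fixes \<phi> :: "'a \<Rightarrow> 'a"
  assumes \<phi>: "test_fun \<Omega> \<phi>" and e: "\<epsilon> > 0"
  shows "comm_defect \<epsilon> \<rho> \<phi> \<le> ennreal (2 * c * unit_ball_vol DIM('a)) * grad_norm r \<Omega> \<phi>"
proof -
  have [measurable]: "\<phi> \<in> borel_measurable borel" by (rule test_fun_borel[OF \<phi>])
  have inner: "(\<integral>\<^sup>+x. ennreal (\<bar>\<rho> x - \<rho> (x + z)\<bar> * norm (\<phi> x - \<phi> (x + z))) \<partial>lborel) \<le> ennreal (2 * c * \<epsilon>) * grad_norm r \<Omega> \<phi>"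
    if z: "norm z \<le> \<epsilon>" for z
  proof -
    have "(\<integral>\<^sup>+x. ennreal (\<bar>\<rho> x - \<rho> (x + z)\<bar> * norm (\<phi> x - \<phi> (x + z))) \<partial>lborel)
      \<le> (\<integral>\<^sup>+x. ennreal (\<bar>\<rho> x\<bar> * norm (\<phi> (x + z) - \<phi> x)) + ennreal (\<bar>\<rho> (x + z)\<bar> * norm (\<phi> x - \<phi> (x + z))) \<partial>lborel)"
    proof (rule nn_integral_mono)
      fix x
      have "\<bar>\<rho> x - \<rho> (x + z)\<bar> * norm (\<phi> x - \<phi> (x + z)) \<le> (\<bar>\<rho> x\<bar> + \<bar>\<rho> (x + z)\<bar>) * norm (\<phi> x - \<phi> (x + z))"
        by (intro mult_right_mono) auto
      then show "ennreal (\<bar>\<rho> x - \<rho> (x + z)\<bar> * norm (\<phi> x - \<phi> (x + z)))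
        \<le> ennreal (\<bar>\<rho> x\<bar> * norm (\<phi> (x + z) - \<phi> x)) + ennreal (\<bar>\<rho> (x + z)\<bar> * norm (\<phi> x - \<phi> (x + z)))"
        by (simp add: ennreal_plus[symmetric] ennreal_leI distrib_right norm_minus_commute del: ennreal_plus)
    qed
    also have "\<dots> = (\<integral>\<^sup>+x. ennreal (\<bar>\<rho> x\<bar> * norm (\<phi> (x + z) - \<phi> x)) \<partial>lborel) + (\<integral>\<^sup>+x. ennreal (\<bar>\<rho> (x + z)\<bar> * norm (\<phi> x - \<phi> (x + z))) \<partial>lborel)"
      by (rule nn_integral_add) measurable
    also have "(\<integral>\<^sup>+x. ennreal (\<bar>\<rho> (x + z)\<bar> * norm (\<phi> x - \<phi> (x + z))) \<partial>lborel) = (\<integral>\<^sup>+x. ennreal (\<bar>\<rho> x\<bar> * norm (\<phi> (x + - z) - \<phi> x)) \<partial>lborel)"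
      by (rule shift_pairing[where F="\<lambda>x y. norm (\<phi> x - \<phi> y)"]) measurable
    also have "(\<integral>\<^sup>+x. ennreal (\<bar>\<rho> x\<bar> * norm (\<phi> (x + z) - \<phi> x)) \<partial>lborel) + (\<integral>\<^sup>+x. ennreal (\<bar>\<rho> x\<bar> * norm (\<phi> (x + - z) - \<phi> x)) \<partial>lborel)
      \<le> ennreal (norm z) * (ennreal c * grad_norm r \<Omega> \<phi>) + ennreal (norm (- z)) * (ennreal c * grad_norm r \<Omega> \<phi>)"
      by (intro add_mono pairing_increment[OF \<phi>])
    also have "\<dots> = ennreal (2 * c * norm z) * grad_norm r \<Omega> \<phi>"
      using c_nonneg by (simp add: ennreal_mult mult_ac flip: mult_2)
    also have "\<dots> \<le> ennreal (2 * c * \<epsilon>) * grad_norm r \<Omega> \<phi>"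
      using z c_nonneg by (intro mult_right_mono ennreal_leI mult_left_mono) auto
    finally show ?thesis .
  qed
  show ?thesis
    unfolding comm_defect_eq[OF \<rho>_borel \<open>\<phi> \<in> borel_measurable borel\<close> e]
    by (rule nn_integral_kern_mult[OF e inner]) (use c_nonneg in auto)
qed

text \<open>No derivative enters, so nothing cancels the mass 1/\<epsilon> of the kernel. This is
  good enough for passing to limits at a fixed \<epsilon>.\<close>

lemma comm_defect_crude:
  fixes v :: "'a \<Rightarrow> 'a"
  assumes v[measurable]: "v \<in> borel_measurable borel" and v0: "\<And>x. x \<notin> \<Omega> \<Longrightarrow> v x = 0" and e: "\<epsilon> > 0"
  shows "comm_defect \<epsilon> \<rho> v \<le> ennreal (4 * c / \<epsilon> * unit_ball_vol DIM('a)) * Lp_norm (ennreal r) \<Omega> v"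
proof -
  let ?N = "Lp_norm (ennreal r) \<Omega> v"
  \<comment> \<open>The four products give 4 c, written as
    \<open>4 * c / \<epsilon> * \<epsilon>\<close> to fit the form \<open>a * \<epsilon>\<close> in
    \<open>nn_integral_kern_mult\<close>.\<close>
  have inner: "(\<integral>\<^sup>+x. ennreal (\<bar>\<rho> x - \<rho> (x + z)\<bar> * norm (v x - v (x + z))) \<partial>lborel) \<le> ennreal (4 * c / \<epsilon> * \<epsilon>) * ?N"
    for z
  proof -
    have "(\<integral>\<^sup>+x. ennreal (\<bar>\<rho> x - \<rho> (x + z)\<bar> * norm (v x - v (x + z))) \<partial>lborel)
      \<le> (\<integral>\<^sup>+x. (ennreal (\<bar>\<rho> x\<bar> * norm (v (x + 0))) + ennreal (\<bar>\<rho> x\<bar> * norm (v (x + z))))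
         + (ennreal (\<bar>\<rho> (x + z)\<bar> * norm (v x)) + ennreal (\<bar>\<rho> (x + z)\<bar> * norm (v (x + z)))) \<partial>lborel)"
    proof (rule nn_integral_mono)
      fix x
      have "\<bar>\<rho> x - \<rho> (x + z)\<bar> * norm (v x - v (x + z)) \<le> (\<bar>\<rho> x\<bar> + \<bar>\<rho> (x + z)\<bar>) * (norm (v x) + norm (v (x + z)))"
        by (intro mult_mono norm_triangle_ineq4) auto
      then show "ennreal (\<bar>\<rho> x - \<rho> (x + z)\<bar> * norm (v x - v (x + z)))
        \<le> (ennreal (\<bar>\<rho> x\<bar> * norm (v (x + 0))) + ennreal (\<bar>\<rho> x\<bar> * norm (v (x + z))))
         + (ennreal (\<bar>\<rho> (x + z)\<bar> * norm (v x)) + ennreal (\<bar>\<rho> (x + z)\<bar> * norm (v (x + z))))"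
        by (simp add: ennreal_plus[symmetric] ennreal_leI algebra_simps del: ennreal_plus)
    qed
    also have "\<dots> = ((\<integral>\<^sup>+x. ennreal (\<bar>\<rho> x\<bar> * norm (v (x + 0))) \<partial>lborel) + (\<integral>\<^sup>+x. ennreal (\<bar>\<rho> x\<bar> * norm (v (x + z))) \<partial>lborel))
       + ((\<integral>\<^sup>+x. ennreal (\<bar>\<rho> (x + z)\<bar> * norm (v x)) \<partial>lborel) + (\<integral>\<^sup>+x. ennreal (\<bar>\<rho> (x + z)\<bar> * norm (v (x + z))) \<partial>lborel))"
      by (subst nn_integral_add, measurable, subst nn_integral_add, measurable, subst nn_integral_add) auto
    also have "(\<integral>\<^sup>+x. ennreal (\<bar>\<rho> (x + z)\<bar> * norm (v x)) \<partial>lborel) = (\<integral>\<^sup>+x. ennreal (\<bar>\<rho> x\<bar> * norm (v (x + - z))) \<partial>lborel)"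
      by (rule shift_pairing[where F="\<lambda>x y. norm (v x)"]) measurable
    also have "(\<integral>\<^sup>+x. ennreal (\<bar>\<rho> (x + z)\<bar> * norm (v (x + z))) \<partial>lborel) = (\<integral>\<^sup>+x. ennreal (\<bar>\<rho> x\<bar> * norm (v (x + 0))) \<partial>lborel)"
      using shift_pairing[where F="\<lambda>x y. norm (v y)", of z] by simp
    also have "((\<integral>\<^sup>+x. ennreal (\<bar>\<rho> x\<bar> * norm (v (x + 0))) \<partial>lborel) + (\<integral>\<^sup>+x. ennreal (\<bar>\<rho> x\<bar> * norm (v (x + z))) \<partial>lborel))
       + ((\<integral>\<^sup>+x. ennreal (\<bar>\<rho> x\<bar> * norm (v (x + - z))) \<partial>lborel) + (\<integral>\<^sup>+x. ennreal (\<bar>\<rho> x\<bar> * norm (v (x + 0))) \<partial>lborel))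
      \<le> (ennreal c * ?N + ennreal c * ?N) + (ennreal c * ?N + ennreal c * ?N)"
      by (intro add_mono pairing_norm v v0)
    also have "\<dots> = ennreal (4 * c / \<epsilon> * \<epsilon>) * ?N" using e c_nonneg by (simp add: ennreal_mult mult_ac flip: mult_2)
    finally show ?thesis .
  qed
  show ?thesis
    unfolding comm_defect_eq[OF \<rho>_borel v e]
    by (rule nn_integral_kern_mult[OF e inner]) (use c_nonneg e in auto)
qed

lemma comm_defect_add:
  assumes [measurable]: "w \<in> borel_measurable borel" "\<phi> \<in> borel_measurable borel" and e: "\<epsilon> > 0"
  shows "comm_defect \<epsilon> \<rho> w \<le> comm_defect \<epsilon> \<rho> \<phi> + comm_defect \<epsilon> \<rho> (\<lambda>x. w x - \<phi> x)"
proof -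
  let ?f = "\<lambda>w x y. ennreal (\<bar>\<rho> x - \<rho> y\<bar> * norm (w x - w y) * kern \<epsilon> (y - x))"
  have "comm_defect \<epsilon> \<rho> w \<le> (\<integral>\<^sup>+y. \<integral>\<^sup>+x. ?f \<phi> x y + ?f (\<lambda>x. w x - \<phi> x) x y \<partial>lborel \<partial>lborel)"
    unfolding comm_defect_def
  proof (intro nn_integral_mono)
    fix x y
    have "norm (w x - w y) \<le> norm (\<phi> x - \<phi> y) + norm ((w x - \<phi> x) - (w y - \<phi> y))"
      using norm_triangle_ineq[of "\<phi> x - \<phi> y" "(w x - \<phi> x) - (w y - \<phi> y)"] by (simp add: algebra_simps)
    then have "\<bar>\<rho> x - \<rho> y\<bar> * norm (w x - w y) * kern \<epsilon> (y - x)
      \<le> \<bar>\<rho> x - \<rho> y\<bar> * (norm (\<phi> x - \<phi> y) + norm ((w x - \<phi> x) - (w y - \<phi> y))) * kern \<epsilon> (y - x)"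
      by (intro mult_right_mono mult_left_mono kern_nonneg[OF e]) auto
    then show "?f w x y \<le> ?f \<phi> x y + ?f (\<lambda>x. w x - \<phi> x) x y"
      using kern_nonneg[OF e, of "y - x"]
      by (simp add: ennreal_plus[symmetric] ennreal_leI distrib_left distrib_right del: ennreal_plus)
  qed
  also have "\<dots> = (\<integral>\<^sup>+y. (\<integral>\<^sup>+x. ?f \<phi> x y \<partial>lborel) + (\<integral>\<^sup>+x. ?f (\<lambda>x. w x - \<phi> x) x y \<partial>lborel) \<partial>lborel)"
    by (intro nn_integral_cong nn_integral_add) measurable
  also have "\<dots> = comm_defect \<epsilon> \<rho> \<phi> + comm_defect \<epsilon> \<rho> (\<lambda>x. w x - \<phi> x)"
    unfolding comm_defect_def by (rule nn_integral_add) measurable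
  finally show ?thesis .
qed

text \<open>At fixed \<epsilon> the crude bound makes the error of replacing \<open>w\<close> by
  \<open>\<phi> j\<close> vanish as j grows, so the bound for test functions, which is free of
  \<epsilon>, survives the limit.\<close>

lemma comm_defect_limit:
  fixes w :: "'a \<Rightarrow> 'a"
  assumes w[measurable]: "w \<in> borel_measurable borel" and w0: "\<And>x. x \<notin> \<Omega> \<Longrightarrow> w x = 0" and e: "\<epsilon> > 0"
    and \<phi>: "\<And>j. test_fun \<Omega> (\<phi> j)"
    and lim: "(\<lambda>j. Lp_norm (ennreal r) \<Omega> (\<lambda>x. w x - \<phi> j x)) \<longlonglongrightarrow> 0"
    and bd: "\<forall>\<^sub>F j in sequentially. grad_norm r \<Omega> (\<phi> j) \<le> B"
  shows "comm_defect \<epsilon> \<rho> w \<le> ennreal (2 * c * unit_ball_vol DIM('a)) * B"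
proof -
  let ?C = "ennreal (4 * c / \<epsilon> * unit_ball_vol DIM('a))"
  have "(\<lambda>j. ?C * Lp_norm (ennreal r) \<Omega> (\<lambda>x. w x - \<phi> j x)) \<longlonglongrightarrow> ?C * 0"
    by (rule ennreal_tendsto_cmult[OF _ lim]) simp
  then have "(\<lambda>j. ennreal (2 * c * unit_ball_vol DIM('a)) * B + ?C * Lp_norm (ennreal r) \<Omega> (\<lambda>x. w x - \<phi> j x))
      \<longlonglongrightarrow> ennreal (2 * c * unit_ball_vol DIM('a)) * B + ?C * 0"
    by (intro tendsto_add tendsto_const)
  then have l: "(\<lambda>j. ennreal (2 * c * unit_ball_vol DIM('a)) * B + ?C * Lp_norm (ennreal r) \<Omega> (\<lambda>x. w x - \<phi> j x))
      \<longlonglongrightarrow> ennreal (2 * c * unit_ball_vol DIM('a)) * B" by simp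
  have "\<forall>\<^sub>F j in sequentially. comm_defect \<epsilon> \<rho> w
      \<le> ennreal (2 * c * unit_ball_vol DIM('a)) * B + ?C * Lp_norm (ennreal r) \<Omega> (\<lambda>x. w x - \<phi> j x)"
    using bd
  proof eventually_elim
    fix j assume b: "grad_norm r \<Omega> (\<phi> j) \<le> B"
    have m[measurable]: "\<phi> j \<in> borel_measurable borel" by (rule test_fun_borel[OF \<phi>])
    have "comm_defect \<epsilon> \<rho> w \<le> comm_defect \<epsilon> \<rho> (\<phi> j) + comm_defect \<epsilon> \<rho> (\<lambda>x. w x - \<phi> j x)"
      by (rule comm_defect_add[OF w m e])
    also have "\<dots> \<le> ennreal (2 * c * unit_ball_vol DIM('a)) * grad_norm r \<Omega> (\<phi> j) + ?C * Lp_norm (ennreal r) \<Omega> (\<lambda>x. w x - \<phi> j x)"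
      by (intro add_mono comm_defect_test[OF \<phi> e] comm_defect_crude[OF _ _ e]) (use w0 test_fun_outside[OF \<phi>] in auto)
    also have "\<dots> \<le> ennreal (2 * c * unit_ball_vol DIM('a)) * B + ?C * Lp_norm (ennreal r) \<Omega> (\<lambda>x. w x - \<phi> j x)"
      by (intro add_mono mult_left_mono b) auto
    finally show "comm_defect \<epsilon> \<rho> w \<le> ennreal (2 * c * unit_ball_vol DIM('a)) * B + ?C * Lp_norm (ennreal r) \<Omega> (\<lambda>x. w x - \<phi> j x)" .
  qed
  then show ?thesis using tendsto_lowerbound[OF l] by simp
qed

text \<open>The Lipschitz constant of \<open>\<phi>\<close> compensates the mass of the kernel
  pointwise. What is left is the L1 modulus of continuity of the density.\<close>

lemma comm_defect_test_tendsto: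
  fixes \<phi> :: "'a \<Rightarrow> 'a"
  assumes \<phi>: "test_fun \<Omega> \<phi>" and \<eta>: "\<eta> > 0"
  shows "\<exists>d>0. \<forall>\<epsilon>. 0 < \<epsilon> \<longrightarrow> \<epsilon> < d \<longrightarrow> comm_defect \<epsilon> \<rho> \<phi> \<le> ennreal \<eta>"
proof -
  have [measurable]: "\<phi> \<in> borel_measurable borel" by (rule test_fun_borel[OF \<phi>])
  obtain L where L: "L > 0" "\<And>x y. norm (\<phi> x - \<phi> y) \<le> L * norm (x - y)" using test_fun_lipschitz[OF \<phi>] by blast
  define V where "V = unit_ball_vol DIM('a) + 1"
  have V: "V > 0" "unit_ball_vol DIM('a) \<le> V" "unit_ball_vol DIM('a) \<ge> 0" by (auto simp: V_def add_nonneg_pos)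
  have "\<eta> / (L * V) > 0" using \<eta> L(1) V(1) by simp
  then obtain d where d: "d > 0" "\<And>z. norm z < d \<Longrightarrow> (\<integral>\<^sup>+x. ennreal \<bar>\<rho> (x + z) - \<rho> x\<bar> \<partial>lborel) \<le> ennreal (\<eta> / (L * V))"
    using L1_translation_continuous[OF \<rho>_int] by blast
  have "comm_defect \<epsilon> \<rho> \<phi> \<le> ennreal \<eta>" if e: "0 < \<epsilon>" "\<epsilon> < d" for \<epsilon>
  proof -
    have inner: "(\<integral>\<^sup>+x. ennreal (\<bar>\<rho> x - \<rho> (x + z)\<bar> * norm (\<phi> x - \<phi> (x + z))) \<partial>lborel) \<le> ennreal (L * \<epsilon>) * ennreal (\<eta> / (L * V))"
      if z: "norm z \<le> \<epsilon>" for z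
    proof -
      have "(\<integral>\<^sup>+x. ennreal (\<bar>\<rho> x - \<rho> (x + z)\<bar> * norm (\<phi> x - \<phi> (x + z))) \<partial>lborel)
        \<le> (\<integral>\<^sup>+x. ennreal (L * \<epsilon>) * ennreal \<bar>\<rho> (x + z) - \<rho> x\<bar> \<partial>lborel)"
      proof (rule nn_integral_mono)
        fix x
        have "norm (\<phi> x - \<phi> (x + z)) \<le> L * norm z" using L(2)[of x "x + z"] by simp
        also have "\<dots> \<le> L * \<epsilon>" using z L(1) by (intro mult_left_mono) auto
        finally have "\<bar>\<rho> x - \<rho> (x + z)\<bar> * norm (\<phi> x - \<phi> (x + z)) \<le> \<bar>\<rho> x - \<rho> (x + z)\<bar> * (L * \<epsilon>)"
          by (rule mult_left_mono) simp
        then have "ennreal (\<bar>\<rho> x - \<rho> (x + z)\<bar> * norm (\<phi> x - \<phi> (x + z))) \<le> ennreal ((L * \<epsilon>) * \<bar>\<rho> (x + z) - \<rho> x\<bar>)"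
          by (intro ennreal_leI) (simp add: abs_minus_commute mult.commute)
        then show "ennreal (\<bar>\<rho> x - \<rho> (x + z)\<bar> * norm (\<phi> x - \<phi> (x + z))) \<le> ennreal (L * \<epsilon>) * ennreal \<bar>\<rho> (x + z) - \<rho> x\<bar>"
          using L(1) e(1) by (simp add: ennreal_mult)
      qed
      also have "\<dots> = ennreal (L * \<epsilon>) * (\<integral>\<^sup>+x. ennreal \<bar>\<rho> (x + z) - \<rho> x\<bar> \<partial>lborel)" by (rule nn_integral_cmult) measurable
      also have "\<dots> \<le> ennreal (L * \<epsilon>) * ennreal (\<eta> / (L * V))" using d(2)[of z] z e by (intro mult_left_mono) auto
      finally show ?thesis .
    qed
    have "comm_defect \<epsilon> \<rho> \<phi> \<le> ennreal (L * unit_ball_vol DIM('a)) * ennreal (\<eta> / (L * V))"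
      unfolding comm_defect_eq[OF \<rho>_borel \<open>\<phi> \<in> borel_measurable borel\<close> e(1)]
      by (rule nn_integral_kern_mult[OF e(1) inner]) (use L(1) in auto)
    also have "\<dots> = ennreal (L * unit_ball_vol DIM('a) * (\<eta> / (L * V)))"
      using L(1) V \<eta> by (intro ennreal_mult[symmetric]) auto
    also have "L * unit_ball_vol DIM('a) * (\<eta> / (L * V)) \<le> L * V * (\<eta> / (L * V))"
      using L(1) V \<eta> by (intro mult_right_mono mult_left_mono) auto
    also have "L * V * (\<eta> / (L * V)) = \<eta>" using L(1) V(1) by simp
    finally show ?thesis by (simp add: ennreal_leI)
  qed
  then show ?thesis using d(1) by blast
qed

text \<open>Split w = \<phi> k + (w - \<phi> k). The second part is small uniformly in \<epsilon>,
  by \<open>comm_defect_limit\<close> with the test functions \<open>\<phi> j - \<phi> k\<close>;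
  then k is fixed and \<epsilon> is taken small for the first part.\<close>

lemma comm_defect_tendsto_0:
  fixes w :: "'a \<Rightarrow> 'a"
  assumes w[measurable]: "w \<in> borel_measurable borel" and w0: "\<And>x. x \<notin> \<Omega> \<Longrightarrow> w x = 0"
    and \<phi>: "\<And>j. test_fun \<Omega> (\<phi> j)"
    and lim: "(\<lambda>j. Lp_norm (ennreal r) \<Omega> (\<lambda>x. w x - \<phi> j x)) \<longlonglongrightarrow> 0"
    and cauchy: "\<And>\<eta>::real. \<eta> > 0 \<Longrightarrow> \<exists>k. \<forall>\<^sub>F j in sequentially. grad_norm r \<Omega> (\<lambda>x. \<phi> j x - \<phi> k x) \<le> ennreal \<eta>"
  shows "(\<lambda>n. comm_defect (1 / (real n + 1)) \<rho> w) \<longlonglongrightarrow> 0"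
proof -
  have small: "\<exists>d>0. \<forall>\<epsilon>. 0 < \<epsilon> \<longrightarrow> \<epsilon> < d \<longrightarrow> comm_defect \<epsilon> \<rho> w \<le> ennreal \<eta>" if \<eta>: "\<eta> > 0" for \<eta>
  proof -
    define V where "V = 2 * c * unit_ball_vol DIM('a) + 1"
    have V0: "0 \<le> 2 * c * unit_ball_vol DIM('a)" using c_nonneg by simp
    then have V: "V > 0" "2 * c * unit_ball_vol DIM('a) \<le> V" by (simp_all add: V_def)
    have "\<eta> / (2 * V) > 0" using \<eta> V by simp
    then obtain k where k: "\<forall>\<^sub>F j in sequentially. grad_norm r \<Omega> (\<lambda>x. \<phi> j x - \<phi> k x) \<le> ennreal (\<eta> / (2 * V))"
      using cauchy by blast
    obtain d where d: "d > 0" "\<forall>\<epsilon>. 0 < \<epsilon> \<longrightarrow> \<epsilon> < d \<longrightarrow> comm_defect \<epsilon> \<rho> (\<phi> k) \<le> ennreal (\<eta> / 2)"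
      using comm_defect_test_tendsto[OF \<phi>, of "\<eta> / 2" k] \<eta> by auto
    have m[measurable]: "\<phi> j \<in> borel_measurable borel" for j by (rule test_fun_borel[OF \<phi>])
    have "comm_defect \<epsilon> \<rho> w \<le> ennreal \<eta>" if e: "0 < \<epsilon>" "\<epsilon> < d" for \<epsilon>
    proof -
      have "comm_defect \<epsilon> \<rho> (\<lambda>x. w x - \<phi> k x) \<le> ennreal (2 * c * unit_ball_vol DIM('a)) * ennreal (\<eta> / (2 * V))"
      proof (rule comm_defect_limit[OF _ _ e(1), where \<phi>="\<lambda>j x. \<phi> j x - \<phi> k x"])
        show "(\<lambda>x. w x - \<phi> k x) \<in> borel_measurable borel" by measurable
        show "w x - \<phi> k x = 0" if "x \<notin> \<Omega>" for x using w0 test_fun_outside[OF \<phi>] that by simp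
        show "test_fun \<Omega> (\<lambda>x. \<phi> j x - \<phi> k x)" for j by (rule test_fun_diff[OF \<phi> \<phi>])
        show "(\<lambda>j. Lp_norm (ennreal r) \<Omega> (\<lambda>x. w x - \<phi> k x - (\<phi> j x - \<phi> k x))) \<longlonglongrightarrow> 0" using lim by simp
      qed (rule k)
      also have "\<dots> \<le> ennreal V * ennreal (\<eta> / (2 * V))" using V by (intro mult_right_mono ennreal_leI) auto
      also have "\<dots> = ennreal (V * (\<eta> / (2 * V)))" using V \<eta> by (intro ennreal_mult[symmetric]) auto
      also have "V * (\<eta> / (2 * V)) = \<eta> / 2" using V by simp
      finally have "comm_defect \<epsilon> \<rho> (\<lambda>x. w x - \<phi> k x) \<le> ennreal (\<eta> / 2)" .
      moreover have "comm_defect \<epsilon> \<rho> (\<phi> k) \<le> ennreal (\<eta> / 2)" using d(2) e by blast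
      ultimately have "comm_defect \<epsilon> \<rho> w \<le> ennreal (\<eta> / 2) + ennreal (\<eta> / 2)"
        using comm_defect_add[OF w m[of k] e(1)] by (meson add_mono order_trans)
      then show ?thesis using \<eta> by (simp add: ennreal_plus[symmetric] del: ennreal_plus)
    qed
    then show ?thesis using d(1) by blast
  qed
  have l: "(\<lambda>n. 1 / (real n + 1)) \<longlonglongrightarrow> 0"
    using LIMSEQ_inverse_real_of_nat by (simp add: inverse_eq_divide add.commute)
  show ?thesis
  proof (rule tendsto_zero_ennreal)
    fix \<eta> :: real assume "0 < \<eta>"
    then obtain d where d: "d > 0" "\<forall>\<epsilon>. 0 < \<epsilon> \<longrightarrow> \<epsilon> < d \<longrightarrow> comm_defect \<epsilon> \<rho> w \<le> ennreal (\<eta> / 2)"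
      using small[of "\<eta> / 2"] by auto
    have lt: "ennreal (\<eta> / 2) < ennreal \<eta>" using \<open>0 < \<eta>\<close> by (simp add: ennreal_lessI)
    show "\<forall>\<^sub>F n in sequentially. comm_defect (1 / (real n + 1)) \<rho> w < ennreal \<eta>"
      using order_tendstoD(2)[OF l d(1)]
      by eventually_elim (rule order_le_less_trans[OF _ lt], use d(2) in simp)
  qed
qed

end

section \<open>Approximation of the velocity by simple functions of time\<close>

lemma Lp_norm_0:
  assumes "r \<ge> 1" shows "Lp_norm (ennreal r) S (\<lambda>x. 0) = 0"
  using assms by (simp add: Lp_norm_finite_exponent pow_int_def)

lemma grad_norm_le_W1_norm:
  assumes "open S" "r \<ge> 1" "test_fun S \<phi>"
  shows "grad_norm r S \<phi> \<le> W1_norm (ennreal r) S \<phi>"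
  unfolding W1_norm_test[OF assms] grad_norm_def by simp

lemma Lp_norm_le_W1_norm: "Lp_norm q S f \<le> W1_norm q S f"
  by (simp add: W1_norm_def)

lemma W1_norm_0: "open S \<Longrightarrow> r \<ge> 1 \<Longrightarrow> W1_norm (ennreal r) S (\<lambda>x. 0) = 0"
  by (simp add: W1_norm_test[OF _ _ test_fun_0] Lp_norm_0)

lemma dderiv_diff:
  assumes "smooth f" "smooth g"
  shows "dderiv (\<lambda>x. f x - g x) v x = dderiv f v x - dderiv g v x"
  by (rule dderiv_eq[OF has_derivative_diff[OF smooth_has_derivative smooth_has_derivative]]) (fact assms)+

lemma simple_function_sum_fibres:
  assumes s: "simple_function M s" and t: "t \<in> space M"
  shows "F (s t) = (\<Sum>v\<in>s ` space M. indicator (s -` {v} \<inter> space M) t *\<^sub>R (F v :: 'b::real_vector))"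
proof -
  have "(\<Sum>v\<in>s ` space M. indicator (s -` {v} \<inter> space M) t *\<^sub>R F v)
      = (\<Sum>v\<in>s ` space M. if v = s t then F v else 0)"
    by (intro sum.cong) (use t in \<open>auto simp: indicator_def\<close>)
  also have "\<dots> = F (s t)"
    using simple_functionD(1)[OF s] t by (subst sum.delta) auto
  finally show ?thesis by simp
qed

text \<open>The values of \<open>s\<close> may themselves be functions of space, in a type without a
  measurable structure. Finitely many measurable fibres reduce joint measurability to that of each
  \<open>F v\<close>.\<close>

lemma simple_function_measurable:
  fixes F :: "'v \<Rightarrow> 'a \<Rightarrow> 'b::euclidean_space"
  assumes s: "simple_function M s" and F: "\<And>v. v \<in> s ` space M \<Longrightarrow> F v \<in> borel_measurable N"
  shows "(\<lambda>z. F (s (fst z)) (snd z)) \<in> borel_measurable (M \<Otimes>\<^sub>M N)"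
proof -
  have "(\<lambda>z. F (s (fst z)) (snd z)) \<in> borel_measurable (M \<Otimes>\<^sub>M N)
    \<longleftrightarrow> (\<lambda>z. \<Sum>v\<in>s ` space M. indicator (s -` {v} \<inter> space M) (fst z) *\<^sub>R F v (snd z)) \<in> borel_measurable (M \<Otimes>\<^sub>M N)"
    by (rule measurable_cong)
      (use simple_function_sum_fibres[OF s, of _ "\<lambda>v. F v (snd _)"] in \<open>auto simp: space_pair_measure\<close>)
  also have "\<dots>"
  proof (intro borel_measurable_sum borel_measurable_scaleR)
    fix v assume v: "v \<in> s ` space M"
    have "s -` {v} \<inter> space M \<in> sets M" by (rule simple_functionD(2)[OF s])
    then have "(\<lambda>t. indicator (s -` {v} \<inter> space M) t :: real) \<in> borel_measurable M" by simp
    then show "(\<lambda>z. indicator (s -` {v} \<inter> space M) (fst z) :: real) \<in> borel_measurable (M \<Otimes>\<^sub>M N)"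
      by (rule measurable_compose[OF measurable_fst])
    show "(\<lambda>z. F v (snd z)) \<in> borel_measurable (M \<Otimes>\<^sub>M N)"
      by (rule measurable_compose[OF measurable_snd F[OF v]])
  qed
  finally show ?thesis .
qed

text \<open>\<open>F\<close> may be arbitrary, since only its values at the finitely many values of
  \<open>s\<close> matter.\<close>

lemma (in finite_measure) simple_function_integral:
  fixes F :: "'v \<Rightarrow> real"
  assumes s: "simple_function M s"
  shows "integrable M (\<lambda>t. F (s t))"
    "(\<integral>t. F (s t) \<partial>M) = (\<Sum>v\<in>s ` space M. measure M (s -` {v} \<inter> space M) * F v)"
proof -
  have e: "F (s t) = (\<Sum>v\<in>s ` space M. indicator (s -` {v} \<inter> space M) t *\<^sub>R F v)" if "t \<in> space M" for t
    by (rule simple_function_sum_fibres[OF s that])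
  have A: "s -` {v} \<inter> space M \<in> sets M" for v by (rule simple_functionD(2)[OF s])
  have i: "integrable M (\<lambda>t. indicator (s -` {v} \<inter> space M) t *\<^sub>R F v)" for v
    by (intro integrable_scaleR_left integrable_real_indicator A) (simp add: less_top[symmetric])
  show "integrable M (\<lambda>t. F (s t))"
    by (rule Bochner_Integration.integrable_cong[OF refl e, THEN iffD2])
      (assumption, rule Bochner_Integration.integrable_sum, rule i)
  have "(\<integral>t. F (s t) \<partial>M) = (\<integral>t. (\<Sum>v\<in>s ` space M. indicator (s -` {v} \<inter> space M) t *\<^sub>R F v) \<partial>M)"
    by (rule Bochner_Integration.integral_cong[OF refl e])
  also have "\<dots> = (\<Sum>v\<in>s ` space M. \<integral>t. indicator (s -` {v} \<inter> space M) t *\<^sub>R F v \<partial>M)"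
    by (rule Bochner_Integration.integral_sum) (rule i)
  also have "\<dots> = (\<Sum>v\<in>s ` space M. measure M (s -` {v} \<inter> space M) * F v)"
    using A by (intro sum.cong refl) simp
  finally show "(\<integral>t. F (s t) \<partial>M) = (\<Sum>v\<in>s ` space M. measure M (s -` {v} \<inter> space M) * F v)" .
qed

lemma suminf_finite_imp_tendsto_0:
  fixes f :: "nat \<Rightarrow> ennreal"
  assumes "(\<Sum>i. f i) \<noteq> top"
  shows "f \<longlonglongrightarrow> 0"
proof -
  have fin: "f i \<noteq> top" for i
    using assms ennreal_suminf_lessD[of f top i] by (auto simp: less_top)
  then have e: "f i = ennreal (enn2real (f i))" for i by (simp add: less_top)
  then have "(\<Sum>i. ennreal (enn2real (f i))) \<noteq> top" using assms by simp
  then have "summable (\<lambda>i. enn2real (f i))" by (intro summable_suminf_not_top) auto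
  then have "(\<lambda>i. enn2real (f i)) \<longlonglongrightarrow> 0" by (rule summable_LIMSEQ_zero)
  then have "(\<lambda>i. ennreal (enn2real (f i))) \<longlonglongrightarrow> ennreal 0" by (rule tendsto_ennrealI)
  then show ?thesis using e by simp
qed

text \<open>\<open>U k\<close> is a simple function of time whose values are test functions in
  space; such approximations exist because the velocity takes values in the closure of the test
  functions. \<open>embed\<close> is the inclusion of L^q into L1 over a set of finite
  measure.\<close>

locale sobolev_velocity = time_interval T for T :: real +
  fixes \<Omega> :: "'a::euclidean_space set" and r c1 :: real and u :: "real \<Rightarrow> 'a \<Rightarrow> 'a" and Mu :: "real \<Rightarrow> real"
    and U :: "nat \<Rightarrow> real \<Rightarrow> 'a \<Rightarrow> 'a"
  assumes open_dom: "open \<Omega>" and dom_finite: "emeasure lborel \<Omega> < \<infinity>" and r_ge_1: "r \<ge> 1"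
    and embed: "\<And>g :: 'a \<Rightarrow> real. g \<in> borel_measurable borel \<Longrightarrow> (\<And>x. x \<notin> \<Omega> \<Longrightarrow> g x = 0) \<Longrightarrow>
      (\<integral>\<^sup>+x. ennreal \<bar>g x\<bar> \<partial>lborel) \<le> ennreal c1 * Lp_norm (ennreal r) \<Omega> g"
    and u_joint: "(\<lambda>z. u (fst z) (snd z)) \<in> borel_measurable (M \<Otimes>\<^sub>M lborel)"
    and u_outside: "\<And>t x. t \<in> {0<..<T} \<Longrightarrow> x \<notin> \<Omega> \<Longrightarrow> u t x = 0"
    and u_le: "\<And>t x. t \<in> {0<..<T} \<Longrightarrow> norm (u t x) \<le> Mu t"
    and Mu_int: "integrable M Mu"
    and U_simple: "\<And>k. simple_function M (U k)"
    and U_test: "\<And>k t. t \<in> {0<..<T} \<Longrightarrow> test_fun \<Omega> (U k t)"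
    and U_lim: "AE t in M. (\<lambda>k. W1_norm (ennreal r) \<Omega> (\<lambda>x. u t x - U k t x)) \<longlonglongrightarrow> 0"
    and u_weakly_diff: "AE t in M. u t \<in> weakly_diff \<Omega>"
    and u_W1_finite: "(\<integral>\<^sup>+t. W1_norm (ennreal r) \<Omega> (u t) \<partial>M) < \<infinity>"
begin

sublocale PP: pair_sigma_finite M lborel by standard

abbreviation W where "W f \<equiv> W1_norm (ennreal r) \<Omega> f"

text \<open>A measurable replacement for \<open>W (u t)\<close>, almost everywhere at most 4 times
  as large: measurability is clear for the simple functions \<open>U k\<close> and passes to the
  upper limit.\<close>

definition lsup :: "real \<Rightarrow> ennreal" where "lsup t = limsup (\<lambda>k. W (U k t))"

text \<open>Truncation makes the bounds on the gradients uniform in \<^term>\<open>k\<close>, hence the error integrands dominated.\<close>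

definition V :: "nat \<Rightarrow> real \<Rightarrow> 'a \<Rightarrow> 'a" where
  "V k t = (if W (U k t) \<le> lsup t + 1 then U k t else (\<lambda>x. 0))"

lemma simple_imp_borel: "simple_function M s \<Longrightarrow> (\<lambda>t. (F (s t) :: ennreal)) \<in> borel_measurable M"
  by (rule borel_measurable_simple_function[OF simple_function_compose1])

lemma lsup_borel[measurable]: "lsup \<in> borel_measurable M"
  unfolding lsup_def[abs_def] by (rule borel_measurable_limsup) (rule simple_imp_borel[OF U_simple])

lemma V_simple: "simple_function M (V k)"
proof -
  have [measurable]: "(\<lambda>t. W (U k t)) \<in> borel_measurable M" by (rule simple_imp_borel[OF U_simple])
  have "{t \<in> space M. W (U k t) \<le> lsup t + 1} \<in> sets M" by measurable
  from simple_function_If[OF U_simple simple_function_const this]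
  show ?thesis unfolding V_def[abs_def] .
qed

lemma V_test: "t \<in> {0<..<T} \<Longrightarrow> test_fun \<Omega> (V k t)"
  by (simp add: V_def U_test test_fun_0)

lemma V_le: "W (V k t) \<le> lsup t + 1"
  by (simp add: V_def W1_norm_0[OF open_dom r_ge_1])

lemma V_grad_le: "t \<in> {0<..<T} \<Longrightarrow> grad_norm r \<Omega> (V k t) \<le> lsup t + 1"
  using grad_norm_le_W1_norm[OF open_dom r_ge_1 V_test] V_le order_trans by blast

lemma test_weakly_diff: "test_fun \<Omega> \<phi> \<Longrightarrow> \<phi> \<in> weakly_diff \<Omega>"
  by (rule test_fun_weakly_diff[OF open_dom])

lemma AE_lsup_le: "AE t in M. lsup t \<le> 4 * W (u t)"
  using U_lim u_weakly_diff AE_space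
proof eventually_elim
  fix t assume l: "(\<lambda>k. W (\<lambda>x. u t x - U k t x)) \<longlonglongrightarrow> 0" and wd: "u t \<in> weakly_diff \<Omega>" and "t \<in> space M"
  then have t: "t \<in> {0<..<T}" by simp
  have le: "W (U k t) \<le> 4 * (W (u t) + W (\<lambda>x. u t x - U k t x))" for k
  proof -
    have "W (\<lambda>x. u t x - (u t x - U k t x)) \<le> 4 * (W (u t) + W (\<lambda>x. u t x - U k t x))"
      by (rule W1_norm_diff[OF open_dom r_ge_1 wd weakly_diff_diff[OF open_dom wd test_weakly_diff[OF U_test[OF t]]]])
    then show ?thesis by simp
  qed
  have "(\<lambda>k. W (u t) + W (\<lambda>x. u t x - U k t x)) \<longlonglongrightarrow> W (u t) + 0"
    by (intro tendsto_add tendsto_const l)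
  then have "(\<lambda>k. 4 * (W (u t) + W (\<lambda>x. u t x - U k t x))) \<longlonglongrightarrow> 4 * (W (u t) + 0)"
    by (rule ennreal_tendsto_cmult[rotated]) simp
  then have "limsup (\<lambda>k. 4 * (W (u t) + W (\<lambda>x. u t x - U k t x))) = 4 * W (u t)"
    using lim_imp_Limsup[OF sequentially_bot] by force
  moreover have "lsup t \<le> limsup (\<lambda>k. 4 * (W (u t) + W (\<lambda>x. u t x - U k t x)))"
    unfolding lsup_def by (rule Limsup_mono) (rule always_eventually, rule allI, rule le)
  ultimately show "lsup t \<le> 4 * W (u t)" by simp
qed

lemma lsup_finite: "(\<integral>\<^sup>+t. lsup t + 1 \<partial>M) < \<infinity>"
proof -
  \<comment> \<open>The constant 4 is moved to the left as 1/4, where the integrand is measurable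
    and the constant can be taken out of the integral.\<close>
  have "(\<integral>\<^sup>+t. ennreal (1/4) * lsup t \<partial>M) \<le> (\<integral>\<^sup>+t. W (u t) \<partial>M)"
  proof (rule nn_integral_mono_AE, use AE_lsup_le in eventually_elim)
    fix t assume "lsup t \<le> 4 * W (u t)"
    then have "ennreal (1/4) * lsup t \<le> ennreal (1/4) * (4 * W (u t))" by (rule mult_left_mono) simp
    also have "\<dots> = (ennreal (1/4) * ennreal 4) * W (u t)" by (simp add: mult.assoc)
    also have "ennreal (1/4) * ennreal 4 = 1" by (subst ennreal_mult[symmetric]) auto
    finally show "ennreal (1/4) * lsup t \<le> W (u t)" by simp
  qed
  then have "(\<integral>\<^sup>+t. ennreal (1/4) * lsup t \<partial>M) < \<infinity>" using u_W1_finite by (rule order_le_less_trans)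
  then have "ennreal (1/4) * (\<integral>\<^sup>+t. lsup t \<partial>M) < \<infinity>" by (simp add: nn_integral_cmult)
  then have "(\<integral>\<^sup>+t. lsup t \<partial>M) < \<infinity>" by (auto simp: ennreal_mult_less_top)
  moreover have "emeasure M (space M) < top" by (simp only: less_top[symmetric] fM.emeasure_finite not_False_eq_True)
  ultimately show ?thesis by (subst nn_integral_add) auto
qed

definition good :: "real \<Rightarrow> bool" where
  "good t \<longleftrightarrow> t \<in> {0<..<T} \<and> (\<lambda>k. W (\<lambda>x. u t x - U k t x)) \<longlonglongrightarrow> 0 \<and> u t \<in> weakly_diff \<Omega> \<and> lsup t < top"

lemma AE_good: "AE t in M. good t"
proof -
  have "(\<integral>\<^sup>+t. lsup t + 1 \<partial>M) \<noteq> \<infinity>" using lsup_finite by simp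
  then have "AE t in M. lsup t + 1 \<noteq> \<infinity>" by (intro nn_integral_PInf_AE) auto
  with U_lim u_weakly_diff AE_space show ?thesis
    by eventually_elim (auto simp: good_def less_top)
qed

text \<open>The summand 1 puts the truncation level strictly above the upper limit, so the
  truncation is eventually inactive.\<close>

lemma good_eventually_V:
  assumes "good t" shows "\<forall>\<^sub>F k in sequentially. V k t = U k t"
proof -
  have "lsup t < lsup t + 1"
    using assms ennreal_add_left_cancel_less[of "lsup t" 0 1] by (simp add: good_def less_top)
  then have "\<forall>\<^sub>F k in sequentially. W (U k t) < lsup t + 1"
    unfolding lsup_def by (rule Limsup_lessD)
  then show ?thesis by eventually_elim (simp add: V_def less_imp_le)
qed

lemma good_V_lim:
  assumes "good t" shows "(\<lambda>k. W (\<lambda>x. u t x - V k t x)) \<longlonglongrightarrow> 0"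
proof (rule Lim_transform_eventually)
  show "(\<lambda>k. W (\<lambda>x. u t x - U k t x)) \<longlonglongrightarrow> 0" using assms unfolding good_def by blast
  show "\<forall>\<^sub>F k in sequentially. W (\<lambda>x. u t x - U k t x) = W (\<lambda>x. u t x - V k t x)"
    using good_eventually_V[OF assms] by eventually_elim simp
qed

lemma good_V_Lp_lim:
  assumes "good t" shows "(\<lambda>k. Lp_norm (ennreal r) \<Omega> (\<lambda>x. u t x - V k t x)) \<longlonglongrightarrow> 0"
proof (rule tendsto_sandwich[OF _ _ tendsto_const good_V_lim[OF assms]])
  show "\<forall>\<^sub>F k in sequentially. Lp_norm (ennreal r) \<Omega> (\<lambda>x. u t x - V k t x) \<le> W (\<lambda>x. u t x - V k t x)"
    by (intro always_eventually allI Lp_norm_le_W1_norm)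
qed simp

lemma good_V_diff:
  assumes "good t"
  shows "W (\<lambda>x. V j t x - V k t x) \<le> 4 * (W (\<lambda>x. u t x - V k t x) + W (\<lambda>x. u t x - V j t x))"
proof -
  have t: "t \<in> {0<..<T}" and wd: "u t \<in> weakly_diff \<Omega>" using assms by (auto simp: good_def)
  have d: "(\<lambda>x. u t x - V k t x) \<in> weakly_diff \<Omega>" for k
    by (rule weakly_diff_diff[OF open_dom wd test_weakly_diff[OF V_test[OF t]]])
  have "W (\<lambda>x. (u t x - V k t x) - (u t x - V j t x)) \<le> 4 * (W (\<lambda>x. u t x - V k t x) + W (\<lambda>x. u t x - V j t x))"
    by (rule W1_norm_diff[OF open_dom r_ge_1 d d])
  then show ?thesis by (simp add: algebra_simps)
qed

lemma good_cauchy: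
  assumes "good t" and \<eta>: "(\<eta>::real) > 0"
  shows "\<exists>N. \<forall>k\<ge>N. \<forall>j\<ge>N. W (\<lambda>x. V j t x - V k t x) \<le> ennreal \<eta>"
proof -
  \<comment> \<open>\<eta>/8 compensates the constant 4 of \<open>good_V_diff\<close> and its two
    summands.\<close>
  have "\<forall>\<^sub>F k in sequentially. W (\<lambda>x. u t x - V k t x) < ennreal (\<eta> / 8)"
    using order_tendstoD(2)[OF good_V_lim[OF assms(1)], of "ennreal (\<eta> / 8)"] \<eta> by simp
  then obtain N where N: "\<And>k. k \<ge> N \<Longrightarrow> W (\<lambda>x. u t x - V k t x) < ennreal (\<eta> / 8)"
    unfolding eventually_sequentially by blast
  have "W (\<lambda>x. V j t x - V k t x) \<le> ennreal \<eta>" if "k \<ge> N" "j \<ge> N" for j k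
  proof -
    have "W (\<lambda>x. V j t x - V k t x) \<le> 4 * (ennreal (\<eta> / 8) + ennreal (\<eta> / 8))"
      by (rule order_trans[OF good_V_diff[OF assms(1)]])
        (intro mult_left_mono add_mono less_imp_le[OF N] that; simp)
    also have "\<dots> = ennreal 4 * ennreal (\<eta> / 4)" using \<eta> by (simp add: ennreal_plus[symmetric] del: ennreal_plus)
    also have "\<dots> = ennreal (4 * (\<eta> / 4))" using \<eta> by (intro ennreal_mult[symmetric]) auto
    finally show ?thesis by simp
  qed
  then show ?thesis by blast
qed

lemma good_grad_cauchy:
  assumes "good t" and \<eta>: "(\<eta>::real) > 0"
  shows "\<exists>k. \<forall>\<^sub>F j in sequentially. grad_norm r \<Omega> (\<lambda>x. V j t x - V k t x) \<le> ennreal \<eta>"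
proof -
  have t: "t \<in> {0<..<T}" using assms by (auto simp: good_def)
  obtain N where N: "\<forall>k\<ge>N. \<forall>j\<ge>N. W (\<lambda>x. V j t x - V k t x) \<le> ennreal \<eta>"
    using good_cauchy[OF assms] by blast
  have "\<forall>j\<ge>N. grad_norm r \<Omega> (\<lambda>x. V j t x - V N t x) \<le> ennreal \<eta>"
    using N order_trans[OF grad_norm_le_W1_norm[OF open_dom r_ge_1 test_fun_diff[OF V_test[OF t] V_test[OF t]]]] by blast
  then show ?thesis unfolding eventually_sequentially by blast
qed

subsection \<open>A rapidly converging subsequence\<close>

definition grad1 :: "('a \<Rightarrow> 'a) \<Rightarrow> 'a \<Rightarrow> ennreal" where
  "grad1 \<phi> x = (\<Sum>b\<in>Basis. ennreal (norm (dderiv \<phi> b x)))"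

lemma embed_norm:
  fixes g :: "'a \<Rightarrow> 'a"
  assumes "g \<in> borel_measurable borel" "\<And>x. x \<notin> \<Omega> \<Longrightarrow> g x = 0"
  shows "(\<integral>\<^sup>+x. ennreal (norm (g x)) \<partial>lborel) \<le> ennreal c1 * Lp_norm (ennreal r) \<Omega> g"
proof -
  have "(\<integral>\<^sup>+x. ennreal \<bar>norm (g x)\<bar> \<partial>lborel) \<le> ennreal c1 * Lp_norm (ennreal r) \<Omega> (\<lambda>x. norm (g x))"
    by (rule embed) (use assms in auto)
  also have "Lp_norm (ennreal r) \<Omega> (\<lambda>x. norm (g x)) = Lp_norm (ennreal r) \<Omega> g"
    by (rule Lp_norm_cong_AE[OF r_ge_1]) simp
  finally show ?thesis by simp
qed

lemma nn_integral_grad1: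
  assumes \<phi>: "test_fun \<Omega> \<phi>"
  shows "(\<integral>\<^sup>+x. grad1 \<phi> x \<partial>lborel) \<le> ennreal c1 * W \<phi>"
proof -
  have [measurable]: "(\<lambda>x. dderiv \<phi> b x) \<in> borel_measurable borel" for b
    by (rule test_fun_borel[OF test_fun_dderiv[OF \<phi>]])
  have "(\<integral>\<^sup>+x. grad1 \<phi> x \<partial>lborel) = (\<Sum>b\<in>Basis. \<integral>\<^sup>+x. ennreal (norm (dderiv \<phi> b x)) \<partial>lborel)"
    unfolding grad1_def by (rule nn_integral_sum) measurable
  also have "\<dots> \<le> (\<Sum>b\<in>Basis. ennreal c1 * Lp_norm (ennreal r) \<Omega> (\<lambda>x. dderiv \<phi> b x))"
    by (intro sum_mono embed_norm test_fun_borel[OF test_fun_dderiv[OF \<phi>]] test_fun_outside[OF test_fun_dderiv[OF \<phi>]])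
  also have "\<dots> = ennreal c1 * grad_norm r \<Omega> \<phi>" by (simp add: grad_norm_def sum_distrib_left)
  also have "\<dots> \<le> ennreal c1 * W \<phi>" by (intro mult_left_mono grad_norm_le_W1_norm[OF open_dom r_ge_1 \<phi>]) simp
  finally show ?thesis .
qed

text \<open>The supremum over j controls the gradient increments to every later index, hence those
  between consecutive members of any subsequence.\<close>

definition err :: "nat \<Rightarrow> real \<Rightarrow> ennreal" where
  "err k t = (\<integral>\<^sup>+x. ennreal (norm (V k t x - u t x)) \<partial>lborel)
     + (SUP j. \<integral>\<^sup>+x. grad1 (\<lambda>x. V (k + j) t x - V k t x) x \<partial>lborel)"

lemma V_joint: "(\<lambda>z. V k (fst z) (snd z)) \<in> borel_measurable (M \<Otimes>\<^sub>M lborel)"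
proof (rule simple_function_measurable[OF V_simple, where F="\<lambda>v. v"])
  fix v assume "v \<in> V k ` space M"
  then show "v \<in> borel_measurable lborel" using test_fun_borel[OF V_test] by auto
qed

lemma err_borel: "err k \<in> borel_measurable M"
proof -
  note [measurable] = V_joint u_joint
  have "(\<lambda>t. \<integral>\<^sup>+x. ennreal (norm (V k t x - u t x)) \<partial>lborel) \<in> borel_measurable M"
  proof -
    have "(\<lambda>(t, x). ennreal (norm (V k t x - u t x))) \<in> borel_measurable (M \<Otimes>\<^sub>M lborel)"
      unfolding split_beta' by measurable
    then show ?thesis by (rule lborel.borel_measurable_nn_integral)
  qed
  moreover have "(\<lambda>t. \<integral>\<^sup>+x. grad1 (\<lambda>x. V (k + j) t x - V k t x) x \<partial>lborel) \<in> borel_measurable M" for j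
    using simple_imp_borel[OF simple_function_Pair[OF V_simple[of "k + j"] V_simple[of k]],
        of "\<lambda>p. \<integral>\<^sup>+x. grad1 (\<lambda>x. fst p x - snd p x) x \<partial>lborel"] by simp
  ultimately show ?thesis unfolding err_def[abs_def] by (intro borel_measurable_add borel_measurable_SUP) auto
qed

lemmas u_sec_borel = borel_measurable_time_slice[OF u_joint]

lemma good_err_lim:
  assumes g: "good t" shows "(\<lambda>k. err k t) \<longlonglongrightarrow> 0"
proof (rule tendsto_zero_ennreal)
  have t: "t \<in> {0<..<T}" using g by (auto simp: good_def)
  fix \<eta> :: real assume "0 < \<eta>"
  define \<zeta> where "\<zeta> = \<eta> / (4 * (\<bar>c1\<bar> + 1))"
  have \<zeta>: "\<zeta> > 0" "\<bar>c1\<bar> * \<zeta> \<le> \<eta> / 4" using \<open>0 < \<eta>\<close> by (auto simp: \<zeta>_def field_simps)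
  have c: "ennreal c1 * ennreal \<zeta> \<le> ennreal (\<eta> / 4)"
  proof -
    have "ennreal c1 * ennreal \<zeta> \<le> ennreal \<bar>c1\<bar> * ennreal \<zeta>" by (intro mult_right_mono ennreal_leI) auto
    also have "\<dots> = ennreal (\<bar>c1\<bar> * \<zeta>)" using \<zeta>(1) by (intro ennreal_mult[symmetric]) auto
    also have "\<dots> \<le> ennreal (\<eta> / 4)" by (rule ennreal_leI[OF \<zeta>(2)])
    finally show ?thesis .
  qed
  obtain N where N: "\<forall>k\<ge>N. \<forall>j\<ge>N. W (\<lambda>x. V j t x - V k t x) \<le> ennreal \<zeta>" using good_cauchy[OF g \<zeta>(1)] by blast
  have "\<forall>\<^sub>F k in sequentially. W (\<lambda>x. u t x - V k t x) < ennreal \<zeta>"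
    using order_tendstoD(2)[OF good_V_lim[OF g], of "ennreal \<zeta>"] \<zeta>(1) by simp
  moreover have "\<forall>\<^sub>F k in sequentially. k \<ge> N" by (rule eventually_ge_at_top)
  ultimately show "\<forall>\<^sub>F k in sequentially. err k t < ennreal \<eta>"
  proof eventually_elim
    fix k assume k: "W (\<lambda>x. u t x - V k t x) < ennreal \<zeta>" "k \<ge> N"
    have "(\<integral>\<^sup>+x. ennreal (norm (V k t x - u t x)) \<partial>lborel) \<le> ennreal c1 * Lp_norm (ennreal r) \<Omega> (\<lambda>x. u t x - V k t x)"
      using embed_norm[of "\<lambda>x. u t x - V k t x"] u_sec_borel[OF t] test_fun_borel[OF V_test[OF t]]
        u_outside[OF t] test_fun_outside[OF V_test[OF t]] by (simp add: norm_minus_commute)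
    also have "\<dots> \<le> ennreal c1 * ennreal \<zeta>"
      by (intro mult_left_mono order_trans[OF Lp_norm_le_W1_norm less_imp_le[OF k(1)]]) simp
    finally have 1: "(\<integral>\<^sup>+x. ennreal (norm (V k t x - u t x)) \<partial>lborel) \<le> ennreal (\<eta> / 4)" using c by (rule order_trans)
    have 2: "(SUP j. \<integral>\<^sup>+x. grad1 (\<lambda>x. V (k + j) t x - V k t x) x \<partial>lborel) \<le> ennreal (\<eta> / 4)"
    proof (rule SUP_least)
      fix j
      have "(\<integral>\<^sup>+x. grad1 (\<lambda>x. V (k + j) t x - V k t x) x \<partial>lborel) \<le> ennreal c1 * W (\<lambda>x. V (k + j) t x - V k t x)"
        by (rule nn_integral_grad1[OF test_fun_diff[OF V_test[OF t] V_test[OF t]]])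
      also have "\<dots> \<le> ennreal c1 * ennreal \<zeta>" using N k(2) by (intro mult_left_mono) auto
      finally show "(\<integral>\<^sup>+x. grad1 (\<lambda>x. V (k + j) t x - V k t x) x \<partial>lborel) \<le> ennreal (\<eta> / 4)" using c by (rule order_trans)
    qed
    have "err k t \<le> ennreal (\<eta> / 4) + ennreal (\<eta> / 4)" unfolding err_def by (intro add_mono 1 2)
    also have "\<dots> = ennreal (\<eta> / 2)" using \<open>0 < \<eta>\<close> by (simp add: ennreal_plus[symmetric] del: ennreal_plus)
    also have "\<dots> < ennreal \<eta>" using \<open>0 < \<eta>\<close> by (simp add: ennreal_lessI)
    finally show "err k t < ennreal \<eta>" .
  qed
qed

text \<open>The number 8 is the constant 4 of \<open>W1_norm_diff\<close> times two truncated
  functions, each of norm at most \<open>lsup t + 1\<close>.\<close>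

definition err_dom :: "real \<Rightarrow> ennreal" where
  "err_dom t = ennreal c1 * (lsup t + 1) + emeasure lborel \<Omega> * ennreal (Mu t) + ennreal c1 * (8 * (lsup t + 1))"

lemma err_le:
  assumes t: "t \<in> {0<..<T}" shows "err k t \<le> err_dom t"
proof -
  have [measurable]: "V k t \<in> borel_measurable borel" "u t \<in> borel_measurable borel"
    using test_fun_borel[OF V_test[OF t]] u_sec_borel[OF t] by auto
  have [measurable]: "\<Omega> \<in> sets borel" using open_dom by simp
  have "(\<integral>\<^sup>+x. ennreal (norm (V k t x - u t x)) \<partial>lborel)
    \<le> (\<integral>\<^sup>+x. ennreal (norm (V k t x)) + ennreal (Mu t) * indicator \<Omega> x \<partial>lborel)"
  proof (rule nn_integral_mono)
    fix x
    have "norm (V k t x - u t x) \<le> norm (V k t x) + Mu t * indicator \<Omega> x"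
      using u_le[OF t, of x] u_outside[OF t, of x] norm_triangle_ineq4[of "V k t x" "u t x"] by (auto simp: indicator_def)
    then show "ennreal (norm (V k t x - u t x)) \<le> ennreal (norm (V k t x)) + ennreal (Mu t) * indicator \<Omega> x"
      using order_trans[OF norm_ge_zero u_le[OF t, of x]]
      by (auto simp: indicator_def ennreal_plus[symmetric] ennreal_leI simp del: ennreal_plus)
  qed
  also have "\<dots> = (\<integral>\<^sup>+x. ennreal (norm (V k t x)) \<partial>lborel) + ennreal (Mu t) * emeasure lborel \<Omega>"
    by (subst nn_integral_add) (auto simp: nn_integral_cmult_indicator)
  also have "(\<integral>\<^sup>+x. ennreal (norm (V k t x)) \<partial>lborel) \<le> ennreal c1 * Lp_norm (ennreal r) \<Omega> (V k t)"
    by (rule embed_norm) (use test_fun_outside[OF V_test[OF t]] in auto)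
  also have "\<dots> \<le> ennreal c1 * (lsup t + 1)"
    by (intro mult_left_mono order_trans[OF Lp_norm_le_W1_norm V_le]) simp
  finally have 1: "(\<integral>\<^sup>+x. ennreal (norm (V k t x - u t x)) \<partial>lborel) \<le> ennreal c1 * (lsup t + 1) + emeasure lborel \<Omega> * ennreal (Mu t)"
    by (simp add: mult.commute)
  have 2: "(SUP j. \<integral>\<^sup>+x. grad1 (\<lambda>x. V (k + j) t x - V k t x) x \<partial>lborel) \<le> ennreal c1 * (8 * (lsup t + 1))"
  proof (rule SUP_least)
    fix j
    have "(\<integral>\<^sup>+x. grad1 (\<lambda>x. V (k + j) t x - V k t x) x \<partial>lborel) \<le> ennreal c1 * W (\<lambda>x. V (k + j) t x - V k t x)"
      by (rule nn_integral_grad1[OF test_fun_diff[OF V_test[OF t] V_test[OF t]]])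
    also have "W (\<lambda>x. V (k + j) t x - V k t x) \<le> 4 * (W (V (k + j) t) + W (V k t))"
      by (rule W1_norm_diff[OF open_dom r_ge_1 test_weakly_diff[OF V_test[OF t]] test_weakly_diff[OF V_test[OF t]]])
    also have "\<dots> \<le> 4 * ((lsup t + 1) + (lsup t + 1))" by (intro mult_left_mono add_mono V_le) simp
    also have "\<dots> = 8 * (lsup t + 1)" by (simp add: mult_2[symmetric] mult.assoc[symmetric] del: distrib_left_numeral)
    finally show "(\<integral>\<^sup>+x. grad1 (\<lambda>x. V (k + j) t x - V k t x) x \<partial>lborel) \<le> ennreal c1 * (8 * (lsup t + 1))"
      by (simp add: mult_left_mono)
  qed
  show ?thesis unfolding err_def err_dom_def by (rule add_mono[OF 1 2])
qed

lemma err_dom_finite: "err_dom \<in> borel_measurable M" "(\<integral>\<^sup>+t. err_dom t \<partial>M) < \<infinity>"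
proof -
  have [measurable]: "Mu \<in> borel_measurable M" using Mu_int by auto
  show "err_dom \<in> borel_measurable M" unfolding err_dom_def[abs_def] by measurable
  have "(\<integral>\<^sup>+t. ennreal (Mu t) \<partial>M) \<le> (\<integral>\<^sup>+t. ennreal (norm (Mu t)) \<partial>M)" by (intro nn_integral_mono ennreal_leI) simp
  also have "\<dots> < \<infinity>" using Mu_int by (subst (asm) integrable_iff_bounded) blast
  finally have m: "(\<integral>\<^sup>+t. ennreal (Mu t) \<partial>M) < \<infinity>" .
  have "(\<integral>\<^sup>+t. err_dom t \<partial>M) = ennreal c1 * (\<integral>\<^sup>+t. lsup t + 1 \<partial>M) + emeasure lborel \<Omega> * (\<integral>\<^sup>+t. ennreal (Mu t) \<partial>M)
    + ennreal c1 * (8 * (\<integral>\<^sup>+t. lsup t + 1 \<partial>M))"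
    unfolding err_dom_def
    by (subst nn_integral_add, measurable, subst nn_integral_add, measurable, subst nn_integral_cmult, measurable,
        subst nn_integral_cmult, measurable, subst nn_integral_cmult, measurable, subst nn_integral_cmult) auto
  also have "\<dots> < \<infinity>"
    using lsup_finite m dom_finite by (auto simp: ennreal_mult_less_top)
  finally show "(\<integral>\<^sup>+t. err_dom t \<partial>M) < \<infinity>" .
qed

lemma err_lim: "(\<lambda>k. \<integral>\<^sup>+t. err k t \<partial>M) \<longlonglongrightarrow> 0"
proof -
  have "(\<lambda>k. \<integral>\<^sup>+t. err k t \<partial>M) \<longlonglongrightarrow> (\<integral>\<^sup>+t. 0 \<partial>M)"
  proof (rule nn_integral_dominated_convergence[where w=err_dom])
    show "AE t in M. err k t \<le> err_dom t" for k by (rule AE_I2) (simp add: err_le)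
    show "AE t in M. (\<lambda>k. err k t) \<longlonglongrightarrow> 0" using AE_good by eventually_elim (rule good_err_lim)
  qed (use err_borel err_dom_finite in auto)
  then show ?thesis by simp
qed

lemma subsequence_exists:
  obtains \<kappa> :: "nat \<Rightarrow> nat" where "mono \<kappa>" "\<And>i. (\<integral>\<^sup>+t. err (\<kappa> i) t \<partial>M) \<le> ennreal ((1/2) ^ i)"
proof -
  have "\<exists>N. \<forall>k\<ge>N. (\<integral>\<^sup>+t. err k t \<partial>M) < ennreal ((1/2) ^ i)" for i :: nat
    using order_tendstoD(2)[OF err_lim, of "ennreal ((1/2) ^ i)"] unfolding eventually_sequentially by simp
  then obtain N where N: "\<And>i k. k \<ge> N i \<Longrightarrow> (\<integral>\<^sup>+t. err k t \<partial>M) < ennreal ((1/2) ^ i)" by metis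
  \<comment> \<open>The partial sums dominate each \<open>N i\<close> and are monotone in i.\<close>
  define \<kappa> where "\<kappa> i = (\<Sum>l\<le>i. N l)" for i
  show thesis
  proof (rule that[of \<kappa>])
    show "mono \<kappa>" unfolding \<kappa>_def mono_def by (auto intro!: sum_mono2)
    show "(\<integral>\<^sup>+t. err (\<kappa> i) t \<partial>M) \<le> ennreal ((1/2) ^ i)" for i
      by (rule less_imp_le[OF N]) (simp add: \<kappa>_def member_le_sum)
  qed
qed

end

section \<open>A smooth regularisation of the modulus\<close>

lemma sqrt_regularisation_bounds:
  assumes "\<delta> > 0" "a \<ge> 0"
  shows "sqrt (a\<^sup>2 + \<delta>\<^sup>2) - \<delta> \<le> a" "a - \<delta> \<le> sqrt (a\<^sup>2 + \<delta>\<^sup>2) - \<delta>" "0 \<le> sqrt (a\<^sup>2 + \<delta>\<^sup>2) - \<delta>"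
proof -
  have "sqrt (a\<^sup>2 + \<delta>\<^sup>2) \<le> sqrt ((a + \<delta>)\<^sup>2)" using assms by (intro real_sqrt_le_mono) (simp add: power2_sum)
  then show "sqrt (a\<^sup>2 + \<delta>\<^sup>2) - \<delta> \<le> a" using assms by simp
  show "a - \<delta> \<le> sqrt (a\<^sup>2 + \<delta>\<^sup>2) - \<delta>" using real_sqrt_sum_squares_ge1[of a \<delta>] by simp
  show "0 \<le> sqrt (a\<^sup>2 + \<delta>\<^sup>2) - \<delta>" using real_sqrt_sum_squares_ge2[of \<delta> a] by simp
qed

text \<open>The subtracted \<delta> makes the function vanish wherever \<open>v\<close> does, so
  compact support is kept; it differs from the norm of \<open>v\<close> by at most \<delta>.\<close>

definition reg_norm :: "real \<Rightarrow> ('a::euclidean_space \<Rightarrow> 'b::euclidean_space) \<Rightarrow> 'a \<Rightarrow> real" where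
  "reg_norm \<delta> v x = sqrt (v x \<bullet> v x + \<delta>\<^sup>2) - \<delta>"

lemma reg_norm_test:
  assumes v: "test_fun S v" and d: "\<delta> > 0"
  shows "test_fun S (reg_norm \<delta> v)"
proof -
  obtain K where K: "compact K" "K \<subseteq> S" "\<And>x. x \<notin> K \<Longrightarrow> v x = 0" using test_funE[OF v] by blast
  have pos: "v x \<bullet> v x + \<delta>\<^sup>2 > 0" for x using d by (simp add: add_nonneg_pos)
  have "smooth (\<lambda>x. sqrt (v x \<bullet> v x + \<delta>\<^sup>2))"
    by (rule smooth_sqrt[OF smooth_add[OF smooth_inner[OF test_fun_smooth[OF v] test_fun_smooth[OF v]] smooth_const] pos])
  then have "smooth (reg_norm \<delta> v)" unfolding reg_norm_def[abs_def] by (rule smooth_diff[OF _ smooth_const])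
  then show ?thesis by (rule test_funI[OF _ K(1,2)]) (use K(3) d in \<open>simp add: reg_norm_def\<close>)
qed

lemma reg_norm_dderiv:
  assumes v: "test_fun S v" and d: "\<delta> > 0"
  shows "\<bar>dderiv (reg_norm \<delta> v) w x\<bar> \<le> norm (dderiv v w x)"
proof -
  have pos: "v x \<bullet> v x + \<delta>\<^sup>2 > 0" using d by (simp add: add_nonneg_pos)
  have "(v has_derivative (\<lambda>w. dderiv v w x)) (at x)" by (rule smooth_has_derivative[OF test_fun_smooth[OF v]])
  then have "((\<lambda>x. v x \<bullet> v x + \<delta>\<^sup>2) has_derivative (\<lambda>w. 2 * (v x \<bullet> dderiv v w x))) (at x)"
    by (auto intro!: derivative_eq_intros simp: inner_commute)
  then have "((\<lambda>x. sqrt (v x \<bullet> v x + \<delta>\<^sup>2)) has_derivative (\<lambda>w. (v x \<bullet> dderiv v w x) / sqrt (v x \<bullet> v x + \<delta>\<^sup>2))) (at x)"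
    by (rule has_derivative_eq_rhs[OF has_derivative_real_sqrt[where g="\<lambda>x. v x \<bullet> v x + \<delta>\<^sup>2", OF pos]])
      (simp add: field_simps)
  then have "(reg_norm \<delta> v has_derivative (\<lambda>w. (v x \<bullet> dderiv v w x) / sqrt (v x \<bullet> v x + \<delta>\<^sup>2) - 0)) (at x)"
    unfolding reg_norm_def[abs_def] by (rule has_derivative_diff[OF _ has_derivative_const])
  then have "dderiv (reg_norm \<delta> v) w x = (v x \<bullet> dderiv v w x) / sqrt (v x \<bullet> v x + \<delta>\<^sup>2) - 0" by (rule dderiv_eq)
  then have "\<bar>dderiv (reg_norm \<delta> v) w x\<bar> = \<bar>v x \<bullet> dderiv v w x\<bar> / sqrt (v x \<bullet> v x + \<delta>\<^sup>2)"
    using pos by (simp add: abs_divide)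
  also have "\<dots> \<le> (norm (v x) * norm (dderiv v w x)) / sqrt (v x \<bullet> v x + \<delta>\<^sup>2)"
    using pos Cauchy_Schwarz_ineq2[of "v x" "dderiv v w x"] by (intro divide_right_mono) auto
  also have "\<dots> \<le> norm (dderiv v w x)"
  proof -
    have "norm (v x) \<le> sqrt (v x \<bullet> v x + \<delta>\<^sup>2)" unfolding norm_eq_sqrt_inner by (rule real_sqrt_le_mono) simp
    then have "norm (v x) * norm (dderiv v w x) \<le> norm (dderiv v w x) * sqrt (v x \<bullet> v x + \<delta>\<^sup>2)"
      by (subst mult.commute, intro mult_left_mono) auto
    then show ?thesis using pos by (simp add: pos_divide_le_eq)
  qed
  finally show ?thesis .
qed

context sobolev_velocity begin

definition grad1r :: "('a \<Rightarrow> 'a) \<Rightarrow> 'a \<Rightarrow> real" where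
  "grad1r \<phi> x = (\<Sum>b\<in>Basis. norm (dderiv \<phi> b x))"

lemma grad1_eq: "grad1 \<phi> x = ennreal (grad1r \<phi> x)"
  unfolding grad1_def grad1r_def by (rule sum_ennreal) simp

lemma grad1r_nonneg: "grad1r \<phi> x \<ge> 0"
  unfolding grad1r_def by (rule sum_nonneg) simp

lemma grad1r_borel: "test_fun \<Omega> \<phi> \<Longrightarrow> grad1r \<phi> \<in> borel_measurable borel"
proof -
  assume \<phi>: "test_fun \<Omega> \<phi>"
  have [measurable]: "(\<lambda>x. dderiv \<phi> b x) \<in> borel_measurable borel" for b
    by (rule test_fun_borel[OF test_fun_dderiv[OF \<phi>]])
  show ?thesis unfolding grad1r_def[abs_def] by measurable
qed

lemma dderiv_le_grad1r:
  assumes "test_fun \<Omega> \<phi>" shows "norm (dderiv \<phi> v x) \<le> norm v * grad1r \<phi> x"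
proof -
  have "norm (dderiv \<phi> v x) = norm (\<Sum>b\<in>Basis. (v \<bullet> b) *\<^sub>R dderiv \<phi> b x)"
    using dderiv_basis_sum[OF smooth_differentiable[OF test_fun_smooth[OF assms], of x], of v] by metis
  also have "\<dots> \<le> (\<Sum>b\<in>Basis. norm v * norm (dderiv \<phi> b x))"
    by (rule sum_norm_le) (auto intro!: mult_right_mono Basis_le_norm)
  finally show ?thesis by (simp add: grad1r_def sum_distrib_left)
qed

lemma grad1_V_joint: "(\<lambda>z. grad1 (V k (fst z)) (snd z)) \<in> borel_measurable (M \<Otimes>\<^sub>M lborel)"
proof -
  have "(\<lambda>z. grad1r (V k (fst z)) (snd z)) \<in> borel_measurable (M \<Otimes>\<^sub>M lborel)"
  proof (rule simple_function_measurable[OF V_simple, where F=grad1r])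
    fix v assume "v \<in> V k ` space M"
    then have "test_fun \<Omega> v" using V_test by auto
    then show "grad1r v \<in> borel_measurable lborel" using grad1r_borel by simp
  qed
  then show ?thesis unfolding grad1_eq by measurable
qed

text \<open>The pair of two simple functions is again simple, so differences are treated like single
  functions.\<close>

lemma grad1_V_diff_joint: "(\<lambda>z. grad1 (\<lambda>y. V j (fst z) y - V k (fst z) y) (snd z)) \<in> borel_measurable (M \<Otimes>\<^sub>M lborel)"
proof -
  have "(\<lambda>z. (\<lambda>p. grad1r (\<lambda>y. fst p y - snd p y)) ((\<lambda>t. (V j t, V k t)) (fst z)) (snd z)) \<in> borel_measurable (M \<Otimes>\<^sub>M lborel)"
  proof (rule simple_function_measurable[OF simple_function_Pair[OF V_simple V_simple]])
    fix p assume "p \<in> (\<lambda>t. (V j t, V k t)) ` space M"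
    then obtain t where "t \<in> {0<..<T}" "p = (V j t, V k t)" by auto
    then have "test_fun \<Omega> (\<lambda>y. fst p y - snd p y)" using test_fun_diff[OF V_test V_test] by simp
    then show "grad1r (\<lambda>y. fst p y - snd p y) \<in> borel_measurable lborel" using grad1r_borel by simp
  qed
  then show ?thesis unfolding grad1_eq by simp
qed

text \<open>The cutoffs are smoothings of the time integral of \<^term>\<open>norm (V k t x)\<close>. Since \<^term>\<open>V k\<close> is a simple
  function of time, these integrals are finite sums, so their spatial derivatives are elementary.\<close>

lemma cutoff_exists:
  obtains h :: "nat \<Rightarrow> 'a \<Rightarrow> real" and G :: "'a \<Rightarrow> real" where
    "\<And>k. test_fun \<Omega> (h k)" "\<And>k x. h k x \<ge> 0"
    "AE x in lborel. (\<lambda>k. h k x) \<longlonglongrightarrow> (\<integral>t. norm (u t x) \<partial>M)"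
    "integrable lborel G" "\<And>x. G x \<ge> 0"
    "\<And>k. AE x in lborel. \<forall>v. \<bar>dderiv (h k) v x\<bar> \<le> G x * norm v"
proof -
  obtain \<kappa> where \<kappa>: "mono \<kappa>" "\<And>i. (\<integral>\<^sup>+t. err (\<kappa> i) t \<partial>M) \<le> ennreal ((1/2) ^ i)"
    using subsequence_exists by blast
  \<comment> \<open>\<open>d l\<close> bounds the change of the time-integrated gradient from one
    member of the subsequence to the next, and \<open>E i\<close> is the time-integrated distance to
    \<open>u\<close>.\<close>
  define d where "d l x = (\<integral>\<^sup>+t. grad1 (\<lambda>y. V (\<kappa> (Suc l)) t y - V (\<kappa> l) t y) x \<partial>M)" for l x
  define g where "g i x = (\<integral>\<^sup>+t. grad1 (V (\<kappa> i) t) x \<partial>M)" for i x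
  define E where "E i x = (\<integral>\<^sup>+t. ennreal (norm (V (\<kappa> i) t x - u t x)) \<partial>M)" for i x
  note joint[measurable] = grad1_V_joint grad1_V_diff_joint V_joint u_joint
  have swap: "(\<lambda>(x, t). f (t, x)) \<in> borel_measurable (lborel \<Otimes>\<^sub>M M)"
    if "f \<in> borel_measurable (M \<Otimes>\<^sub>M lborel)" for f :: "real \<times> 'a \<Rightarrow> ennreal"
    using measurable_compose[OF measurable_pair_swap' that] by (simp add: split_beta')
  have gm[measurable]: "g i \<in> borel_measurable lborel" for i
    unfolding g_def using fM.borel_measurable_nn_integral[OF swap[OF joint(1)]] by simp
  have dm[measurable]: "d l \<in> borel_measurable lborel" for l
    unfolding d_def using fM.borel_measurable_nn_integral[OF swap[OF joint(2)]] by simp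
  have VE: "(\<lambda>z. ennreal (norm (V k (fst z) (snd z) - u (fst z) (snd z)))) \<in> borel_measurable (M \<Otimes>\<^sub>M lborel)" for k
    by measurable
  have Em[measurable]: "E i \<in> borel_measurable lborel" for i
    unfolding E_def using fM.borel_measurable_nn_integral[OF swap[OF VE]] by simp
  have d_int: "(\<integral>\<^sup>+x. d l x \<partial>lborel) \<le> ennreal ((1/2) ^ l)" for l
  proof -
    have "(\<integral>\<^sup>+x. d l x \<partial>lborel) = (\<integral>\<^sup>+t. \<integral>\<^sup>+x. grad1 (\<lambda>y. V (\<kappa> (Suc l)) t y - V (\<kappa> l) t y) x \<partial>lborel \<partial>M)"
      unfolding d_def by (rule PP.Fubini') (use joint(2) in \<open>simp add: split_beta'\<close>)
    also have "\<dots> \<le> (\<integral>\<^sup>+t. err (\<kappa> l) t \<partial>M)"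
    proof (rule nn_integral_mono)
      fix t
      define j where "j = \<kappa> (Suc l) - \<kappa> l"
      have j: "\<kappa> (Suc l) = \<kappa> l + j" using monoD[OF \<kappa>(1), of l "Suc l"] by (simp add: j_def)
      have "(\<integral>\<^sup>+x. grad1 (\<lambda>y. V (\<kappa> (Suc l)) t y - V (\<kappa> l) t y) x \<partial>lborel)
        \<le> (SUP j. \<integral>\<^sup>+x. grad1 (\<lambda>x. V (\<kappa> l + j) t x - V (\<kappa> l) t x) x \<partial>lborel)"
        unfolding j using SUP_upper[of j UNIV "\<lambda>j. \<integral>\<^sup>+x. grad1 (\<lambda>x. V (\<kappa> l + j) t x - V (\<kappa> l) t x) x \<partial>lborel"]
        by simp
      then show "(\<integral>\<^sup>+x. grad1 (\<lambda>y. V (\<kappa> (Suc l)) t y - V (\<kappa> l) t y) x \<partial>lborel) \<le> err (\<kappa> l) t"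
        unfolding err_def by (rule order_trans) simp
    qed
    finally show ?thesis using \<kappa>(2)[of l] by (rule order_trans)
  qed
  have E_int: "(\<integral>\<^sup>+x. E i x \<partial>lborel) \<le> ennreal ((1/2) ^ i)" for i
  proof -
    have "(\<integral>\<^sup>+x. E i x \<partial>lborel) = (\<integral>\<^sup>+t. \<integral>\<^sup>+x. ennreal (norm (V (\<kappa> i) t x - u t x)) \<partial>lborel \<partial>M)"
      unfolding E_def by (rule PP.Fubini') (use VE in \<open>simp add: split_beta'\<close>)
    also have "\<dots> \<le> (\<integral>\<^sup>+t. err (\<kappa> i) t \<partial>M)" unfolding err_def by (intro nn_integral_mono) simp
    finally show ?thesis using \<kappa>(2)[of i] by (rule order_trans)
  qed
  have geo: "(\<Sum>i. ennreal ((1/2) ^ i)) < \<infinity>"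
  proof -
    have "(\<Sum>i. ennreal ((1/2) ^ i)) = ennreal (\<Sum>i. (1/2) ^ i)" by (rule suminf_ennreal2) (auto intro: summable_geometric)
    then show ?thesis by simp
  qed
  \<comment> \<open>The first gradient plus all increments bounds every \<open>g i\<close>, and the
    increments have integrals at most 2^(-l), so the sum is integrable.\<close>
  define Gh where "Gh x = g 0 x + (\<Sum>l. d l x)" for x
  have Ghm[measurable]: "Gh \<in> borel_measurable lborel" unfolding Gh_def[abs_def] by measurable
  have Gh_int: "(\<integral>\<^sup>+x. Gh x \<partial>lborel) < \<infinity>"
  proof -
    have "(\<integral>\<^sup>+x. g 0 x \<partial>lborel) = (\<integral>\<^sup>+t. \<integral>\<^sup>+x. grad1 (V (\<kappa> 0) t) x \<partial>lborel \<partial>M)"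
      unfolding g_def by (rule PP.Fubini') (use joint(1) in \<open>simp add: split_beta'\<close>)
    also have "\<dots> \<le> (\<integral>\<^sup>+t. ennreal c1 * (lsup t + 1) \<partial>M)"
    proof (rule nn_integral_mono)
      fix t assume "t \<in> space M"
      then have t: "t \<in> {0<..<T}" by simp
      show "(\<integral>\<^sup>+x. grad1 (V (\<kappa> 0) t) x \<partial>lborel) \<le> ennreal c1 * (lsup t + 1)"
        by (rule order_trans[OF nn_integral_grad1[OF V_test[OF t]] mult_left_mono[OF V_le]]) simp
    qed
    also have "\<dots> = ennreal c1 * (\<integral>\<^sup>+t. lsup t + 1 \<partial>M)" by (rule nn_integral_cmult) measurable
    also have "\<dots> < \<infinity>" using lsup_finite by (simp add: ennreal_mult_less_top)
    finally have 1: "(\<integral>\<^sup>+x. g 0 x \<partial>lborel) < \<infinity>" .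
    have "(\<integral>\<^sup>+x. (\<Sum>l. d l x) \<partial>lborel) = (\<Sum>l. \<integral>\<^sup>+x. d l x \<partial>lborel)" by (rule nn_integral_suminf) measurable
    also have "\<dots> \<le> (\<Sum>i. ennreal ((1/2) ^ i))" by (rule suminf_le[OF d_int]) auto
    also note geo
    finally have 2: "(\<integral>\<^sup>+x. (\<Sum>l. d l x) \<partial>lborel) < \<infinity>" .
    have "(\<integral>\<^sup>+x. Gh x \<partial>lborel) = (\<integral>\<^sup>+x. g 0 x \<partial>lborel) + (\<integral>\<^sup>+x. (\<Sum>l. d l x) \<partial>lborel)"
      unfolding Gh_def by (rule nn_integral_add) measurable
    then show ?thesis using 1 2 by simp
  qed
  have g_step: "g (Suc i) x \<le> g i x + d i x" for i x
  proof -
    have m1: "(\<lambda>t. grad1 (V (\<kappa> i) t) x) \<in> borel_measurable M"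
      using measurable_compose[OF measurable_Pair2' joint(1), of x] by simp
    have m2: "(\<lambda>t. grad1 (\<lambda>y. V (\<kappa> (Suc i)) t y - V (\<kappa> i) t y) x) \<in> borel_measurable M"
      using measurable_compose[OF measurable_Pair2' joint(2), of x] by simp
    have "g (Suc i) x \<le> (\<integral>\<^sup>+t. grad1 (V (\<kappa> i) t) x + grad1 (\<lambda>y. V (\<kappa> (Suc i)) t y - V (\<kappa> i) t y) x \<partial>M)"
      unfolding g_def
    proof (rule nn_integral_mono)
      fix t assume "t \<in> space M"
      then have t: "t \<in> {0<..<T}" by simp
      have "grad1r (V (\<kappa> (Suc i)) t) x \<le> grad1r (V (\<kappa> i) t) x + grad1r (\<lambda>y. V (\<kappa> (Suc i)) t y - V (\<kappa> i) t y) x"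
        unfolding grad1r_def sum.distrib[symmetric]
      proof (rule sum_mono)
        fix b
        show "norm (dderiv (V (\<kappa> (Suc i)) t) b x) \<le> norm (dderiv (V (\<kappa> i) t) b x) + norm (dderiv (\<lambda>y. V (\<kappa> (Suc i)) t y - V (\<kappa> i) t y) b x)"
          unfolding dderiv_diff[OF test_fun_smooth[OF V_test[OF t]] test_fun_smooth[OF V_test[OF t]]]
          using norm_triangle_sub[of "dderiv (V (\<kappa> (Suc i)) t) b x" "dderiv (V (\<kappa> i) t) b x"] by simp
      qed
      then show "grad1 (V (\<kappa> (Suc i)) t) x \<le> grad1 (V (\<kappa> i) t) x + grad1 (\<lambda>y. V (\<kappa> (Suc i)) t y - V (\<kappa> i) t y) x"
        unfolding grad1_eq using grad1r_nonneg by (simp add: ennreal_plus[symmetric] ennreal_leI del: ennreal_plus)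
    qed
    also have "\<dots> = g i x + d i x" unfolding g_def d_def by (rule nn_integral_add[OF m1 m2])
    finally show ?thesis .
  qed
  have g_le: "g i x \<le> Gh x" for i x
  proof -
    have "g i x \<le> g 0 x + (\<Sum>l<i. d l x)"
    proof (induction i)
      case (Suc i)
      have "g (Suc i) x \<le> (g 0 x + (\<Sum>l<i. d l x)) + d i x"
        by (rule order_trans[OF g_step]) (rule add_right_mono[OF Suc.IH])
      then show ?case by (simp add: add.assoc)
    qed simp
    also have "\<dots> \<le> Gh x" unfolding Gh_def by (intro add_left_mono sum_le_suminf) auto
    finally show ?thesis .
  qed
  \<comment> \<open>\<open>enn2real\<close> sends an infinite value to 0, so \<open>G\<close> bounds
    the gradients only where \<open>Gh\<close> is finite, that is, almost everywhere.\<close>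
  define G where "G x = enn2real (Gh x)" for x
  have G_nonneg: "G x \<ge> 0" for x by (simp add: G_def)
  have G_int: "integrable lborel G"
  proof (rule integrableI_bounded)
    show "G \<in> borel_measurable lborel" unfolding G_def[abs_def] by measurable
    have "(\<integral>\<^sup>+x. ennreal (norm (G x)) \<partial>lborel) \<le> (\<integral>\<^sup>+x. Gh x \<partial>lborel)"
      by (intro nn_integral_mono) (simp add: G_def ennreal_enn2real_if)
    then show "(\<integral>\<^sup>+x. ennreal (norm (G x)) \<partial>lborel) < \<infinity>" using Gh_int by (rule order_le_less_trans)
  qed
  have AE_Gh: "AE x in lborel. Gh x = ennreal (G x)"
  proof -
    have "AE x in lborel. Gh x \<noteq> \<infinity>" by (rule nn_integral_PInf_AE) (use Gh_int in auto)
    then show ?thesis by eventually_elim (simp add: G_def less_top)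
  qed
  define \<delta> where "\<delta> i = 1 / (real i + 1)" for i
  have \<delta>: "\<delta> i > 0" for i by (simp add: \<delta>_def)
  have \<delta>_lim: "\<delta> \<longlonglongrightarrow> 0" unfolding \<delta>_def using LIMSEQ_inverse_real_of_nat by (simp add: inverse_eq_divide add.commute)
  define S where "S i = V (\<kappa> i) ` space M" for i
  define m where "m i v = measure M (V (\<kappa> i) -` {v} \<inter> space M)" for i v
  define h where "h i x = (\<Sum>v\<in>S i. m i v * reg_norm (\<delta> i) v x)" for i x
  have S_test: "test_fun \<Omega> v" if "v \<in> S i" for v i using that V_test by (auto simp: S_def)
  have h_test: "test_fun \<Omega> (h i)" for i
    unfolding h_def[abs_def]
    by (intro test_fun_sum test_fun_bounded_linear[OF bounded_linear_mult_right] reg_norm_test[OF S_test \<delta>])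
  \<comment> \<open>The finite sum is the form that is smooth in x; this integral is the form that
    compares with the time integral of the speed.\<close>
  have h_eq: "h i x = (\<integral>t. reg_norm (\<delta> i) (V (\<kappa> i) t) x \<partial>M)" for i x
    unfolding h_def S_def m_def by (rule fM.simple_function_integral(2)[OF V_simple, symmetric])
  have reg_eq: "reg_norm e v x = sqrt ((norm (v x))\<^sup>2 + e\<^sup>2) - e" for e and v :: "'a \<Rightarrow> 'a" and x
    by (simp add: reg_norm_def power2_norm_eq_inner)
  have h_nonneg: "h i x \<ge> 0" for i x
    unfolding h_def m_def reg_eq by (intro sum_nonneg mult_nonneg_nonneg sqrt_regularisation_bounds(3) \<delta>) auto
  have h_deriv: "AE x in lborel. \<forall>v. \<bar>dderiv (h i) v x\<bar> \<le> G x * norm v" for i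
    using AE_Gh
  proof eventually_elim
    fix x assume Gx: "Gh x = ennreal (G x)"
    have int: "(\<integral>t. grad1r (V (\<kappa> i) t) x \<partial>M) = (\<Sum>v\<in>S i. m i v * grad1r v x)"
      "integrable M (\<lambda>t. grad1r (V (\<kappa> i) t) x)"
      unfolding S_def m_def by (rule fM.simple_function_integral[OF V_simple])+
    have "ennreal (\<integral>t. grad1r (V (\<kappa> i) t) x \<partial>M) = g i x"
      unfolding g_def grad1_eq by (rule nn_integral_eq_integral[symmetric, OF int(2)]) (simp add: grad1r_nonneg)
    also have "\<dots> \<le> ennreal (G x)" using g_le[of i x] Gx by simp
    finally have le: "(\<Sum>v\<in>S i. m i v * grad1r v x) \<le> G x" using G_nonneg[of x] int(1) by simp
    show "\<forall>w. \<bar>dderiv (h i) w x\<bar> \<le> G x * norm w"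
    proof
      fix w
      have "(h i has_derivative (\<lambda>w. \<Sum>v\<in>S i. m i v * dderiv (reg_norm (\<delta> i) v) w x)) (at x)"
        unfolding h_def[abs_def]
      proof (rule has_derivative_sum, rule has_derivative_mult_right)
        fix v assume "v \<in> S i"
        show "(reg_norm (\<delta> i) v has_derivative (\<lambda>w. dderiv (reg_norm (\<delta> i) v) w x)) (at x)"
          by (rule smooth_has_derivative[OF test_fun_smooth[OF reg_norm_test[OF S_test[OF \<open>v \<in> S i\<close>] \<delta>]]])
      qed
      then have "dderiv (h i) w x = (\<Sum>v\<in>S i. m i v * dderiv (reg_norm (\<delta> i) v) w x)" by (rule dderiv_eq)
      then have "\<bar>dderiv (h i) w x\<bar> \<le> (\<Sum>v\<in>S i. \<bar>m i v * dderiv (reg_norm (\<delta> i) v) w x\<bar>)" by simp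
      also have "\<dots> \<le> (\<Sum>v\<in>S i. m i v * (norm w * grad1r v x))"
      proof (rule sum_mono)
        fix v assume v: "v \<in> S i"
        have "\<bar>dderiv (reg_norm (\<delta> i) v) w x\<bar> \<le> norm w * grad1r v x"
          by (rule order_trans[OF reg_norm_dderiv[OF S_test[OF v] \<delta>] dderiv_le_grad1r[OF S_test[OF v]]])
        then show "\<bar>m i v * dderiv (reg_norm (\<delta> i) v) w x\<bar> \<le> m i v * (norm w * grad1r v x)"
          by (simp add: abs_mult m_def mult_left_mono)
      qed
      also have "\<dots> = norm w * (\<Sum>v\<in>S i. m i v * grad1r v x)" by (simp add: sum_distrib_left mult.left_commute)
      also have "\<dots> \<le> norm w * G x" by (rule mult_left_mono[OF le]) simp
      finally show "\<bar>dderiv (h i) w x\<bar> \<le> G x * norm w" by (simp add: mult.commute)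
    qed
  qed
  \<comment> \<open>The integrals of the \<open>E i\<close> are summable, so almost everywhere the
    series converges and its terms tend to 0 without a further subsequence.\<close>
  have "AE x in lborel. (\<Sum>i. E i x) \<noteq> \<infinity>"
  proof (rule nn_integral_PInf_AE)
    have "(\<integral>\<^sup>+x. (\<Sum>i. E i x) \<partial>lborel) = (\<Sum>i. \<integral>\<^sup>+x. E i x \<partial>lborel)" by (rule nn_integral_suminf) measurable
    also have "\<dots> \<le> (\<Sum>i. ennreal ((1/2) ^ i))" by (rule suminf_le[OF E_int]) auto
    also note geo
    finally show "(\<integral>\<^sup>+x. (\<Sum>i. E i x) \<partial>lborel) \<noteq> \<infinity>" by simp
  qed measurable
  then have h_lim: "AE x in lborel. (\<lambda>i. h i x) \<longlonglongrightarrow> (\<integral>t. norm (u t x) \<partial>M)"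
  proof eventually_elim
    fix x assume "(\<Sum>i. E i x) \<noteq> \<infinity>"
    then have E0: "(\<lambda>i. E i x) \<longlonglongrightarrow> 0" by (intro suminf_finite_imp_tendsto_0) simp
    have um[measurable]: "(\<lambda>t. u t x) \<in> borel_measurable M"
      using measurable_compose[OF measurable_Pair2' u_joint, of x] by simp
    have Vm[measurable]: "(\<lambda>t. V (\<kappa> i) t x) \<in> borel_measurable M" for i
      using measurable_compose[OF measurable_Pair2' V_joint, of x] by simp
    have ui: "integrable M (\<lambda>t. norm (u t x))"
      by (rule Bochner_Integration.integrable_bound[OF Mu_int])
        (use u_le um in \<open>auto intro!: AE_I2 order_trans[OF _ abs_ge_self]\<close>)
    have ri: "integrable M (\<lambda>t. reg_norm (\<delta> i) (V (\<kappa> i) t) x)" for i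
      by (rule fM.simple_function_integral(1)[OF V_simple])
    have le: "ennreal \<bar>h i x - (\<integral>t. norm (u t x) \<partial>M)\<bar> \<le> E i x + ennreal (\<delta> i) * emeasure M (space M)" for i
    proof -
      have "h i x - (\<integral>t. norm (u t x) \<partial>M) = (\<integral>t. reg_norm (\<delta> i) (V (\<kappa> i) t) x - norm (u t x) \<partial>M)"
        unfolding h_eq by (rule Bochner_Integration.integral_diff[symmetric, OF ri ui])
      then have "ennreal \<bar>h i x - (\<integral>t. norm (u t x) \<partial>M)\<bar> \<le> (\<integral>\<^sup>+t. ennreal (norm (reg_norm (\<delta> i) (V (\<kappa> i) t) x - norm (u t x))) \<partial>M)"
        using integral_norm_bound_ennreal[OF Bochner_Integration.integrable_diff[OF ri ui]] by simp
      also have "\<dots> \<le> (\<integral>\<^sup>+t. ennreal (norm (V (\<kappa> i) t x - u t x)) + ennreal (\<delta> i) \<partial>M)"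
      proof (rule nn_integral_mono)
        fix t
        have "\<bar>reg_norm (\<delta> i) (V (\<kappa> i) t) x - norm (u t x)\<bar> \<le> norm (V (\<kappa> i) t x - u t x) + \<delta> i"
          unfolding reg_eq abs_le_iff
          using sqrt_regularisation_bounds[OF \<delta>[of i] norm_ge_zero[of "V (\<kappa> i) t x"]] norm_triangle_ineq3[of "V (\<kappa> i) t x" "u t x"] \<delta>[of i]
          by linarith
        then show "ennreal (norm (reg_norm (\<delta> i) (V (\<kappa> i) t) x - norm (u t x))) \<le> ennreal (norm (V (\<kappa> i) t x - u t x)) + ennreal (\<delta> i)"
          using \<delta>[of i] by (simp add: ennreal_plus[symmetric] ennreal_leI del: ennreal_plus)
      qed
      also have "\<dots> = E i x + ennreal (\<delta> i) * emeasure M (space M)"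
        unfolding E_def by (subst nn_integral_add) auto
      finally show ?thesis .
    qed
    have "(\<lambda>i. ennreal (\<delta> i)) \<longlonglongrightarrow> ennreal 0" by (rule tendsto_ennrealI[OF \<delta>_lim])
    then have "(\<lambda>i. emeasure M (space M) * ennreal (\<delta> i)) \<longlonglongrightarrow> emeasure M (space M) * ennreal 0"
      by (rule ennreal_tendsto_cmult[rotated]) (simp only: less_top[symmetric] fM.emeasure_finite not_False_eq_True)
    then have "(\<lambda>i. E i x + ennreal (\<delta> i) * emeasure M (space M)) \<longlonglongrightarrow> 0 + 0"
      using E0 by (intro tendsto_add) (simp_all add: mult.commute)
    then have up: "(\<lambda>i. E i x + ennreal (\<delta> i) * emeasure M (space M)) \<longlonglongrightarrow> 0" by simp
    have "(\<lambda>i. ennreal \<bar>h i x - (\<integral>t. norm (u t x) \<partial>M)\<bar>) \<longlonglongrightarrow> 0"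
      by (rule tendsto_sandwich[OF _ _ tendsto_const up]) (rule always_eventually, simp, rule always_eventually, rule allI, rule le)
    then have "(\<lambda>i. \<bar>h i x - (\<integral>t. norm (u t x) \<partial>M)\<bar>) \<longlonglongrightarrow> 0"
      using tendsto_ennreal_iff[of "\<lambda>i. \<bar>h i x - (\<integral>t. norm (u t x) \<partial>M)\<bar>" sequentially 0] by simp
    then have "(\<lambda>i. h i x - (\<integral>t. norm (u t x) \<partial>M)) \<longlonglongrightarrow> 0" by (rule tendsto_rabs_zero_cancel)
    then show "(\<lambda>i. h i x) \<longlonglongrightarrow> (\<integral>t. norm (u t x) \<partial>M)" by (simp add: LIM_zero_iff)
  qed
  show thesis by (rule that[OF h_test h_nonneg h_lim G_int G_nonneg h_deriv])
qed

end

subsection \<open>Borel representatives\<close>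

text \<open>Completeness of Lebesgue measure.\<close>

lemma borel_measurable_lebesgue_on_AE:
  fixes f g :: "'a::euclidean_space \<Rightarrow> 'b::euclidean_space"
  assumes S: "S \<in> sets lebesgue" and g: "g \<in> borel_measurable (lebesgue_on S)"
    and eq: "AE x in lebesgue_on S. f x = g x"
  shows "f \<in> borel_measurable (lebesgue_on S)"
proof -
  have S': "S \<inter> space lebesgue \<in> sets lebesgue" using S by simp
  have "(\<lambda>x. indicator S x *\<^sub>R g x) \<in> borel_measurable lebesgue"
    using g unfolding borel_measurable_restrict_space_iff[OF S'] .
  moreover have "AE x in lebesgue. indicator S x *\<^sub>R g x = indicator S x *\<^sub>R f x"
    using eq unfolding AE_lebesgue_on_iff[OF S] by eventually_elim (auto simp: indicator_def)
  ultimately have "(\<lambda>x. indicator S x *\<^sub>R f x) \<in> borel_measurable lebesgue"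
    by (rule borel_measurable_AE)
  then show ?thesis unfolding borel_measurable_restrict_space_iff[OF S'] .
qed

lemma integral_lebesgue_on_eq_lborel:
  fixes f g :: "'a::euclidean_space \<Rightarrow> real"
  assumes S: "S \<in> sets lebesgue" and g: "g \<in> borel_measurable borel" and g0: "\<And>x. x \<notin> S \<Longrightarrow> g x = 0"
    and eq: "AE x in lebesgue_on S. f x = g x"
  shows "(LINT x|lebesgue_on S. f x) = (\<integral>x. g x \<partial>lborel)"
proof -
  note gS = borel_imp_lebesgue_on[OF g, of S]
  have "(LINT x|lebesgue_on S. f x) = (LINT x|lebesgue_on S. g x)"
    by (rule integral_cong_AE[OF borel_measurable_lebesgue_on_AE[OF S gS eq] gS eq])
  also have "\<dots> = (LINT x|lebesgue. indicator S x *\<^sub>R g x)"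
    by (rule integral_restrict_space) (use S in simp)
  also have "(\<lambda>x. indicator S x *\<^sub>R g x) = g" using g0 by (auto simp: indicator_def fun_eq_iff)
  also have "(LINT x|lebesgue. g x) = (\<integral>x. g x \<partial>lborel)"
    by (rule integral_completion) (use g in simp)
  finally show ?thesis .
qed

lemma nn_integral_lebesgue_on_eq_lborel:
  fixes g :: "'a::euclidean_space \<Rightarrow> ennreal"
  assumes S: "S \<in> sets lebesgue" and g: "g \<in> borel_measurable borel" and g0: "\<And>x. x \<notin> S \<Longrightarrow> g x = 0"
  shows "(\<integral>\<^sup>+x. g x \<partial>lebesgue_on S) = (\<integral>\<^sup>+x. g x \<partial>lborel)"
proof -
  have "(\<integral>\<^sup>+x. g x \<partial>lebesgue_on S) = (\<integral>\<^sup>+x. g x * indicator S x \<partial>lebesgue)"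
    by (rule nn_integral_restrict_space) (use S in simp)
  also have "(\<lambda>x. g x * indicator S x) = g" using g0 by (auto simp: indicator_def fun_eq_iff)
  also have "(\<integral>\<^sup>+x. g x \<partial>lebesgue) = (\<integral>\<^sup>+x. g x \<partial>lborel)" by (rule nn_integral_completion)
  finally show ?thesis .
qed

lemma nn_integral_lebesgue_on_le_lborel:
  fixes g :: "'a::euclidean_space \<Rightarrow> ennreal"
  assumes S: "S \<in> sets lebesgue" and g: "g \<in> borel_measurable borel"
  shows "(\<integral>\<^sup>+x. g x \<partial>lebesgue_on S) \<le> (\<integral>\<^sup>+x. g x \<partial>lborel)"
proof -
  have "(\<integral>\<^sup>+x. g x \<partial>lebesgue_on S) = (\<integral>\<^sup>+x. g x * indicator S x \<partial>lebesgue)"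
    by (rule nn_integral_restrict_space) (use S in simp)
  also have "\<dots> \<le> (\<integral>\<^sup>+x. g x \<partial>lebesgue)" by (rule nn_integral_mono) (simp add: indicator_def)
  also have "(\<integral>\<^sup>+x. g x \<partial>lebesgue) = (\<integral>\<^sup>+x. g x \<partial>lborel)" by (rule nn_integral_completion)
  finally show ?thesis .
qed

text \<open>Lebesgue measure on the product is a completion, so single time slices of a measurable
  function need not be measurable. Fubini is therefore applied to a Borel function that agrees with
  it almost everywhere.\<close>

lemma joint_borel_representative:
  fixes \<rho> :: "real \<Rightarrow> 'a::euclidean_space \<Rightarrow> real"
  assumes S: "open S" and \<rho>: "(\<lambda>(t, x). \<rho> t x) \<in> borel_measurable (lebesgue_on ({0<..<T} \<times> S))"
  obtains g :: "real \<Rightarrow> 'a \<Rightarrow> real" where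
    "(\<lambda>z. g (fst z) (snd z)) \<in> borel_measurable (borel \<Otimes>\<^sub>M borel)" "\<And>t x. x \<notin> S \<Longrightarrow> g t x = 0"
    "AE t in lebesgue_on {0<..<T}. AE x in lebesgue_on S. \<rho> t x = g t x"
proof -
  let ?Q = "{0<..<T} \<times> S"
  have Q: "open ?Q" by (intro open_Times S) simp
  then have Q': "?Q \<in> sets lebesgue" by simp
  have "(\<lambda>z. indicator ?Q z *\<^sub>R (case z of (t, x) \<Rightarrow> \<rho> t x)) \<in> borel_measurable lebesgue"
    using \<rho> by (subst (asm) borel_measurable_restrict_space_iff) (use Q' in auto)
  then obtain f where f: "f \<in> borel_measurable lborel"
    "AE z in lborel. indicator ?Q z *\<^sub>R (case z of (t, x) \<Rightarrow> \<rho> t x) = f z"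
    using completion_ex_borel_measurable_real by blast
  define g where "g t x = indicator S x * f (t, x)" for t x
  have "AE z in lborel \<Otimes>\<^sub>M lborel. indicator ?Q z *\<^sub>R (case z of (t, x) \<Rightarrow> \<rho> t x) = f z"
    unfolding lborel_prod by (rule f(2))
  from lborel_pair.AE_pair[OF this] have ae: "AE t in lborel. AE x in lborel. indicator ?Q (t, x) *\<^sub>R \<rho> t x = f (t, x)"
    by simp
  have S': "S \<in> sets lebesgue" using S by simp
  show ?thesis
  proof
    have fb: "f \<in> borel_measurable (borel \<Otimes>\<^sub>M borel)" using f(1) by (simp add: borel_prod)
    have [measurable]: "S \<in> sets borel" using S by simp
    have "(\<lambda>z. indicator S (snd z) * f z) \<in> borel_measurable (borel \<Otimes>\<^sub>M borel)"
      using fb by measurable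
    then show "(\<lambda>z. g (fst z) (snd z)) \<in> borel_measurable (borel \<Otimes>\<^sub>M borel)" by (simp add: g_def)
    show "g t x = 0" if "x \<notin> S" for t x using that by (simp add: g_def)
    have "AE t in lebesgue_on {0<..<T}. AE x in lborel. indicator ?Q (t, x) *\<^sub>R \<rho> t x = f (t, x)"
      by (rule AE_lborel_imp_lebesgue_on[OF _ ae]) simp
    moreover have "AE t in lebesgue_on {0<..<T}. t \<in> {0<..<T}" by (rule AE_I2) simp
    ultimately show "AE t in lebesgue_on {0<..<T}. AE x in lebesgue_on S. \<rho> t x = g t x"
    proof eventually_elim
      case (elim t)
      have "AE x in lebesgue_on S. indicator ?Q (t, x) *\<^sub>R \<rho> t x = f (t, x)"
        by (rule AE_lborel_imp_lebesgue_on[OF S' elim(1)])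
      moreover have "AE x in lebesgue_on S. x \<in> S" by (rule AE_I2) simp
      ultimately show ?case by eventually_elim (use elim(2) in \<open>simp add: g_def\<close>)
    qed
  qed
qed

subsection \<open>Representatives of the velocity field\<close>

lemma norm_le_sup_norm: "x \<in> K \<Longrightarrow> ennreal (norm (f x)) \<le> sup_norm K f"
  unfolding sup_norm_def by (rule SUP_upper)

lemma sup_norm_le_add: "sup_norm K f \<le> sup_norm K g + sup_norm K (\<lambda>x. f x - g x)"
  unfolding sup_norm_def[of K f]
proof (rule SUP_least)
  fix x assume x: "x \<in> K"
  have "ennreal (norm (f x)) \<le> ennreal (norm (g x) + norm (f x - g x))"
    using norm_triangle_ineq[of "g x" "f x - g x"] by (intro ennreal_leI) simp
  also have "\<dots> = ennreal (norm (g x)) + ennreal (norm (f x - g x))" by simp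
  also have "\<dots> \<le> sup_norm K g + sup_norm K (\<lambda>x. f x - g x)"
    using x norm_le_sup_norm[of x K g] norm_le_sup_norm[of x K "\<lambda>x. f x - g x"] by (intro add_mono) auto
  finally show "ennreal (norm (f x)) \<le> sup_norm K g + sup_norm K (\<lambda>x. f x - g x)" .
qed

lemma sup_norm_lim_pointwise:
  assumes lim: "(\<lambda>k. sup_norm K (\<lambda>x. s k x - f x)) \<longlonglongrightarrow> 0" and x: "x \<in> K"
  shows "(\<lambda>k. s k x) \<longlonglongrightarrow> f x"
proof -
  have "(\<lambda>k. ennreal (norm (s k x - f x))) \<longlonglongrightarrow> ennreal 0"
    unfolding ennreal_0
    by (rule tendsto_sandwich[OF _ _ tendsto_const lim])
      (use norm_le_sup_norm[OF x, of "\<lambda>x. s _ x - f x"] in auto)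
  then have "(\<lambda>k. norm (s k x - f x)) \<longlonglongrightarrow> 0" by (subst (asm) tendsto_ennreal_iff) auto
  then show ?thesis using tendsto_norm_zero_iff LIM_zero_cancel by blast
qed

lemma sup_norm_liminf:
  assumes lim: "(\<lambda>k. sup_norm K (\<lambda>x. s k x - f x)) \<longlonglongrightarrow> 0"
  shows "liminf (\<lambda>k. sup_norm K (s k)) \<le> sup_norm K f"
    and "x \<in> K \<Longrightarrow> ennreal (norm (f x)) \<le> liminf (\<lambda>k. sup_norm K (s k))"
proof -
  have "(\<lambda>k. sup_norm K f + sup_norm K (\<lambda>x. s k x - f x)) \<longlonglongrightarrow> sup_norm K f + 0"
    by (intro tendsto_add tendsto_const lim)
  from lim_imp_Liminf[OF sequentially_bot this]
  have e: "liminf (\<lambda>k. sup_norm K f + sup_norm K (\<lambda>x. s k x - f x)) = sup_norm K f" by simp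
  have "liminf (\<lambda>k. sup_norm K (s k)) \<le> liminf (\<lambda>k. sup_norm K f + sup_norm K (\<lambda>x. s k x - f x))"
    by (rule Liminf_mono) (intro always_eventually allI sup_norm_le_add)
  then show "liminf (\<lambda>k. sup_norm K (s k)) \<le> sup_norm K f" by (simp only: e)
  assume x: "x \<in> K"
  have "(\<lambda>k. ennreal (norm (s k x))) \<longlonglongrightarrow> ennreal (norm (f x))"
    by (intro tendsto_ennrealI tendsto_norm sup_norm_lim_pointwise[OF lim x])
  from lim_imp_Liminf[OF sequentially_bot this]
  have "ennreal (norm (f x)) = liminf (\<lambda>k. ennreal (norm (s k x)))" by simp
  also have "\<dots> \<le> liminf (\<lambda>k. sup_norm K (s k))"
    by (rule Liminf_mono) (intro always_eventually allI norm_le_sup_norm x)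
  finally show "ennreal (norm (f x)) \<le> liminf (\<lambda>k. sup_norm K (s k))" .
qed

context time_interval begin

text \<open>Uniform convergence of the simple functions gives pointwise limits, hence joint
  measurability over a set of times of full measure. \<open>Mu\<close> comes from the lower limit of
  their sup norms, which is measurable in time, bounds the velocity, and is almost everywhere at
  most its sup norm.\<close>

lemma Bochner_C_representative:
  fixes u :: "real \<Rightarrow> 'a::euclidean_space \<Rightarrow> 'a"
  assumes S: "open S" and u: "u \<in> Bochner_L1 T (C_space (closure S)) (sup_norm (closure S))"
  obtains A Mu where "A \<in> sets M" "AE t in M. t \<in> A" "A \<subseteq> {0<..<T}"
    "(\<lambda>z. if fst z \<in> A \<and> snd z \<in> S then u (fst z) (snd z) else 0) \<in> borel_measurable (M \<Otimes>\<^sub>M lborel)"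
    "integrable M Mu" "\<And>t. Mu t \<ge> 0" "\<And>t x. t \<in> A \<Longrightarrow> x \<in> S \<Longrightarrow> norm (u t x) \<le> Mu t"
proof -
  let ?N = "sup_norm (closure S) :: ('a \<Rightarrow> 'a) \<Rightarrow> ennreal"
  obtain s where s: "\<And>k. simple_function M (s k)" "\<And>k t. t \<in> {0<..<T} \<Longrightarrow> s k t \<in> C_space (closure S)"
    and s_lim: "AE t in M. (\<lambda>k. ?N (\<lambda>x. s k t x - u t x)) \<longlonglongrightarrow> 0" and u_fin: "(\<integral>\<^sup>+t. ?N (u t) \<partial>M) < \<infinity>"
    using u unfolding Bochner_L1_def M_def by blast
  define L where "L t = liminf (\<lambda>k. ?N (s k t))" for t
  have L[measurable]: "L \<in> borel_measurable M"
    unfolding L_def[abs_def]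
    by (rule borel_measurable_liminf) (rule borel_measurable_simple_function[OF simple_function_compose1[OF s(1)]])
  have "(\<integral>\<^sup>+t. L t \<partial>M) \<le> (\<integral>\<^sup>+t. ?N (u t) \<partial>M)"
    by (rule nn_integral_mono_AE, use s_lim in eventually_elim) (unfold L_def, rule sup_norm_liminf(1))
  then have L_fin: "(\<integral>\<^sup>+t. L t \<partial>M) < \<infinity>" using u_fin by (rule order_le_less_trans)
  then have "AE t in M. L t \<noteq> \<infinity>" by (intro nn_integral_PInf_AE L) auto
  with s_lim have "AE t in M. (\<lambda>k. ?N (\<lambda>x. s k t x - u t x)) \<longlonglongrightarrow> 0 \<and> L t \<noteq> \<infinity>"
    by eventually_elim blast
  from AE_E3[OF this] obtain N where
    N: "\<And>t. t \<in> space M - N \<Longrightarrow> (\<lambda>k. ?N (\<lambda>x. s k t x - u t x)) \<longlonglongrightarrow> 0 \<and> L t \<noteq> \<infinity>" "N \<in> null_sets M"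
    by blast
  define A where "A = space M - N"
  have A: "A \<in> sets M" unfolding A_def using null_setsD2[OF N(2)] by (rule sets.compl_sets)
  have Sb: "S \<in> sets borel" using S by simp
  let ?F = "\<lambda>v x. indicator S x *\<^sub>R (v x :: 'a)"
  have F: "?F v \<in> borel_measurable lborel" if "v \<in> s k ` space M" for v k
  proof -
    have "continuous_on (closure S) v" using that s(2)[of _ k] by (auto simp: C_space_def)
    then have "continuous_on S v" by (rule continuous_on_subset[OF _ closure_subset])
    from borel_measurable_continuous_on_indicator[OF Sb this] show ?thesis by simp
  qed
  let ?G = "\<lambda>k z. indicator A (fst z) *\<^sub>R ?F (s k (fst z)) (snd z)"
  have G: "?G k \<in> borel_measurable (M \<Otimes>\<^sub>M lborel)" for k
  proof -
    have [measurable]: "(\<lambda>z. ?F (s k (fst z)) (snd z)) \<in> borel_measurable (M \<Otimes>\<^sub>M lborel)"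
      by (rule simple_function_measurable[OF s(1), where F="?F"]) (rule F)
    have [measurable]: "A \<in> sets M" by (rule A)
    show ?thesis by measurable
  qed
  have meas: "(\<lambda>z. if fst z \<in> A \<and> snd z \<in> S then u (fst z) (snd z) else 0) \<in> borel_measurable (M \<Otimes>\<^sub>M lborel)"
  proof (rule borel_measurable_LIMSEQ_metric[OF G])
    fix z :: "real \<times> 'a" assume "z \<in> space (M \<Otimes>\<^sub>M lborel)"
    show "(\<lambda>k. ?G k z) \<longlonglongrightarrow> (if fst z \<in> A \<and> snd z \<in> S then u (fst z) (snd z) else 0)"
    proof (cases "fst z \<in> A \<and> snd z \<in> S")
      case True
      then have "(\<lambda>k. s k (fst z) (snd z)) \<longlonglongrightarrow> u (fst z) (snd z)"
        by (intro sup_norm_lim_pointwise[where K="closure S"])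
          (use N(1)[of "fst z"] closure_subset in \<open>auto simp: A_def\<close>)
      with True show ?thesis by simp
    qed auto
  qed
  have le: "norm (u t x) \<le> enn2real (L t)" if t: "t \<in> A" and x: "x \<in> S" for t x
  proof -
    have "x \<in> closure S" using x closure_subset by blast
    then have "ennreal (norm (u t x)) \<le> L t"
      unfolding L_def by (intro sup_norm_liminf(2)) (use N(1)[of t] t in \<open>auto simp: A_def\<close>)
    then have "enn2real (ennreal (norm (u t x))) \<le> enn2real (L t)"
      by (rule enn2real_mono) (use N(1)[of t] t in \<open>auto simp: A_def less_top\<close>)
    then show ?thesis by simp
  qed
  have int: "integrable M (\<lambda>t. enn2real (L t))"
  proof (rule integrableI_nonneg)
    have "(\<integral>\<^sup>+t. ennreal (enn2real (L t)) \<partial>M) \<le> (\<integral>\<^sup>+t. L t \<partial>M)"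
      by (rule nn_integral_mono) (simp add: ennreal_enn2real_if)
    then show "(\<integral>\<^sup>+t. ennreal (enn2real (L t)) \<partial>M) < \<infinity>" using L_fin by (rule order_le_less_trans)
  qed auto
  show ?thesis
  proof (rule that[of A "\<lambda>t. enn2real (L t)"])
    show "AE t in M. t \<in> A" using AE_not_in[OF N(2)] AE_space by eventually_elim (simp add: A_def)
    show "A \<subseteq> {0<..<T}" by (auto simp: A_def)
  qed (use A meas le int in auto)
qed

text \<open>The given simple functions take values in the closure of the test functions. Moving each
  value by at most 1 / (k + 1) makes it a test function, and the quasi-triangle inequality preserves
  the convergence.\<close>

lemma Bochner_W1_0_representative:
  fixes u :: "real \<Rightarrow> 'a::euclidean_space \<Rightarrow> 'a"
  assumes S: "open S" and r: "r \<ge> 1" and u: "u \<in> Bochner_L1 T (W1_0 (ennreal r) S) (W1_norm (ennreal r) S)"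
  obtains U where "\<And>k. simple_function M (U k)" "\<And>k t. t \<in> {0<..<T} \<Longrightarrow> test_fun S (U k t)"
    "AE t in M. (\<lambda>k. W1_norm (ennreal r) S (\<lambda>x. u t x - U k t x)) \<longlonglongrightarrow> 0"
    "AE t in M. u t \<in> weakly_diff S" "(\<integral>\<^sup>+t. W1_norm (ennreal r) S (u t) \<partial>M) < \<infinity>"
proof -
  let ?W = "W1_norm (ennreal r) S :: ('a \<Rightarrow> 'a) \<Rightarrow> ennreal" and ?X = "W1_0 (ennreal r) S :: ('a \<Rightarrow> 'a) set"
  obtain s where s: "\<And>k. simple_function M (s k)" "\<And>k t. t \<in> {0<..<T} \<Longrightarrow> s k t \<in> ?X"
    and s_lim: "AE t in M. (\<lambda>k. ?W (\<lambda>x. s k t x - u t x)) \<longlonglongrightarrow> 0" and u_fin: "(\<integral>\<^sup>+t. ?W (u t) \<partial>M) < \<infinity>"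
    and uX: "AE t in M. u t \<in> ?X"
    using u unfolding Bochner_L1_def M_def by blast
  have X: "v \<in> weakly_diff S" if "v \<in> ?X" for v
    using that W1_subset_weakly_diff[of "ennreal r" S] unfolding W1_0_def by blast
  have ex: "\<exists>\<phi>. test_fun S \<phi> \<and> ?W (\<lambda>x. v x - \<phi> x) \<le> ennreal (1 / (real k + 1))" if v: "v \<in> ?X" for v k
  proof -
    have "(1 / (real k + 1)) > 0" by simp
    with v obtain \<psi> where \<psi>: "\<psi> \<in> Cc_infinity S" "?W (\<lambda>x. v x - \<psi> x) < ennreal (1 / (real k + 1))"
      unfolding W1_0_def by blast
    have "?W (\<lambda>x. v x - (if x \<in> S then \<psi> x else 0)) = ?W (\<lambda>x. v x - \<psi> x)"
      by (rule W1_norm_cong[OF r]) simp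
    then show ?thesis using Cc_infinity_imp_test_fun[OF \<psi>(1) S] \<psi>(2) by (intro exI conjI) auto
  qed
  \<comment> \<open>The choice depends on the value \<open>v\<close> and not on the time, so
    composing it with a simple function gives a simple function.\<close>
  define \<Psi> where "\<Psi> k v = (SOME \<phi>. test_fun S \<phi> \<and> ?W (\<lambda>x. v x - \<phi> x) \<le> ennreal (1 / (real k + 1)))" for k :: nat and v
  have \<Psi>: "test_fun S (\<Psi> k v)" "?W (\<lambda>x. v x - \<Psi> k v x) \<le> ennreal (1 / (real k + 1))" if "v \<in> ?X" for k v
    using someI_ex[OF ex[OF that, of k]] unfolding \<Psi>_def by blast+
  show ?thesis
  proof (rule that[of "\<lambda>k t. \<Psi> k (s k t)"])
    show "simple_function M (\<lambda>t. \<Psi> k (s k t))" for k by (rule simple_function_compose1[OF s(1)])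
    show "test_fun S (\<Psi> k (s k t))" if "t \<in> {0<..<T}" for k t by (rule \<Psi>(1)[OF s(2)[OF that]])
    show "AE t in M. (\<lambda>k. ?W (\<lambda>x. u t x - \<Psi> k (s k t) x)) \<longlonglongrightarrow> 0"
      using s_lim uX AE_space
    proof eventually_elim
      case (elim t)
      then have t: "t \<in> {0<..<T}" by simp
      have le: "?W (\<lambda>x. u t x - \<Psi> k (s k t) x) \<le> 4 * (ennreal (1 / (real k + 1)) + ?W (\<lambda>x. s k t x - u t x))" for k
      proof -
        note sk = s(2)[OF t, of k]
        have wd: "(\<lambda>x. s k t x - \<Psi> k (s k t) x) \<in> weakly_diff S" "(\<lambda>x. s k t x - u t x) \<in> weakly_diff S"
          by (rule weakly_diff_diff[OF S X[OF sk]], rule test_fun_weakly_diff[OF S \<Psi>(1)[OF sk]])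
            (rule weakly_diff_diff[OF S X[OF sk] X[OF elim(2)]])
        have "?W (\<lambda>x. (s k t x - \<Psi> k (s k t) x) - (s k t x - u t x))
          \<le> 4 * (?W (\<lambda>x. s k t x - \<Psi> k (s k t) x) + ?W (\<lambda>x. s k t x - u t x))"
          by (rule W1_norm_diff[OF S r wd])
        also have "\<dots> \<le> 4 * (ennreal (1 / (real k + 1)) + ?W (\<lambda>x. s k t x - u t x))"
          by (intro mult_left_mono add_right_mono \<Psi>(2)[OF sk]) simp
        finally show ?thesis by simp
      qed
      have "(\<lambda>k. 1 / (real k + 1)) \<longlonglongrightarrow> 0" using LIMSEQ_inverse_real_of_nat by (simp add: inverse_eq_divide add.commute)
      then have "(\<lambda>k. ennreal (1 / (real k + 1))) \<longlonglongrightarrow> ennreal 0" by (rule tendsto_ennrealI)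
      then have "(\<lambda>k. 4 * (ennreal (1 / (real k + 1)) + ?W (\<lambda>x. s k t x - u t x))) \<longlonglongrightarrow> 4 * (ennreal 0 + 0)"
        by (intro ennreal_tendsto_cmult tendsto_add elim(1)) auto
      then have lim: "(\<lambda>k. 4 * (ennreal (1 / (real k + 1)) + ?W (\<lambda>x. s k t x - u t x))) \<longlonglongrightarrow> 0" by simp
      show ?case
        by (rule tendsto_sandwich[OF _ _ tendsto_const lim]) (use le in auto)
    qed
    show "AE t in M. u t \<in> weakly_diff S" using uX by eventually_elim (rule X)
  qed (rule u_fin)
qed

end

subsection \<open>Duality of the density and Sobolev functions\<close>

text \<open>Only an inequality, because part of the translated function may leave
  \<open>S\<close>.\<close>

lemma Lp_norm_translate_le:
  fixes g :: "'a::euclidean_space \<Rightarrow> real"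
  assumes S: "open S" and r: "r \<ge> 1" and g[measurable]: "g \<in> borel_measurable borel" and g0: "\<And>x. x \<notin> S \<Longrightarrow> g x = 0"
  shows "Lp_norm (ennreal r) S (\<lambda>x. g (x + a)) \<le> Lp_norm (ennreal r) S g"
proof (rule pow_int_le_imp_Lp_norm_le[OF r])
  have S': "S \<in> sets lebesgue" using S by simp
  have "pow_int r S (\<lambda>x. g (x + a)) \<le> (\<integral>\<^sup>+x. ennreal (norm (g (x + a)) powr r) \<partial>lborel)"
    unfolding pow_int_def by (rule nn_integral_lebesgue_on_le_lborel[OF S']) measurable
  also have "\<dots> = (\<integral>\<^sup>+x. ennreal (norm (g x) powr r) \<partial>lborel)"
    by (rule nn_integral_lborel_translate[where f="\<lambda>x. ennreal (norm (g x) powr r)"]) measurable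
  also have "\<dots> = pow_int r S g"
    unfolding pow_int_def
    by (rule nn_integral_lebesgue_on_eq_lborel[OF S', symmetric]) (measurable, use g0 in simp)
  finally show "pow_int r S (\<lambda>x. g (x + a)) \<le> pow_int r S g" .
qed

lemma Lp_pairing_translate:
  fixes f g :: "'a::euclidean_space \<Rightarrow> real"
  assumes pq: "1 < p" "1 / p + 1 / ennreal r = 1" and r: "r \<ge> 1" and S: "open S" and c: "c > 0"
    and f[measurable]: "f \<in> borel_measurable borel" and f0: "\<And>x. x \<notin> S \<Longrightarrow> f x = 0" and f_le: "Lp_norm p S f \<le> ennreal c"
    and g[measurable]: "g \<in> borel_measurable borel" and g0: "\<And>x. x \<notin> S \<Longrightarrow> g x = 0"
  shows "(\<integral>\<^sup>+x. ennreal (\<bar>f x\<bar> * \<bar>g (x + a)\<bar>) \<partial>lborel) \<le> ennreal (2 * c) * Lp_norm (ennreal r) S g"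
proof -
  have S': "S \<in> sets lebesgue" using S by simp
  have ga: "(\<lambda>x. g (x + a)) \<in> borel_measurable borel" by measurable
  have "(\<integral>\<^sup>+x. ennreal (\<bar>f x\<bar> * \<bar>g (x + a)\<bar>) \<partial>lborel) = (\<integral>\<^sup>+x. ennreal (\<bar>f x\<bar> * norm (g (x + a))) \<partial>lebesgue_on S)"
    unfolding real_norm_def
    by (rule nn_integral_lebesgue_on_eq_lborel[OF S', symmetric]) (measurable, use f0 in simp)
  also have "\<dots> \<le> ennreal (2 * c) * Lp_norm (ennreal r) S (\<lambda>x. g (x + a))"
    by (rule Holder_Lp_norm[OF pq c f_le borel_imp_lebesgue_on[OF f] borel_imp_lebesgue_on[OF ga]])
  also have "\<dots> \<le> ennreal (2 * c) * Lp_norm (ennreal r) S g"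
    by (intro mult_left_mono Lp_norm_translate_le[OF S r g g0]) auto
  finally show ?thesis .
qed

lemma Lp_norm_1_finite:
  fixes S :: "'a::euclidean_space set"
  assumes S: "open S" "emeasure lborel S < \<infinity>"
  shows "Lp_norm p S (\<lambda>x. 1 :: real) < \<infinity>"
proof (cases "p = \<infinity>")
  case True
  have "Lp_norm p S (\<lambda>x. 1 :: real) = esssup (lebesgue_on S) (\<lambda>x. 1 :: ennreal)"
    unfolding Lp_norm_def using True by simp
  also have "\<dots> \<le> 1" by (rule esssup_I) auto
  finally show ?thesis by (rule order_le_less_trans) simp
next
  case False
  have S': "S \<in> sets lebesgue" using S by simp
  have "(\<integral>\<^sup>+x. ennreal (norm (1::real) powr enn2real p) \<partial>lebesgue_on S) = emeasure lborel S"
    using S S' by (simp add: emeasure_restrict_space)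
  then show ?thesis using S(2) False by (auto simp: Lp_norm_def Let_def)
qed

subsection \<open>Vanishing of the density\<close>

context time_interval begin

lemma borel_measurable_slice_integrals:
  fixes \<rho> :: "real \<Rightarrow> 'a::euclidean_space \<Rightarrow> real" and u :: "real \<Rightarrow> 'a \<Rightarrow> 'a"
  assumes \<rho>[measurable]: "(\<lambda>z. \<rho> (fst z) (snd z)) \<in> borel_measurable (M \<Otimes>\<^sub>M lborel)"
    and u[measurable]: "(\<lambda>z. u (fst z) (snd z)) \<in> borel_measurable (M \<Otimes>\<^sub>M lborel)"
    and \<phi>: "test_fun \<Omega> (\<phi> :: 'a \<Rightarrow> real)" and a: "smooth (a :: real \<Rightarrow> real)"
  shows "(\<lambda>t. dderiv a 1 t * (\<integral>x. \<rho> t x * \<phi> x \<partial>lborel)) \<in> borel_measurable M"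
    and "(\<lambda>t. a t * (\<integral>x. \<rho> t x * dderiv \<phi> (u t x) x \<partial>lborel)) \<in> borel_measurable M"
proof -
  have [measurable]: "\<phi> \<in> borel_measurable borel" by (rule test_fun_borel[OF \<phi>])
  have [measurable]: "a \<in> borel_measurable M" "(\<lambda>t. dderiv a 1 t) \<in> borel_measurable M"
    by (rule borel_M[OF smooth_borel[OF a]], rule borel_M[OF smooth_borel[OF smooth_dderiv[OF a]]])
  have [measurable]: "(\<lambda>z. dderiv \<phi> (u (fst z) (snd z)) (snd z)) \<in> borel_measurable (M \<Otimes>\<^sub>M lborel)"
    by (rule dderiv_measurable[OF test_fun_smooth[OF \<phi>] u]) measurable
  have [measurable]: "(\<lambda>t. \<integral>x. \<rho> t x * \<phi> x \<partial>lborel) \<in> borel_measurable M"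
  proof (rule lborel.borel_measurable_lebesgue_integral)
    have "(\<lambda>z. \<rho> (fst z) (snd z) * \<phi> (snd z)) \<in> borel_measurable (M \<Otimes>\<^sub>M lborel)" by measurable
    then show "(\<lambda>(t, x). \<rho> t x * \<phi> x) \<in> borel_measurable (M \<Otimes>\<^sub>M lborel)" by (simp add: case_prod_beta')
  qed
  have [measurable]: "(\<lambda>t. \<integral>x. \<rho> t x * dderiv \<phi> (u t x) x \<partial>lborel) \<in> borel_measurable M"
  proof (rule lborel.borel_measurable_lebesgue_integral)
    have "(\<lambda>z. \<rho> (fst z) (snd z) * dderiv \<phi> (u (fst z) (snd z)) (snd z)) \<in> borel_measurable (M \<Otimes>\<^sub>M lborel)"
      by measurable
    then show "(\<lambda>(t, x). \<rho> t x * dderiv \<phi> (u t x) x) \<in> borel_measurable (M \<Otimes>\<^sub>M lborel)"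
      by (simp add: case_prod_beta')
  qed
  show "(\<lambda>t. dderiv a 1 t * (\<integral>x. \<rho> t x * \<phi> x \<partial>lborel)) \<in> borel_measurable M"
    "(\<lambda>t. a t * (\<integral>x. \<rho> t x * dderiv \<phi> (u t x) x \<partial>lborel)) \<in> borel_measurable M"
    by measurable
qed

end

context sobolev_velocity begin

text \<open>Setting density and velocity to 0 at the exceptional times keeps all integrals over time
  and turns statements for almost every time into statements for every time, as the locale
  \<open>transport\<close> asks.\<close>

lemma density_vanishes_AE:
  fixes \<rho> :: "real \<Rightarrow> 'a \<Rightarrow> real"
  assumes pq: "1 < p" "1 / p + 1 / ennreal r = 1" and c: "c > 0"
    and \<rho>: "(\<lambda>z. \<rho> (fst z) (snd z)) \<in> borel_measurable (M \<Otimes>\<^sub>M lborel)" and \<rho>0: "\<And>t x. x \<notin> \<Omega> \<Longrightarrow> \<rho> t x = 0"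
    and \<rho>_le: "AE t in M. Lp_norm p \<Omega> (\<rho> t) \<le> ennreal c"
    and div: "AE t in M. \<forall>\<phi>. test_fun \<Omega> \<phi> \<longrightarrow> (\<integral>x. dderiv (\<phi> :: 'a \<Rightarrow> real) (u t x) x \<partial>lborel) = 0"
    and weak: "\<And>a \<tau> \<phi>. smooth a \<Longrightarrow> \<tau> < T \<Longrightarrow> (\<And>t. t \<ge> \<tau> \<Longrightarrow> a t = 0) \<Longrightarrow> test_fun \<Omega> \<phi> \<Longrightarrow>
      (\<integral>t. dderiv a 1 t * (\<integral>x. \<rho> t x * \<phi> x \<partial>lborel) \<partial>M)
      = (\<integral>t. a t * (\<integral>x. \<rho> t x * dderiv (\<phi> :: 'a \<Rightarrow> real) (u t x) x \<partial>lborel) \<partial>M)"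
  shows "AE t in M. AE x in lborel. \<rho> t x = 0"
proof -
  note [measurable] = \<rho> u_joint
  have "AE t in M. good t \<and> Lp_norm p \<Omega> (\<rho> t) \<le> ennreal c \<and>
      (\<forall>\<phi>. test_fun \<Omega> \<phi> \<longrightarrow> (\<integral>x. dderiv (\<phi> :: 'a \<Rightarrow> real) (u t x) x \<partial>lborel) = 0)"
    using AE_good \<rho>_le div by eventually_elim (intro conjI)
  from AE_E3[OF this] obtain N where N: "N \<in> null_sets M" and
    N': "\<And>t. t \<in> space M - N \<Longrightarrow> good t \<and> Lp_norm p \<Omega> (\<rho> t) \<le> ennreal c \<and>
      (\<forall>\<phi>. test_fun \<Omega> \<phi> \<longrightarrow> (\<integral>x. dderiv (\<phi> :: 'a \<Rightarrow> real) (u t x) x \<partial>lborel) = 0)"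
    by blast
  define A where "A = space M - N"
  have A[measurable]: "A \<in> sets M" unfolding A_def using null_setsD2[OF N] by (rule sets.compl_sets)
  have AE_A: "AE t in M. t \<in> A" using AE_not_in[OF N] AE_space by eventually_elim (simp add: A_def)
  have A_T: "t \<in> {0<..<T}" if "t \<in> A" for t using that by (simp add: A_def)
  have A_good: "good t" and A_\<rho>: "Lp_norm p \<Omega> (\<rho> t) \<le> ennreal c"
    and A_div: "test_fun \<Omega> \<phi> \<Longrightarrow> (\<integral>x. dderiv (\<phi> :: 'a \<Rightarrow> real) (u t x) x \<partial>lborel) = 0" if "t \<in> A" for t \<phi>
    using N' that unfolding A_def by blast+
  define \<rho>' where "\<rho>' t x = (if t \<in> A then \<rho> t x else 0)" for t x
  define u' where "u' t x = (if t \<in> A then u t x else 0)" for t x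
  have \<Omega>_borel: "\<Omega> \<in> sets borel" using open_dom by auto
  note \<rho>_borel = borel_measurable_time_slice[OF \<rho>]
  have pair: "(\<integral>\<^sup>+x. ennreal (\<bar>\<rho> t x\<bar> * \<bar>g (x + a)\<bar>) \<partial>lborel) \<le> ennreal (2 * c) * Lp_norm (ennreal r) \<Omega> g"
    if t: "t \<in> A" and g: "g \<in> borel_measurable borel" "\<And>x. x \<notin> \<Omega> \<Longrightarrow> g x = 0" for t a and g :: "'a \<Rightarrow> real"
    by (rule Lp_pairing_translate[OF pq r_ge_1 open_dom c \<rho>_borel[OF A_T[OF t]] \<rho>0 A_\<rho>[OF t] g])
  \<comment> \<open>Bounds the L1 norm of the density by pairing it with the indicator of
    \<open>\<Omega>\<close>, whose norm is finite as \<open>\<Omega>\<close> has finite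
    measure.\<close>
  define E where "E = ennreal (2 * c) * Lp_norm (ennreal r) \<Omega> (\<lambda>x. 1 :: real)"
  have E: "E < \<infinity>"
    unfolding E_def using Lp_norm_1_finite[OF open_dom dom_finite] by (simp add: ennreal_mult_less_top)
  have \<rho>_L1: "(\<integral>\<^sup>+x. ennreal \<bar>\<rho> t x\<bar> \<partial>lborel) \<le> E" if t: "t \<in> A" for t
  proof -
    have "(\<integral>\<^sup>+x. ennreal \<bar>\<rho> t x\<bar> \<partial>lborel) = (\<integral>\<^sup>+x. ennreal (\<bar>\<rho> t x\<bar> * \<bar>indicator \<Omega> (x + 0)\<bar>) \<partial>lborel)"
      by (rule nn_integral_cong) (use \<rho>0[of _ t] in \<open>auto simp: indicator_def\<close>)
    also have "\<dots> \<le> ennreal (2 * c) * Lp_norm (ennreal r) \<Omega> (indicator \<Omega> :: 'a \<Rightarrow> real)"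
      by (rule pair[OF t]) (use \<Omega>_borel in auto)
    also have "Lp_norm (ennreal r) \<Omega> (indicator \<Omega> :: 'a \<Rightarrow> real) = Lp_norm (ennreal r) \<Omega> (\<lambda>x. 1 :: real)"
      by (rule Lp_norm_cong_AE[OF r_ge_1]) (rule AE_I2, simp)
    finally show ?thesis unfolding E_def .
  qed
  have \<rho>_int: "integrable lborel (\<rho> t)" and \<rho>_int_le: "(\<integral>x. \<bar>\<rho> t x\<bar> \<partial>lborel) \<le> enn2real E" if t: "t \<in> A" for t
  proof -
    have b: "\<rho> t \<in> borel_measurable lborel" using \<rho>_borel[OF A_T[OF t]] by simp
    show "integrable lborel (\<rho> t)"
      by (rule integrableI_bounded[OF b]) (use order_le_less_trans[OF \<rho>_L1[OF t] E] in simp)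
    have "(\<integral>x. \<bar>\<rho> t x\<bar> \<partial>lborel) = enn2real (\<integral>\<^sup>+x. ennreal \<bar>\<rho> t x\<bar> \<partial>lborel)"
      by (rule integral_eq_nn_integral) (use b in auto)
    also have "\<dots> \<le> enn2real E" by (rule enn2real_mono[OF \<rho>_L1[OF t]]) (use E in simp)
    finally show "(\<integral>x. \<bar>\<rho> t x\<bar> \<partial>lborel) \<le> enn2real E" .
  qed
  have \<rho>'_meas: "(\<lambda>z. \<rho>' (fst z) (snd z)) \<in> borel_measurable (M \<Otimes>\<^sub>M lborel)"
    and u'_meas: "(\<lambda>z. u' (fst z) (snd z)) \<in> borel_measurable (M \<Otimes>\<^sub>M lborel)"
    unfolding \<rho>'_def u'_def by measurable
  have Mu0: "Mu t \<ge> 0" if "t \<in> {0<..<T}" for t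
    using order_trans[OF norm_ge_zero u_le[OF that]] .
  interpret Tr: transport T \<Omega> \<rho>' u' "enn2real E" Mu
  proof
    show "open \<Omega>" by (rule open_dom)
    show "integrable lborel (\<rho>' t)" "(\<integral>x. \<bar>\<rho>' t x\<bar> \<partial>lborel) \<le> enn2real E" for t
      using \<rho>_int[of t] \<rho>_int_le[of t] by (cases "t \<in> A"; simp add: \<rho>'_def[abs_def])+
    show "norm (u' t x) \<le> Mu t" if "t \<in> {0<..<T}" for t x
      using u_le[OF that] Mu0[OF that] by (simp add: u'_def)
    show "integrable M Mu" by (rule Mu_int)
    show "(\<integral>x. dderiv (\<phi> :: 'a \<Rightarrow> real) (u' t x) x \<partial>lborel) = 0" if "test_fun \<Omega> \<phi>" for t \<phi>
      using A_div[of t, OF _ that] linear_0[OF smooth_dderiv_linear[OF test_fun_smooth[OF that]]]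
      by (cases "t \<in> A") (simp_all add: u'_def)
    fix a :: "real \<Rightarrow> real" and \<tau> and \<phi> :: "'a \<Rightarrow> real"
    assume a: "smooth a" "\<tau> < T" "\<And>t. t \<ge> \<tau> \<Longrightarrow> a t = 0" and \<phi>: "test_fun \<Omega> \<phi>"
    note mp = borel_measurable_slice_integrals[OF \<rho>'_meas u'_meas \<phi> a(1)]
    note m = borel_measurable_slice_integrals[OF \<rho> u_joint \<phi> a(1)]
    have "(\<integral>t. dderiv a 1 t * (\<integral>x. \<rho>' t x * \<phi> x \<partial>lborel) \<partial>M) = (\<integral>t. dderiv a 1 t * (\<integral>x. \<rho> t x * \<phi> x \<partial>lborel) \<partial>M)"
      by (rule integral_cong_AE[OF mp(1) m(1)], use AE_A in eventually_elim) (simp add: \<rho>'_def)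
    also have "\<dots> = (\<integral>t. a t * (\<integral>x. \<rho> t x * dderiv \<phi> (u t x) x \<partial>lborel) \<partial>M)"
      by (rule weak[OF a(1,2) _ \<phi>]) (rule a(3))
    also have "\<dots> = (\<integral>t. a t * (\<integral>x. \<rho>' t x * dderiv \<phi> (u' t x) x \<partial>lborel) \<partial>M)"
      by (rule integral_cong_AE[OF m(2) mp(2)], use AE_A in eventually_elim) (simp add: \<rho>'_def u'_def)
    finally show "(\<integral>t. dderiv a 1 t * (\<integral>x. \<rho>' t x * \<phi> x \<partial>lborel) \<partial>M)
      = (\<integral>t. a t * (\<integral>x. \<rho>' t x * dderiv \<phi> (u' t x) x \<partial>lborel) \<partial>M)" .
  qed (rule \<rho>'_meas u'_meas)+
  have pairing: "density_pairing \<Omega> r (2 * c) (\<rho> t)" if t: "t \<in> A" for t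
    by unfold_locales (use open_dom r_ge_1 c \<rho>_int[OF t] pair[OF t] in auto)
  have defect_in: "Tr.defect \<epsilon> t = comm_defect \<epsilon> (\<rho> t) (u t)" if "t \<in> A" for t \<epsilon>
    using that by (simp add: Tr.defect_def comm_defect_def kern_def \<rho>'_def u'_def)
  have defect_out: "Tr.defect \<epsilon> t = 0" if "t \<notin> A" for t \<epsilon>
    using that by (simp add: Tr.defect_def u'_def)
  \<comment> \<open>The constant of \<open>comm_defect_limit\<close> with \<open>2 * c\<close> for
    its \<open>c\<close>, times the truncation bound for the gradients of \<open>V\<close>;
    \<open>lsup_finite\<close> makes it integrable in time.\<close>
  define D where "D t = ennreal (2 * (2 * c) * unit_ball_vol DIM('a)) * (lsup t + 1)" for t
  obtain h :: "nat \<Rightarrow> 'a \<Rightarrow> real" and G :: "'a \<Rightarrow> real" where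
    h: "\<And>k. test_fun \<Omega> (h k)" "\<And>k x. h k x \<ge> 0"
    "AE x in lborel. (\<lambda>k. h k x) \<longlonglongrightarrow> (\<integral>t. norm (u t x) \<partial>M)"
    and G: "integrable lborel G" "\<And>x. G x \<ge> 0"
    "\<And>k. AE x in lborel. \<forall>v. \<bar>dderiv (h k) v x\<bar> \<le> G x * norm v"
    by (rule cutoff_exists) blast
  interpret Tc: transport_cutoff T \<Omega> \<rho>' u' "enn2real E" Mu D h G
  proof
    show "(\<lambda>n. Tr.defect (1 / (real n + 1)) s) \<longlonglongrightarrow> 0" for s
    proof (cases "s \<in> A")
      case True
      show ?thesis
        unfolding defect_in[OF True]
        by (rule density_pairing.comm_defect_tendsto_0[OF pairing[OF True] u_sec_borel[OF A_T[OF True]] u_outside[OF A_T[OF True]]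
              V_test[OF A_T[OF True]] good_V_Lp_lim[OF A_good[OF True]] good_grad_cauchy[OF A_good[OF True]]])
    qed (simp add: defect_out)
    show "Tr.defect (1 / (real n + 1)) s \<le> D s" for n s
    proof (cases "s \<in> A")
      case True
      show ?thesis
        unfolding defect_in[OF True] D_def
        by (rule density_pairing.comm_defect_limit[OF pairing[OF True] u_sec_borel[OF A_T[OF True]] u_outside[OF A_T[OF True]] _
              V_test[OF A_T[OF True]] good_V_Lp_lim[OF A_good[OF True]]])
          (use V_grad_le[OF A_T[OF True]] in auto)
    qed (simp add: defect_out)
    show "D \<in> borel_measurable M" unfolding D_def[abs_def] by measurable
    have "(\<integral>\<^sup>+s. D s \<partial>M) = ennreal (2 * (2 * c) * unit_ball_vol DIM('a)) * (\<integral>\<^sup>+s. lsup s + 1 \<partial>M)"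
      unfolding D_def by (rule nn_integral_cmult) measurable
    also have "\<dots> < \<infinity>" using lsup_finite by (simp add: ennreal_mult_less_top)
    finally show "(\<integral>\<^sup>+s. D s \<partial>M) < \<infinity>" .
    show "\<rho>' t x = 0" if "x \<notin> \<Omega>" for t x using \<rho>0[OF that] by (simp add: \<rho>'_def)
    show "AE x in lborel. (\<lambda>k. h k x) \<longlonglongrightarrow> (\<integral>t. norm (u' t x) \<partial>M)"
      using h(3)
    proof eventually_elim
      case (elim x)
      have m: "(\<lambda>t. (t, x)) \<in> measurable M (M \<Otimes>\<^sub>M lborel)" by (intro measurable_Pair2') simp
      have "(\<integral>t. norm (u' t x) \<partial>M) = (\<integral>t. norm (u t x) \<partial>M)"
      proof (rule integral_cong_AE)
        show "(\<lambda>t. norm (u' t x)) \<in> borel_measurable M" "(\<lambda>t. norm (u t x)) \<in> borel_measurable M"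
          using measurable_compose[OF m u'_meas] measurable_compose[OF m u_joint] by simp_all
        show "AE t in M. norm (u' t x) = norm (u t x)"
          using AE_A by eventually_elim (simp add: u'_def)
      qed
      with elim show ?case by simp
    qed
  qed (fact h G)+
  show ?thesis using Tc.density_vanishes AE_A by eventually_elim (simp add: \<rho>'_def)
qed

end

lemma Lp_norm_cong_AE':
  fixes f g :: "'a::euclidean_space \<Rightarrow> real"
  assumes S: "S \<in> sets lebesgue" and g: "g \<in> borel_measurable (lebesgue_on S)" and eq: "AE x in lebesgue_on S. f x = g x"
  shows "Lp_norm p S f = Lp_norm p S g"
proof (cases "p = \<infinity>")
  case True
  note f = borel_measurable_lebesgue_on_AE[OF S g eq]
  have "esssup (lebesgue_on S) (\<lambda>x. ennreal (norm (f x))) = esssup (lebesgue_on S) (\<lambda>x. ennreal (norm (g x)))"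
  proof (rule esssup_AE_cong)
    show "(\<lambda>x. ennreal (norm (f x))) \<in> borel_measurable (lebesgue_on S)"
      "(\<lambda>x. ennreal (norm (g x))) \<in> borel_measurable (lebesgue_on S)"
      using f g by measurable
    show "AE x in lebesgue_on S. ennreal (norm (f x)) = ennreal (norm (g x))"
      using eq by eventually_elim simp
  qed
  with True show ?thesis by (simp add: Lp_norm_def)
next
  case False
  have "(\<integral>\<^sup>+x. ennreal (norm (f x) powr enn2real p) \<partial>lebesgue_on S)
    = (\<integral>\<^sup>+x. ennreal (norm (g x) powr enn2real p) \<partial>lebesgue_on S)"
    by (rule nn_integral_cong_AE, use eq in eventually_elim) simp
  with False show ?thesis by (simp add: Lp_norm_def Let_def)
qed

section \<open>Test functions of product form and the final assembly\<close>

lemma tensor_in_Cc_infinity: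
  fixes a :: "real \<Rightarrow> real" and \<phi> :: "'a::euclidean_space \<Rightarrow> real"
  assumes a: "smooth a" and \<tau>: "\<tau> < T" "\<And>t. t \<ge> \<tau> \<Longrightarrow> a t = 0" and \<phi>: "test_fun S \<phi>"
  shows "(\<lambda>z. a (fst z) * \<phi> (snd z)) \<in> Cc_infinity ({0..<T} \<times> S)"
proof -
  let ?\<Phi> = "\<lambda>z. a (fst z) * \<phi> (snd z)"
  have "smooth (\<lambda>z :: real \<times> 'a. a (0 + fst z))" "smooth (\<lambda>z :: real \<times> 'a. \<phi> (0 + snd z))"
    by (rule smooth_compose_affine[OF bounded_linear_fst a],
        rule smooth_compose_affine[OF bounded_linear_snd test_fun_smooth[OF \<phi>]])
  from smooth_mult[OF this] have "smooth ?\<Phi>" by simp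
  then have sm: "smooth_on ({0..<T} \<times> S) ?\<Phi>"
    unfolding smooth_on_def smooth_def by (intro exI[of _ UNIV]) simp
  obtain K where K: "compact K" "K \<subseteq> S" "\<And>x. x \<notin> K \<Longrightarrow> \<phi> x = 0" using test_funE[OF \<phi>] by blast
  \<comment> \<open>This set lies in [0,T) \<times> S because \<tau> < T. It includes the bottom t =
    0, so \<open>a\<close> may be nonzero there.\<close>
  have C: "compact ({0..\<tau>} \<times> K)" by (intro compact_Times K) simp
  have "support_on ({0..<T} \<times> S) ?\<Phi> \<subseteq> {0..\<tau>} \<times> K"
  proof
    fix z assume "z \<in> support_on ({0..<T} \<times> S) ?\<Phi>"
    then have "fst z \<ge> 0" "a (fst z) \<noteq> 0" "\<phi> (snd z) \<noteq> 0" by (auto simp: support_on_def)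
    then show "z \<in> {0..\<tau>} \<times> K" using \<tau>(2)[of "fst z"] K(3)[of "snd z"] by (cases z) force
  qed
  then have cl: "closure (support_on ({0..<T} \<times> S) ?\<Phi>) \<subseteq> {0..\<tau>} \<times> K"
    by (rule closure_minimal) (rule compact_imp_closed[OF C])
  have "compact (closure (support_on ({0..<T} \<times> S) ?\<Phi>))"
    using compact_Int_closed[OF C closed_closure[of "support_on ({0..<T} \<times> S) ?\<Phi>"]] cl by (simp add: Int_absorb1)
  moreover have "{0..\<tau>} \<times> K \<subseteq> {0..<T} \<times> S" using \<tau>(1) K(2) by auto
  ultimately show ?thesis using sm cl unfolding Cc_infinity_def by blast
qed

lemma deriv_smooth_mult_const:
  fixes a :: "real \<Rightarrow> real"
  assumes "smooth a"
  shows "deriv (\<lambda>s. a s * c) t = dderiv a 1 t * c"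
proof -
  have lin: "dderiv a (h *\<^sub>R 1) t = h *\<^sub>R dderiv a 1 t" for h
    by (rule linear_scale[OF smooth_dderiv_linear[OF assms]])
  have "frechet_derivative a (at t) = (\<lambda>h. dderiv a 1 t * h)"
  proof
    fix h show "dderiv a h t = dderiv a 1 t * h" using lin[of h] by (simp only: real_scaleR_def mult_1_right) (rule mult.commute)
  qed
  then have "(a has_derivative (\<lambda>h. dderiv a 1 t * h)) (at t)"
    using smooth_has_derivative[OF assms, of t] by (simp only:)
  then have "(a has_field_derivative dderiv a 1 t) (at t)" by (simp add: has_field_derivative_def)
  then show ?thesis by (intro DERIV_imp_deriv DERIV_cmult_right)
qed

lemma inner_grad_cmult:
  fixes \<phi> :: "'a::euclidean_space \<Rightarrow> real"
  assumes "smooth \<phi>"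
  shows "v \<bullet> grad (\<lambda>y. c * \<phi> y) x = c * dderiv \<phi> v x"
proof -
  have d: "((\<lambda>y. c * \<phi> y) has_derivative (\<lambda>v. c * dderiv \<phi> v x)) (at x)"
    by (rule has_derivative_mult_right[OF smooth_has_derivative[OF assms]])
  then have "(\<lambda>y. c * \<phi> y) differentiable (at x)" unfolding differentiable_def by blast
  then show ?thesis using dderiv_eq[OF d] by (simp add: inner_grad)
qed

context time_interval begin

text \<open>The two Bochner hypotheses enter separately: continuity up to the boundary gives joint
  measurability and the pointwise bound \<open>Mu\<close>, the Sobolev part the approximation by
  test functions. Borel representatives vanishing off \<open>\<Omega>\<close> change neither the
  weak equation nor the norms.\<close>

lemma weak_transport_vanishes:
  fixes \<Omega> :: "'a::euclidean_space set"
  assumes \<Omega>: "open \<Omega>" "bounded \<Omega>" and pq: "1 < p" "1 / p + 1 / q = 1"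
    and uW: "u \<in> Bochner_L1 T (W1_0 q \<Omega>) (W1_norm q \<Omega>)"
    and uC: "u \<in> Bochner_L1 T (C_space (closure \<Omega>)) (sup_norm (closure \<Omega>))"
    and div: "weakly_div_free T \<Omega> u"
    and \<rho>: "\<rho> \<in> Linf_Lp T p \<Omega>"
    and weak: "weak_transport_solution T p \<Omega> u (\<lambda>x. 0) \<rho>"
  shows "AE t in M. AE x in lebesgue_on \<Omega>. \<rho> t x = 0"
proof -
  obtain r where r: "r \<ge> 1" "q = ennreal r"
    using pq by (cases rule: conjugate_exponent_cases) (auto intro: less_imp_le)
  have pr: "1 / p + 1 / ennreal r = 1" using pq(2) by (simp only: r(2))
  have \<Omega>': "\<Omega> \<in> sets lebesgue" and \<Omega>_borel[measurable]: "\<Omega> \<in> sets borel" using \<Omega>(1) by auto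
  have \<Omega>_fin: "emeasure lborel \<Omega> < \<infinity>" by (rule emeasure_bounded_finite[OF \<Omega>(2)])
  obtain A Mu where A: "A \<in> sets M" "AE t in M. t \<in> A" "A \<subseteq> {0<..<T}"
    and uA: "(\<lambda>z. if fst z \<in> A \<and> snd z \<in> \<Omega> then u (fst z) (snd z) else 0) \<in> borel_measurable (M \<Otimes>\<^sub>M lborel)"
    and Mu: "integrable M Mu" "\<And>t. Mu t \<ge> 0" "\<And>t x. t \<in> A \<Longrightarrow> x \<in> \<Omega> \<Longrightarrow> norm (u t x) \<le> Mu t"
    by (rule Bochner_C_representative[OF \<Omega>(1) uC]) blast
  obtain U where U: "\<And>k. simple_function M (U k)" "\<And>k t. t \<in> {0<..<T} \<Longrightarrow> test_fun \<Omega> (U k t)"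
    "AE t in M. (\<lambda>k. W1_norm (ennreal r) \<Omega> (\<lambda>x. u t x - U k t x)) \<longlonglongrightarrow> 0"
    and u_wd: "AE t in M. u t \<in> weakly_diff \<Omega>" and u_fin: "(\<integral>\<^sup>+t. W1_norm (ennreal r) \<Omega> (u t) \<partial>M) < \<infinity>"
    by (rule Bochner_W1_0_representative[OF \<Omega>(1) r(1) uW[unfolded r(2)]]) blast
  define v where "v t x = (if t \<in> A \<and> x \<in> \<Omega> then u t x else 0)" for t x
  have v_eq: "v t x = u t x" if "t \<in> A" "x \<in> \<Omega>" for t x using that by (simp add: v_def)
  obtain g where g: "(\<lambda>z. g (fst z) (snd z)) \<in> borel_measurable (borel \<Otimes>\<^sub>M borel)" "\<And>t x. x \<notin> \<Omega> \<Longrightarrow> g t x = 0"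
    and g_eq: "AE t in M. AE x in lebesgue_on \<Omega>. \<rho> t x = (g t x :: real)"
    using joint_borel_representative[OF \<Omega>(1), of \<rho> T] \<rho> unfolding Linf_Lp_def M_def by blast
  have g_M: "(\<lambda>z. g (fst z) (snd z)) \<in> borel_measurable (M \<Otimes>\<^sub>M lborel)"
  proof -
    have "(\<lambda>z. (fst z, snd z)) \<in> measurable (M \<Otimes>\<^sub>M (lborel :: 'a measure)) (borel \<Otimes>\<^sub>M borel)"
      by (rule measurable_Pair) (use measurable_compose[OF measurable_fst id_M] in simp_all)
    from measurable_compose[OF this g(1)] show ?thesis by simp
  qed
  have v_M: "(\<lambda>z. v (fst z) (snd z)) \<in> borel_measurable (M \<Otimes>\<^sub>M lborel)" using uA by (simp add: v_def)
  note g_sec = borel_measurable_time_slice[OF g_M] and v_sec = borel_measurable_time_slice[OF v_M]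
  define c where "c = enn2real (esssup M (\<lambda>t. Lp_norm p \<Omega> (\<rho> t))) + 1"
  \<comment> \<open>The factor 2 is that of \<open>Holder_Lp_norm\<close>, applied to f and the
    constant 1; the summand 1 makes the bound positive.\<close>
  define c1 where "c1 = 2 * (enn2real (Lp_norm p \<Omega> (\<lambda>x::'a. 1 :: real)) + 1)"
  have emb: "(\<integral>\<^sup>+x. ennreal \<bar>f x\<bar> \<partial>lborel) \<le> ennreal c1 * Lp_norm (ennreal r) \<Omega> f"
    if f: "f \<in> borel_measurable borel" "\<And>x. x \<notin> \<Omega> \<Longrightarrow> f x = 0" for f :: "'a \<Rightarrow> real"
  proof -
    let ?L = "Lp_norm p \<Omega> (\<lambda>x::'a. 1 :: real)"
    have L: "?L < \<infinity>" by (rule Lp_norm_1_finite[OF \<Omega>(1) \<Omega>_fin])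
    then have "?L = ennreal (enn2real ?L)" by simp
    also have "\<dots> \<le> ennreal (enn2real ?L + 1)" by (rule ennreal_leI) simp
    finally have le: "?L \<le> ennreal (enn2real ?L + 1)" .
    have pos: "enn2real ?L + 1 > 0" using enn2real_nonneg[of ?L] by linarith
    have "(\<integral>\<^sup>+x. ennreal \<bar>f x\<bar> \<partial>lborel) = (\<integral>\<^sup>+x. ennreal (\<bar>1::real\<bar> * norm (f x)) \<partial>lebesgue_on \<Omega>)"
      by (subst nn_integral_lebesgue_on_eq_lborel[OF \<Omega>']) (use f in auto)
    also have "\<dots> \<le> ennreal c1 * Lp_norm (ennreal r) \<Omega> f"
      unfolding c1_def
      by (rule Holder_Lp_norm[OF pq(1) pr pos le _ borel_imp_lebesgue_on[OF f(1)]]) simp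
    finally show ?thesis .
  qed
  interpret sobolev_velocity T \<Omega> r c1 v Mu U
  proof
    show "open \<Omega>" "emeasure lborel \<Omega> < \<infinity>" "r \<ge> 1" by (rule \<Omega> \<Omega>_fin r)+
    show "(\<lambda>z. v (fst z) (snd z)) \<in> borel_measurable (M \<Otimes>\<^sub>M lborel)" by (rule v_M)
    show "v t x = 0" if "x \<notin> \<Omega>" for t x using that by (simp add: v_def)
    show "norm (v t x) \<le> Mu t" for t x using Mu(2,3) by (simp add: v_def)
    show "integrable M Mu" by (rule Mu)
    show "simple_function M (U k)" for k by (rule U)
    show "test_fun \<Omega> (U k t)" if "t \<in> {0<..<T}" for k t by (rule U(2)[OF that])
    show "AE t in M. (\<lambda>k. W1_norm (ennreal r) \<Omega> (\<lambda>x. v t x - U k t x)) \<longlonglongrightarrow> 0"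
      using U(3) A(2)
    proof eventually_elim
      case (elim t)
      have "W1_norm (ennreal r) \<Omega> (\<lambda>x. v t x - U k t x) = W1_norm (ennreal r) \<Omega> (\<lambda>x. u t x - U k t x)" for k
        by (rule W1_norm_cong(1)[OF r(1)]) (simp add: v_eq[OF elim(2)])
      with elim(1) show ?case by simp
    qed
    show "AE t in M. v t \<in> weakly_diff \<Omega>"
      using u_wd A(2)
    proof eventually_elim
      case (elim t)
      then show ?case using W1_norm_cong(2)[OF r(1), of \<Omega> "v t" "u t"] v_eq[OF elim(2)] by blast
    qed
    have "(\<integral>\<^sup>+t. W1_norm (ennreal r) \<Omega> (v t) \<partial>M) = (\<integral>\<^sup>+t. W1_norm (ennreal r) \<Omega> (u t) \<partial>M)"
      by (rule nn_integral_cong_AE, use A(2) in eventually_elim) (rule W1_norm_cong(1)[OF r(1) v_eq])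
    with u_fin show "(\<integral>\<^sup>+t. W1_norm (ennreal r) \<Omega> (v t) \<partial>M) < \<infinity>" by simp
  qed (rule emb)
  have "AE t in M. AE x in lborel. g t x = 0"
  proof (rule density_vanishes_AE[OF pq(1) pr _ g_M g(2)])
    show "c > 0" unfolding c_def using enn2real_nonneg[of "esssup M (\<lambda>t. Lp_norm p \<Omega> (\<rho> t))"] by linarith
    have fin: "esssup M (\<lambda>t. Lp_norm p \<Omega> (\<rho> t)) < \<infinity>" using \<rho> unfolding Linf_Lp_def M_def by blast
    have le: "esssup M (\<lambda>t. Lp_norm p \<Omega> (\<rho> t)) \<le> ennreal c"
    proof -
      have "esssup M (\<lambda>t. Lp_norm p \<Omega> (\<rho> t)) = ennreal (enn2real (esssup M (\<lambda>t. Lp_norm p \<Omega> (\<rho> t))))"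
        using fin by simp
      also have "\<dots> \<le> ennreal c" unfolding c_def by (rule ennreal_leI) simp
      finally show ?thesis .
    qed
    show "AE t in M. Lp_norm p \<Omega> (g t) \<le> ennreal c"
      using esssup_AE[of "\<lambda>t. Lp_norm p \<Omega> (\<rho> t)" M] g_eq AE_space
    proof eventually_elim
      case (elim t)
      have "Lp_norm p \<Omega> (\<rho> t) = Lp_norm p \<Omega> (g t)"
        by (rule Lp_norm_cong_AE'[OF \<Omega>' borel_imp_lebesgue_on[OF g_sec] elim(2)]) (use elim(3) in simp)
      with elim(1) le show ?case by simp
    qed
    show "AE t in M. \<forall>\<phi>. test_fun \<Omega> \<phi> \<longrightarrow> (\<integral>x. dderiv (\<phi> :: 'a \<Rightarrow> real) (v t x) x \<partial>lborel) = 0"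
      using div[unfolded weakly_div_free_def, folded M_def] A(2)
    proof eventually_elim
      case (elim t)
      show ?case
      proof (intro allI impI)
        fix \<phi> :: "'a \<Rightarrow> real" assume \<phi>: "test_fun \<Omega> \<phi>"
        have t: "t \<in> {0<..<T}" using elim(2) A(3) by blast
        have "(LINT x|lebesgue_on \<Omega>. u t x \<bullet> grad \<phi> x) = (\<integral>x. dderiv \<phi> (v t x) x \<partial>lborel)"
        proof (rule integral_lebesgue_on_eq_lborel[OF \<Omega>'])
          show "(\<lambda>x. dderiv \<phi> (v t x) x) \<in> borel_measurable borel"
            by (rule dderiv_measurable[OF test_fun_smooth[OF \<phi>] v_sec[OF t]]) simp
          show "dderiv \<phi> (v t x) x = 0" if "x \<notin> \<Omega>" for x
            using test_fun_outside[OF test_fun_dderiv[OF \<phi>] that] .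
          show "AE x in lebesgue_on \<Omega>. u t x \<bullet> grad \<phi> x = dderiv \<phi> (v t x) x"
            by (rule AE_I2)
              (simp add: inner_grad[OF smooth_differentiable[OF test_fun_smooth[OF \<phi>]]] v_eq[OF elim(2)])
        qed
        then show "(\<integral>x. dderiv \<phi> (v t x) x \<partial>lborel) = 0"
          using elim(1) test_fun_imp_Cc_infinity[OF \<phi>] by simp
      qed
    qed
    fix a :: "real \<Rightarrow> real" and \<tau> and \<phi> :: "'a \<Rightarrow> real"
    assume a: "smooth a" "\<tau> < T" "\<And>t. t \<ge> \<tau> \<Longrightarrow> a t = 0" and \<phi>: "test_fun \<Omega> \<phi>"
    note \<phi>s = test_fun_smooth[OF \<phi>]
    let ?\<Phi> = "\<lambda>z. a (fst z) * \<phi> (snd z)"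
    let ?I = "\<lambda>t. LINT x|lebesgue_on \<Omega>. \<rho> t x * deriv (\<lambda>s. ?\<Phi> (s, x)) t"
    let ?J = "\<lambda>t. LINT x|lebesgue_on \<Omega>. \<rho> t x * (u t x \<bullet> grad (\<lambda>y. ?\<Phi> (t, y)) x)"
    let ?I' = "\<lambda>t. dderiv a 1 t * (\<integral>x. g t x * \<phi> x \<partial>lborel)"
    let ?J' = "\<lambda>t. a t * (\<integral>x. g t x * dderiv \<phi> (v t x) x \<partial>lborel)"
    have "?\<Phi> \<in> Cc_infinity ({0..<T} \<times> \<Omega>)" by (rule tensor_in_Cc_infinity[OF a(1,2) _ \<phi>]) (rule a(3))
    with weak have main: "- (LINT t|M. ?I t) - (LINT x|lebesgue_on \<Omega>. 0 * ?\<Phi> (0, x)) + (LINT t|M. ?J t) = 0"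
      unfolding weak_transport_solution_def M_def by blast
    have eqI: "AE t in M. ?I t = ?I' t"
      using g_eq AE_space
    proof eventually_elim
      case (elim t)
      then have t: "t \<in> {0<..<T}" by simp
      have "?I t = (\<integral>x. dderiv a 1 t * (g t x * \<phi> x) \<partial>lborel)"
      proof (rule integral_lebesgue_on_eq_lborel[OF \<Omega>'])
        show "(\<lambda>x. dderiv a 1 t * (g t x * \<phi> x)) \<in> borel_measurable borel"
          using g_sec[OF t] test_fun_borel[OF \<phi>] by measurable
        show "dderiv a 1 t * (g t x * \<phi> x) = 0" if "x \<notin> \<Omega>" for x using g(2)[OF that] by simp
        show "AE x in lebesgue_on \<Omega>. \<rho> t x * deriv (\<lambda>s. ?\<Phi> (s, x)) t = dderiv a 1 t * (g t x * \<phi> x)"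
          using elim(1) by eventually_elim (simp add: deriv_smooth_mult_const[OF a(1)])
      qed
      then show ?case by simp
    qed
    have eqJ: "AE t in M. ?J t = ?J' t"
      using g_eq AE_space A(2)
    proof eventually_elim
      case (elim t)
      then have t: "t \<in> {0<..<T}" by simp
      have "?J t = (\<integral>x. a t * (g t x * dderiv \<phi> (v t x) x) \<partial>lborel)"
      proof (rule integral_lebesgue_on_eq_lborel[OF \<Omega>'])
        have "(\<lambda>x. dderiv \<phi> (v t x) x) \<in> borel_measurable borel"
          by (rule dderiv_measurable[OF \<phi>s v_sec[OF t]]) simp
        then show "(\<lambda>x. a t * (g t x * dderiv \<phi> (v t x) x)) \<in> borel_measurable borel"
          using g_sec[OF t] by measurable
        show "a t * (g t x * dderiv \<phi> (v t x) x) = 0" if "x \<notin> \<Omega>" for x using g(2)[OF that] by simp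
        have "AE x in lebesgue_on \<Omega>. x \<in> \<Omega>" by (rule AE_I2) simp
        with elim(1)
        show "AE x in lebesgue_on \<Omega>. \<rho> t x * (u t x \<bullet> grad (\<lambda>y. ?\<Phi> (t, y)) x) = a t * (g t x * dderiv \<phi> (v t x) x)"
          by eventually_elim (simp add: inner_grad_cmult[OF \<phi>s] v_eq[OF elim(3)])
      qed
      then show ?case by simp
    qed
    note m = borel_measurable_slice_integrals[OF g_M v_M \<phi> a(1)]
    \<comment> \<open>Equality of the integrals requires measurability of the left integrands too,
      which they inherit from the right ones by completeness.\<close>
    have "(LINT t|M. ?I t) = (LINT t|M. ?I' t)" "(LINT t|M. ?J t) = (LINT t|M. ?J' t)"
      using integral_cong_AE[OF borel_measurable_lebesgue_on_AE[OF I_sets m(1)[unfolded M_def] eqI[unfolded M_def]] m(1)[unfolded M_def] eqI[unfolded M_def]]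
        integral_cong_AE[OF borel_measurable_lebesgue_on_AE[OF I_sets m(2)[unfolded M_def] eqJ[unfolded M_def]] m(2)[unfolded M_def] eqJ[unfolded M_def]]
      unfolding M_def by blast+
    with main show "(LINT t|M. ?I' t) = (LINT t|M. ?J' t)" by simp
  qed
  with g_eq show ?thesis
  proof eventually_elim
    case (elim t)
    have "AE x in lebesgue_on \<Omega>. g t x = 0" by (rule AE_lborel_imp_lebesgue_on[OF \<Omega>' elim(2)])
    with elim(1) show ?case by eventually_elim simp
  qed
qed

end

theorem theorem7:
  fixes \<Omega> :: "(real ^ 'n) set"
    and T :: real
    and p q :: ennreal
    and u :: "real \<Rightarrow> real ^ 'n \<Rightarrow> real ^ 'n"
    and \<rho> :: "real \<Rightarrow> real ^ 'n \<Rightarrow> real"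
  assumes "open \<Omega>" and "bounded \<Omega>" and "connected \<Omega>" and "simply_connected \<Omega>"
    and "smooth_boundary \<Omega>"
    and "T > 0"
    and "1 < p" and "1 / p + 1 / q = 1"
    and "u \<in> Bochner_L1 T (W1_0 q \<Omega>) (W1_norm q \<Omega>)"
    and "u \<in> Bochner_L1 T (C_space (closure \<Omega>)) (sup_norm (closure \<Omega>))"
    and "weakly_div_free T \<Omega> u"
    and "\<rho> \<in> Linf_Lp T p \<Omega>"
    and "weak_transport_solution T p \<Omega> u (\<lambda>x. 0) \<rho>"
  shows "AE t in lebesgue_on {0<..<T}. AE x in lebesgue_on \<Omega>. \<rho> t x = 0"
proof -
  interpret time_interval T by standard fact
  show ?thesis
    using weak_transport_vanishes[OF assms(1,2,7-13)] unfolding M_def .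
qed

end
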